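(* Let $V$ be a category with (small) coproducts, let $(E,u,\sigma)$ be a distributive multitensor on $V$, and let $(\Gamma E,\eta,\mu)$ be the corresponding monad on $\mathcal{G}V$. Let $\lambda$ be a regular cardinal. (1) $\Gamma E$ preserves coproducts. (2) Suppose $V$ has $\lambda$-filtered colimits. Then $E$ is $\lambda$-accessible if and only if $\Gamma E$ is $\lambda$-accessible (i.e. preserves $\lambda$-filtered colimits). (3) Suppose $V$ has pullbacks and every object of $V$ is a coproduct of connected objects. Then $(E,u,\sigma)$ is a cartesian multitensor if and only if $(\Gamma E,\eta,\mu)$ is a cartesian monad. (4) Suppose $V$ is locally $\lambda$-c-presentable. Then $(E,u,\sigma)$ is a local right adjoint multitensor if and only if $(\Gamma E,\eta,\mu)$ is a local right adjoint monad.
   Context: Enriched graphs. For a category $V$, a $V$-graph $X$ consists of a set $X_0$ of objects and, for each ordered pair $(a,b)$ of elements of $X_0$, an object $X(a,b)$ of $V$ (a hom). A morphism $f:X\to Y$ is a function $f_0:X_0\to Y_0$ with morphisms $f_{a,b}:X(a,b)\to Y(fa,fb)$ of $V$. These form the category $\mathcal{G}V$, with forgetful functor $(-)_0:\mathcal{G}V\to\mathbf{Set}$. Multitensors. Let $MV=\coprod_{n\in\mathbb{N}}V^n$ be the category of finite sequences of objects of $V$ (maps are sequences of maps, only between sequences of equal length). A multitensor $(E,u,\sigma)$ on $V$ is a functor $E:MV\to V$, written $E(X_1,\dots,X_n)=E_iX_i$, with unary part $E_1:V\to V$ and $n$-ary parts $E_n:V^n\to V$, together with natural families $u_X:X\to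 E_1X$ and $\sigma_{X_{ij}}:E_iE_jX_{ij}\to E_{ij}X_{ij}$ (where $E_{ij}X_{ij}$ is $E$ applied to the concatenated sequence), such that $\sigma\circ u_{E_iX_i}=1$, $\sigma\circ E_i(u_{X_i})=1$ as endomorphisms of $E_iX_i$, and the two composites of $\sigma$'s $E_iE_jE_kX_{ijk}\to E_{ijk}X_{ijk}$ (substituting the outer two, or the inner two, first) agree. It is distributive when each $E_n:V^n\to V$ preserves coproducts in each variable. The monad $\Gamma E$. For $V$ with coproducts and $E$ distributive, $\Gamma E(X)$ has the same objects as $X$ and $$\Gamma E(X)(a,b)=\coprod_{n\in\mathbb{N},\ a=x_0,\dots,x_n=b}E_iX(x_{i-1},x_i),$$ the coproduct over all finite sequences of objects of $X$ from $a$ to $b$. The unit $\eta_X$ is the identity on objects with hom maps $u_{X(a,b)}:X(a,b)\to E_1X(a,b)$ followed by the coproduct inclusion at $(a,b)$. By distributivity $(\Gamma E)^2(X)(a,b)$ is the coproduct of the $E_iE_jX(x_{ij-1},x_{ij})$ over doubly nested composable sequences from $a$ to $b$, and $\mu_X$ is the identity on objects with hom maps given on these summands by $\sigma:E_iE_jX(x_{ij-1},x_{ij})\to E_{ij}X(x_{ij-1},x_{ij})$ followed by the coproduct inclusion. Properties. $E$ is $\lambda$-accessible when $E:MV\to V$ preserves $\lambda$-filtered colimits (equivalently every $E_n$ does). A transformation is cartesian when its naturality squares are pullbacks. On a category with pullbacks, a monad is cartesian when its functor preserves pullbacks and its unit and multiplication are cartesian; a multitensor is cartesian when $E:MV\to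 V$ preserves pullbacks and $u,\sigma$ are cartesian. A functor $F:C\to D$ is a local right adjoint when for every $X\in C$ the induced functor $C/X\to D/FX$ is a right adjoint. A monad is local right adjoint when its functor is a local right adjoint and its unit and multiplication are cartesian; a multitensor is local right adjoint when $E:MV\to V$ is a local right adjoint and $u,\sigma$ are cartesian. An object $C$ is connected when $V(C,-)$ preserves coproducts. A category is $\lambda$-c-filtered when each of its connected components is $\lambda$-filtered. A locally small category $V$ is locally $\lambda$-c-presentable when it is cocomplete and has a set $\mathcal{S}$ of connected $\lambda$-presentable objects such that every object of $V$ is a $\lambda$-c-filtered colimit of objects of $\mathcal{S}$. *)

theory Defs
  imports Main "HOL-Library.FuncSet"
begin

unbundle cardinal_syntax

text \<open>
  Size conventions.  The type \<open>'u\<close> plays the role of the universe of small sets: with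
  \<open>\<kappa> = |UNIV :: 'u set|\<close> uncountable and regular, a set of any type is small if its cardinality is
  below \<open>\<kappa>\<close>.  A Grothendieck universe is the case where \<open>\<kappa>\<close> is moreover a strong limit (that is,
  strongly inaccessible); that extra assumption is not made, so that the hypothesis on \<open>'u\<close> can be
  satisfied in HOL.  As every small set embeds into \<open>'u\<close>, it suffices to let small index sets and
  small index categories have their elements in \<open>'u\<close>.
\<close>

definition universe :: "'u itself \<Rightarrow> bool" where
  "universe (_ :: 'u itself) \<longleftrightarrow> natLeq <o |UNIV :: 'u set| \<and> regularCard |UNIV :: 'u set|"

definition small :: "'u itself \<Rightarrow> 'x set \<Rightarrow> bool" where
  "small (_ :: 'u itself) A \<longleftrightarrow> |A| <o |UNIV :: 'u set|"

definition small_regular_cardinal :: "'u itself \<Rightarrow> 'l rel \<Rightarrow> bool" where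
  "small_regular_cardinal (_ :: 'u itself) lam \<longleftrightarrow>
     Cinfinite lam \<and> regularCard lam \<and> lam <o |UNIV :: 'u set|"


record ('o, 'a) cat =
  Obj :: "'o set"
  Arr :: "'a set"
  Dom :: "'a \<Rightarrow> 'o"
  Cod :: "'a \<Rightarrow> 'o"
  Ide :: "'o \<Rightarrow> 'a"
  Comp :: "'a \<Rightarrow> 'a \<Rightarrow> 'a"  (infixl "\<cdot>\<index>" 70)

definition Hom :: "('o, 'a) cat \<Rightarrow> 'o \<Rightarrow> 'o \<Rightarrow> 'a set" where
  "Hom C X Y = {f \<in> Arr C. Dom C f = X \<and> Cod C f = Y}"

definition category :: "('o, 'a) cat \<Rightarrow> bool" where
  "category C \<longleftrightarrow>
     (\<forall>f\<in>Arr C. Dom C f \<in> Obj C \<and> Cod C f \<in> Obj C) \<and>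
     (\<forall>X\<in>Obj C. Ide C X \<in> Hom C X X) \<and>
     (\<forall>f\<in>Arr C. \<forall>g\<in>Arr C. Cod C f = Dom C g \<longrightarrow> g \<cdot>\<^bsub>C\<^esub> f \<in> Hom C (Dom C f) (Cod C g)) \<and>
     (\<forall>f\<in>Arr C. f \<cdot>\<^bsub>C\<^esub> Ide C (Dom C f) = f \<and> Ide C (Cod C f) \<cdot>\<^bsub>C\<^esub> f = f) \<and>
     (\<forall>f\<in>Arr C. \<forall>g\<in>Arr C. \<forall>h\<in>Arr C. Cod C f = Dom C g \<longrightarrow> Cod C g = Dom C h \<longrightarrow>
        h \<cdot>\<^bsub>C\<^esub> (g \<cdot>\<^bsub>C\<^esub> f) = (h \<cdot>\<^bsub>C\<^esub> g) \<cdot>\<^bsub>C\<^esub> f)"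

record ('o, 'a, 'p, 'b) ftor =
  OMap :: "'o \<Rightarrow> 'p"
  AMap :: "'a \<Rightarrow> 'b"

definition is_functor :: "('o, 'a) cat \<Rightarrow> ('p, 'b) cat \<Rightarrow> ('o, 'a, 'p, 'b) ftor \<Rightarrow> bool" where
  "is_functor C D F \<longleftrightarrow>
     category C \<and> category D \<and>
     (\<forall>X\<in>Obj C. OMap F X \<in> Obj D) \<and>
     (\<forall>f\<in>Arr C. AMap F f \<in> Hom D (OMap F (Dom C f)) (OMap F (Cod C f))) \<and>
     (\<forall>X\<in>Obj C. AMap F (Ide C X) = Ide D (OMap F X)) \<and>
     (\<forall>f\<in>Arr C. \<forall>g\<in>Arr C. Cod C f = Dom C g \<longrightarrow>
        AMap F (g \<cdot>\<^bsub>C\<^esub> f) = AMap F g \<cdot>\<^bsub>D\<^esub> AMap F f)"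

definition id_ftor :: "('o, 'a, 'o, 'a) ftor" where
  "id_ftor = \<lparr>OMap = (\<lambda>X. X), AMap = (\<lambda>f. f)\<rparr>"

definition comp_ftor ::
    "('p, 'b, 'q, 'c) ftor \<Rightarrow> ('o, 'a, 'p, 'b) ftor \<Rightarrow> ('o, 'a, 'q, 'c) ftor" where
  "comp_ftor G F = \<lparr>OMap = OMap G \<circ> OMap F, AMap = AMap G \<circ> AMap F\<rparr>"

definition natural ::
    "('o, 'a) cat \<Rightarrow> ('p, 'b) cat \<Rightarrow> ('o, 'a, 'p, 'b) ftor \<Rightarrow> ('o, 'a, 'p, 'b) ftor \<Rightarrow>
     ('o \<Rightarrow> 'b) \<Rightarrow> bool" where
  "natural C D F G t \<longleftrightarrow>
     (\<forall>X\<in>Obj C. t X \<in> Hom D (OMap F X) (OMap G X)) \<and>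
     (\<forall>f\<in>Arr C. AMap G f \<cdot>\<^bsub>D\<^esub> t (Dom C f) = t (Cod C f) \<cdot>\<^bsub>D\<^esub> AMap F f)"


definition is_coproduct ::
    "('o, 'a) cat \<Rightarrow> 'i set \<Rightarrow> ('i \<Rightarrow> 'o) \<Rightarrow> 'o \<Rightarrow> ('i \<Rightarrow> 'a) \<Rightarrow> bool" where
  "is_coproduct C I X Q incl \<longleftrightarrow>
     Q \<in> Obj C \<and> (\<forall>i\<in>I. X i \<in> Obj C \<and> incl i \<in> Hom C (X i) Q) \<and>
     (\<forall>T\<in>Obj C. \<forall>f. (\<forall>i\<in>I. f i \<in> Hom C (X i) T) \<longrightarrow>
        (\<exists>!h. h \<in> Hom C Q T \<and> (\<forall>i\<in>I. h \<cdot>\<^bsub>C\<^esub> incl i = f i)))"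

definition has_coproducts :: "'u itself \<Rightarrow> ('o, 'a) cat \<Rightarrow> bool" where
  "has_coproducts U C \<longleftrightarrow>
     (\<forall>(I :: 'u set) X. small U I \<longrightarrow> (\<forall>i\<in>I. X i \<in> Obj C) \<longrightarrow> (\<exists>Q incl. is_coproduct C I X Q incl))"

definition preserves_coproducts ::
    "'u itself \<Rightarrow> ('o, 'a) cat \<Rightarrow> ('p, 'b) cat \<Rightarrow> ('o, 'a, 'p, 'b) ftor \<Rightarrow> bool" where
  "preserves_coproducts U C D F \<longleftrightarrow>
     (\<forall>(I :: 'u set) X Q incl. small U I \<longrightarrow> is_coproduct C I X Q incl \<longrightarrow>
        is_coproduct D I (OMap F \<circ> X) (OMap F Q) (AMap F \<circ> incl))"

definition is_cocone ::
    "('j, 't) cat \<Rightarrow> ('o, 'a) cat \<Rightarrow> ('j, 't, 'o, 'a) ftor \<Rightarrow> 'o \<Rightarrow> ('j \<Rightarrow> 'a) \<Rightarrow> bool" where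
  "is_cocone J C D L incl \<longleftrightarrow>
     L \<in> Obj C \<and> (\<forall>j\<in>Obj J. incl j \<in> Hom C (OMap D j) L) \<and>
     (\<forall>t\<in>Arr J. incl (Cod J t) \<cdot>\<^bsub>C\<^esub> AMap D t = incl (Dom J t))"

definition is_colimit ::
    "('j, 't) cat \<Rightarrow> ('o, 'a) cat \<Rightarrow> ('j, 't, 'o, 'a) ftor \<Rightarrow> 'o \<Rightarrow> ('j \<Rightarrow> 'a) \<Rightarrow> bool" where
  "is_colimit J C D L incl \<longleftrightarrow>
     is_cocone J C D L incl \<and>
     (\<forall>T f. is_cocone J C D T f \<longrightarrow>
        (\<exists>!h. h \<in> Hom C L T \<and> (\<forall>j\<in>Obj J. h \<cdot>\<^bsub>C\<^esub> incl j = f j)))"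

definition small_category :: "'u itself \<Rightarrow> ('j, 't) cat \<Rightarrow> bool" where
  "small_category U J \<longleftrightarrow> category J \<and> small U (Arr J)"

definition cocomplete :: "'u itself \<Rightarrow> ('o, 'a) cat \<Rightarrow> bool" where
  "cocomplete U C \<longleftrightarrow>
     (\<forall>(J :: ('u, 'u) cat) D. small_category U J \<longrightarrow> is_functor J C D \<longrightarrow>
        (\<exists>L incl. is_colimit J C D L incl))"

text \<open>
  A category is \<open>\<lambda>\<close>-filtered if every diagram in it with fewer than \<open>\<lambda>\<close> arrows has a cocone (in
  particular it is nonempty).  Up to isomorphism, the shapes of such diagrams have objects and arrows
  in the type underlying \<open>\<lambda>\<close>.
\<close>

definition filtered :: "'l rel \<Rightarrow> ('j, 't) cat \<Rightarrow> bool" where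
  "filtered lam J \<longleftrightarrow>
     category J \<and>
     (\<forall>(K :: ('l, 'l) cat) D. is_functor K J D \<longrightarrow> |Arr K| <o lam \<longrightarrow>
        (\<exists>L incl. is_cocone K J D L incl))"

definition has_filtered_colimits :: "'u itself \<Rightarrow> 'l rel \<Rightarrow> ('o, 'a) cat \<Rightarrow> bool" where
  "has_filtered_colimits U lam C \<longleftrightarrow>
     (\<forall>(J :: ('u, 'u) cat) D. small_category U J \<longrightarrow> filtered lam J \<longrightarrow> is_functor J C D \<longrightarrow>
        (\<exists>L incl. is_colimit J C D L incl))"

definition accessible ::
    "'u itself \<Rightarrow> 'l rel \<Rightarrow> ('o, 'a) cat \<Rightarrow> ('p, 'b) cat \<Rightarrow> ('o, 'a, 'p, 'b) ftor \<Rightarrow> bool" where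
  "accessible U lam C D F \<longleftrightarrow>
     (\<forall>(J :: ('u, 'u) cat) G L incl.
        small_category U J \<longrightarrow> filtered lam J \<longrightarrow> is_functor J C G \<longrightarrow> is_colimit J C G L incl \<longrightarrow>
        is_colimit J D (comp_ftor F G) (OMap F L) (AMap F \<circ> incl))"

definition component_rel :: "('j, 't) cat \<Rightarrow> 'j rel" where
  "component_rel J =
     (let R = {(Dom J t, Cod J t) | t. t \<in> Arr J} in (R \<union> R\<inverse>)\<^sup>* \<inter> Obj J \<times> Obj J)"

definition full_subcategory :: "('j, 't) cat \<Rightarrow> 'j set \<Rightarrow> ('j, 't) cat" where
  "full_subcategory J S = J\<lparr>Obj := S, Arr := {t \<in> Arr J. Dom J t \<in> S \<and> Cod J t \<in> S}\<rparr>"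

definition c_filtered :: "'l rel \<Rightarrow> ('j, 't) cat \<Rightarrow> bool" where
  "c_filtered lam J \<longleftrightarrow>
     category J \<and> (\<forall>S \<in> Obj J // component_rel J. filtered lam (full_subcategory J S))"


text \<open>
  \<open>V(C,-)\<close> preserves coproducts: the coproduct of sets is the disjoint union, and the canonical map
  from the coproduct of the sets \<open>V(C,X i)\<close> to \<open>V(C,Q)\<close> is required to be invertible.
\<close>

definition connected_object :: "'u itself \<Rightarrow> ('o, 'a) cat \<Rightarrow> 'o \<Rightarrow> bool" where
  "connected_object U V C \<longleftrightarrow>
     C \<in> Obj V \<and>
     (\<forall>(I :: 'u set) X Q incl. small U I \<longrightarrow> is_coproduct V I X Q incl \<longrightarrow>
        bij_betw (\<lambda>(i, f). incl i \<cdot>\<^bsub>V\<^esub> f) (SIGMA i:I. Hom V C (X i)) (Hom V C Q))"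

text \<open>
  \<open>V(C,-)\<close> preserves \<open>\<lambda>\<close>-filtered colimits: the colimit in sets of the \<open>V(C,D j)\<close> is the quotient of
  their disjoint union by the equivalence relation generated by the transition maps, and the
  canonical map from it to \<open>V(C,L)\<close> (the common value on each class) is required to be invertible.
\<close>

definition hom_colimit_rel ::
    "('j, 't) cat \<Rightarrow> ('o, 'a) cat \<Rightarrow> ('j, 't, 'o, 'a) ftor \<Rightarrow> 'o \<Rightarrow> ('j \<times> 'a) rel" where
  "hom_colimit_rel J V D C =
     (let A = (SIGMA j:Obj J. Hom V C (OMap D j));
          R = {((Dom J t, f), (Cod J t, AMap D t \<cdot>\<^bsub>V\<^esub> f)) | t f.
                 t \<in> Arr J \<and> f \<in> Hom V C (OMap D (Dom J t))}
      in (R \<union> R\<inverse>)\<^sup>* \<inter> A \<times> A)"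

definition presentable_object :: "'u itself \<Rightarrow> 'l rel \<Rightarrow> ('o, 'a) cat \<Rightarrow> 'o \<Rightarrow> bool" where
  "presentable_object U lam V C \<longleftrightarrow>
     C \<in> Obj V \<and>
     (\<forall>(J :: ('u, 'u) cat) D L incl.
        small_category U J \<longrightarrow> filtered lam J \<longrightarrow> is_functor J V D \<longrightarrow> is_colimit J V D L incl \<longrightarrow>
        bij_betw (\<lambda>c. the_elem ((\<lambda>(j, f). incl j \<cdot>\<^bsub>V\<^esub> f) ` c))
          ((SIGMA j:Obj J. Hom V C (OMap D j)) // hom_colimit_rel J V D C)
          (Hom V C L))"

definition locally_small :: "'u itself \<Rightarrow> ('o, 'a) cat \<Rightarrow> bool" where
  "locally_small U V \<longleftrightarrow> (\<forall>X\<in>Obj V. \<forall>Y\<in>Obj V. small U (Hom V X Y))"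

definition locally_c_presentable :: "'u itself \<Rightarrow> 'l rel \<Rightarrow> ('o, 'a) cat \<Rightarrow> bool" where
  "locally_c_presentable U lam V \<longleftrightarrow>
     category V \<and> locally_small U V \<and> cocomplete U V \<and>
     (\<exists>S. small U S \<and>
        (\<forall>C\<in>S. connected_object U V C \<and> presentable_object U lam V C) \<and>
        (\<forall>X\<in>Obj V. \<exists>(J :: ('u, 'u) cat) D incl.
           small_category U J \<and> c_filtered lam J \<and> is_functor J V D \<and>
           (\<forall>j\<in>Obj J. OMap D j \<in> S) \<and> is_colimit J V D X incl))"

definition coproducts_of_connected :: "'u itself \<Rightarrow> ('o, 'a) cat \<Rightarrow> bool" where
  "coproducts_of_connected U V \<longleftrightarrow>
     (\<forall>Q\<in>Obj V. \<exists>(I :: 'u set) X incl.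
        small U I \<and> (\<forall>i\<in>I. connected_object U V (X i)) \<and> is_coproduct V I X Q incl)"


definition is_pullback :: "('o, 'a) cat \<Rightarrow> 'a \<Rightarrow> 'a \<Rightarrow> 'a \<Rightarrow> 'a \<Rightarrow> bool" where
  "is_pullback C p q f g \<longleftrightarrow>
     p \<in> Arr C \<and> q \<in> Arr C \<and> f \<in> Arr C \<and> g \<in> Arr C \<and>
     Dom C p = Dom C q \<and> Cod C p = Dom C f \<and> Cod C q = Dom C g \<and> Cod C f = Cod C g \<and>
     f \<cdot>\<^bsub>C\<^esub> p = g \<cdot>\<^bsub>C\<^esub> q \<and>
     (\<forall>T\<in>Obj C. \<forall>x\<in>Hom C T (Dom C f). \<forall>y\<in>Hom C T (Dom C g). f \<cdot>\<^bsub>C\<^esub> x = g \<cdot>\<^bsub>C\<^esub> y \<longrightarrow>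
        (\<exists>!h. h \<in> Hom C T (Dom C p) \<and> p \<cdot>\<^bsub>C\<^esub> h = x \<and> q \<cdot>\<^bsub>C\<^esub> h = y))"

definition has_pullbacks :: "('o, 'a) cat \<Rightarrow> bool" where
  "has_pullbacks C \<longleftrightarrow>
     (\<forall>f\<in>Arr C. \<forall>g\<in>Arr C. Cod C f = Cod C g \<longrightarrow> (\<exists>p q. is_pullback C p q f g))"

definition preserves_pullbacks ::
    "('o, 'a) cat \<Rightarrow> ('p, 'b) cat \<Rightarrow> ('o, 'a, 'p, 'b) ftor \<Rightarrow> bool" where
  "preserves_pullbacks C D F \<longleftrightarrow>
     (\<forall>p q f g. is_pullback C p q f g \<longrightarrow>
        is_pullback D (AMap F p) (AMap F q) (AMap F f) (AMap F g))"

definition cartesian_transformation ::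
    "('o, 'a) cat \<Rightarrow> ('p, 'b) cat \<Rightarrow> ('o, 'a, 'p, 'b) ftor \<Rightarrow> ('o, 'a, 'p, 'b) ftor \<Rightarrow>
     ('o \<Rightarrow> 'b) \<Rightarrow> bool" where
  "cartesian_transformation C D F G t \<longleftrightarrow>
     natural C D F G t \<and>
     (\<forall>f\<in>Arr C. is_pullback D (t (Dom C f)) (AMap F f) (AMap G f) (t (Cod C f)))"


text \<open>
  An arrow of the slice over \<open>X\<close> from \<open>f\<close> to \<open>g\<close> is stored as the triple \<open>(f, h, g)\<close>, so that its
  domain and codomain can be recovered from it.
\<close>

definition slice :: "('o, 'a) cat \<Rightarrow> 'o \<Rightarrow> ('a, 'a \<times> 'a \<times> 'a) cat" where
  "slice C X =
     \<lparr>Obj = {f \<in> Arr C. Cod C f = X},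
      Arr = {(f, h, g). f \<in> Arr C \<and> Cod C f = X \<and> g \<in> Arr C \<and> Cod C g = X \<and>
               h \<in> Hom C (Dom C f) (Dom C g) \<and> g \<cdot>\<^bsub>C\<^esub> h = f},
      Dom = (\<lambda>(f, h, g). f),
      Cod = (\<lambda>(f, h, g). g),
      Ide = (\<lambda>f. (f, Ide C (Dom C f), f)),
      Comp = (\<lambda>(_, k, l) (f, h, _). (f, k \<cdot>\<^bsub>C\<^esub> h, l))\<rparr>"

definition slice_ftor ::
    "('o, 'a, 'p, 'b) ftor \<Rightarrow> ('a, 'a \<times> 'a \<times> 'a, 'b, 'b \<times> 'b \<times> 'b) ftor" where
  "slice_ftor F =
     \<lparr>OMap = AMap F, AMap = (\<lambda>(f, h, g). (AMap F f, AMap F h, AMap F g))\<rparr>"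

definition is_right_adjoint ::
    "('o, 'a) cat \<Rightarrow> ('p, 'b) cat \<Rightarrow> ('o, 'a, 'p, 'b) ftor \<Rightarrow> bool" where
  "is_right_adjoint A B G \<longleftrightarrow>
     is_functor A B G \<and>
     (\<exists>F unit counit.
        is_functor B A F \<and>
        natural B B id_ftor (comp_ftor G F) unit \<and>
        natural A A (comp_ftor F G) id_ftor counit \<and>
        (\<forall>Y\<in>Obj B. counit (OMap F Y) \<cdot>\<^bsub>A\<^esub> AMap F (unit Y) = Ide A (OMap F Y)) \<and>
        (\<forall>X\<in>Obj A. AMap G (counit X) \<cdot>\<^bsub>B\<^esub> unit (OMap G X) = Ide B (OMap G X)))"

definition local_right_adjoint ::
    "('o, 'a) cat \<Rightarrow> ('p, 'b) cat \<Rightarrow> ('o, 'a, 'p, 'b) ftor \<Rightarrow> bool" where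
  "local_right_adjoint C D F \<longleftrightarrow>
     is_functor C D F \<and>
     (\<forall>X\<in>Obj C. is_right_adjoint (slice C X) (slice D (OMap F X)) (slice_ftor F))"


definition monad ::
    "('o, 'a) cat \<Rightarrow> ('o, 'a, 'o, 'a) ftor \<Rightarrow> ('o \<Rightarrow> 'a) \<Rightarrow> ('o \<Rightarrow> 'a) \<Rightarrow> bool" where
  "monad C T eta mu \<longleftrightarrow>
     is_functor C C T \<and> natural C C id_ftor T eta \<and> natural C C (comp_ftor T T) T mu \<and>
     (\<forall>X\<in>Obj C. mu X \<cdot>\<^bsub>C\<^esub> eta (OMap T X) = Ide C (OMap T X) \<and>
        mu X \<cdot>\<^bsub>C\<^esub> AMap T (eta X) = Ide C (OMap T X) \<and>
        mu X \<cdot>\<^bsub>C\<^esub> mu (OMap T X) = mu X \<cdot>\<^bsub>C\<^esub> AMap T (mu X))"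

definition cartesian_monad ::
    "('o, 'a) cat \<Rightarrow> ('o, 'a, 'o, 'a) ftor \<Rightarrow> ('o \<Rightarrow> 'a) \<Rightarrow> ('o \<Rightarrow> 'a) \<Rightarrow> bool" where
  "cartesian_monad C T eta mu \<longleftrightarrow>
     monad C T eta mu \<and> preserves_pullbacks C C T \<and>
     cartesian_transformation C C id_ftor T eta \<and>
     cartesian_transformation C C (comp_ftor T T) T mu"

definition lra_monad ::
    "('o, 'a) cat \<Rightarrow> ('o, 'a, 'o, 'a) ftor \<Rightarrow> ('o \<Rightarrow> 'a) \<Rightarrow> ('o \<Rightarrow> 'a) \<Rightarrow> bool" where
  "lra_monad C T eta mu \<longleftrightarrow>
     monad C T eta mu \<and> local_right_adjoint C C T \<and>
     cartesian_transformation C C id_ftor T eta \<and>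
     cartesian_transformation C C (comp_ftor T T) T mu"


text \<open>
  The category \<open>MV\<close> of finite sequences.  Composition is only meaningful on composable arrows, which
  have equal length.
\<close>

definition seq_cat :: "('o, 'a) cat \<Rightarrow> ('o list, 'a list) cat" where
  "seq_cat V =
     \<lparr>Obj = lists (Obj V), Arr = lists (Arr V), Dom = map (Dom V), Cod = map (Cod V),
      Ide = map (Ide V), Comp = map2 (Comp V)\<rparr>"

definition unary_part :: "('o list, 'a list, 'o, 'a) ftor \<Rightarrow> ('o, 'a, 'o, 'a) ftor" where
  "unary_part E = \<lparr>OMap = (\<lambda>X. OMap E [X]), AMap = (\<lambda>f. AMap E [f])\<rparr>"

definition map_ftor :: "('o, 'a, 'p, 'b) ftor \<Rightarrow> ('o list, 'a list, 'p list, 'b list) ftor" where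
  "map_ftor F = \<lparr>OMap = map (OMap F), AMap = map (AMap F)\<rparr>"

definition concat_ftor :: "('o list list, 'a list list, 'o list, 'a list) ftor" where
  "concat_ftor = \<lparr>OMap = concat, AMap = concat\<rparr>"

text \<open>
  The transformation \<open>\<sigma>\<close> is indexed by sequences of sequences.  For a triply nested sequence, the
  source \<open>E\<^sub>i E\<^sub>j E\<^sub>k X\<^sub>i\<^sub>j\<^sub>k\<close> of the associativity axiom is reached from the outer pair of \<open>E\<close>s by
  \<open>sig (map (map (OMap E)) XSSS)\<close>, and from the inner pair by \<open>E\<close> applied to the \<open>sig XSS\<close>.
\<close>

definition multitensor ::
    "('o, 'a) cat \<Rightarrow> ('o list, 'a list, 'o, 'a) ftor \<Rightarrow> ('o \<Rightarrow> 'a) \<Rightarrow> ('o list list \<Rightarrow> 'a) \<Rightarrow> bool"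
  where
  "multitensor V E u sig \<longleftrightarrow>
     is_functor (seq_cat V) V E \<and>
     natural V V id_ftor (unary_part E) u \<and>
     natural (seq_cat (seq_cat V)) V (comp_ftor E (map_ftor E)) (comp_ftor E concat_ftor) sig \<and>
     (\<forall>Xs\<in>lists (Obj V).
        sig [Xs] \<cdot>\<^bsub>V\<^esub> u (OMap E Xs) = Ide V (OMap E Xs) \<and>
        sig (map (\<lambda>X. [X]) Xs) \<cdot>\<^bsub>V\<^esub> AMap E (map u Xs) = Ide V (OMap E Xs)) \<and>
     (\<forall>XSSS\<in>lists (lists (lists (Obj V))).
        sig (concat XSSS) \<cdot>\<^bsub>V\<^esub> sig (map (map (OMap E)) XSSS) =
        sig (map concat XSSS) \<cdot>\<^bsub>V\<^esub> AMap E (map sig XSSS))"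

definition nth_variable ::
    "('o, 'a) cat \<Rightarrow> ('o list, 'a list, 'o, 'a) ftor \<Rightarrow> 'o list \<Rightarrow> nat \<Rightarrow> ('o, 'a, 'o, 'a) ftor" where
  "nth_variable V E Xs i =
     \<lparr>OMap = (\<lambda>Y. OMap E (Xs[i := Y])), AMap = (\<lambda>f. AMap E ((map (Ide V) Xs)[i := f]))\<rparr>"

definition distributive_multitensor ::
    "'u itself \<Rightarrow> ('o, 'a) cat \<Rightarrow> ('o list, 'a list, 'o, 'a) ftor \<Rightarrow> ('o \<Rightarrow> 'a) \<Rightarrow>
     ('o list list \<Rightarrow> 'a) \<Rightarrow> bool" where
  "distributive_multitensor U V E u sig \<longleftrightarrow>
     multitensor V E u sig \<and>
     (\<forall>Xs\<in>lists (Obj V). \<forall>i<length Xs. preserves_coproducts U V V (nth_variable V E Xs i))"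

definition cartesian_multitensor ::
    "('o, 'a) cat \<Rightarrow> ('o list, 'a list, 'o, 'a) ftor \<Rightarrow> ('o \<Rightarrow> 'a) \<Rightarrow> ('o list list \<Rightarrow> 'a) \<Rightarrow> bool"
  where
  "cartesian_multitensor V E u sig \<longleftrightarrow>
     multitensor V E u sig \<and> preserves_pullbacks (seq_cat V) V E \<and>
     cartesian_transformation V V id_ftor (unary_part E) u \<and>
     cartesian_transformation (seq_cat (seq_cat V)) V
       (comp_ftor E (map_ftor E)) (comp_ftor E concat_ftor) sig"

definition lra_multitensor ::
    "('o, 'a) cat \<Rightarrow> ('o list, 'a list, 'o, 'a) ftor \<Rightarrow> ('o \<Rightarrow> 'a) \<Rightarrow> ('o list list \<Rightarrow> 'a) \<Rightarrow> bool"
  where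
  "lra_multitensor V E u sig \<longleftrightarrow>
     multitensor V E u sig \<and> local_right_adjoint (seq_cat V) V E \<and>
     cartesian_transformation V V id_ftor (unary_part E) u \<and>
     cartesian_transformation (seq_cat (seq_cat V)) V
       (comp_ftor E (map_ftor E)) (comp_ftor E concat_ftor) sig"


text \<open>
  The homs of a \<open>V\<close>-graph, and the components of a morphism, are undefined outside the set of
  objects, so that equality of graphs and of morphisms is the mathematical one.  The small sets of
  objects are taken inside \<open>'u\<close>.
\<close>

record ('u, 'o) vgraph =
  Verts :: "'u set"
  Edge :: "'u \<times> 'u \<Rightarrow> 'o"

record ('u, 'o, 'a) vgraph_map =
  Src :: "('u, 'o) vgraph"
  Tgt :: "('u, 'o) vgraph"
  VMap :: "'u \<Rightarrow> 'u"
  EMap :: "'u \<times> 'u \<Rightarrow> 'a"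

definition vgraphs :: "'u itself \<Rightarrow> ('o, 'a) cat \<Rightarrow> ('u, 'o) vgraph set" where
  "vgraphs U V =
     {X. small U (Verts X) \<and> Edge X \<in> Verts X \<times> Verts X \<rightarrow>\<^sub>E Obj V}"

definition vgraph_maps :: "'u itself \<Rightarrow> ('o, 'a) cat \<Rightarrow> ('u, 'o, 'a) vgraph_map set" where
  "vgraph_maps U V =
     {f. Src f \<in> vgraphs U V \<and> Tgt f \<in> vgraphs U V \<and>
         VMap f \<in> Verts (Src f) \<rightarrow>\<^sub>E Verts (Tgt f) \<and>
         EMap f \<in> (\<Pi>\<^sub>E (a, b)\<in>Verts (Src f) \<times> Verts (Src f).
                     Hom V (Edge (Src f) (a, b)) (Edge (Tgt f) (VMap f a, VMap f b)))}"

definition vgraph_cat ::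
    "'u itself \<Rightarrow> ('o, 'a) cat \<Rightarrow> (('u, 'o) vgraph, ('u, 'o, 'a) vgraph_map) cat" where
  "vgraph_cat U V =
     \<lparr>Obj = vgraphs U V,
      Arr = vgraph_maps U V,
      Dom = Src,
      Cod = Tgt,
      Ide = (\<lambda>X. \<lparr>Src = X, Tgt = X, VMap = (\<lambda>a\<in>Verts X. a),
                   EMap = (\<lambda>ab\<in>Verts X \<times> Verts X. Ide V (Edge X ab))\<rparr>),
      Comp = (\<lambda>g f. \<lparr>Src = Src f, Tgt = Tgt g,
                      VMap = (\<lambda>a\<in>Verts (Src f). VMap g (VMap f a)),
                      EMap = (\<lambda>ab\<in>Verts (Src f) \<times> Verts (Src f).
                        EMap g (map_prod (VMap f) (VMap f) ab) \<cdot>\<^bsub>V\<^esub> EMap f ab)\<rparr>)\<rparr>"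


text \<open>
  Chosen coproducts.  The choice is immaterial: \<open>coproduct_obj\<close> and \<open>coproduct_inj\<close> form a coproduct
  cocone whenever one exists.
\<close>

definition coproduct_cocone :: "('o, 'a) cat \<Rightarrow> 'i set \<Rightarrow> ('i \<Rightarrow> 'o) \<Rightarrow> 'o \<times> ('i \<Rightarrow> 'a)" where
  "coproduct_cocone V I X = (SOME c. is_coproduct V I X (fst c) (snd c))"

definition coproduct_obj :: "('o, 'a) cat \<Rightarrow> 'i set \<Rightarrow> ('i \<Rightarrow> 'o) \<Rightarrow> 'o" where
  "coproduct_obj V I X = fst (coproduct_cocone V I X)"

definition coproduct_inj :: "('o, 'a) cat \<Rightarrow> 'i set \<Rightarrow> ('i \<Rightarrow> 'o) \<Rightarrow> 'i \<Rightarrow> 'a" where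
  "coproduct_inj V I X = snd (coproduct_cocone V I X)"

text \<open>
  A finite sequence \<open>a = x\<^sub>0, ..., x\<^sub>n = b\<close> is the nonempty list of its \<open>n + 1\<close> entries.
\<close>

definition paths :: "('u, 'o) vgraph \<Rightarrow> 'u \<Rightarrow> 'u \<Rightarrow> 'u list set" where
  "paths X a b = {p. p \<noteq> [] \<and> set p \<subseteq> Verts X \<and> hd p = a \<and> last p = b}"

definition steps :: "'u list \<Rightarrow> ('u \<times> 'u) list" where
  "steps p = zip p (tl p)"

definition Gamma_summand ::
    "('o list, 'a list, 'o, 'a) ftor \<Rightarrow> ('u, 'o) vgraph \<Rightarrow> 'u list \<Rightarrow> 'o" where
  "Gamma_summand E X p = OMap E (map (Edge X) (steps p))"

definition Gamma_obj ::
    "('o, 'a) cat \<Rightarrow> ('o list, 'a list, 'o, 'a) ftor \<Rightarrow> ('u, 'o) vgraph \<Rightarrow> ('u, 'o) vgraph" where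
  "Gamma_obj V E X =
     \<lparr>Verts = Verts X,
      Edge = (\<lambda>(a, b)\<in>Verts X \<times> Verts X. coproduct_obj V (paths X a b) (Gamma_summand E X))\<rparr>"

definition Gamma_inj ::
    "('o, 'a) cat \<Rightarrow> ('o list, 'a list, 'o, 'a) ftor \<Rightarrow> ('u, 'o) vgraph \<Rightarrow> 'u list \<Rightarrow> 'a" where
  "Gamma_inj V E X p = coproduct_inj V (paths X (hd p) (last p)) (Gamma_summand E X) p"

definition Gamma_map ::
    "('o, 'a) cat \<Rightarrow> ('o list, 'a list, 'o, 'a) ftor \<Rightarrow>
     ('u, 'o, 'a) vgraph_map \<Rightarrow> ('u, 'o, 'a) vgraph_map" where
  "Gamma_map V E f =
     \<lparr>Src = Gamma_obj V E (Src f),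
      Tgt = Gamma_obj V E (Tgt f),
      VMap = VMap f,
      EMap = (\<lambda>(a, b)\<in>Verts (Src f) \<times> Verts (Src f).
        THE h. h \<in> Hom V (Edge (Gamma_obj V E (Src f)) (a, b))
                         (Edge (Gamma_obj V E (Tgt f)) (VMap f a, VMap f b)) \<and>
          (\<forall>p\<in>paths (Src f) a b.
             h \<cdot>\<^bsub>V\<^esub> Gamma_inj V E (Src f) p =
             Gamma_inj V E (Tgt f) (map (VMap f) p) \<cdot>\<^bsub>V\<^esub> AMap E (map (EMap f) (steps p))))\<rparr>"

definition Gamma ::
    "('o, 'a) cat \<Rightarrow> ('o list, 'a list, 'o, 'a) ftor \<Rightarrow>
     (('u, 'o) vgraph, ('u, 'o, 'a) vgraph_map, ('u, 'o) vgraph, ('u, 'o, 'a) vgraph_map) ftor" where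
  "Gamma V E = \<lparr>OMap = Gamma_obj V E, AMap = Gamma_map V E\<rparr>"

definition Gamma_unit ::
    "('o, 'a) cat \<Rightarrow> ('o list, 'a list, 'o, 'a) ftor \<Rightarrow> ('o \<Rightarrow> 'a) \<Rightarrow>
     ('u, 'o) vgraph \<Rightarrow> ('u, 'o, 'a) vgraph_map" where
  "Gamma_unit V E u X =
     \<lparr>Src = X,
      Tgt = Gamma_obj V E X,
      VMap = (\<lambda>a\<in>Verts X. a),
      EMap = (\<lambda>(a, b)\<in>Verts X \<times> Verts X. Gamma_inj V E X [a, b] \<cdot>\<^bsub>V\<^esub> u (Edge X (a, b)))\<rparr>"

text \<open>
  A doubly nested composable sequence consists of a sequence \<open>p = (x\<^sub>0, ..., x\<^sub>n)\<close> and, for each step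
  of \<open>p\<close>, a sequence with the same endpoints; when \<open>n = 0\<close> there are no inner sequences and the
  composite sequence is \<open>(x\<^sub>0)\<close>.  The \<open>tl\<close> removes the shared endpoints on concatenation.  On such a
  summand, the multiplication is \<open>\<sigma>\<close> followed by the coproduct inclusion; by distributivity this
  determines it.
\<close>

definition nested_paths :: "('u, 'o) vgraph \<Rightarrow> 'u list \<Rightarrow> 'u list list set" where
  "nested_paths X p = {qs. list_all2 (\<lambda>(x, y) q. q \<in> paths X x y) (steps p) qs}"

definition join_paths :: "'u list \<Rightarrow> 'u list list \<Rightarrow> 'u list" where
  "join_paths p qs = hd p # concat (map tl qs)"

definition Gamma_mult ::
    "('o, 'a) cat \<Rightarrow> ('o list, 'a list, 'o, 'a) ftor \<Rightarrow> ('o list list \<Rightarrow> 'a) \<Rightarrow>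
     ('u, 'o) vgraph \<Rightarrow> ('u, 'o, 'a) vgraph_map" where
  "Gamma_mult V E sig X =
     \<lparr>Src = Gamma_obj V E (Gamma_obj V E X),
      Tgt = Gamma_obj V E X,
      VMap = (\<lambda>a\<in>Verts X. a),
      EMap = (\<lambda>(a, b)\<in>Verts X \<times> Verts X.
        THE h. h \<in> Hom V (Edge (Gamma_obj V E (Gamma_obj V E X)) (a, b))
                         (Edge (Gamma_obj V E X) (a, b)) \<and>
          (\<forall>p\<in>paths X a b. \<forall>qs\<in>nested_paths X p.
             h \<cdot>\<^bsub>V\<^esub> (Gamma_inj V E (Gamma_obj V E X) p \<cdot>\<^bsub>V\<^esub> AMap E (map (Gamma_inj V E X) qs)) =
             Gamma_inj V E X (join_paths p qs) \<cdot>\<^bsub>V\<^esub> sig (map (\<lambda>q. map (Edge X) (steps q)) qs)))\<rparr>"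

end

theory Submission
  imports Defs
begin

text \<open>
  A hom of \<open>\<Gamma>E(X)\<close> is a coproduct, so everything is checked on coproduct inclusions or, when every
  object is a coproduct of connected ones, on arrows out of connected objects: such an arrow into
  \<open>\<Gamma>E(X)(a,b)\<close> factors uniquely through the summand of a single path.

  Properties pass from \<open>E\<close> to \<open>\<Gamma>E\<close> path by path.  For coproducts a path of the sum lies in one
  summand; for a \<open>\<lambda>\<close>-filtered colimit a path lifts to some stage, and \<open>E\<close> is applied to the diagram
  on the coslice under that stage; for generic factorizations the paths obtained from the connected
  summands of the homs are glued along their end points.  Conversely, a sequence \<open>X\<^sub>1,...,X\<^sub>n\<close> is
  the linear graph \<open>0 \<rightarrow> 1 \<rightarrow> ... \<rightarrow> n\<close> with initial homs elsewhere; in \<open>\<Gamma>E\<close> of it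
  the hom from \<open>0\<close> to \<open>n\<close> is \<open>E\<^sub>i X\<^sub>i\<close>, since by distributivity \<open>E\<close> is initial as soon as one of its
  arguments is.

  A functor \<open>F\<close> is a local right adjoint iff every \<open>f : B \<rightarrow> F X\<close> has a generic factorization
  \<open>B \<rightarrow> F A \<rightarrow> F X\<close>, initial among the factorizations through \<open>F\<close> of an arrow to \<open>X\<close>.
\<close>

text \<open>A given colimit or pullback of graphs is analysed through its universal property alone,
  by morphisms to or from test graphs made for the purpose. This yields a description by vertices
  and homs that can be carried along \<open>Gamma\<close> and turned back into a universal property.
  For pullbacks the test graphs are the linear graphs with one edge; for colimits they are
  modifications of the colimit itself. The coslice under a stage appears because a path of a colimit
  lifts only to some stage, whereas accessibility of \<open>E\<close> needs a filtered diagram of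
  sequences, all of the same length. For generic factorizations the delicate direction is from
  \<open>Gamma\<close> to \<open>E\<close>: the graph supplied by genericity is arbitrary and has to
  be compared with the sequence of labels along one of its paths. The definitions fix the types of
  index sets and shapes. Paths, nested paths and coslices live in other types, so index sets are
  embedded and shapes transported before a definition applies.\<close>

abbreviation comp_in ("(_ \<star>_ _)" [70, 1000, 71] 70) where
  "g \<star>C f \<equiv> g \<cdot>\<^bsub>C\<^esub> f"


section \<open>Small sets\<close>

lemma small_subset: "small U B ==> A \<subseteq> B ==> small U A"
 unfolding small_def using card_of_mono1 ordLeq_ordLess_trans by blast

lemma small_image: "small U A ==> small U (f ` A)" unfolding small_def using card_of_image ordLeq_ordLess_trans by blast

text \<open>\<open>has_coproducts\<close> and similar definitions quantify over index sets in
  \<open>'u\<close>; an embedding of a small set of any type makes them applicable.\<close>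

lemma small_embedding:
 fixes U :: "'u itself"
 assumes "small U A"
 obtains e :: "'x => 'u" where "inj_on e A" using assms unfolding small_def by (metis card_of_ordLeq ordLess_imp_ordLeq)

lemma universe_Cinfinite: "universe (U :: 'u itself) ==> Cinfinite |UNIV :: 'u set|" unfolding universe_def
 by (metis Cinfinite_cong card_of_Card_order cinfinite_mono natLeq_Cinfinite ordLess_imp_ordLeq)

text \<open>Regularity of the cardinal of \<open>'u\<close> is what makes small unions of small sets
  small.\<close>

lemma small_UN:
 fixes U :: "'u itself"
 assumes "universe U" "small U I" "!!i. i : I ==> small U (A i)"
 shows "small U (\<Union>i\<in>I. A i)" using card_of_UNION_ordLess_infinite_Field_regularCard[of "|UNIV :: 'u set|" I A]
  universe_Cinfinite[OF assms(1)] assms unfolding small_def universe_def by blast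

lemma small_finite: "universe (U :: 'u itself) ==> finite A ==> small U A" unfolding small_def universe_def
 by (meson card_of_Well_order finite_iff_ordLess_natLeq ordLess_transitive)

lemma small_nat: "universe (U :: 'u itself) ==> small U (UNIV :: nat set)" unfolding small_def universe_def
 using card_of_nat ordIso_ordLess_trans by blast

lemma infinite_universe: "universe (U :: 'u itself) ==> infinite (UNIV :: 'u set)"
 using universe_Cinfinite[of U] by (simp add: cinfinite_def Field_card_of)

lemma small_Sigma:
 assumes "universe U" "small U I" "!!i. i : I ==> small U (A i)"
 shows "small U (Sigma I A)"
proof -
 have "Sigma I A = (\<Union>i\<in>I. Pair i ` A i)" by auto
 then show ?thesis using small_UN[OF assms(1,2), of "%i. Pair i ` A i"] assms(3) by (simp add: small_image)
qed

lemma small_Times: "universe U ==> small U A ==> small U B ==> small U (A \<times> B)" by (rule small_Sigma)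

text \<open>Lists form a countable union of finite powers, and countable sets are small because the
  universe is uncountable. Hence the paths of a graph can index a coproduct.\<close>

lemma small_lists:
 assumes "universe U" "small U A"
 shows "small U (lists A)"
proof -
 have n: "small U {xs. set xs \<subseteq> A & length xs = n}" for n
 proof (induction n)
  case 0
  have "{xs. set xs \<subseteq> A & length xs = 0} = {[]}" by auto
  then show ?case using small_finite[OF assms(1)] by (metis finite.emptyI finite_insert)
 next
  case (Suc n)
  have "{xs. set xs \<subseteq> A & length xs = Suc n} =
   (%(x, xs). x # xs) ` (A \<times> {xs. set xs \<subseteq> A & length xs = n})" by (auto simp: length_Suc_conv image_iff)
  then show ?case using small_image[OF small_Times[OF assms Suc]] by simp
 qed
 have "lists A = (\<Union>n\<in>UNIV. {xs. set xs \<subseteq> A & length xs = n})" by auto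
 then show ?thesis using small_UN[OF assms(1) small_nat[OF assms(1)] n] by simp
qed

section \<open>Categories and coproducts\<close>

lemma HomI: "f : Arr C ==> Dom C f = X ==> Cod C f = Y ==> f : Hom C X Y" by (simp add: Hom_def)

lemma HomD:
 assumes "f : Hom C X Y"
 shows "f : Arr C" "Dom C f = X" "Cod C f = Y" using assms by (auto simp: Hom_def)

locale Category =
 fixes C :: "('o, 'a) cat" (structure)
 assumes category: "category C"
begin

lemma Dom_Obj [simp]: "f : Arr C ==> Dom C f : Obj C" and Cod_Obj [simp]: "f : Arr C ==> Cod C f : Obj C"
 and Ide_Hom: "X : Obj C ==> Ide C X : Hom C X X" using category by (auto simp: category_def)

lemma Ide_simps [simp]:
 assumes "X : Obj C"
 shows "Ide C X : Arr C" "Dom C (Ide C X) = X" "Cod C (Ide C X) = X" using HomD[OF Ide_Hom[OF assms]] by auto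

lemma Hom_Obj: "f : Hom C X Y ==> X : Obj C & Y : Obj C" by (auto simp: Hom_def)

lemma comp_Hom: "f : Hom C X Y ==> g : Hom C Y Z ==> g \<cdot> f : Hom C X Z" using category by (auto simp: category_def Hom_def)

lemma comp_simps [simp]:
 assumes "f : Arr C" "g : Arr C" "Cod C f = Dom C g"
 shows "g \<cdot> f : Arr C" "Dom C (g \<cdot> f) = Dom C f" "Cod C (g \<cdot> f) = Cod C g"
 using HomD[OF comp_Hom[of f "Dom C f" "Cod C f" g "Cod C g"]] assms by (auto simp: Hom_def)

lemma comp_assoc: "f : Arr C ==> g : Arr C ==> h : Arr C ==> Cod C f = Dom C g ==> Cod C g = Dom C h ==>
  (h \<cdot> g) \<cdot> f = h \<cdot> (g \<cdot> f)" using category by (auto simp: category_def)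

lemma assoc: "f : Hom C X Y ==> g : Hom C Y Z ==> h : Hom C Z W ==> (h \<cdot> g) \<cdot> f = h \<cdot> (g \<cdot> f)"
 by (rule comp_assoc) (auto simp: Hom_def)

lemma comp_Ide [simp]: "f : Arr C ==> Dom C f = X ==> f \<cdot> Ide C X = f"
 and Ide_comp [simp]: "f : Arr C ==> Cod C f = X ==> Ide C X \<cdot> f = f" using category by (auto simp: category_def)

lemma id_r: "f : Hom C X Y ==> f \<cdot> Ide C X = f" and id_l: "f : Hom C X Y ==> Ide C Y \<cdot> f = f" by (auto simp: Hom_def)

lemma small_Obj: "small U (Arr C) ==> small U (Obj C)"
 using small_subset[OF small_image[of U "Arr C" "Dom C"], of "Obj C"] Ide_simps by (metis image_eqI subsetI)

lemma coproductD:
 assumes "is_coproduct C I X Q inc"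
 shows "Q : Obj C" "!!i. i : I ==> X i : Obj C" "!!i. i : I ==> inc i : Hom C (X i) Q" using assms by (auto simp: is_coproduct_def)

lemma coproduct_ex:
 assumes "is_coproduct C I X Q inc" "T : Obj C" "!!i. i : I ==> f i : Hom C (X i) T"
 obtains h where "h : Hom C Q T" "!!i. i : I ==> h \<cdot> inc i = f i" using assms unfolding is_coproduct_def by metis

lemma coproduct_eq:
 assumes "is_coproduct C I X Q inc" "h : Hom C Q T" "h' : Hom C Q T" and "!!i. i : I ==> h \<cdot> inc i = h' \<cdot> inc i"
 shows "h = h'"
proof -
 have T: "T : Obj C" using assms(2) Hom_Obj by blast
 have u: "ALL f. (ALL i:I. f i : Hom C (X i) T) --> (EX! k. k : Hom C Q T & (ALL i:I. k \<cdot> inc i = f i))"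
  using assms(1) T unfolding is_coproduct_def by blast
 have "ALL i:I. h \<cdot> inc i : Hom C (X i) T" using comp_Hom[OF coproductD(3)[OF assms(1)] assms(2)] by blast
 then have "EX! k. k : Hom C Q T & (ALL i:I. k \<cdot> inc i = h \<cdot> inc i)"
  using u[rule_format, of "%i. h \<cdot> inc i"] by simp
 then show ?thesis using assms by metis
qed

lemma coproductI:
 assumes Q: "Q : Obj C" "!!i. i : I ==> inc i : Hom C (X i) Q" and "!!T f. T : Obj C ==> (!!i. i : I ==> f i : Hom C (X i) T) ==>
   EX h. h : Hom C Q T & (ALL i:I. h \<cdot> inc i = f i)" and "!!T h h'. T : Obj C ==> h : Hom C Q T ==> h' : Hom C Q T ==>
   (!!i. i : I ==> h \<cdot> inc i = h' \<cdot> inc i) ==> h = h'"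
 shows "is_coproduct C I X Q inc" unfolding is_coproduct_def
proof (intro conjI ballI allI impI)
 fix T f assume T: "T : Obj C" and f: "ALL i:I. f i : Hom C (X i) T"
 obtain h where h: "h : Hom C Q T" "ALL i:I. h \<cdot> inc i = f i" using assms(3) T f by metis
 show "EX! h. h : Hom C Q T & (ALL i:I. h \<cdot> inc i = f i)" using h assms(4)[OF T] by (intro ex1I[of _ h]) auto
qed (use Q Hom_Obj in blast)+

text \<open>The comparison of families is pointwise on the index set, so with \<open>e\<close> the
  identity this also exchanges families that differ outside it.\<close>

lemma coproduct_reindex:
 assumes Q: "is_coproduct C I X Q inc" and e: "bij_betw e I' I"
  and X': "!!i. i : I' ==> X' i = X (e i)" and inc': "!!i. i : I' ==> inc' i = inc (e i)"
 shows "is_coproduct C I' X' Q inc'"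
proof (rule coproductI)
 note D = coproductD[OF Q]
 have eI: "!!i. i : I' ==> e i : I" using e by (auto simp: bij_betw_def)
 let ?d = "the_inv_into I' e"
 have d: "?d i : I'" "e (?d i) = i" if "i : I" for i
  using that e by (auto simp: bij_betw_def intro!: the_inv_into_into f_the_inv_into_f)
 have d': "?d (e i) = i" if "i : I'" for i using that e by (auto simp: bij_betw_def intro!: the_inv_into_f_f)
 show "Q : Obj C" by (rule D)
 show "inc' i : Hom C (X' i) Q" if "i : I'" for i using that D eI X' inc' by auto
 {
  fix T f assume T: "T : Obj C" and f: "!!i. i : I' ==> f i : Hom C (X' i) T"
  obtain h where "h : Hom C Q T" "!!i. i : I ==> h \<cdot> inc i = f (?d i)"
   by (rule coproduct_ex[OF Q T, of "%i. f (?d i)"]) (use f d X' in "metis+")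
  then show "EX h. h : Hom C Q T & (ALL i:I'. h \<cdot> inc' i = f i)" using eI inc' d' by metis
 }
 fix T h h' assume "h : Hom C Q T" "h' : Hom C Q T" "!!i. i : I' ==> h \<cdot> inc' i = h' \<cdot> inc' i"
 then show "h = h'" using coproduct_eq[OF Q] d inc' by metis
qed

text \<open>Needed for iterating \<open>Gamma\<close>: a coproduct over paths whose summands are, by
  distributivity, coproducts themselves.\<close>

lemma coproduct_nested:
 assumes Q: "is_coproduct C I X Q inc" and X: "!!i. i : I ==> is_coproduct C (K i) (Y i) (X i) (j i)"
 shows "is_coproduct C (Sigma I K) (%(i, k). Y i k) Q (%(i, k). inc i \<cdot> j i k)"
proof (rule coproductI)
 note D = coproductD[OF Q] and D' = coproductD[OF X]
 show "Q : Obj C" by (rule D)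
 show "(case ik of (i, k) => inc i \<cdot> j i k) : Hom C (case ik of (i, k) => Y i k) Q" if "ik : Sigma I K" for ik
  using that D'(3) D(3) by (auto intro: comp_Hom)
 {
  fix T f assume T: "T : Obj C" and f: "!!ik. ik : Sigma I K ==> f ik : Hom C (case ik of (i, k) => Y i k) T"
  have "EX g. g : Hom C (X i) T & (ALL k:K i. g \<cdot> j i k = f (i, k))" if i: "i : I" for i
  proof -
   obtain g where "g : Hom C (X i) T" "!!k. k : K i ==> g \<cdot> j i k = f (i, k)"
    by (rule coproduct_ex[OF X[OF i] T, of "%k. f (i, k)"]) (use f[of "(i, _)"] i in auto)
   then show ?thesis by blast
  qed
  then obtain g where g: "!!i. i : I ==> g i : Hom C (X i) T" "!!i k. i : I ==> k : K i ==> g i \<cdot> j i k = f (i, k)" by metis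
  obtain h where h: "h : Hom C Q T" "!!i. i : I ==> h \<cdot> inc i = g i" by (rule coproduct_ex[OF Q T, of g]) (use g in auto)
  show "EX h. h : Hom C Q T & (ALL ik:Sigma I K. h \<cdot> (case ik of (i, k) => inc i \<cdot> j i k) = f ik)"
   using h g assoc[OF D'(3) D(3) h(1)] by (intro exI[of _ h] conjI ballI) auto
 }
 fix T h h' assume h: "h : Hom C Q T" "h' : Hom C Q T" and eq: "!!ik. ik : Sigma I K ==>
   h \<cdot> (case ik of (i, k) => inc i \<cdot> j i k) = h' \<cdot> (case ik of (i, k) => inc i \<cdot> j i k)"
 show "h = h'"
 proof (rule coproduct_eq[OF Q h])
  fix i assume i: "i : I"
  show "h \<cdot> inc i = h' \<cdot> inc i"
  proof (rule coproduct_eq[OF X[OF i], where T = T])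
   fix k assume k: "k : K i"
   show "(h \<cdot> inc i) \<cdot> j i k = (h' \<cdot> inc i) \<cdot> j i k"
    using eq[of "(i, k)"] i k assoc[OF D'(3)[OF i k] D(3)[OF i] h(1)] assoc[OF D'(3)[OF i k] D(3)[OF i] h(2)] by simp
  qed (rule comp_Hom[OF D(3)[OF i] h(1)], rule comp_Hom[OF D(3)[OF i] h(2)])
 qed
qed

text \<open>Arrows out of \<open>Q\<close> are families over all pairs \<open>(i, k)\<close>, and
  those over a fixed \<open>i\<close> amount to one arrow out of \<open>X i\<close>. It regroups a
  coproduct over paths by their end points.\<close>

lemma coproduct_unnest:
 assumes Q: "is_coproduct C (Sigma I K) Y Q l" and X: "!!i. i : I ==> is_coproduct C (K i) (%k. Y (i, k)) (X i) (j i)"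
  and inc: "!!i. i : I ==> inc i : Hom C (X i) Q" and l: "!!i k. i : I ==> k : K i ==> l (i, k) = inc i \<cdot> j i k"
 shows "is_coproduct C I X Q inc"
proof (rule coproductI)
 note D = coproductD[OF Q] and D' = coproductD[OF X]
 show "Q : Obj C" by (rule D)
 show "inc i : Hom C (X i) Q" if "i : I" for i by (rule inc[OF that])
 {
  fix T f assume T: "T : Obj C" and f: "!!i. i : I ==> f i : Hom C (X i) T"
  obtain h where h: "h : Hom C Q T" "!!ik. ik : Sigma I K ==> h \<cdot> l ik = f (fst ik) \<cdot> j (fst ik) (snd ik)"
  proof (rule coproduct_ex[OF Q T, of "%ik. f (fst ik) \<cdot> j (fst ik) (snd ik)"])
   show "f (fst ik) \<cdot> j (fst ik) (snd ik) : Hom C (Y ik) T" if "ik : Sigma I K" for ik using comp_Hom[OF D'(3) f] that by force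
  qed blast
  have "h \<cdot> inc i = f i" if i: "i : I" for i
  proof (rule coproduct_eq[OF X[OF i], where T = T])
   fix k assume k: "k : K i"
   show "(h \<cdot> inc i) \<cdot> j i k = f i \<cdot> j i k"
    using h(2)[of "(i, k)"] i k l assoc[OF D'(3)[OF i k] inc[OF i] h(1)] by simp
  qed (rule comp_Hom[OF inc[OF i] h(1)], rule f[OF i])
  then show "EX h. h : Hom C Q T & (ALL i:I. h \<cdot> inc i = f i)" using h by blast
 }
 fix T h h' assume h: "h : Hom C Q T" "h' : Hom C Q T" and eq: "!!i. i : I ==> h \<cdot> inc i = h' \<cdot> inc i"
 show "h = h'"
 proof (rule coproduct_eq[OF Q h])
  fix ik assume "ik : Sigma I K"
  then obtain i k where [simp]: "ik = (i, k)" and ik: "i : I" "k : K i" by auto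
  show "h \<cdot> l ik = h' \<cdot> l ik" using eq[OF ik(1)] assoc[OF D'(3)[OF ik] inc[OF ik(1)] h(1)]
    assoc[OF D'(3)[OF ik] inc[OF ik(1)] h(2)] l[OF ik] by simp
 qed
qed

lemma coproduct_exists:
 fixes U :: "'u itself" and I :: "'i set"
 assumes "has_coproducts U C" "small U I" "!!i. i : I ==> X i : Obj C"
 shows "EX Q inc. is_coproduct C I X Q inc"
proof -
 obtain e :: "'i => 'u" where e: "inj_on e I" using small_embedding[OF assms(2)] by blast
 have b: "bij_betw e I (e ` I)" using e by (simp add: bij_betw_def)
 have "EX Q inc. is_coproduct C (e ` I) (X \<circ> the_inv_into I e) Q inc"
  using assms(1)[unfolded has_coproducts_def, rule_format, of "e ` I" "X \<circ> the_inv_into I e"]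
   small_image[OF assms(2), of e] assms(3) e by (force simp: the_inv_into_f_f)
 then obtain Q inc where "is_coproduct C (e ` I) (X \<circ> the_inv_into I e) Q inc" by blast
 then have "is_coproduct C I X Q (inc \<circ> e)" by (rule coproduct_reindex[OF _ b]) (auto simp: the_inv_into_f_f[OF e])
 then show ?thesis by blast
qed

lemma coproduct_chosen:
 assumes "has_coproducts U C" "small U I" "!!i. i : I ==> X i : Obj C"
 shows "is_coproduct C I X (coproduct_obj C I X) (coproduct_inj C I X)"
proof -
 have "EX c. is_coproduct C I X (fst c) (snd c)" using coproduct_exists[OF assms] by auto
 from someI_ex[OF this] show ?thesis by (simp add: coproduct_obj_def coproduct_inj_def coproduct_cocone_def)
qed

lemma preserves_coproducts_small:
 fixes U :: "'u itself" and I :: "'i set"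
 assumes "preserves_coproducts U C D F" "small U I" "is_coproduct C I X Q inc" "category D"
 shows "is_coproduct D I (OMap F \<circ> X) (OMap F Q) (AMap F \<circ> inc)"
proof -
 obtain e :: "'i => 'u" where e: "inj_on e I" using small_embedding[OF assms(2)] by blast
 interpret D: Category D by unfold_locales (rule assms)
 have b: "bij_betw e I (e ` I)" using e by (simp add: bij_betw_def)
 have "is_coproduct C (e ` I) (X \<circ> the_inv_into I e) Q (inc \<circ> the_inv_into I e)"
  by (rule coproduct_reindex[OF assms(3) bij_betw_the_inv_into[OF b]]) auto
 then have "is_coproduct D (e ` I) (OMap F \<circ> (X \<circ> the_inv_into I e)) (OMap F Q)
  (AMap F \<circ> (inc \<circ> the_inv_into I e))"
  using assms(1) small_image[OF assms(2), of e] unfolding preserves_coproducts_def by blast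
 then show ?thesis by (rule D.coproduct_reindex[OF _ b]) (auto simp: the_inv_into_f_f[OF e])
qed

text \<open>Stated as an empty coproduct, so that a functor preserving coproducts is seen at once to
  preserve initial objects.\<close>

definition initial :: "'o => bool" where
 "initial Z \<longleftrightarrow> is_coproduct C ({} :: unit set) (%_. undefined) Z (%_. undefined)"

lemma initial_iff: "initial Z \<longleftrightarrow> Z : Obj C & (ALL T:Obj C. EX! h. h : Hom C Z T)"
 by (simp add: initial_def is_coproduct_def)

lemma initial_coproduct: "initial Z \<longleftrightarrow> is_coproduct C {} X Z inc" by (simp add: initial_def is_coproduct_def)

lemma initialD:
 assumes "initial Z"
 shows "Z : Obj C" "!!T. T : Obj C ==> EX h. h : Hom C Z T" "!!f g T. f : Hom C Z T ==> g : Hom C Z T ==> f = g"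
proof -
 fix f g T assume "f : Hom C Z T" "g : Hom C Z T"
 then show "f = g" using assms Hom_Obj unfolding initial_iff by blast
qed (use assms in "auto simp: initial_iff")

section \<open>Connected objects\<close>

lemma connected_objectD:
 fixes U :: "'u itself" and I :: "'i set"
 assumes T: "connected_object U C T" and I: "small U I" and Q: "is_coproduct C I X Q inc"
 shows "bij_betw (%(i, f). inc i \<cdot> f) (SIGMA i:I. Hom C T (X i)) (Hom C T Q)"
proof -
 obtain e :: "'i => 'u" where e: "inj_on e I" using small_embedding[OF I] by blast
 let ?d = "the_inv_into I e"
 have b: "bij_betw e I (e ` I)" using e by (simp add: bij_betw_def)
 have "is_coproduct C (e ` I) (X \<circ> ?d) Q (inc \<circ> ?d)" by (rule coproduct_reindex[OF Q bij_betw_the_inv_into[OF b]]) auto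
 then have *: "bij_betw (%(i, f). (inc \<circ> ?d) i \<cdot> f) (SIGMA i:e ` I. Hom C T ((X \<circ> ?d) i)) (Hom C T Q)"
  using T small_image[OF I, of e] unfolding connected_object_def by blast
 have "bij_betw (%(i, f). (e i, f)) (SIGMA i:I. Hom C T (X i)) (SIGMA i:e ` I. Hom C T ((X \<circ> ?d) i))"
  using e by (auto simp: bij_betw_def inj_on_def the_inv_into_f_f image_iff)
 from bij_betw_trans[OF this *] show ?thesis by (rule bij_betw_cong[THEN iffD1, rotated]) (auto simp: the_inv_into_f_f[OF e])
qed

lemma connected_ex:
 assumes "connected_object U C T" "small U I" "is_coproduct C I X Q inc" "f : Hom C T Q"
 obtains i g where "i : I" "g : Hom C T (X i)" "f = inc i \<cdot> g"
proof -
 have "f : (%(i, f). inc i \<cdot> f) ` (SIGMA i:I. Hom C T (X i))"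
  using connected_objectD[OF assms(1-3)] assms(4) by (auto simp: bij_betw_def)
 then show ?thesis using that by auto
qed
lemma connected_eq:
 assumes "connected_object U C T" "small U I" "is_coproduct C I X Q inc"
  "i : I" "g : Hom C T (X i)" "i' : I" "g' : Hom C T (X i')" "inc i \<cdot> g = inc i' \<cdot> g'"
 shows "i = i' & g = g'" using connected_objectD[OF assms(1-3)] assms(4-) by (auto simp: bij_betw_def inj_on_def)

lemma coproducts_of_connectedE:
 assumes "coproducts_of_connected U C" "Q : Obj C"
 obtains I :: "'u set" and X inc where "small (U :: 'u itself) I"
  "!!i. i : I ==> connected_object U C (X i)" "is_coproduct C I X Q inc" using assms unfolding coproducts_of_connected_def by metis

text \<open>Any test object is a coproduct of connected ones, and both existence and uniqueness of
  the mediating arrow can be settled summand by summand. Squares between coproducts are thereby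
  reduced to arrows that choose a summand.\<close>

lemma pullback_on_connected:
 fixes U :: "'u itself"
 assumes cc: "coproducts_of_connected U C"
  and pb: "p : Hom C P A" "q : Hom C P B" "f : Hom C A D" "g : Hom C B D" "f \<cdot> p = g \<cdot> q"
  and ex: "!!T x y. connected_object U C T ==> x : Hom C T A ==> y : Hom C T B ==>
   f \<cdot> x = g \<cdot> y ==> EX h. h : Hom C T P & p \<cdot> h = x & q \<cdot> h = y"
  and un: "!!T h h'. connected_object U C T ==> h : Hom C T P ==> h' : Hom C T P ==>
   p \<cdot> h = p \<cdot> h' ==> q \<cdot> h = q \<cdot> h' ==> h = h'"
 shows "is_pullback C p q f g" unfolding is_pullback_def
proof (intro conjI ballI impI)
 fix T x y assume T: "T : Obj C" and x0: "x : Hom C T (Dom C f)" and y0: "y : Hom C T (Dom C g)"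
  and eq: "f \<cdot> x = g \<cdot> y"
 have x: "x : Hom C T A" and y: "y : Hom C T B" using x0 y0 HomD[OF pb(3)] HomD[OF pb(4)] by auto
 obtain I :: "'u set" and X inc where I: "!!i. i : I ==> connected_object U C (X i)"
  and Q: "is_coproduct C I X T inc" using coproducts_of_connectedE[OF cc T] by metis
 note D = coproductD[OF Q]
 have "EX h. h : Hom C (X i) P & p \<cdot> h = x \<cdot> inc i & q \<cdot> h = y \<cdot> inc i" if i: "i : I" for i
  by (rule ex[OF I[OF i]]) (use D(3)[OF i] x y eq assoc[OF D(3)[OF i] x pb(3)] assoc[OF D(3)[OF i] y pb(4)] comp_Hom in auto)
 then obtain k where k: "!!i. i : I ==> k i : Hom C (X i) P"
  "!!i. i : I ==> p \<cdot> k i = x \<cdot> inc i" "!!i. i : I ==> q \<cdot> k i = y \<cdot> inc i" by metis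
 obtain h where h: "h : Hom C T P" "!!i. i : I ==> h \<cdot> inc i = k i"
  by (rule coproduct_ex[OF Q, of P k]) (use k pb Hom_Obj in auto)
 have "p \<cdot> h = x" by (rule coproduct_eq[OF Q comp_Hom[OF h(1) pb(1)] x]) (use k h assoc[OF D(3) h(1) pb(1)] in auto)
 moreover have "q \<cdot> h = y" by (rule coproduct_eq[OF Q comp_Hom[OF h(1) pb(2)] y]) (use k h assoc[OF D(3) h(1) pb(2)] in auto)
 moreover have "h' = h" if h': "h' : Hom C T P" "p \<cdot> h' = x" "q \<cdot> h' = y" for h'
 proof (rule coproduct_eq[OF Q h'(1) h(1)])
  fix i assume i: "i : I"
  show "h' \<cdot> inc i = h \<cdot> inc i"
  proof (rule un[OF I[OF i]])
   show "h' \<cdot> inc i : Hom C (X i) P" "h \<cdot> inc i : Hom C (X i) P" using comp_Hom[OF D(3)[OF i]] h h' by blast+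
   show "p \<cdot> (h' \<cdot> inc i) = p \<cdot> (h \<cdot> inc i)"
    using h(2)[OF i] k(2)[OF i] assoc[OF D(3)[OF i] h'(1) pb(1)] h'(2) by simp
   show "q \<cdot> (h' \<cdot> inc i) = q \<cdot> (h \<cdot> inc i)"
    using h(2)[OF i] k(3)[OF i] assoc[OF D(3)[OF i] h'(1) pb(2)] h'(3) by simp
  qed
 qed
 ultimately show "EX! h. h : Hom C T (Dom C p) & p \<cdot> h = x & q \<cdot> h = y" unfolding HomD(2)[OF pb(1)] using h(1) by blast
qed (use pb in "auto simp: Hom_def")

lemma pullbackD:
 assumes "is_pullback C p q f g"
 shows "p : Hom C (Dom C p) (Dom C f)" "q : Hom C (Dom C p) (Dom C g)"
  "f : Hom C (Dom C f) (Cod C f)" "g : Hom C (Dom C g) (Cod C f)" "f \<cdot> p = g \<cdot> q"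
 using assms by (auto simp: is_pullback_def Hom_def)

lemma pullback_ex:
 assumes "is_pullback C p q f g" "x : Hom C T (Dom C f)" "y : Hom C T (Dom C g)" "f \<cdot> x = g \<cdot> y"
 obtains h where "h : Hom C T (Dom C p)" "p \<cdot> h = x" "q \<cdot> h = y"
 using assms Hom_Obj[OF assms(2)] unfolding is_pullback_def by metis

lemma pullback_eq:
 assumes "is_pullback C p q f g" "h : Hom C T (Dom C p)" "h' : Hom C T (Dom C p)"
  "p \<cdot> h = p \<cdot> h'" "q \<cdot> h = q \<cdot> h'"
 shows "h = h'"
proof -
 note D = pullbackD[OF assms(1)]
 have "p \<cdot> h : Hom C T (Dom C f)" "q \<cdot> h : Hom C T (Dom C g)" "f \<cdot> (p \<cdot> h) = g \<cdot> (q \<cdot> h)"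
  using D assms comp_Hom assoc[OF assms(2) D(1) D(3)] assoc[OF assms(2) D(2) D(4)] by auto
 then have "EX! k. k : Hom C T (Dom C p) & p \<cdot> k = p \<cdot> h & q \<cdot> k = q \<cdot> h"
  using assms(1) Hom_Obj[OF assms(2)] unfolding is_pullback_def by blast
 then show ?thesis using assms by metis
qed

lemma pullbackI:
 assumes pb: "p : Hom C P A" "q : Hom C P B" "f : Hom C A D" "g : Hom C B D" "f \<cdot> p = g \<cdot> q"
  and ex: "!!T x y. x : Hom C T A ==> y : Hom C T B ==>
   f \<cdot> x = g \<cdot> y ==> EX h. h : Hom C T P & p \<cdot> h = x & q \<cdot> h = y"
  and un: "!!T h h'. h : Hom C T P ==> h' : Hom C T P ==> p \<cdot> h = p \<cdot> h' ==> q \<cdot> h = q \<cdot> h' ==> h = h'"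
 shows "is_pullback C p q f g" unfolding is_pullback_def
proof (intro conjI ballI impI)
 fix T x y assume "x : Hom C T (Dom C f)" "y : Hom C T (Dom C g)" "f \<cdot> x = g \<cdot> y"
 then obtain h where "h : Hom C T P" "p \<cdot> h = x" "q \<cdot> h = y" using ex HomD[OF pb(3)] HomD[OF pb(4)] by metis
 then show "EX! h. h : Hom C T (Dom C p) & p \<cdot> h = x & q \<cdot> h = y" using un HomD[OF pb(1)] by (intro ex1I[of _ h]) auto
qed (use pb in "auto simp: Hom_def")

end

lemma functorD:
 assumes "is_functor C D F"
 shows "category C" "category D" "!!X. X : Obj C ==> OMap F X : Obj D"
  "!!f X Y. f : Hom C X Y ==> AMap F f : Hom D (OMap F X) (OMap F Y)" "!!X. X : Obj C ==> AMap F (Ide C X) = Ide D (OMap F X)"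
  "!!f g X Y Z. f : Hom C X Y ==> g : Hom C Y Z ==> AMap F (g \<star>C f) = AMap F g \<star>D AMap F f"
 using assms by (auto simp: is_functor_def Hom_def)

lemma is_functorI:
 assumes "category C" "category D" "!!X. X : Obj C ==> OMap F X : Obj D"
  "!!f X Y. f : Hom C X Y ==> AMap F f : Hom D (OMap F X) (OMap F Y)" "!!X. X : Obj C ==> AMap F (Ide C X) = Ide D (OMap F X)"
  "!!f g X Y Z. f : Hom C X Y ==> g : Hom C Y Z ==> AMap F (g \<star>C f) = AMap F g \<star>D AMap F f"
 shows "is_functor C D F" using assms by (auto simp: is_functor_def Hom_def)

section \<open>Graphs\<close>

definition mk_graph :: "'u set => ('u \<times> 'u => 'o) => ('u, 'o) vgraph" where
 "mk_graph W e = \<lparr>Verts = W, Edge = restrict e (W \<times> W)\<rparr>"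

definition mk_map :: "('u, 'o) vgraph => ('u, 'o) vgraph => ('u => 'u) => ('u \<times> 'u => 'a) => ('u, 'o, 'a) vgraph_map" where
 "mk_map X Y \<phi> \<epsilon> = \<lparr>Src = X, Tgt = Y, VMap = restrict \<phi> (Verts X),
   EMap = restrict \<epsilon> (Verts X \<times> Verts X)\<rparr>"

lemma mk_graph_simps [simp]: "Verts (mk_graph W e) = W" "a : W ==> b : W ==> Edge (mk_graph W e) (a, b) = e (a, b)"
 by (auto simp: mk_graph_def)

lemma mk_map_simps [simp]: "a : Verts X ==> VMap (mk_map X Y \<phi> \<epsilon>) a = \<phi> a"
 "a : Verts X ==> b : Verts X ==> EMap (mk_map X Y \<phi> \<epsilon>) (a, b) = \<epsilon> (a, b)"
 "Src (mk_map X Y \<phi> \<epsilon>) = X" "Tgt (mk_map X Y \<phi> \<epsilon>) = Y" by (auto simp: mk_map_def)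

locale VGraphs = V: Category V for V :: "('o, 'a) cat" (structure) +
 fixes U :: "'u itself"
 assumes universe: "universe U" and has_coproducts: "has_coproducts U V"
begin

abbreviation compV (infixl "**" 70) where "g ** f \<equiv> g \<cdot> f"

abbreviation SV :: "('o list, 'a list) cat" where "SV \<equiv> seq_cat V"

abbreviation Seqs where "Seqs \<equiv> lists (Obj V)"

abbreviation conn where "conn \<equiv> connected_object U V"

abbreviation GV :: "(('u, 'o) vgraph, ('u, 'o, 'a) vgraph_map) cat" where "GV \<equiv> vgraph_cat U V"

lemma GV_sel: "Obj GV = vgraphs U V" "Arr GV = vgraph_maps U V" "Dom GV = Src" "Cod GV = Tgt" by (simp_all add: vgraph_cat_def)

lemma mk_graph_Obj: "small U W ==> (!!a b. a : W ==> b : W ==> e (a, b) : Obj V) ==> mk_graph W e : Obj GV"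
 by (auto simp: GV_sel vgraphs_def mk_graph_def)

lemma GObjD:
 assumes "X : Obj GV"
 shows "small U (Verts X)" "!!a b. a : Verts X ==> b : Verts X ==> Edge X (a, b) : Obj V"
  "Edge X : extensional (Verts X \<times> Verts X)" using assms by (auto simp: GV_sel vgraphs_def PiE_def)

lemma GHom_iff: "f : Hom GV X Y \<longleftrightarrow> X : Obj GV & Y : Obj GV & Src f = X & Tgt f = Y &
  VMap f : Verts X \<rightarrow>\<^sub>E Verts Y & EMap f : extensional (Verts X \<times> Verts X) &
  (ALL a:Verts X. ALL b:Verts X. EMap f (a, b) : Hom V (Edge X (a, b)) (Edge Y (VMap f a, VMap f b)))"
 by (auto simp: Hom_def[of GV] GV_sel vgraph_maps_def PiE_def Pi_def)

lemma GHomD: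
 assumes "f : Hom GV X Y"
 shows "X : Obj GV" "Y : Obj GV" "Src f = X" "Tgt f = Y" "!!a. a : Verts X ==> VMap f a : Verts Y"
  "!!a b. a : Verts X ==> b : Verts X ==> EMap f (a, b) : Hom V (Edge X (a, b)) (Edge Y (VMap f a, VMap f b))"
 using assms by (auto simp: GHom_iff PiE_def Pi_def)

lemma mk_map_Hom:
 assumes "X : Obj GV" "Y : Obj GV" "!!a. a : Verts X ==> \<phi> a : Verts Y" "!!a b. a : Verts X ==> b : Verts X ==>
    \<epsilon> (a, b) : Hom V (Edge X (a, b)) (Edge Y (\<phi> a, \<phi> b))"
 shows "mk_map X Y \<phi> \<epsilon> : Hom GV X Y" using assms by (auto simp: GHom_iff mk_map_def)

lemma GHom_eqI:
 assumes "f : Hom GV X Y" "g : Hom GV X Y" "!!a. a : Verts X ==> VMap f a = VMap g a"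
  "!!a b. a : Verts X ==> b : Verts X ==> EMap f (a, b) = EMap g (a, b)"
 shows "f = g"
proof -
 have "VMap f : Verts X \<rightarrow>\<^sub>E Verts Y" "VMap g : Verts X \<rightarrow>\<^sub>E Verts Y"
  using assms(1,2) unfolding GHom_iff by simp_all
 then have "VMap f = VMap g" by (rule PiE_ext) (rule assms(3))
 moreover have "EMap f = EMap g"
  using assms(1,2,4) unfolding GHom_iff by (auto intro!: extensionalityI[of _ "Verts X \<times> Verts X"])
 ultimately show ?thesis using assms(1,2) unfolding GHom_iff by auto
qed

lemma GComp:
 assumes "f : Hom GV X Y" "a : Verts X"
 shows "VMap (g \<star>GV f) a = VMap g (VMap f a)"
  "b : Verts X ==> EMap (g \<star>GV f) (a, b) = EMap g (VMap f a, VMap f b) ** EMap f (a, b)"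
 using assms GHomD(3)[OF assms(1)] by (auto simp: vgraph_cat_def)

lemma GIde:
 assumes "a : Verts X"
 shows "VMap (Ide GV X) a = a" "b : Verts X ==> EMap (Ide GV X) (a, b) = Ide V (Edge X (a, b))"
 using assms by (auto simp: vgraph_cat_def)

lemma GComp_Hom: "f : Hom GV X Y ==> g : Hom GV Y Z ==> g \<star>GV f : Hom GV X Z"
proof -
 assume f: "f : Hom GV X Y" and g: "g : Hom GV Y Z"
 have "g \<star>GV f = mk_map X Z (%a. VMap g (VMap f a)) (%(a, b). EMap g (VMap f a, VMap f b) ** EMap f (a, b))"
  using GHomD[OF f] GHomD[OF g] by (auto simp: vgraph_cat_def mk_map_def fun_eq_iff)
 moreover have "\<dots> : Hom GV X Z" by (rule mk_map_Hom)
   (use GHomD[OF f] GHomD[OF g] V.comp_Hom[OF GHomD(6)[OF f] GHomD(6)[OF g]] in auto)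
 ultimately show ?thesis by simp
qed

lemma GIde_Hom: "X : Obj GV ==> Ide GV X : Hom GV X X"
proof -
 assume X: "X : Obj GV"
 have "Ide GV X = mk_map X X (%a. a) (%ab. Ide V (Edge X ab))" by (auto simp: vgraph_cat_def mk_map_def)
 then show ?thesis using X GObjD[OF X] by (auto intro!: mk_map_Hom simp: V.Ide_Hom)
qed

lemma category_GV: "category GV"
proof -
 have Arr: "f : Hom GV (Src f) (Tgt f)" if "f : Arr GV" for f using that by (auto simp: Hom_def GV_sel)
 have 1: "f \<star>GV Ide GV X = f" "Ide GV Y \<star>GV f = f" if f: "f : Hom GV X Y" for f X Y
 proof -
  note D = GHomD[OF f]
  show "f \<star>GV Ide GV X = f" by (rule GHom_eqI[OF GComp_Hom[OF GIde_Hom[OF D(1)] f] f])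
    (use D GIde_Hom[OF D(1)] GIde[of _ X] GComp[OF GIde_Hom[OF D(1)]] V.id_r[OF D(6)] in auto)
  show "Ide GV Y \<star>GV f = f" by (rule GHom_eqI[OF GComp_Hom[OF f GIde_Hom[OF D(2)]] f])
    (use D GIde[of _ Y] GComp[OF f] V.id_l[OF D(6)] in auto)
 qed
 have 2: "h \<star>GV (g \<star>GV f) = (h \<star>GV g) \<star>GV f"
  if f: "f : Hom GV X Y" and g: "g : Hom GV Y Z" and h: "h : Hom GV Z W" for f g h X Y Z W
 proof (rule GHom_eqI[OF GComp_Hom[OF GComp_Hom[OF f g] h] GComp_Hom[OF f GComp_Hom[OF g h]]])
  fix a b assume a: "a : Verts X" "b : Verts X"
  note F = GHomD[OF f] and G = GHomD[OF g] and H = GHomD[OF h]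
  show "EMap (h \<star>GV (g \<star>GV f)) (a, b) = EMap ((h \<star>GV g) \<star>GV f) (a, b)"
   using a F G H by (simp add: GComp[OF f] GComp[OF g] GComp[OF GComp_Hom[OF f g]] V.assoc[OF F(6) G(6) H(6)])
 qed (use GHomD[OF f] in "simp add: GComp[OF f] GComp[OF g] GComp[OF GComp_Hom[OF f g]]")
 show ?thesis unfolding category_def
 proof (intro conjI ballI impI)
  fix f assume f: "f : Arr GV"
  show "Dom GV f : Obj GV" "Cod GV f : Obj GV" using GHomD(1,2)[OF Arr[OF f]] by (auto simp: GV_sel)
  show "f \<star>GV Ide GV (Dom GV f) = f" "Ide GV (Cod GV f) \<star>GV f = f" using 1[OF Arr[OF f]] by (auto simp: GV_sel)
  fix g assume g: "g : Arr GV" and fg: "Cod GV f = Dom GV g"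
  show "g \<star>GV f : Hom GV (Dom GV f) (Cod GV g)" by (rule GComp_Hom[of _ _ "Cod GV f"]) (use f g fg in "auto simp: Hom_def")
  fix h assume h: "h : Arr GV" and gh: "Cod GV g = Dom GV h"
  show "h \<star>GV (g \<star>GV f) = (h \<star>GV g) \<star>GV f" by (rule 2[of f "Dom GV f" "Dom GV g" g "Dom GV h" h "Cod GV h"])
    (use f g h fg gh in "auto simp: Hom_def")
 qed (use GIde_Hom in auto)
qed

sublocale GV: Category "vgraph_cat U V" by unfold_locales (rule category_GV)

section \<open>Initial homs, linear graphs and morphisms out of them\<close>

definition Zero :: 'o where "Zero = (SOME Z. V.initial Z)"

lemma initial_Zero: "V.initial Zero"
proof -
 have "EX Q inc. is_coproduct V ({} :: unit set) (%_. undefined) Q inc"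
  by (rule V.coproduct_exists[OF has_coproducts]) (use small_finite[OF universe] in auto)
 then obtain Q inc where "is_coproduct V ({} :: unit set) (%_. undefined) Q inc" by blast
 then have "EX Z. V.initial Z" by (metis V.initial_coproduct)
 then show ?thesis unfolding Zero_def by (rule someI_ex)
qed

definition zero_map :: "'o => 'a" where "zero_map T = (SOME f. f : Hom V Zero T)"

lemma zero_map: "T : Obj V ==> zero_map T : Hom V Zero T"
 unfolding zero_map_def using V.initialD(2)[OF initial_Zero] by (metis someI_ex)

lemma Zero_Obj [simp]: "Zero : Obj V" by (rule V.initialD(1)[OF initial_Zero])

lemma Zero_eq: "f : Hom V Zero T ==> g : Hom V Zero T ==> f = g" by (rule V.initialD(3)[OF initial_Zero])

text \<open>The vertices of linear graphs have to lie in \<open>'u\<close>, which is infinite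
  because the universe is uncountable.\<close>

definition vtx :: "nat => 'u" where "vtx = (SOME f. inj f)"

lemma inj_vtx: "inj vtx"
proof -
 have "EX f :: nat => 'u. inj f" using infinite_universe[OF universe] infinite_countable_subset by blast
 then show ?thesis unfolding vtx_def by (rule someI_ex)
qed

lemma vtx_eq [simp]: "vtx i = vtx j \<longleftrightarrow> i = j" using inj_vtx by (auto simp: inj_def)

abbreviation ends where "ends Xs \<equiv> (vtx 0, vtx (length Xs))"

abbreviation e01 where "e01 \<equiv> (vtx 0, vtx (Suc 0))"

definition seq_graph :: "'o list => ('u, 'o) vgraph" where "seq_graph Xs = mk_graph (vtx ` {..length Xs})
   (%(a, b). if EX i<length Xs. a = vtx i & b = vtx (Suc i) then Xs ! inv vtx a else Zero)"

text \<open>Arrows out of \<open>Zero\<close> are unique, so a sequence of vertices with an arrow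
  for each step is exactly what a morphism out of the linear graph consists of.\<close>

definition seq_map :: "'o list => ('u, 'o) vgraph => (nat => 'u) => (nat => 'a) => ('u, 'o, 'a) vgraph_map" where
 "seq_map Xs Y p e = mk_map (seq_graph Xs) Y (%a. p (inv vtx a))
   (%(a, b). if EX i<length Xs. a = vtx i & b = vtx (Suc i) then e (inv vtx a)
    else zero_map (Edge Y (p (inv vtx a), p (inv vtx b))))"

lemma inv_vtx [simp]: "inv vtx (vtx i) = i" by (rule inv_f_f[OF inj_vtx])

lemma Verts_seq_graph: "Verts (seq_graph Xs) = vtx ` {..length Xs}" by (simp add: seq_graph_def)

lemma vtx_Verts [simp]: "vtx i : Verts (seq_graph Xs) \<longleftrightarrow> i \<le> length Xs" by (auto simp: Verts_seq_graph)

lemma Edge_seq_graph: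
 assumes "i \<le> length Xs" "j \<le> length Xs"
 shows "Edge (seq_graph Xs) (vtx i, vtx j) = (if j = Suc i then Xs ! i else Zero)" using assms by (auto simp: seq_graph_def)

lemma seq_graph_Obj: "Xs : Seqs ==> seq_graph Xs : Obj GV" unfolding seq_graph_def
 by (rule mk_graph_Obj) (auto simp: small_finite[OF universe] in_lists_conv_set)

lemma seq_map_simps:
 shows "i \<le> length Xs ==> VMap (seq_map Xs Y p e) (vtx i) = p i"
  "i < length Xs ==> EMap (seq_map Xs Y p e) (vtx i, vtx (Suc i)) = e i" by (auto simp: seq_map_def)

lemma seq_map_Hom:
 assumes X: "Xs : Seqs" and Y: "Y : Obj GV" and p: "!!i. i \<le> length Xs ==> p i : Verts Y"
  and e: "!!i. i < length Xs ==> e i : Hom V (Xs ! i) (Edge Y (p i, p (Suc i)))"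
 shows "seq_map Xs Y p e : Hom GV (seq_graph Xs) Y" unfolding seq_map_def
proof (rule mk_map_Hom[OF seq_graph_Obj[OF X] Y])
 fix a b assume "a : Verts (seq_graph Xs)" "b : Verts (seq_graph Xs)"
 then obtain i j where [simp]: "a = vtx i" "b = vtx j" and ij: "i \<le> length Xs" "j \<le> length Xs"
  by (auto simp: Verts_seq_graph)
 show "(case (a, b) of (a, b) => if EX i<length Xs. a = vtx i & b = vtx (Suc i) then e (inv vtx a)
     else zero_map (Edge Y (p (inv vtx a), p (inv vtx b))))
   : Hom V (Edge (seq_graph Xs) (a, b)) (Edge Y (p (inv vtx a), p (inv vtx b)))"
  using e p GObjD(2)[OF Y] ij by (auto simp: Edge_seq_graph intro!: zero_map)
qed (use p in "auto simp: Verts_seq_graph")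

lemma seq_graph_eqI:
 assumes f: "f : Hom GV (seq_graph Xs) Y" and g: "g : Hom GV (seq_graph Xs) Y"
  and v: "!!i. i \<le> length Xs ==> VMap f (vtx i) = VMap g (vtx i)"
  and e: "!!i. i < length Xs ==> EMap f (vtx i, vtx (Suc i)) = EMap g (vtx i, vtx (Suc i))"
 shows "f = g"
proof (rule GHom_eqI[OF f g])
 fix a assume "a : Verts (seq_graph Xs)"
 then show va: "VMap f a = VMap g a" using v by (auto simp: Verts_seq_graph)
 fix b assume "b : Verts (seq_graph Xs)"
 then obtain i j where [simp]: "a = vtx i" "b = vtx j" and ij: "i \<le> length Xs" "j \<le> length Xs"
  using \<open>a : _\<close> by (auto simp: Verts_seq_graph)
 show "EMap f (a, b) = EMap g (a, b)"
 proof (cases "j = Suc i")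
  case True
  then show ?thesis using e ij by auto
 next
  case False
  then show ?thesis using Zero_eq GHomD(6)[OF f, of a b] GHomD(6)[OF g, of a b] v ij by (auto simp: Edge_seq_graph)
 qed
qed

text \<open>A morphism into \<open>P\<close> is a vertex map together with arrows into homs, so the
  mediating morphism is assembled from a pullback of sets and one pullback in \<open>V\<close> for
  each pair of vertices.\<close>

lemma GV_pullbackI:
 assumes p: "p : Hom GV P X" and q: "q : Hom GV P Y" and f: "f : Hom GV X Z" and g: "g : Hom GV Y Z"
  and com: "!!c. c : Verts P ==> VMap f (VMap p c) = VMap g (VMap q c)"
  and vex: "!!x y. x : Verts X ==> y : Verts Y ==> VMap f x = VMap g y ==> EX c:Verts P. VMap p c = x & VMap q c = y"
  and vun: "!!c d. c : Verts P ==> d : Verts P ==> VMap p c = VMap p d ==> VMap q c = VMap q d ==> c = d"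
  and pb: "!!c d. c : Verts P ==> d : Verts P ==> is_pullback V (EMap p (c, d)) (EMap q (c, d))
    (EMap f (VMap p c, VMap p d)) (EMap g (VMap q c, VMap q d))"
 shows "is_pullback GV p q f g"
proof (rule GV.pullbackI[OF p q f g])
 note DP = GHomD[OF p] and DQ = GHomD[OF q] and DF = GHomD[OF f] and DG = GHomD[OF g]
 show "f \<star>GV p = g \<star>GV q" by (rule GHom_eqI[OF GComp_Hom[OF p f] GComp_Hom[OF q g]])
   (use com V.pullbackD(5)[OF pb] in "auto simp: GComp[OF p] GComp[OF q]")
 fix T
 show "h = h'" if h: "h : Hom GV T P" and h': "h' : Hom GV T P"
  and e: "p \<star>GV h = p \<star>GV h'" "q \<star>GV h = q \<star>GV h'" for h h'
 proof (rule GHom_eqI[OF h h'])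
  note H = GHomD[OF h] and H' = GHomD[OF h']
  fix a assume a: "a : Verts T"
  have veq: "VMap h a = VMap h' a" if a: "a : Verts T" for a
   by (rule vun) (use a H H' e GComp(1)[OF h a] GComp(1)[OF h' a] in metis)+
  then show "VMap h a = VMap h' a" using a .
  fix b assume b: "b : Verts T"
  have ha: "VMap h a : Verts P" "VMap h b : Verts P" using H a b by auto
  note hd = HomD[OF DP(6)[OF ha]]
  show "EMap h (a, b) = EMap h' (a, b)"
  proof (rule V.pullback_eq[OF pb[OF ha], where T = "Edge T (a, b)"])
   show "EMap h (a, b) : Hom V (Edge T (a, b)) (Dom V (EMap p (VMap h a, VMap h b)))" using H(6)[OF a b] hd by simp
   show "EMap h' (a, b) : Hom V (Edge T (a, b)) (Dom V (EMap p (VMap h a, VMap h b)))"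
    using H'(6)[OF a b] hd veq[OF a] veq[OF b] by simp
   show "EMap p (VMap h a, VMap h b) ** EMap h (a, b) = EMap p (VMap h a, VMap h b) ** EMap h' (a, b)"
    using GComp(2)[OF h a b, of p] GComp(2)[OF h' a b, of p] e veq[OF a] veq[OF b] by simp
   show "EMap q (VMap h a, VMap h b) ** EMap h (a, b) = EMap q (VMap h a, VMap h b) ** EMap h' (a, b)"
    using GComp(2)[OF h a b, of q] GComp(2)[OF h' a b, of q] e veq[OF a] veq[OF b] by simp
  qed
 qed
 fix x y assume x: "x : Hom GV T X" and y: "y : Hom GV T Y" and e: "f \<star>GV x = g \<star>GV y"
 note DX = GHomD[OF x] and DY = GHomD[OF y]
 have "EX c:Verts P. VMap p c = VMap x a & VMap q c = VMap y a" if a: "a : Verts T" for a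
  by (rule vex) (use a DX DY GComp(1)[OF x a, of f] GComp(1)[OF y a, of g] e in auto)
 then obtain \<phi> where \<phi>: "!!a. a : Verts T ==> \<phi> a : Verts P"
  "!!a. a : Verts T ==> VMap p (\<phi> a) = VMap x a" "!!a. a : Verts T ==> VMap q (\<phi> a) = VMap y a" by metis
 have "EX k. k : Hom V (Edge T (a, b)) (Edge P (\<phi> a, \<phi> b)) & EMap p (\<phi> a, \<phi> b) ** k = EMap x (a, b) &
   EMap q (\<phi> a, \<phi> b) ** k = EMap y (a, b)" if a: "a : Verts T" and b: "b : Verts T" for a b
 proof -
  note pa = \<phi>(1)[OF a] \<phi>(1)[OF b]
  have "EMap x (a, b) : Hom V (Edge T (a, b)) (Dom V (EMap f (VMap p (\<phi> a), VMap p (\<phi> b))))"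
   using HomD(2)[OF DF(6)] DX a b \<phi> by auto
  moreover have "EMap y (a, b) : Hom V (Edge T (a, b)) (Dom V (EMap g (VMap q (\<phi> a), VMap q (\<phi> b))))"
   using HomD(2)[OF DG(6)] DY a b \<phi> by auto
  moreover have "EMap f (VMap p (\<phi> a), VMap p (\<phi> b)) ** EMap x (a, b) =
   EMap g (VMap q (\<phi> a), VMap q (\<phi> b)) ** EMap y (a, b)"
   using GComp(2)[OF x a b, of f] GComp(2)[OF y a b, of g] e \<phi> a b by simp
  ultimately show ?thesis using V.pullback_ex[OF pb[OF pa]] HomD(2)[OF DP(6)[OF pa]] by metis
 qed
 then obtain k0 where k0: "!!a b. a : Verts T ==> b : Verts T ==>
   k0 a b : Hom V (Edge T (a, b)) (Edge P (\<phi> a, \<phi> b)) & EMap p (\<phi> a, \<phi> b) ** k0 a b = EMap x (a, b) &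
   EMap q (\<phi> a, \<phi> b) ** k0 a b = EMap y (a, b)" by metis
 define k where "k = (%(a, b). k0 a b)"
 have k: "k (a, b) : Hom V (Edge T (a, b)) (Edge P (\<phi> a, \<phi> b)) & EMap p (\<phi> a, \<phi> b) ** k (a, b) = EMap x (a, b) &
   EMap q (\<phi> a, \<phi> b) ** k (a, b) = EMap y (a, b)" if "a : Verts T" "b : Verts T" for a b
  using k0[OF that] by (simp add: k_def)
 have h: "mk_map T P \<phi> k : Hom GV T P" by (rule mk_map_Hom) (use DX DP \<phi> k in auto)
 have "p \<star>GV mk_map T P \<phi> k = x" by (rule GHom_eqI[OF GComp_Hom[OF h p] x]) (use \<phi> k in "auto simp: GComp[OF h]")
 moreover have "q \<star>GV mk_map T P \<phi> k = y"
  by (rule GHom_eqI[OF GComp_Hom[OF h q] y]) (use \<phi> k in "auto simp: GComp[OF h]")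
 ultimately show "EX h. h : Hom GV T P & p \<star>GV h = x & q \<star>GV h = y" using h by blast
qed

lemma seq_map_comp:
 assumes X: "Xs : Seqs" and f: "f : Hom GV Y Z" and p: "!!i. i \<le> length Xs ==> p i : Verts Y"
  and e: "!!i. i < length Xs ==> e i : Hom V (Xs ! i) (Edge Y (p i, p (Suc i)))"
  and p': "!!i. i \<le> length Xs ==> p' i = VMap f (p i)" and e': "!!i. i < length Xs ==> e' i = EMap f (p i, p (Suc i)) ** e i"
 shows "f \<star>GV seq_map Xs Y p e = seq_map Xs Z p' e'"
proof -
 note F = GHomD[OF f]
 have s: "seq_map Xs Y p e : Hom GV (seq_graph Xs) Y" by (rule seq_map_Hom[OF X F(1) p e])
 have "seq_map Xs Z p' e' : Hom GV (seq_graph Xs) Z" by (rule seq_map_Hom[OF X F(2)])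
   (use p' e' p F(5) V.comp_Hom[OF e F(6)] in auto)
 from GComp_Hom[OF s f] this show ?thesis by (rule seq_graph_eqI) (auto simp: GComp[OF s] seq_map_simps p' e')
qed

text \<open>The pullback is probed with the one-edge graphs \<open>seq_graph [T]\<close>: a morphism
  from such a graph is a pair of vertices together with an arrow from \<open>T\<close> to the hom
  between them. Taking \<open>T\<close> initial leaves a bare pair of vertices.\<close>

lemma GV_pullbackD:
 assumes pb: "is_pullback GV p q f g" and p: "p : Hom GV P X" and q: "q : Hom GV P Y"
  and f: "f : Hom GV X Z" and g: "g : Hom GV Y Z"
 shows "!!c. c : Verts P ==> VMap f (VMap p c) = VMap g (VMap q c)"
  and "!!x y. x : Verts X ==> y : Verts Y ==> VMap f x = VMap g y ==> EX c:Verts P. VMap p c = x & VMap q c = y"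
  and "!!c d. c : Verts P ==> d : Verts P ==> VMap p c = VMap p d ==> VMap q c = VMap q d ==> c = d"
  and "!!c d. c : Verts P ==> d : Verts P ==> is_pullback V (EMap p (c, d)) (EMap q (c, d))
    (EMap f (VMap p c, VMap p d)) (EMap g (VMap q c, VMap q d))"
proof -
 note DP = GHomD[OF p] and DQ = GHomD[OF q] and DF = GHomD[OF f] and DG = GHomD[OF g]
 note dom = HomD(2)[OF p] HomD(2)[OF f] HomD(2)[OF g]
 have com: "f \<star>GV p = g \<star>GV q" by (rule GV.pullbackD(5)[OF pb])
 show vcom: "VMap f (VMap p c) = VMap g (VMap q c)" if "c : Verts P" for c
  using GComp(1)[OF p that, of f] GComp(1)[OF q that, of g] com by simp
 have ecom: "EMap f (VMap p c, VMap p d) ** EMap p (c, d) = EMap g (VMap q c, VMap q d) ** EMap q (c, d)"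
  if "c : Verts P" "d : Verts P" for c d using GComp(2)[OF p that, of f] GComp(2)[OF q that, of g] com by simp
 \<comment> \<open>Existence of the mediating morphism out of a one-edge graph. The vertices
   \<open>c\<close> and \<open>d\<close> over the given ones are part of the output.\<close>
 have point: "EX c d k. c : Verts P & d : Verts P & k : Hom V T (Edge P (c, d)) &
   VMap p c = x & VMap q c = y & VMap p d = x' & VMap q d = y' & EMap p (c, d) ** k = e & EMap q (c, d) ** k = e'"
  if x: "x : Verts X" "x' : Verts X" and y: "y : Verts Y" "y' : Verts Y"
   and xy: "VMap f x = VMap g y" "VMap f x' = VMap g y'" and T: "T : Obj V"
   and e: "e : Hom V T (Edge X (x, x'))" "e' : Hom V T (Edge Y (y, y'))"
   and ee: "EMap f (x, x') ** e = EMap g (y, y') ** e'" for x x' y y' T e e'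
 proof -
  let ?x = "seq_map [T] X (%i. if i = 0 then x else x') (%_. e)"
  let ?y = "seq_map [T] Y (%i. if i = 0 then y else y') (%_. e')"
  have hx: "?x : Hom GV (seq_graph [T]) X" and hy: "?y : Hom GV (seq_graph [T]) Y" using x y T e DF DG by (auto intro!: seq_map_Hom)
  have "f \<star>GV ?x = seq_map [T] Z (%i. if i = 0 then VMap f x else VMap f x') (%_. EMap f (x, x') ** e)"
   by (rule seq_map_comp) (use x T e f in auto)
  moreover have "g \<star>GV ?y = seq_map [T] Z (%i. if i = 0 then VMap f x else VMap f x') (%_. EMap f (x, x') ** e)"
   by (rule seq_map_comp) (use y T e g xy ee in auto)
  ultimately obtain h where h: "h : Hom GV (seq_graph [T]) P" "p \<star>GV h = ?x" "q \<star>GV h = ?y"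
   using GV.pullback_ex[OF pb, of ?x _ ?y] hx hy dom by metis
  note H = GHomD[OF h(1)]
  have v: "vtx 0 : Verts (seq_graph [T])" "vtx (Suc 0) : Verts (seq_graph [T])" by auto
  have "EMap h e01 : Hom V T (Edge P (VMap h (vtx 0), VMap h (vtx (Suc 0))))" using H(6)[OF v] by (simp add: Edge_seq_graph)
  moreover note H(5)[OF v(1)] H(5)[OF v(2)]
  moreover have "VMap p (VMap h (vtx 0)) = x" "VMap p (VMap h (vtx (Suc 0))) = x'"
   "VMap q (VMap h (vtx 0)) = y" "VMap q (VMap h (vtx (Suc 0))) = y'" using GComp(1)[OF h(1) v(1), of p] GComp(1)[OF h(1) v(2), of p]
    GComp(1)[OF h(1) v(1), of q] GComp(1)[OF h(1) v(2), of q] h by (simp_all add: seq_map_simps)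
  moreover have "EMap p (VMap h (vtx 0), VMap h (vtx (Suc 0))) ** EMap h e01 = e"
   "EMap q (VMap h (vtx 0), VMap h (vtx (Suc 0))) ** EMap h e01 = e'"
   using GComp(2)[OF h(1) v, of p] GComp(2)[OF h(1) v, of q] h by (auto simp: seq_map_simps)
  ultimately show ?thesis by blast
 qed
 have uniq: "c = c' & d = d' & k = k'" if c: "c : Verts P" "d : Verts P" "c' : Verts P" "d' : Verts P"
   and k: "k : Hom V T (Edge P (c, d))" "k' : Hom V T (Edge P (c', d'))" and T: "T : Obj V"
   and ceq: "VMap p c = VMap p c'" "VMap q c = VMap q c'" "VMap p d = VMap p d'" "VMap q d = VMap q d'"
   and keq: "EMap p (c, d) ** k = EMap p (c', d') ** k'" "EMap q (c, d) ** k = EMap q (c', d') ** k'" for c d c' d' k k' T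
 proof -
  let ?h = "seq_map [T] P (%i. if i = 0 then c else d) (%_. k)"
  let ?h' = "seq_map [T] P (%i. if i = 0 then c' else d') (%_. k')"
  have h: "?h : Hom GV (seq_graph [T]) P" "?h' : Hom GV (seq_graph [T]) P" using c k T DP by (auto intro!: seq_map_Hom)
  have "p \<star>GV ?h = seq_map [T] X (%i. if i = 0 then VMap p c else VMap p d) (%_. EMap p (c, d) ** k)"
   by (rule seq_map_comp) (use c T k p in auto)
  moreover have "p \<star>GV ?h' = seq_map [T] X (%i. if i = 0 then VMap p c else VMap p d) (%_. EMap p (c, d) ** k)"
   by (rule seq_map_comp) (use c T k p ceq keq in auto)
  moreover have "q \<star>GV ?h = seq_map [T] Y (%i. if i = 0 then VMap q c else VMap q d) (%_. EMap q (c, d) ** k)"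
   by (rule seq_map_comp) (use c T k q in auto)
  moreover have "q \<star>GV ?h' = seq_map [T] Y (%i. if i = 0 then VMap q c else VMap q d) (%_. EMap q (c, d) ** k)"
   by (rule seq_map_comp) (use c T k q ceq keq in auto)
  ultimately have eq: "?h = ?h'" using GV.pullback_eq[OF pb, of ?h _ ?h'] h dom by simp
  have "VMap ?h (vtx 0) = VMap ?h' (vtx 0)" "VMap ?h (vtx (Suc 0)) = VMap ?h' (vtx (Suc 0))"
   "EMap ?h e01 = EMap ?h' e01" using eq by auto
  then show ?thesis by (simp add: seq_map_simps)
 qed
 show "EX c:Verts P. VMap p c = x & VMap q c = y" if x: "x : Verts X" and y: "y : Verts Y" and xy: "VMap f x = VMap g y" for x y
 proof -
  have X: "Edge X (x, x) : Obj V" "Edge Y (y, y) : Obj V" using GObjD(2)[OF DF(1)] GObjD(2)[OF DG(1)] x y by auto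
  have "EMap f (x, x) ** zero_map (Edge X (x, x)) = EMap g (y, y) ** zero_map (Edge Y (y, y))"
   by (rule Zero_eq[OF V.comp_Hom[OF zero_map[OF X(1)] DF(6)[OF x x]]])
    (use V.comp_Hom[OF zero_map[OF X(2)] DG(6)[OF y y]] xy in simp)
  then show ?thesis using point[OF x x y y xy xy Zero_Obj zero_map zero_map] X by blast
 qed
 show "c = d" if c: "c : Verts P" and d: "d : Verts P" and cd: "VMap p c = VMap p d" "VMap q c = VMap q d" for c d
 proof -
  have e: "Edge P (c, c) : Obj V" "Edge P (d, d) : Obj V" using GObjD(2)[OF DP(1)] c d by auto
  have "EMap p (c, c) ** zero_map (Edge P (c, c)) = EMap p (d, d) ** zero_map (Edge P (d, d))"
   by (rule Zero_eq[OF V.comp_Hom[OF zero_map[OF e(1)] DP(6)[OF c c]]])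
    (use V.comp_Hom[OF zero_map[OF e(2)] DP(6)[OF d d]] cd in simp)
  moreover have "EMap q (c, c) ** zero_map (Edge P (c, c)) = EMap q (d, d) ** zero_map (Edge P (d, d))"
   by (rule Zero_eq[OF V.comp_Hom[OF zero_map[OF e(1)] DQ(6)[OF c c]]])
    (use V.comp_Hom[OF zero_map[OF e(2)] DQ(6)[OF d d]] cd in simp)
  ultimately show ?thesis using uniq[OF c c d d zero_map[OF e(1)] zero_map[OF e(2)] Zero_Obj cd cd] by blast
 qed
 show "is_pullback V (EMap p (c, d)) (EMap q (c, d)) (EMap f (VMap p c, VMap p d)) (EMap g (VMap q c, VMap q d))"
  if c: "c : Verts P" and d: "d : Verts P" for c d
 proof (rule V.pullbackI[OF DP(6)[OF c d] DQ(6)[OF c d] DF(6)[OF DP(5)[OF c] DP(5)[OF d]] _ ecom[OF c d]])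
  show "EMap g (VMap q c, VMap q d) : Hom V (Edge Y (VMap q c, VMap q d)) (Edge Z (VMap f (VMap p c), VMap f (VMap p d)))"
   using DG(6)[OF DQ(5)[OF c] DQ(5)[OF d]] vcom c d by simp
  fix T
  show "h = h'" if "h : Hom V T (Edge P (c, d))" "h' : Hom V T (Edge P (c, d))"
   "EMap p (c, d) ** h = EMap p (c, d) ** h'" "EMap q (c, d) ** h = EMap q (c, d) ** h'" for h h'
   using uniq[OF c d c d that(1,2)] that V.Hom_Obj by blast
  fix x y assume x: "x : Hom V T (Edge X (VMap p c, VMap p d))" and y: "y : Hom V T (Edge Y (VMap q c, VMap q d))"
   and e: "EMap f (VMap p c, VMap p d) ** x = EMap g (VMap q c, VMap q d) ** y"
  have T: "T : Obj V" using x V.Hom_Obj by blast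
  obtain c' d' k where k: "c' : Verts P" "d' : Verts P" "k : Hom V T (Edge P (c', d'))"
   "VMap p c' = VMap p c" "VMap q c' = VMap q c" "VMap p d' = VMap p d" "VMap q d' = VMap q d"
   "EMap p (c', d') ** k = x" "EMap q (c', d') ** k = y"
   using point[OF DP(5)[OF c] DP(5)[OF d] DQ(5)[OF c] DQ(5)[OF d] vcom[OF c] vcom[OF d] T x y e] by blast
  \<comment> \<open>The arrow \<open>k\<close> was found over some pair of vertices with the right
    projections; comparing the arrows out of \<open>Zero\<close> at both pairs identifies that pair
    with \<open>(c, d)\<close>.\<close>
  have "c' = c" "d' = d"
  proof -
   have z: "Edge P (c', d') : Obj V" "Edge P (c, d) : Obj V" using GObjD(2)[OF DP(1)] c d k by auto
   have "EMap p (c', d') ** zero_map (Edge P (c', d')) = EMap p (c, d) ** zero_map (Edge P (c, d))"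
    by (rule Zero_eq[OF V.comp_Hom[OF zero_map[OF z(1)] DP(6)[OF k(1,2)]]])
     (use V.comp_Hom[OF zero_map[OF z(2)] DP(6)[OF c d]] k in simp)
   moreover have "EMap q (c', d') ** zero_map (Edge P (c', d')) = EMap q (c, d) ** zero_map (Edge P (c, d))"
    by (rule Zero_eq[OF V.comp_Hom[OF zero_map[OF z(1)] DQ(6)[OF k(1,2)]]])
     (use V.comp_Hom[OF zero_map[OF z(2)] DQ(6)[OF c d]] k in simp)
   ultimately show "c' = c" "d' = d" using uniq[OF k(1,2) c d zero_map[OF z(1)] zero_map[OF z(2)] Zero_Obj k(4-7)] by blast+
  qed
  then show "EX h. h : Hom V T (Edge P (c, d)) & EMap p (c, d) ** h = x & EMap q (c, d) ** h = y" using k by blast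
 qed
qed

end

section \<open>Colimits of graphs\<close>

lemma is_cocone_comp:
 assumes "category C" "is_cocone J C D L inc" "h : Hom C L T" "is_functor J C D"
 shows "is_cocone J C D T (%j. h \<star>C inc j)"
proof -
 interpret C: Category C by unfold_locales (rule assms)
 interpret J: Category J by unfold_locales (rule functorD(1)[OF assms(4)])
 have i: "!!j. j : Obj J ==> inc j : Hom C (OMap D j) L"
  and c: "!!t. t : Arr J ==> inc (Cod J t) \<star>C AMap D t = inc (Dom J t)" using assms(2) by (auto simp: is_cocone_def)
 have "(h \<star>C inc (Cod J t)) \<star>C AMap D t = h \<star>C inc (Dom J t)" if t: "t : Arr J" for t
  using C.assoc[OF functorD(4)[OF assms(4), of t "Dom J t" "Cod J t"] i assms(3)] c t by (simp add: Hom_def)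
 then show ?thesis using C.comp_Hom[OF i assms(3)] C.Hom_Obj[OF assms(3)] by (simp add: is_cocone_def)
qed

lemma is_colimit_ex:
 assumes "is_colimit J C D L inc" "is_cocone J C D T f"
 obtains h where "h : Hom C L T" "!!j. j : Obj J ==> h \<star>C inc j = f j" using assms unfolding is_colimit_def by metis

lemma is_colimit_eq:
 assumes "category C" "is_functor J C D" "is_colimit J C D L inc" "h : Hom C L T" "h' : Hom C L T"
  "!!j. j : Obj J ==> h \<star>C inc j = h' \<star>C inc j"
 shows "h = h'"
proof -
 have "is_cocone J C D T (%j. h \<star>C inc j)"
  using is_cocone_comp[OF assms(1) _ assms(4,2)] assms(3) by (simp add: is_colimit_def)
 then have "EX! k. k : Hom C L T & (ALL j:Obj J. k \<star>C inc j = h \<star>C inc j)"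
  using assms(3) by (auto simp: is_colimit_def)
 then show ?thesis using assms(4-6) by metis
qed

text \<open>Its classes, on the vertices of the diagram, are the vertices of the colimit.\<close>

definition vertex_rel :: "('j, 't) cat => ('j, 't, ('u, 'o) vgraph, ('u, 'o, 'a) vgraph_map) ftor => ('j \<times> 'u) rel" where
 "vertex_rel J G = (let R = {((Dom J t, x), (Cod J t, VMap (AMap G t) x)) | t x.
   t : Arr J & x : Verts (OMap G (Dom J t))} in (R \<union> R\<inverse>)\<^sup>*)"

lemma vertex_rel_step: "t : Arr J ==> x : Verts (OMap G (Dom J t)) ==>
  ((Dom J t, x), (Cod J t, VMap (AMap G t) x)) : vertex_rel J G" unfolding vertex_rel_def Let_def by (rule r_into_rtrancl) auto

lemma equiv_vertex_rel: "equiv UNIV (vertex_rel J G)" unfolding vertex_rel_def Let_def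
 by (intro equivI refl_rtrancl trans_rtrancl sym_rtrancl sym_Un_converse) auto

lemma vertex_rel_invariant:
 assumes "!!t x. t : Arr J ==> x : Verts (OMap G (Dom J t)) ==> F (Cod J t) (VMap (AMap G t) x) = F (Dom J t) x"
  and "((j, x), (j', x')) : vertex_rel J G"
 shows "F j x = F j' x'"
proof -
 have "case_prod F a = case_prod F b" if "(a, b) : vertex_rel J G" for a b using that unfolding vertex_rel_def Let_def
  by (induction rule: rtrancl_induct) (auto simp: assms(1))
 from this[OF assms(2)] show ?thesis by simp
qed

context VGraphs
begin

text \<open>Cocones to \<open>T\<close> from all homs lying over the pair \<open>(v, w)\<close>:
  different stages, and different preimages of \<open>v\<close> and \<open>w\<close> at one stage,
  occur in the same diagram.\<close>

definition edge_cocone where "edge_cocone J G inc v w T f \<longleftrightarrow>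
   (ALL j:Obj J. ALL x:Verts (OMap G j). ALL y:Verts (OMap G j). VMap (inc j) x = v --> VMap (inc j) y = w -->
    f j x y : Hom V (Edge (OMap G j) (x, y)) T) & (ALL t:Arr J. ALL x:Verts (OMap G (Dom J t)). ALL y:Verts (OMap G (Dom J t)).
    VMap (inc (Dom J t)) x = v --> VMap (inc (Dom J t)) y = w -->
    f (Cod J t) (VMap (AMap G t) x) (VMap (AMap G t) y) ** EMap (AMap G t) (x, y) = f (Dom J t) x y)"

definition edge_colimit where "edge_colimit J G L inc v w \<longleftrightarrow>
   (ALL T:Obj V. ALL f. edge_cocone J G inc v w T f -->
    (EX! h. h : Hom V (Edge L (v, w)) T & (ALL j:Obj J. ALL x:Verts (OMap G j). ALL y:Verts (OMap G j).
      VMap (inc j) x = v --> VMap (inc j) y = w --> h ** EMap (inc j) (x, y) = f j x y)))"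

text \<open>The concrete form of a colimit of graphs: the vertices are the colimit of the vertex
  sets and each hom is the colimit of the homs above it. In this form colimits are compared before
  and after applying \<open>Gamma\<close>.\<close>

definition graph_colimit where "graph_colimit J G L inc \<longleftrightarrow> is_cocone J GV G L inc &
   (ALL v:Verts L. EX j:Obj J. EX x:Verts (OMap G j). VMap (inc j) x = v) &
   (ALL j:Obj J. ALL j':Obj J. ALL x:Verts (OMap G j). ALL x':Verts (OMap G j').
    VMap (inc j) x = VMap (inc j') x' --> ((j, x), (j', x')) : vertex_rel J G) &
   (ALL v:Verts L. ALL w:Verts L. edge_colimit J G L inc v w)"

lemma GcoconeI:
 assumes "is_functor J GV G" "L : Obj GV" "!!j. j : Obj J ==> inc j : Hom GV (OMap G j) L"
  and "!!t x. t : Arr J ==> x : Verts (OMap G (Dom J t)) ==> VMap (inc (Cod J t)) (VMap (AMap G t) x) = VMap (inc (Dom J t)) x"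
  and "!!t x y. t : Arr J ==> x : Verts (OMap G (Dom J t)) ==> y : Verts (OMap G (Dom J t)) ==>
   EMap (inc (Cod J t)) (VMap (AMap G t) x, VMap (AMap G t) y) ** EMap (AMap G t) (x, y) = EMap (inc (Dom J t)) (x, y)"
 shows "is_cocone J GV G L inc" unfolding is_cocone_def
proof (intro conjI ballI)
 interpret J: Category J by unfold_locales (rule functorD(1)[OF assms(1)])
 fix t assume t: "t : Arr J"
 have G: "AMap G t : Hom GV (OMap G (Dom J t)) (OMap G (Cod J t))"
  by (rule functorD(4)[OF assms(1)]) (use t in "simp add: Hom_def")
 show "inc (Cod J t) \<star>GV AMap G t = inc (Dom J t)"
  by (rule GHom_eqI[OF GComp_Hom[OF G assms(3)] assms(3)]) (use t assms(4,5) in "auto simp: GComp[OF G]")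
qed (use assms in auto)

lemma GcoconeD:
 assumes "is_functor J GV G" "is_cocone J GV G L inc"
 shows "L : Obj GV" "!!j. j : Obj J ==> inc j : Hom GV (OMap G j) L" and "!!t x. t : Arr J ==> x : Verts (OMap G (Dom J t)) ==>
   VMap (inc (Cod J t)) (VMap (AMap G t) x) = VMap (inc (Dom J t)) x"
  and "!!t x y. t : Arr J ==> x : Verts (OMap G (Dom J t)) ==> y : Verts (OMap G (Dom J t)) ==>
   EMap (inc (Cod J t)) (VMap (AMap G t) x, VMap (AMap G t) y) ** EMap (AMap G t) (x, y) = EMap (inc (Dom J t)) (x, y)"
proof -
 fix t x assume t: "t : Arr J" "x : Verts (OMap G (Dom J t))"
 have G: "AMap G t : Hom GV (OMap G (Dom J t)) (OMap G (Cod J t))"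
  by (rule functorD(4)[OF assms(1)]) (use t in "simp add: Hom_def")
 have e: "inc (Cod J t) \<star>GV AMap G t = inc (Dom J t)" using assms(2) t by (auto simp: is_cocone_def)
 show "VMap (inc (Cod J t)) (VMap (AMap G t) x) = VMap (inc (Dom J t)) x" using GComp(1)[OF G t(2)] e by metis
 fix y assume y: "y : Verts (OMap G (Dom J t))"
 show "EMap (inc (Cod J t)) (VMap (AMap G t) x, VMap (AMap G t) y) ** EMap (AMap G t) (x, y) = EMap (inc (Dom J t)) (x, y)"
  using GComp(2)[OF G t(2) y] e by metis
qed (use assms in "auto simp: is_cocone_def")

lemma graph_colimit_imp_colimit:
 assumes G: "is_functor J GV G" and good: "graph_colimit J G L inc"
 shows "is_colimit J GV G L inc" unfolding is_colimit_def
proof (intro conjI allI impI)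
 interpret J: Category J by unfold_locales (rule functorD(1)[OF G])
 have coc: "is_cocone J GV G L inc" using good by (simp add: graph_colimit_def)
 note D = GcoconeD[OF G coc]
 show "is_cocone J GV G L inc" by (rule coc)
 fix T f assume Tf: "is_cocone J GV G T f"
 note F = GcoconeD[OF G Tf]
 have Gt: "AMap G t : Hom GV (OMap G (Dom J t)) (OMap G (Cod J t))" if "t : Arr J" for t
  by (rule functorD(4)[OF G]) (use that in "simp add: Hom_def")
 have sur: "EX j:Obj J. EX x:Verts (OMap G j). VMap (inc j) x = v" if "v : Verts L" for v
  using good that by (auto simp: graph_colimit_def)
 have inv: "VMap (f j) x = VMap (f j') x'" if "j : Obj J" "j' : Obj J" "x : Verts (OMap G j)"
  "x' : Verts (OMap G j')" "VMap (inc j) x = VMap (inc j') x'" for j j' x x'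
  by (rule vertex_rel_invariant[where F = "%j. VMap (f j)", OF F(3)]) (use good that in "auto simp: graph_colimit_def")
 have "EX \<phi>. ALL j:Obj J. ALL x:Verts (OMap G j). \<phi> (VMap (inc j) x) = VMap (f j) x"
 proof -
  \<comment> \<open>A vertex of \<open>L\<close> is sent to the value at any of its preimages;
    \<open>inv\<close> makes the choice irrelevant.\<close>
  define \<phi> where "\<phi> v = (let jx = SOME jx. fst jx : Obj J & snd jx : Verts (OMap G (fst jx)) &
   VMap (inc (fst jx)) (snd jx) = v in VMap (f (fst jx)) (snd jx))" for v
  have "\<phi> (VMap (inc j) x) = VMap (f j) x" if j: "j : Obj J" "x : Verts (OMap G j)" for j x
  proof -
   let ?P = "%jx. fst jx : Obj J & snd jx : Verts (OMap G (fst jx)) & VMap (inc (fst jx)) (snd jx) = VMap (inc j) x"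
   have "?P (SOME jx. ?P jx)" by (rule someI[of ?P "(j, x)"]) (use j in simp)
   then show ?thesis unfolding \<phi>_def Let_def using inv j by blast
  qed
  then show ?thesis by blast
 qed
 then obtain \<phi> where \<phi>: "!!j x. j : Obj J ==> x : Verts (OMap G j) ==> \<phi> (VMap (inc j) x) = VMap (f j) x" by blast
 have \<phi>T: "\<phi> v : Verts T" if "v : Verts L" for v using sur[OF that] \<phi> GHomD(5)[OF F(2)] by metis
 let ?comm = "%v w h. ALL j:Obj J. ALL x:Verts (OMap G j). ALL y:Verts (OMap G j).
      VMap (inc j) x = v --> VMap (inc j) y = w --> h ** EMap (inc j) (x, y) = EMap (f j) (x, y)"
 have ex1: "EX! h. h : Hom V (Edge L (v, w)) (Edge T (\<phi> v, \<phi> w)) & ?comm v w h"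
  if v: "v : Verts L" and w: "w : Verts L" for v w
 proof -
  have "edge_cocone J G inc v w (Edge T (\<phi> v, \<phi> w)) (%j x y. EMap (f j) (x, y))" unfolding edge_cocone_def
  proof (intro conjI ballI impI)
   fix j x y assume j: "j : Obj J" "x : Verts (OMap G j)" "y : Verts (OMap G j)" "VMap (inc j) x = v" "VMap (inc j) y = w"
   then show "EMap (f j) (x, y) : Hom V (Edge (OMap G j) (x, y)) (Edge T (\<phi> v, \<phi> w))"
    using GHomD(6)[OF F(2)] \<phi> by metis
  qed (use F in auto)
  moreover have "edge_colimit J G L inc v w" using good v w by (auto simp: graph_colimit_def)
  ultimately show ?thesis using GObjD(2)[OF F(1) \<phi>T[OF v] \<phi>T[OF w]] unfolding edge_colimit_def by blast
 qed
 then obtain \<epsilon>0 where \<epsilon>0: "!!v w. v : Verts L ==> w : Verts L ==>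
  \<epsilon>0 v w : Hom V (Edge L (v, w)) (Edge T (\<phi> v, \<phi> w)) & ?comm v w (\<epsilon>0 v w)" by metis
 let ?h = "mk_map L T \<phi> (%(v, w). \<epsilon>0 v w)"
 have h: "?h : Hom GV L T" by (rule mk_map_Hom) (use D F \<phi>T \<epsilon>0 in auto)
 have hc: "?h \<star>GV inc j = f j" if j: "j : Obj J" for j by (rule GHom_eqI[OF GComp_Hom[OF D(2)[OF j] h] F(2)[OF j]])
   (use GHomD[OF D(2)[OF j]] \<phi> \<epsilon>0 j in "auto simp: GComp[OF D(2)[OF j]]")
 show "EX! h. h : Hom GV L T & (ALL j:Obj J. h \<star>GV inc j = f j)"
 proof (intro ex1I[of _ ?h] conjI ballI)
  fix k assume k: "k : Hom GV L T & (ALL j:Obj J. k \<star>GV inc j = f j)"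
  then have kh: "k : Hom GV L T" and kc: "!!j. j : Obj J ==> k \<star>GV inc j = f j" by auto
  have kv: "VMap k v = \<phi> v" if v: "v : Verts L" for v
  proof -
   obtain j x where j: "j : Obj J" "x : Verts (OMap G j)" "VMap (inc j) x = v" using sur[OF v] by blast
   then show ?thesis using GComp(1)[OF D(2)[OF j(1)] j(2), of k] kc[OF j(1)] \<phi>[OF j(1,2)] by simp
  qed
  show "k = ?h"
  proof (rule GHom_eqI[OF kh h])
   show "VMap k v = VMap ?h v" if "v : Verts L" for v using kv that by simp
   fix v w assume v: "v : Verts L" and w: "w : Verts L"
   have "EMap k (v, w) : Hom V (Edge L (v, w)) (Edge T (\<phi> v, \<phi> w))" using GHomD(6)[OF kh v w] kv v w by simp
   moreover have "?comm v w (EMap k (v, w))" using kc GComp(2)[OF D(2)] by metis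
   ultimately show "EMap k (v, w) = EMap ?h (v, w)" using ex1[OF v w] \<epsilon>0[OF v w] v w by auto
  qed
 qed (use h hc in auto)
qed

text \<open>Two kinds of test graphs are used. The classes of vertices, with homs copied from
  \<open>L\<close>, show that \<open>L\<close> has the right vertices; the graph \<open>L\<close>
  with one hom replaced by a test object isolates the universal property of that hom.\<close>

lemma colimit_imp_graph_colimit:
 assumes G: "is_functor J GV G" and J: "small U (Obj J)" and colim: "is_colimit J GV G L inc"
 shows "graph_colimit J G L inc"
proof -
 interpret J: Category J by unfold_locales (rule functorD(1)[OF G])
 have coc: "is_cocone J GV G L inc" using colim by (simp add: is_colimit_def)
 note D = GcoconeD[OF G coc]
 note DE = GHomD[OF D(2)]
 have Gt: "AMap G t : Hom GV (OMap G (Dom J t)) (OMap G (Cod J t))" if "t : Arr J" for t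
  by (rule functorD(4)[OF G]) (use that in "simp add: Hom_def")
 have GO: "OMap G j : Obj GV" if "j : Obj J" for j using functorD(3)[OF G that] .
 define W where "W = (SIGMA j:Obj J. Verts (OMap G j))"
 define cls where "cls jx = vertex_rel J G `` {jx}" for jx
 have cls_eq: "cls jx = cls kx \<longleftrightarrow> (jx, kx) : vertex_rel J G" for jx kx
  unfolding cls_def by (rule eq_equiv_class_iff[OF equiv_vertex_rel]) auto
 have sW: "small U (cls ` W)" unfolding W_def by (intro small_image small_Sigma[OF universe J]) (use GObjD(1)[OF GO] in auto)
 then obtain e :: "_ => 'u" where e: "inj_on e (cls ` W)" using small_embedding by blast
 have small: "small U (e ` cls ` W)" by (rule small_image[OF sW])
 have increl: "VMap (inc j) x = VMap (inc j') x'" if "((j, x), (j', x')) : vertex_rel J G" for j x j' x'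
  by (rule vertex_rel_invariant[where F = "%j. VMap (inc j)", OF D(3) that])
 \<comment> \<open>The canonical map from classes of vertices to vertices of \<open>L\<close>. Its
   inverse will come from the universal property of \<open>L\<close>.\<close>
 define \<pi> where "\<pi> q = (let jx = SOME jx. jx : W & e (cls jx) = q in VMap (inc (fst jx)) (snd jx))" for q
 have \<pi>: "\<pi> (e (cls (j, x))) = VMap (inc j) x" if jx: "(j, x) : W" for j x
 proof -
  let ?P = "%kx. kx : W & e (cls kx) = e (cls (j, x))"
  have P: "?P (SOME kx. ?P kx)" by (rule someI[of ?P "(j, x)"]) (use jx in simp)
  obtain k y where ky: "(SOME kx. ?P kx) = (k, y)" by fastforce
  have "cls (k, y) = cls (j, x)" using P jx inj_onD[OF e] unfolding ky by blast
  then show ?thesis using increl unfolding cls_eq \<pi>_def ky Let_def by simp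
 qed
 have \<pi>L: "\<pi> c : Verts L" if "c : e ` cls ` W" for c using that \<pi> DE(5) unfolding W_def by force
 \<comment> \<open>Homs are pulled back along \<open>\<pi>\<close>, so the cocone into
   \<open>T\<close> can keep the hom maps of \<open>inc\<close>.\<close>
 define T where "T = mk_graph (e ` cls ` W) (%(c, d). Edge L (\<pi> c, \<pi> d))"
 have T: "T : Obj GV" unfolding T_def by (rule mk_graph_Obj[OF small]) (use \<pi>L GObjD(2)[OF D(1)] in auto)
 define f where "f j = mk_map (OMap G j) T (%x. e (cls (j, x))) (EMap (inc j))" for j
 have W: "(j, x) : W \<longleftrightarrow> j : Obj J & x : Verts (OMap G j)" for j x by (auto simp: W_def)
 have f: "f j : Hom GV (OMap G j) T" if j: "j : Obj J" for j unfolding f_def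
 proof (rule mk_map_Hom[OF GO[OF j] T])
  fix x y assume x: "x : Verts (OMap G j)" and y: "y : Verts (OMap G j)"
  show "e (cls (j, x)) : Verts T" using x j W by (auto simp: T_def)
  have "(j, x) : W" "(j, y) : W" using x y j W by auto
  then show "EMap (inc j) (x, y) : Hom V (Edge (OMap G j) (x, y)) (Edge T (e (cls (j, x)), e (cls (j, y))))"
   using DE(6)[OF j x y] \<pi> by (simp add: T_def)
 qed
 have "is_cocone J GV G T f"
 proof (rule GcoconeI[OF G T f])
  fix t x assume t: "t : Arr J" and x: "x : Verts (OMap G (Dom J t))"
  then show "VMap (f (Cod J t)) (VMap (AMap G t) x) = VMap (f (Dom J t)) x"
   using vertex_rel_step[OF t x] GHomD(5)[OF Gt[OF t] x] by (simp add: f_def cls_eq[symmetric])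
  fix y assume y: "y : Verts (OMap G (Dom J t))"
  show "EMap (f (Cod J t)) (VMap (AMap G t) x, VMap (AMap G t) y) ** EMap (AMap G t) (x, y) = EMap (f (Dom J t)) (x, y)"
   using D(4)[OF t x y] GHomD(5)[OF Gt[OF t]] x y by (simp add: f_def)
 qed
 then obtain h where h: "h : Hom GV L T" and hc: "!!j. j : Obj J ==> h \<star>GV inc j = f j"
  using is_colimit_ex[OF colim] by metis
 define p where "p = mk_map T L \<pi> (%(c, d). Ide V (Edge L (\<pi> c, \<pi> d)))"
 have VT: "Verts T = e ` cls ` W" by (simp add: T_def)
 have p: "p : Hom GV T L" unfolding p_def by (rule mk_map_Hom[OF T D(1)])
   (use \<pi>L GObjD(2)[OF D(1)] V.Ide_Hom in "auto simp: VT T_def simp del: image_eqI")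
 have pf: "p \<star>GV f j = inc j" if j: "j : Obj J" for j
 proof (rule GHom_eqI[OF GComp_Hom[OF f[OF j] p] D(2)[OF j]])
  fix x assume x: "x : Verts (OMap G j)"
  have xW: "(j, x) : W" using j x W by simp
  show "VMap (p \<star>GV f j) x = VMap (inc j) x" unfolding GComp(1)[OF f[OF j] x] using xW x by (simp add: p_def f_def VT \<pi>)
  fix y assume y: "y : Verts (OMap G j)"
  have yW: "(j, y) : W" using j y W by simp
  show "EMap (p \<star>GV f j) (x, y) = EMap (inc j) (x, y)" unfolding GComp(2)[OF f[OF j] x y]
   using xW x yW y V.id_l[OF DE(6)[OF j x y]] by (simp add: p_def f_def VT \<pi>)
 qed
 \<comment> \<open>On vertices this says that every vertex of \<open>L\<close> comes from a class,
   while \<open>hi\<close> below separates distinct classes.\<close>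
 have "p \<star>GV h = Ide GV L"
 proof (rule is_colimit_eq[OF category_GV G colim GComp_Hom[OF h p] GIde_Hom[OF D(1)]])
  fix j assume j: "j : Obj J"
  show "(p \<star>GV h) \<star>GV inc j = Ide GV L \<star>GV inc j"
   using GV.assoc[OF D(2)[OF j] h p] hc[OF j] pf[OF j] GV.id_l[OF D(2)[OF j]] by simp
 qed
 then have ph: "\<pi> (VMap h v) = v" if "v : Verts L" for v
  using GComp(1)[OF h that, of p] GIde(1)[OF that] that GHomD(5)[OF h that] by (simp add: p_def)
 have hi: "VMap h (VMap (inc j) x) = e (cls (j, x))" if "j : Obj J" "x : Verts (OMap G j)" for j x
  using GComp(1)[OF D(2)[OF that(1)] that(2), of h] hc[OF that(1)] that by (simp add: f_def)
 have sur: "EX j:Obj J. EX x:Verts (OMap G j). VMap (inc j) x = v" if v: "v : Verts L" for v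
 proof -
  obtain j x where jx: "(j, x) : W" "VMap h v = e (cls (j, x))" using GHomD(5)[OF h v] by (auto simp: VT)
  then show ?thesis using ph[OF v] \<pi> W by metis
 qed
 have inj: "((j, x), (j', x')) : vertex_rel J G" if "j : Obj J" "j' : Obj J" "x : Verts (OMap G j)"
  "x' : Verts (OMap G j')" "VMap (inc j) x = VMap (inc j') x'" for j j' x x'
 proof -
  have "e (cls (j, x)) = e (cls (j', x'))" using hi that by metis
  moreover have "(j, x) : W" "(j', x') : W" using that W by auto
  ultimately have "cls (j, x) = cls (j', x')" using inj_onD[OF e] by blast
  then show ?thesis by (simp add: cls_eq)
 qed
 have "edge_colimit J G L inc v w" if v: "v : Verts L" and w: "w : Verts L" for v w unfolding edge_colimit_def
 proof (intro ballI allI impI)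
  fix A g assume A: "A : Obj V" and g: "edge_cocone J G inc v w A g"
  \<comment> \<open>With only the hom at \<open>(v, w)\<close> changed, to \<open>A\<close>, the
    cocone \<open>g\<close> on the homs over that pair and the maps \<open>inc\<close> elsewhere
    combine to a cocone of graphs.\<close>
  define L' where "L' = mk_graph (Verts L) (%ab. if ab = (v, w) then A else Edge L ab)"
  have L': "L' : Obj GV" unfolding L'_def by (rule mk_graph_Obj) (use GObjD[OF D(1)] A in auto)
  have VL': "Verts L' = Verts L" by (simp add: L'_def)
  define m where "m j = mk_map (OMap G j) L' (VMap (inc j))
   (%(x, y). if VMap (inc j) x = v & VMap (inc j) y = w then g j x y else EMap (inc j) (x, y))" for j
  have m: "m j : Hom GV (OMap G j) L'" if j: "j : Obj J" for j unfolding m_def by (rule mk_map_Hom[OF GO[OF j] L'])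
    (use DE(5,6)[OF j] g j in "auto simp: VL' L'_def edge_cocone_def")
  have "is_cocone J GV G L' m"
  proof (rule GcoconeI[OF G L' m])
   fix t x assume t: "t : Arr J" and x: "x : Verts (OMap G (Dom J t))"
   then show "VMap (m (Cod J t)) (VMap (AMap G t) x) = VMap (m (Dom J t)) x"
    using D(3)[OF t x] GHomD(5)[OF Gt[OF t] x] by (simp add: m_def)
   fix y assume y: "y : Verts (OMap G (Dom J t))"
   show "EMap (m (Cod J t)) (VMap (AMap G t) x, VMap (AMap G t) y) ** EMap (AMap G t) (x, y) = EMap (m (Dom J t)) (x, y)"
    using D(3)[OF t x] D(3)[OF t y] D(4)[OF t x y] GHomD(5)[OF Gt[OF t]] x y g t by (simp add: m_def edge_cocone_def)
  qed
  note coc' = this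
  obtain k where k: "k : Hom GV L L'" and kc: "!!j. j : Obj J ==> k \<star>GV inc j = m j"
   using is_colimit_ex[OF colim coc'] by metis
  have kv: "VMap k a = a" if a: "a : Verts L" for a
  proof -
   obtain j x where j: "j : Obj J" "x : Verts (OMap G j)" "VMap (inc j) x = a" using sur[OF a] by blast
   then show ?thesis using GComp(1)[OF D(2)[OF j(1)] j(2), of k] kc[OF j(1)] by (simp add: m_def)
  qed
  show "EX! h. h : Hom V (Edge L (v, w)) A & (ALL j:Obj J. ALL x:Verts (OMap G j). ALL y:Verts (OMap G j).
      VMap (inc j) x = v --> VMap (inc j) y = w --> h ** EMap (inc j) (x, y) = g j x y)"
  proof (intro ex1I[of _ "EMap k (v, w)"] conjI ballI impI)
   show "EMap k (v, w) : Hom V (Edge L (v, w)) A" using GHomD(6)[OF k v w] kv v w by (simp add: L'_def)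
   fix j x y assume j: "j : Obj J" "x : Verts (OMap G j)" "y : Verts (OMap G j)" "VMap (inc j) x = v" "VMap (inc j) y = w"
   then show "EMap k (v, w) ** EMap (inc j) (x, y) = g j x y"
    using GComp(2)[OF D(2)[OF j(1)] j(2,3), of k] kc[OF j(1)] by (simp add: m_def)
  next
   fix h assume h: "h : Hom V (Edge L (v, w)) A & (ALL j:Obj J. ALL x:Verts (OMap G j). ALL y:Verts (OMap G j).
      VMap (inc j) x = v --> VMap (inc j) y = w --> h ** EMap (inc j) (x, y) = g j x y)"
   \<comment> \<open>A competitor \<open>h\<close> is extended by identities to a morphism into
     \<open>L'\<close>, so uniqueness for graphs gives uniqueness for the hom.\<close>
   define k' where "k' = mk_map L L' (%a. a) (%ab. if ab = (v, w) then h else Ide V (Edge L ab))"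
   have k': "k' : Hom GV L L'" unfolding k'_def
    by (rule mk_map_Hom[OF D(1) L']) (use h GObjD(2)[OF D(1)] V.Ide_Hom in "auto simp: L'_def")
   have "k' = k"
   proof (rule is_colimit_eq[OF category_GV G colim k' k])
    fix j assume j: "j : Obj J"
    have "k' \<star>GV inc j = m j"
    proof (rule GHom_eqI[OF GComp_Hom[OF D(2)[OF j] k'] m[OF j]])
     fix x assume x: "x : Verts (OMap G j)"
     show "VMap (k' \<star>GV inc j) x = VMap (m j) x" using x DE(5)[OF j x] by (simp add: GComp[OF D(2)[OF j]] m_def k'_def)
     fix y assume y: "y : Verts (OMap G j)"
     show "EMap (k' \<star>GV inc j) (x, y) = EMap (m j) (x, y)" using x y DE(5)[OF j] h j V.id_l[OF DE(6)[OF j x y]]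
      by (simp add: GComp[OF D(2)[OF j]] m_def k'_def)
    qed
    then show "k' \<star>GV inc j = k \<star>GV inc j" using kc[OF j] by simp
   qed
   then show "h = EMap k (v, w)" using v w by (auto simp: k'_def)
  qed
 qed
 then show ?thesis unfolding graph_colimit_def using coc sur inj by blast
qed

end

text \<open>Coproducts of graphs are treated as colimits over discrete categories, which makes the
  description by \<open>graph_colimit\<close> available for them.\<close>

definition discrete :: "'i set => ('i, 'i) cat" where
 "discrete I = \<lparr>Obj = I, Arr = I, Dom = (%i. i), Cod = (%i. i), Ide = (%i. i), Comp = (%g f. f)\<rparr>"

lemma discrete_simps [simp]: "Obj (discrete I) = I" "Arr (discrete I) = I" "Dom (discrete I) i = i" "Cod (discrete I) i = i"
 "Ide (discrete I) i = i" "Comp (discrete I) g f = f" by (simp_all add: discrete_def)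

lemma category_discrete: "category (discrete I)" by (auto simp: category_def Hom_def)

definition discrete_diagram :: "('o, 'a) cat => ('i => 'o) => ('i, 'i, 'o, 'a) ftor" where
 "discrete_diagram C X = \<lparr>OMap = X, AMap = (%i. Ide C (X i))\<rparr>"

lemma discrete_diagram_simps [simp]: "OMap (discrete_diagram C X) = X" "AMap (discrete_diagram C X) i = Ide C (X i)"
 by (simp_all add: discrete_diagram_def)

context Category
begin

abbreviation SC where "SC \<equiv> seq_cat C"

lemma functor_discrete_diagram: "(!!i. i : I ==> X i : Obj C) ==> is_functor (discrete I) C (discrete_diagram C X)"
 using category category_discrete by (auto simp: is_functor_def Ide_Hom)

lemma coproduct_iff_colimit:
 assumes "!!i. i : I ==> X i : Obj C"
 shows "is_coproduct C I X Q inc \<longleftrightarrow> is_colimit (discrete I) C (discrete_diagram C X) Q inc"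
proof -
 have "is_cocone (discrete I) C (discrete_diagram C X) T f \<longleftrightarrow> T : Obj C & (ALL i:I. f i : Hom C (X i) T)" for T f
  using id_r by (auto simp: is_cocone_def)
 then show ?thesis using assms by (simp add: is_coproduct_def is_colimit_def Ball_def) blast
qed

end

section \<open>Finite sequences\<close>

lemma seq_cat_simps [simp]: "Obj (seq_cat C) = lists (Obj C)" "Arr (seq_cat C) = lists (Arr C)" "Dom (seq_cat C) = map (Dom C)"
 "Cod (seq_cat C) = map (Cod C)" "Ide (seq_cat C) = map (Ide C)" "Comp (seq_cat C) = map2 (Comp C)" by (simp_all add: seq_cat_def)

lemma seq_Hom_iff: "fs : Hom (seq_cat C) Xs Ys \<longleftrightarrow> length fs = length Xs & length fs = length Ys &
  (ALL i<length Xs. fs ! i : Hom C (Xs ! i) (Ys ! i))"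
proof
 assume "fs : Hom (seq_cat C) Xs Ys"
 then have "fs : lists (Arr C)" "map (Dom C) fs = Xs" "map (Cod C) fs = Ys" by (auto simp: Hom_def)
 then show "length fs = length Xs & length fs = length Ys &
  (ALL i<length Xs. fs ! i : Hom C (Xs ! i) (Ys ! i))" by (auto simp: Hom_def in_lists_conv_set)
next
 assume "length fs = length Xs & length fs = length Ys & (ALL i<length Xs. fs ! i : Hom C (Xs ! i) (Ys ! i))"
 then show "fs : Hom (seq_cat C) Xs Ys" by (auto simp: Hom_def in_lists_conv_set in_set_conv_nth intro: nth_equalityI)
qed

lemma seq_HomI: "(!!z. z : set zs ==> f z : Hom C (A z) (B z)) ==> map f zs : Hom (seq_cat C) (map A zs) (map B zs)"
 by (simp add: seq_Hom_iff)

context Category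
begin

lemma category_seq_cat: "category SC"
proof -
 have comp: "map2 (\<cdot>) gs fs : Hom SC Xs Zs" if "fs : Hom SC Xs Ys" "gs : Hom SC Ys Zs" for fs gs Xs Ys Zs
  using that comp_Hom unfolding seq_Hom_iff by simp metis
 have Arr: "fs : Hom SC (map (Dom C) fs) (map (Cod C) fs)" if "fs : lists (Arr C)" for fs using that by (auto simp: Hom_def)
 show ?thesis unfolding category_def
 proof (intro conjI ballI impI)
  fix X assume "X : Obj SC"
  then show "Ide SC X : Hom SC X X" by (auto simp: seq_Hom_iff in_lists_conv_set Ide_Hom)
 next
  fix fs assume f: "fs : Arr SC"
  show "Dom SC fs : Obj SC" "Cod SC fs : Obj SC" using f by (auto simp: in_lists_conv_set)
  show "fs \<star>SC Ide SC (Dom SC fs) = fs" "Ide SC (Cod SC fs) \<star>SC fs = fs"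
   using f by (auto simp: in_lists_conv_set intro!: nth_equalityI)
  fix gs assume g: "gs : Arr SC" and fg: "Cod SC fs = Dom SC gs"
  show "gs \<star>SC fs : Hom SC (Dom SC fs) (Cod SC gs)"
   using comp[of fs "map (Dom C) fs" "map (Dom C) gs" gs "map (Cod C) gs"] Arr[of fs] Arr[of gs] f g fg by simp
  fix hs assume h: "hs : Arr SC" and gh: "Cod SC gs = Dom SC hs"
  have l: "length gs = length fs" "length hs = length gs" using fg gh by (metis length_map seq_cat_simps(3,4))+
  show "hs \<star>SC (gs \<star>SC fs) = (hs \<star>SC gs) \<star>SC fs"
  proof (rule nth_equalityI)
   fix i assume "i < length (hs \<star>SC (gs \<star>SC fs))"
   then have i: "i < length fs" using l by simp
   have "Cod C (fs ! i) = Dom C (gs ! i)" "Cod C (gs ! i) = Dom C (hs ! i)" using fg gh i l by (metis nth_map seq_cat_simps(3,4))+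
   then show "(hs \<star>SC (gs \<star>SC fs)) ! i = ((hs \<star>SC gs) \<star>SC fs) ! i"
    using i l f g h by (auto simp: in_lists_conv_set comp_assoc)
  qed (use l in simp)
 qed
qed

text \<open>From left to right, a component is tested by altering the projections in that one place
  and keeping them in all others.\<close>

lemma seq_pullback_iff:
 assumes p: "ps : Hom SC Ps As" and q: "qs : Hom SC Ps Bs" and f: "fs : Hom SC As Ds" and g: "gs : Hom SC Bs Ds"
 shows "is_pullback SC ps qs fs gs \<longleftrightarrow> (ALL i<length Ps. is_pullback C (ps ! i) (qs ! i) (fs ! i) (gs ! i))"
proof -
 interpret S: Category "SC" by unfold_locales (rule category_seq_cat)
 have len: "length ps = length Ps" "length qs = length Ps" "length fs = length Ps" "length gs = length Ps"
  "length As = length Ps" "length Bs = length Ps" "length Ds = length Ps" using p q f g by (auto simp: seq_Hom_iff)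
 have n: "ps ! i : Hom C (Ps ! i) (As ! i)" "qs ! i : Hom C (Ps ! i) (Bs ! i)"
  "fs ! i : Hom C (As ! i) (Ds ! i)" "gs ! i : Hom C (Bs ! i) (Ds ! i)" if "i < length Ps" for i
  using that p q f g by (auto simp: seq_Hom_iff)
 show ?thesis
 proof (intro iffI allI impI)
  assume pb: "is_pullback SC ps qs fs gs"
  fix i assume i: "i < length Ps"
  have com: "fs ! j \<cdot> ps ! j = gs ! j \<cdot> qs ! j" if "j < length Ps" for j
  proof -
   have "map2 (\<cdot>) fs ps ! j = map2 (\<cdot>) gs qs ! j" using S.pullbackD(5)[OF pb] by simp
   then show ?thesis using that len by simp
  qed
  note dom = HomD(2)[OF p] HomD(2)[OF f] HomD(2)[OF g]
  show "is_pullback C (ps ! i) (qs ! i) (fs ! i) (gs ! i)"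
  proof (rule pullbackI[OF n[OF i] com[OF i]])
   fix T x y assume x: "x : Hom C T (As ! i)" and y: "y : Hom C T (Bs ! i)" and e: "fs ! i \<cdot> x = gs ! i \<cdot> y"
   have xs: "ps[i := x] : Hom SC (Ps[i := T]) As" and ys: "qs[i := y] : Hom SC (Ps[i := T]) Bs"
    using len n x y i by (auto simp: seq_Hom_iff nth_list_update)
   have "fs \<star>SC ps[i := x] = gs \<star>SC qs[i := y]" using len com e i by (auto intro!: nth_equalityI simp: nth_list_update)
   then obtain hs where hs: "hs : Hom SC (Ps[i := T]) Ps" "ps \<star>SC hs = ps[i := x]" "qs \<star>SC hs = qs[i := y]"
    using S.pullback_ex[OF pb, of "ps[i := x]" _ "qs[i := y]"] xs ys dom by metis
   have lh: "length hs = length Ps" using hs(1) by (simp add: seq_Hom_iff)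
   have "(ps \<star>SC hs) ! i = x" "(qs \<star>SC hs) ! i = y" using hs len i by auto
   then have "ps ! i \<cdot> hs ! i = x" "qs ! i \<cdot> hs ! i = y" using len i lh by auto
   moreover have "hs ! i : Hom C T (Ps ! i)" using hs(1) i by (auto simp: seq_Hom_iff)
   ultimately show "EX h. h : Hom C T (Ps ! i) & ps ! i \<cdot> h = x & qs ! i \<cdot> h = y" by blast
  next
   fix T h h' assume h: "h : Hom C T (Ps ! i)" "h' : Hom C T (Ps ! i)"
    "ps ! i \<cdot> h = ps ! i \<cdot> h'" "qs ! i \<cdot> h = qs ! i \<cdot> h'"
   have P: "Ps ! j : Obj C" if "j < length Ps" for j using n(1)[OF that] Hom_Obj by blast
   let ?h = "(map (Ide C) Ps)[i := h]" and ?h' = "(map (Ide C) Ps)[i := h']"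
   have hh: "?h : Hom SC (Ps[i := T]) Ps" "?h' : Hom SC (Ps[i := T]) Ps"
    using h P i by (auto simp: seq_Hom_iff nth_list_update Ide_Hom)
   have "?h = ?h'"
   proof (rule S.pullback_eq[OF pb, where T = "Ps[i := T]"])
    show "?h : Hom SC (Ps[i := T]) (Dom SC ps)" "?h' : Hom SC (Ps[i := T]) (Dom SC ps)" using hh dom(1) by simp_all
    show "ps \<star>SC ?h = ps \<star>SC ?h'" by (rule nth_equalityI) (use h(3,4) len i in "auto simp: nth_list_update")
    show "qs \<star>SC ?h = qs \<star>SC ?h'" by (rule nth_equalityI) (use h(3,4) len i in "auto simp: nth_list_update")
   qed
   then have "?h ! i = ?h' ! i" by simp
   then show "h = h'" using i by simp
  qed
 next
  assume pb: "ALL i<length Ps. is_pullback C (ps ! i) (qs ! i) (fs ! i) (gs ! i)"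
  note D = pullbackD[OF pb[rule_format]]
  show "is_pullback SC ps qs fs gs"
  proof (rule S.pullbackI[OF p q f g])
   show "fs \<star>SC ps = gs \<star>SC qs" using len D(5) by (auto intro!: nth_equalityI)
   fix Ts
   show "hs = hs'" if hs: "hs : Hom SC Ts Ps" "hs' : Hom SC Ts Ps"
    "ps \<star>SC hs = ps \<star>SC hs'" "qs \<star>SC hs = qs \<star>SC hs'" for hs hs'
   proof (rule nth_equalityI)
    have lh: "length hs = length Ps" "length hs' = length Ps" using hs by (auto simp: seq_Hom_iff)
    then show "length hs = length hs'" by simp
    fix i assume "i < length hs"
    then have i: "i < length Ps" using lh by simp
    have "(ps \<star>SC hs) ! i = (ps \<star>SC hs') ! i" "(qs \<star>SC hs) ! i = (qs \<star>SC hs') ! i" using hs by auto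
    then have "ps ! i \<cdot> hs ! i = ps ! i \<cdot> hs' ! i" "qs ! i \<cdot> hs ! i = qs ! i \<cdot> hs' ! i" using len lh i by auto
    moreover have "hs ! i : Hom C (Ts ! i) (Dom C (ps ! i))" "hs' ! i : Hom C (Ts ! i) (Dom C (ps ! i))"
     using hs i HomD(2)[OF n(1)[OF i]] by (auto simp: seq_Hom_iff)
    ultimately show "hs ! i = hs' ! i" using pullback_eq pb i by metis
   qed
   fix xs ys assume xs: "xs : Hom SC Ts As" and ys: "ys : Hom SC Ts Bs" and e: "fs \<star>SC xs = gs \<star>SC ys"
   have l: "length xs = length Ps" "length ys = length Ps" "length Ts = length Ps" using xs ys len by (auto simp: seq_Hom_iff)
   have "EX h. h : Hom C (Ts ! i) (Ps ! i) & ps ! i \<cdot> h = xs ! i & qs ! i \<cdot> h = ys ! i" if i: "i < length Ps" for i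
   proof -
    have "(fs \<star>SC xs) ! i = (gs \<star>SC ys) ! i" using e by simp
    then have "fs ! i \<cdot> xs ! i = gs ! i \<cdot> ys ! i" using i len l by simp
    moreover have "xs ! i : Hom C (Ts ! i) (Dom C (fs ! i))" "ys ! i : Hom C (Ts ! i) (Dom C (gs ! i))"
     using xs ys i len HomD(2)[OF n(3)[OF i]] HomD(2)[OF n(4)[OF i]] by (auto simp: seq_Hom_iff)
    ultimately show ?thesis using pullback_ex[OF pb[rule_format, OF i]] HomD(2)[OF n(1)[OF i]] by metis
   qed
   then obtain h where h: "!!i. i < length Ps ==> h i : Hom C (Ts ! i) (Ps ! i) & ps ! i \<cdot> h i = xs ! i & qs ! i \<cdot> h i = ys ! i"
    by metis
   have "map h [0..<length Ps] : Hom SC Ts Ps" using h l by (auto simp: seq_Hom_iff)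
   moreover have "ps \<star>SC map h [0..<length Ps] = xs" "qs \<star>SC map h [0..<length Ps] = ys"
    using h l len by (auto intro!: nth_equalityI)
   ultimately show "EX hs. hs : Hom SC Ts Ps & ps \<star>SC hs = xs & qs \<star>SC hs = ys" by blast
  qed
 qed
qed

end

lemma small_list_all2:
 assumes "universe U" "!!z. z : set zs ==> small U (I z)"
 shows "small U {qs. list_all2 (%z q. q : I z) zs qs}"
proof -
 have "{qs. list_all2 (%z q. q : I z) zs qs} \<subseteq> lists (\<Union>z\<in>set zs. I z)"
  by (force simp: list_all2_conv_all_nth in_lists_conv_set in_set_conv_nth)
 moreover have "small U (lists (\<Union>z\<in>set zs. I z))" by (intro small_lists small_UN assms small_finite) auto
 ultimately show ?thesis using small_subset by blast
qed

section \<open>Distributivity in several variables\<close>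

locale Multitensor = VGraphs V U for V :: "('o, 'a) cat" (structure) and U :: "'u itself" +
 fixes E :: "('o list, 'a list, 'o, 'a) ftor" and u :: "'o => 'a" and sig :: "'o list list => 'a"
 assumes distributive: "distributive_multitensor U V E u sig"
begin

lemma multitensor: "multitensor V E u sig" using distributive by (simp add: distributive_multitensor_def)

lemma functor_E: "is_functor SV V E" using multitensor by (simp add: multitensor_def)

lemmas E_Obj = functorD(3)[OF functor_E, simplified]
lemmas E_Hom_seq = functorD(4)[OF functor_E]
lemmas E_comp_seq = functorD(6)[OF functor_E]

lemma E_Hom: "(!!z. z : set zs ==> f z : Hom V (A z) (B z)) ==> AMap E (map f zs) : Hom V (OMap E (map A zs)) (OMap E (map B zs))"
 by (rule E_Hom_seq[OF seq_HomI])

lemma E_comp: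
 assumes "!!z. z : set zs ==> f z : Hom V (A z) (B z)" "!!z. z : set zs ==> g z : Hom V (B z) (D z)"
 shows "AMap E (map g zs) ** AMap E (map f zs) = AMap E (map (%z. g z ** f z) zs)"
proof -
 have f: "map f zs : Hom SV (map A zs) (map B zs)" and g: "map g zs : Hom SV (map B zs) (map D zs)"
  using assms by (auto intro!: seq_HomI)
 have "map2 (\<cdot>) (map g zs) (map f zs) = map (%z. g z ** f z) zs" by (induction zs) auto
 then show ?thesis using E_comp_seq[OF f g] by simp
qed

lemma E_Ide: "Xs : Seqs ==> AMap E (map (Ide V) Xs) = Ide V (OMap E Xs)" using functorD(5)[OF functor_E, of Xs] by simp

text \<open>Distributivity concerns one variable at a time, so the variables are expanded from left
  to right: \<open>As\<close> holds those already fixed at a summand, \<open>zs\<close> stands for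
  those still to be expanded.\<close>

lemma E_coproduct_prefix:
 assumes "As : Seqs" "!!z. z : set zs ==> is_coproduct V (I z) F (Q z) inc" "!!z. z : set zs ==> small U (I z)"
 shows "is_coproduct V {qs. list_all2 (%z q. q : I z) zs qs} (%qs. OMap E (As @ map F qs))
  (OMap E (As @ map Q zs)) (%qs. AMap E (map (Ide V) As @ map inc qs))" using assms
proof (induction zs arbitrary: As)
 case Nil
 have i: "AMap E (map (Ide V) As) = Ide V (OMap E As)" by (rule E_Ide) (use Nil in auto)
 have o: "OMap E As : Obj V" by (rule E_Obj) (use Nil in auto)
 show ?case using i o V.id_r V.Ide_Hom[OF o] by (auto intro!: V.coproductI)
next
 case (Cons z zs)
 have cop: "is_coproduct V (I z) F (Q z) inc" and sm: "small U (I z)" using Cons.prems by auto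
 note D = V.coproductD[OF cop]
 have Qs: "Q y : Obj V" if "y : set zs" for y using V.coproductD(1)[OF Cons.prems(2)] that by simp
 let ?Xs = "As @ Q z # map Q zs"
 have "?Xs : Seqs" using Cons.prems(1) D(1) Qs by (auto simp: in_lists_conv_set)
 then have "preserves_coproducts U V V (nth_variable V E ?Xs (length As))"
  using distributive by (simp add: distributive_multitensor_def)
 from V.preserves_coproducts_small[OF this sm cop V.category]
 have c1: "is_coproduct V (I z) (%q. OMap E (As @ F q # map Q zs)) (OMap E ?Xs)
  (%q. AMap E (map (Ide V) As @ inc q # map (Ide V) (map Q zs)))" by (simp add: nth_variable_def comp_def list_update_append)
 let ?L = "{qs. list_all2 (%z q. q : I z) zs qs}"
 have c2: "is_coproduct V ?L (%qs. OMap E ((As @ [F q]) @ map F qs))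
  (OMap E ((As @ [F q]) @ map Q zs)) (%qs. AMap E (map (Ide V) (As @ [F q]) @ map inc qs))" if q: "q : I z" for q
  by (rule Cons.IH) (use Cons.prems D(2)[OF q] in auto)
 \<comment> \<open>Expanding the first variable and then the others amounts to applying
   \<open>E\<close> to all injections at once.\<close>
 have eq: "AMap E (map (Ide V) As @ inc q # map (Ide V) (map Q zs)) ** AMap E (map (Ide V) (As @ [F q]) @ map inc qs)
  = AMap E (map (Ide V) As @ inc q # map inc qs)" if q: "q : I z" and qs: "qs : ?L" for q qs
 proof -
  have len: "length qs = length zs" using qs by (auto simp: list_all2_lengthD)
  have n: "inc (qs ! i) : Hom V (F (qs ! i)) (Q (zs ! i))" if "i < length zs" for i
   using qs that V.coproductD(3)[OF Cons.prems(2)[of "zs ! i"]] by (auto simp: list_all2_conv_all_nth)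
  have 1: "map (Ide V) (As @ [F q]) @ map inc qs : Hom SV (As @ F q # map F qs) (As @ F q # map Q zs)"
   using Cons.prems(1) D(2)[OF q] len n by (auto simp: seq_Hom_iff nth_append nth_Cons in_lists_conv_set V.Ide_Hom split: nat.splits)
  have 2: "map (Ide V) As @ inc q # map (Ide V) (map Q zs) : Hom SV (As @ F q # map Q zs) ?Xs" using Cons.prems(1) D(3)[OF q] Qs
   by (auto simp: seq_Hom_iff nth_append nth_Cons in_lists_conv_set V.Ide_Hom split: nat.splits)
  have A: "map2 (\<cdot>) (map (Ide V) As) (map (Ide V) As) = map (Ide V) As"
   using Cons.prems(1) by (auto intro!: nth_equalityI simp: in_lists_conv_set)
  have B: "map2 (\<cdot>) (map (Ide V) (map Q zs)) (map inc qs) = map inc qs" using len V.id_l[OF n] by (auto intro!: nth_equalityI)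
  have "map2 (\<cdot>) (map (Ide V) As @ inc q # map (Ide V) (map Q zs)) (map (Ide V) (As @ [F q]) @ map inc qs)
   = map (Ide V) As @ inc q # map inc qs" using A B V.id_r[OF D(3)[OF q]] by simp
  then show ?thesis using E_comp_seq[OF 1 2] by simp
 qed
 have c2': "is_coproduct V ?L (%qs. OMap E (As @ F q # map F qs)) (OMap E (As @ F q # map Q zs))
  (%qs. AMap E (map (Ide V) (As @ [F q]) @ map inc qs))" if "q : I z" for q using c2[OF that] by simp
 have c3: "is_coproduct V (SIGMA q:I z. ?L) (%(q, qs). OMap E (As @ F q # map F qs)) (OMap E ?Xs)
  (%(q, qs). AMap E (map (Ide V) As @ inc q # map (Ide V) (map Q zs)) ** AMap E (map (Ide V) (As @ [F q]) @ map inc qs))"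
  by (rule V.coproduct_nested[OF c1 c2'])
 have bij: "bij_betw (%l. (hd l, tl l)) {qs. list_all2 (%z q. q : I z) (z # zs) qs} (SIGMA q:I z. ?L)"
  by (rule bij_betwI[where g = "%(q, qs). q # qs"]) (auto simp: list_all2_Cons1)
 show ?case unfolding list.map by (rule V.coproduct_reindex[OF c3 bij]) (use eq in "auto simp: list_all2_Cons1")
qed

lemma E_coproduct:
 assumes "!!z. z : set zs ==> is_coproduct V (I z) F (Q z) inc" "!!z. z : set zs ==> small U (I z)"
 shows "is_coproduct V {qs. list_all2 (%z q. q : I z) zs qs} (%qs. OMap E (map F qs))
  (OMap E (map Q zs)) (%qs. AMap E (map inc qs))" using E_coproduct_prefix[of "[]" zs I F Q inc] assms by simp

lemma sig_Hom: "XSS : lists Seqs ==> sig XSS : Hom V (OMap E (map (OMap E) XSS)) (OMap E (concat XSS))"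
 using multitensor by (simp add: multitensor_def natural_def comp_ftor_def map_ftor_def concat_ftor_def)

lemma sig_natural:
 assumes "fss : Hom (seq_cat SV) XSS YSS"
 shows "AMap E (concat fss) ** sig XSS = sig YSS ** AMap E (map (AMap E) fss)" using multitensor assms
 by (auto simp: multitensor_def natural_def comp_ftor_def map_ftor_def concat_ftor_def Hom_def)

lemma u_Hom: "X : Obj V ==> u X : Hom V X (OMap E [X])"
 using multitensor by (simp add: multitensor_def natural_def id_ftor_def unary_part_def)

lemma u_natural: "f : Hom V X Y ==> AMap E [f] ** u X = u Y ** f"
 using multitensor by (auto simp: multitensor_def natural_def id_ftor_def unary_part_def Hom_def)

lemma multitensor_laws:
 shows "Xs : Seqs ==> sig [Xs] ** u (OMap E Xs) = Ide V (OMap E Xs)"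
  "Xs : Seqs ==> sig (map (%X. [X]) Xs) ** AMap E (map u Xs) = Ide V (OMap E Xs)" "XSSS : lists (lists Seqs) ==>
    sig (concat XSSS) ** sig (map (map (OMap E)) XSSS) = sig (map concat XSSS) ** AMap E (map sig XSSS)"
 using multitensor by (auto simp: multitensor_def)

end

section \<open>Paths\<close>

lemma steps_simps [simp]: "steps [] = []" "steps [x] = []" "steps (x # y # p) = (x, y) # steps (y # p)"
 by (simp_all add: steps_def)

lemma length_steps: "length (steps p) = length p - 1" by (simp add: steps_def)

lemma nth_steps: "i < length p - 1 ==> steps p ! i = (p ! i, p ! Suc i)" by (simp add: steps_def nth_tl)

lemma steps_map: "steps (map f p) = map (map_prod f f) (steps p)" by (induction p rule: induct_list012) auto

lemma set_steps: "(x, y) : set (steps p) ==> x : set p & y : set p" by (induction p rule: induct_list012) auto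

lemma steps_append: "q ~= [] ==> r ~= [] ==> last q = hd r ==> steps (q @ tl r) = steps q @ steps r"
proof (induction q rule: induct_list012)
 case (2 x)
 then show ?case by (cases r) auto
qed auto

lemma pathsD:
 assumes "p : paths X a b"
 shows "p ~= []" "set p \<subseteq> Verts X" "hd p = a" "last p = b" "a : Verts X" "b : Verts X"
 using assms by (auto simp: paths_def)

lemma paths_steps: "p : paths X a b ==> z : set (steps p) ==> fst z : Verts X & snd z : Verts X"
 using set_steps[of "fst z" "snd z" p] by (auto simp: paths_def)

lemma nested_Nil: "nested_paths X [x] = {[]}" by (auto simp: nested_paths_def)

lemma nested_Cons: "qs : nested_paths X (x # y # p) \<longleftrightarrow>
  (EX q qs'. qs = q # qs' & q : paths X x y & qs' : nested_paths X (y # p))" by (auto simp: nested_paths_def list_all2_Cons1)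

lemma nested_steps: "qs : nested_paths X p ==> steps p = map (%q. (hd q, last q)) qs"
 by (auto simp: nested_paths_def list_all2_conv_all_nth paths_def case_prod_beta' intro!: nth_equalityI prod_eqI)

lemma nested_mem: "qs : nested_paths X p ==> q : set qs ==> q : paths X (hd q) (last q)"
 by (auto simp: nested_paths_def list_all2_conv_all_nth in_set_conv_nth paths_def case_prod_beta')

lemma nestedI: "steps p = map (%q. (hd q, last q)) qs ==> (!!q. q : set qs ==> q ~= [] & set q \<subseteq> Verts X) ==>
  qs : nested_paths X p" by (auto simp: nested_paths_def list_all2_conv_all_nth paths_def)

lemma nested_iff: "qs : nested_paths X p \<longleftrightarrow>
  steps p = map (%q. (hd q, last q)) qs & (ALL q:set qs. q ~= [] & set q \<subseteq> Verts X)"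
proof
 assume qs: "qs : nested_paths X p"
 show "steps p = map (%q. (hd q, last q)) qs & (ALL q:set qs. q ~= [] & set q \<subseteq> Verts X)"
  using nested_steps[OF qs] pathsD(1,2)[OF nested_mem[OF qs]] by simp
qed (use nestedI in blast)

lemma join_Cons: "q ~= [] ==> hd q = x ==> join_paths (x # y # p) (q # qs) = q @ tl (join_paths (y # p) qs)"
 by (cases q) (auto simp: join_paths_def)

lemma join_nonempty [simp]: "join_paths p qs ~= []" "hd (join_paths p qs) = hd p" by (auto simp: join_paths_def)

text \<open>The vertex \<open>hd p\<close> is listed separately: a path of length 0 has no inner
  paths that would place it among the vertices of \<open>X\<close>.\<close>

lemma join_steps:
 assumes "p ~= []" "qs : nested_paths X p"
 shows "steps (join_paths p qs) = concat (map steps qs) & last (join_paths p qs) = last p &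
  set (join_paths p qs) \<subseteq> insert (hd p) (Verts X)" using assms
proof (induction p arbitrary: qs rule: induct_list012)
 case (2 x)
 then show ?case by (auto simp: nested_Nil join_paths_def)
next
 case (3 x y p)
 then obtain q qs' where qs: "qs = q # qs'" and q: "q : paths X x y" and qs': "qs' : nested_paths X (y # p)"
  by (auto simp: nested_Cons)
 note Q = pathsD[OF q]
 have IH: "steps (join_paths (y # p) qs') = concat (map steps qs')" "last (join_paths (y # p) qs') = last (y # p)"
  "set (join_paths (y # p) qs') \<subseteq> insert y (Verts X)" using 3(2)[OF _ qs'] by auto
 have j: "join_paths (x # y # p) qs = q @ tl (join_paths (y # p) qs')" unfolding qs by (rule join_Cons) (use Q in auto)
 have "steps (join_paths (x # y # p) qs) = steps q @ steps (join_paths (y # p) qs')"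
  unfolding j by (rule steps_append) (use Q in auto)
 moreover have "last (join_paths (x # y # p) qs) = last (y # p)"
 proof (cases "tl (join_paths (y # p) qs')")
  case Nil
  then have "last (join_paths (y # p) qs') = hd (join_paths (y # p) qs')" by (metis join_nonempty(1) last_ConsL list.collapse)
  then show ?thesis using Nil j IH Q by simp
 next
  case (Cons a l)
  then show ?thesis using j IH(2) by (metis last_append last_tl list.distinct(1))
 qed
 moreover have "set (join_paths (x # y # p) qs) \<subseteq> insert x (Verts X)"
  unfolding j using Q IH(3) by (auto dest: list.set_sel(2)[rotated])
 ultimately show ?case by (simp add: qs IH)
qed auto

lemma join_mem:
 assumes "p : paths X a b" "qs : nested_paths X p"
 shows "join_paths p qs : paths X a b"
 using join_steps[OF pathsD(1)[OF assms(1)] assms(2)] pathsD[OF assms(1)] by (auto simp: paths_def)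

lemma join_single: "q : paths X a b ==> join_paths [a, b] [q] = q" by (auto simp: paths_def join_paths_def)

lemma path_map: "p : paths X a b ==> (!!x. x : Verts X ==> f x : Verts Y) ==> map f p : paths Y (f a) (f b)"
 by (auto simp: paths_def hd_map last_map)

lemma nested_map: "qs : nested_paths X p ==> (!!x. x : Verts X ==> f x : Verts Y) ==> map (map f) qs : nested_paths Y (map f p)"
 by (auto simp: nested_iff steps_map hd_map last_map)

lemma join_map: "p ~= [] ==> join_paths (map f p) (map (map f) qs) = map f (join_paths p qs)"
 by (auto simp: join_paths_def hd_map map_concat map_tl comp_def)

lemma paths_cong: "Verts X = Verts Y ==> paths X = paths Y" "Verts X = Verts Y ==> nested_paths X = nested_paths Y"
 by (auto simp: paths_def nested_paths_def fun_eq_iff)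

section \<open>The monad of a distributive multitensor\<close>

lemma Verts_Gamma [simp]: "Verts (Gamma_obj V E X) = Verts X" by (simp add: Gamma_obj_def)

lemma paths_Gamma [simp]: "paths (Gamma_obj V E X) = paths X" "nested_paths (Gamma_obj V E X) = nested_paths X"
 by (auto intro: paths_cong)

lemma (in Category) coproduct_ex1:
 assumes "is_coproduct C I X Q inc" "T : Obj C" "!!i. i : I ==> f i : Hom C (X i) T"
 shows "EX! h. h : Hom C Q T & (ALL i:I. h \<cdot> inc i = f i)" using assms by (simp add: is_coproduct_def)

context Multitensor
begin

abbreviation \<G> :: "('u, 'o) vgraph => ('u, 'o) vgraph" where "\<G> \<equiv> Gamma_obj V E"
abbreviation \<G>m :: "('u, 'o, 'a) vgraph_map => ('u, 'o, 'a) vgraph_map" where "\<G>m \<equiv> Gamma_map V E"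
abbreviation \<iota> :: "('u, 'o) vgraph => 'u list => 'a" where "\<iota> \<equiv> Gamma_inj V E"
abbreviation smd :: "('u, 'o) vgraph => 'u list => 'o" where "smd \<equiv> Gamma_summand E"

text \<open>The arrow that \<open>f\<close> induces on the summand of the path
  \<open>p\<close>.\<close>

definition path_arr :: "('u, 'o, 'a) vgraph_map => 'u list => 'a" where "path_arr f p = AMap E (map (EMap f) (steps p))"

lemma small_paths: "X : Obj GV ==> small U (paths X a b)"
 by (rule small_subset[OF small_lists[OF universe GObjD(1)]]) (auto simp: paths_def)

lemma steps_Obj: "X : Obj GV ==> p : paths X a b ==> map (Edge X) (steps p) : Seqs"
 using paths_steps[of p X a b] GObjD(2)[of X] by (force simp: in_lists_conv_set)

lemma smd_Obj: "X : Obj GV ==> p : paths X a b ==> smd X p : Obj V" unfolding Gamma_summand_def by (rule E_Obj[OF steps_Obj])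

text \<open>\<open>Gamma_inj\<close> reads the end points off the path, so that one family of
  injections serves all pairs \<open>(a, b)\<close>; an identity reindexing exchanges it for the
  chosen injections.\<close>

lemma \<G>_coproduct:
 assumes X: "X : Obj GV" and a: "a : Verts X" "b : Verts X"
 shows "is_coproduct V (paths X a b) (smd X) (Edge (\<G> X) (a, b)) (\<iota> X)"
proof -
 have "is_coproduct V (paths X a b) (smd X) (Edge (\<G> X) (a, b)) (coproduct_inj V (paths X a b) (smd X))"
  using V.coproduct_chosen[OF has_coproducts small_paths[OF X] smd_Obj[OF X]] a by (simp add: Gamma_obj_def)
 then show ?thesis by (rule V.coproduct_reindex[OF _ bij_betw_id]) (auto simp: Gamma_inj_def paths_def)
qed

lemma \<G>_Obj: "X : Obj GV ==> \<G> X : Obj GV" using GObjD(1)[of X] V.coproductD(1)[OF \<G>_coproduct[of X]]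
 by (auto simp: GV_sel vgraphs_def Gamma_obj_def)

lemma \<iota>_Hom: "X : Obj GV ==> p : paths X a b ==> \<iota> X p : Hom V (smd X p) (Edge (\<G> X) (a, b))"
 using V.coproductD(3)[OF \<G>_coproduct] pathsD(5,6) by metis

lemma \<G>_edge_eqI:
 assumes "X : Obj GV" "a : Verts X" "b : Verts X" "h : Hom V (Edge (\<G> X) (a, b)) T"
  "h' : Hom V (Edge (\<G> X) (a, b)) T" "!!p. p : paths X a b ==> h ** \<iota> X p = h' ** \<iota> X p"
 shows "h = h'" using V.coproduct_eq[OF \<G>_coproduct[OF assms(1-3)] assms(4-6)] .

lemma path_map_Hom:
 assumes "f : Hom GV X Y" "p : paths X a b"
 shows "map (VMap f) p : paths Y (VMap f a) (VMap f b)" using path_map[OF assms(2) GHomD(5)[OF assms(1)]] .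

lemma EMap_steps:
 assumes f: "f : Hom GV X Y" and p: "p : paths X a b"
 shows "map (EMap f) (steps p) : Hom SV (map (Edge X) (steps p)) (map (Edge Y) (steps (map (VMap f) p)))"
proof -
 have "map (EMap f) (steps p) : Hom SV (map (Edge X) (steps p)) (map (Edge Y \<circ> map_prod (VMap f) (VMap f)) (steps p))"
  by (rule seq_HomI) (use GHomD(6)[OF f] paths_steps[OF p] in force)
 then show ?thesis by (simp add: steps_map)
qed

lemma path_arr_Hom:
 assumes f: "f : Hom GV X Y" and p: "p : paths X a b"
 shows "path_arr f p : Hom V (smd X p) (smd Y (map (VMap f) p))"
 unfolding path_arr_def Gamma_summand_def by (rule E_Hom_seq[OF EMap_steps[OF f p]])

lemma path_arr_comp:
 assumes f: "f : Hom GV X Y" and g: "g : Hom GV Y Z" and p: "p : paths X a b"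
 shows "path_arr (g \<star>GV f) p = path_arr g (map (VMap f) p) ** path_arr f p"
proof -
 have st: "fst z : Verts X & snd z : Verts X" if "z : set (steps p)" for z using paths_steps[OF p that] .
 have "path_arr g (map (VMap f) p) ** path_arr f p =
  AMap E (map (EMap g \<circ> map_prod (VMap f) (VMap f)) (steps p)) ** AMap E (map (EMap f) (steps p))"
  by (simp add: path_arr_def steps_map)
 also have "\<dots> = AMap E (map (%z. (EMap g \<circ> map_prod (VMap f) (VMap f)) z ** EMap f z) (steps p))"
 proof (rule E_comp)
  fix z assume z: "z : set (steps p)"
  show "EMap f z : Hom V (Edge X z) (Edge Y (VMap f (fst z), VMap f (snd z)))"
   using GHomD(6)[OF f, of "fst z" "snd z"] st[OF z] by simp
  show "(EMap g \<circ> map_prod (VMap f) (VMap f)) z : Hom V (Edge Y (VMap f (fst z), VMap f (snd z)))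
    (Edge Z (VMap g (VMap f (fst z)), VMap g (VMap f (snd z))))"
   using GHomD(6)[OF g, of "VMap f (fst z)" "VMap f (snd z)"] GHomD(5)[OF f] st[OF z] by (cases z) simp
 qed
 also have "map (%z. (EMap g \<circ> map_prod (VMap f) (VMap f)) z ** EMap f z) (steps p) = map (EMap (g \<star>GV f)) (steps p)"
  using st GComp(2)[OF f] by force
 finally show ?thesis by (simp add: path_arr_def)
qed

lemma path_arr_Ide:
 assumes X: "X : Obj GV" and p: "p : paths X a b"
 shows "path_arr (Ide GV X) p = Ide V (smd X p)"
proof -
 have "map (EMap (Ide GV X)) (steps p) = map (Ide V) (map (Edge X) (steps p))" using GIde(2)[of _ X] paths_steps[OF p] by force
 then show ?thesis using E_Ide[OF steps_Obj[OF X p]] unfolding path_arr_def Gamma_summand_def by (simp only:)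
qed

text \<open>The definite description in \<open>Gamma_map\<close> is discharged by the universal
  property of the coproduct over paths; afterwards hom maps are known by their behaviour on
  coproduct inclusions.\<close>

lemma \<G>m_props:
 assumes f: "f : Hom GV X Y"
 shows "\<G>m f : Hom GV (\<G> X) (\<G> Y)" "VMap (\<G>m f) = VMap f"
  "!!p a b. p : paths X a b ==> EMap (\<G>m f) (a, b) ** \<iota> X p = \<iota> Y (map (VMap f) p) ** path_arr f p"
proof -
 note D = GHomD[OF f]
 let ?P = "%a b h. h : Hom V (Edge (\<G> X) (a, b)) (Edge (\<G> Y) (VMap f a, VMap f b)) &
  (ALL p:paths X a b. h ** \<iota> X p = \<iota> Y (map (VMap f) p) ** AMap E (map (EMap f) (steps p)))"
 have ex: "EX! h. ?P a b h" if a: "a : Verts X" "b : Verts X" for a b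
 proof -
  have "\<iota> Y (map (VMap f) p) ** AMap E (map (EMap f) (steps p)) : Hom V (smd X p) (Edge (\<G> Y) (VMap f a, VMap f b))"
   if p: "p : paths X a b" for p
   using V.comp_Hom[OF path_arr_Hom[OF f p] \<iota>_Hom[OF D(2) path_map_Hom[OF f p]]] by (simp add: path_arr_def)
  then show ?thesis using \<G>_coproduct[OF D(1) a] GObjD(2)[OF \<G>_Obj[OF D(2)]] D(5) a unfolding is_coproduct_def by simp
 qed
 have E: "EMap (\<G>m f) (a, b) = (THE h. ?P a b h)" if "a : Verts X" "b : Verts X" for a b
  using that D(3,4) by (simp add: Gamma_map_def)
 have P: "?P a b (EMap (\<G>m f) (a, b))" if "a : Verts X" "b : Verts X" for a b unfolding E[OF that] using theI'[OF ex[OF that]] .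
 show v: "VMap (\<G>m f) = VMap f" by (simp add: Gamma_map_def)
 have "VMap f : Verts X \<rightarrow>\<^sub>E Verts Y" using f unfolding GHom_iff by simp
 then show "\<G>m f : Hom GV (\<G> X) (\<G> Y)" unfolding GHom_iff using P \<G>_Obj D(1-4) v by (simp add: Gamma_map_def)
 show "EMap (\<G>m f) (a, b) ** \<iota> X p = \<iota> Y (map (VMap f) p) ** path_arr f p" if p: "p : paths X a b" for p a b
  using P[OF pathsD(5,6)[OF p]] p by (simp add: path_arr_def)
qed

lemma \<G>m_eqI:
 assumes "k : Hom GV (\<G> X) T" "k' : Hom GV (\<G> X) T" "X : Obj GV" "!!a. a : Verts X ==> VMap k a = VMap k' a"
  "!!a b p. p : paths X a b ==> EMap k (a, b) ** \<iota> X p = EMap k' (a, b) ** \<iota> X p"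
 shows "k = k'"
proof (rule GHom_eqI[OF assms(1,2)])
 show va: "VMap k a = VMap k' a" if "a : Verts (\<G> X)" for a using assms(4) that by simp
 fix a b assume a: "a : Verts (\<G> X)" "b : Verts (\<G> X)"
 show "EMap k (a, b) = EMap k' (a, b)"
  by (rule \<G>_edge_eqI[OF assms(3)]) (use a GHomD(6)[OF assms(1) a] GHomD(6)[OF assms(2) a] va assms(5) in auto)
qed

lemma \<G>m_comp:
 assumes f: "f : Hom GV X Y" and g: "g : Hom GV Y Z"
 shows "\<G>m (g \<star>GV f) = \<G>m g \<star>GV \<G>m f"
proof (rule \<G>m_eqI)
 note D = GHomD[OF f] and F = \<G>m_props[OF f] and G = \<G>m_props[OF g] and GF = \<G>m_props[OF GComp_Hom[OF f g]]
 show "\<G>m (g \<star>GV f) : Hom GV (\<G> X) (\<G> Z)" "\<G>m g \<star>GV \<G>m f : Hom GV (\<G> X) (\<G> Z)" "X : Obj GV"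
  using GF F G GComp_Hom D by auto
 show "VMap (\<G>m (g \<star>GV f)) a = VMap (\<G>m g \<star>GV \<G>m f) a" if "a : Verts X" for a
  using that by (simp add: GF F G GComp[OF f] GComp[OF F(1)])
 fix a b p assume p: "p : paths X a b"
 note P = pathsD[OF p]
 have "EMap (\<G>m g \<star>GV \<G>m f) (a, b) ** \<iota> X p = EMap (\<G>m g) (VMap f a, VMap f b) ** (EMap (\<G>m f) (a, b) ** \<iota> X p)"
  using P V.assoc[OF \<iota>_Hom[OF D(1) p] GHomD(6)[OF F(1)] GHomD(6)[OF G(1)]] D(5) by (simp add: GComp[OF F(1)] F(2))
 also have "\<dots> = (EMap (\<G>m g) (VMap f a, VMap f b) ** \<iota> Y (map (VMap f) p)) ** path_arr f p"
  unfolding F(3)[OF p] using P D(5)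
  by (intro V.assoc[OF path_arr_Hom[OF f p] \<iota>_Hom[OF D(2) path_map_Hom[OF f p]] GHomD(6)[OF G(1)], symmetric]) auto
 also have "\<dots> = \<iota> Z (map (VMap g) (map (VMap f) p)) ** (path_arr g (map (VMap f) p) ** path_arr f p)"
  unfolding G(3)[OF path_map_Hom[OF f p]] by (rule V.assoc[OF path_arr_Hom[OF f p] path_arr_Hom[OF g path_map_Hom[OF f p]]
   \<iota>_Hom[OF GHomD(2)[OF g] path_map_Hom[OF g path_map_Hom[OF f p]]]])
 also have "\<dots> = \<iota> Z (map (VMap (g \<star>GV f)) p) ** path_arr (g \<star>GV f) p"
 proof -
  have "map (VMap g) (map (VMap f) p) = map (VMap (g \<star>GV f)) p" using P(2) GComp(1)[OF f] by auto
  then show ?thesis unfolding path_arr_comp[OF f g p] by (simp only:)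
 qed
 finally show "EMap (\<G>m (g \<star>GV f)) (a, b) ** \<iota> X p = EMap (\<G>m g \<star>GV \<G>m f) (a, b) ** \<iota> X p"
  using GF(3)[OF p] by simp
qed

lemma \<G>m_Ide:
 assumes X: "X : Obj GV"
 shows "\<G>m (Ide GV X) = Ide GV (\<G> X)"
proof (rule \<G>m_eqI[OF _ GIde_Hom[OF \<G>_Obj[OF X]] X])
 note I = \<G>m_props[OF GIde_Hom[OF X]]
 show "\<G>m (Ide GV X) : Hom GV (\<G> X) (\<G> X)" by (rule I)
 show "VMap (\<G>m (Ide GV X)) a = VMap (Ide GV (\<G> X)) a" if "a : Verts X" for a using that by (simp add: I(2) GIde)
 fix a b p assume p: "p : paths X a b"
 have "map (VMap (Ide GV X)) p = p" using pathsD(2)[OF p] GIde(1)[of _ X] by (auto intro!: map_idI)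
 then show "EMap (\<G>m (Ide GV X)) (a, b) ** \<iota> X p = EMap (Ide GV (\<G> X)) (a, b) ** \<iota> X p"
  using I(3)[OF p] path_arr_Ide[OF X p] pathsD[OF p] V.id_r[OF \<iota>_Hom[OF X p]] V.id_l[OF \<iota>_Hom[OF X p]]
  by (simp add: GIde)
qed

lemma functor_\<G>: "is_functor GV GV (Gamma V E)" by (rule is_functorI[OF category_GV category_GV])
  (auto simp: Gamma_def \<G>_Obj \<G>m_props \<G>m_comp \<G>m_Ide)

section \<open>The iterated construction, the unit and the multiplication\<close>

definition nested_arr :: "('u, 'o) vgraph => 'u list list => 'a" where "nested_arr X qs = AMap E (map (\<iota> X) qs)"

definition nested_obj :: "('u, 'o) vgraph => 'u list list => 'o" where "nested_obj X qs = OMap E (map (smd X) qs)"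

abbreviation nested_inj ("\<iota>\<iota>") where "nested_inj X p qs \<equiv> \<iota> (\<G> X) p ** nested_arr X qs"

lemma small_nested: "X : Obj GV ==> small U (nested_paths X p)"
 using small_list_all2[OF universe, of "steps p" "%(x, y). paths X x y"] small_paths
 by (simp add: nested_paths_def case_prod_beta')

text \<open>Distributivity is applied to the coproducts that label the steps of \<open>p\<close>:
  choosing a summand for each step is choosing an inner path.\<close>

lemma nested_coproduct:
 assumes X: "X : Obj GV" and p: "p : paths X a b"
 shows "is_coproduct V (nested_paths X p) (nested_obj X) (smd (\<G> X) p) (nested_arr X)"
proof -
 have "is_coproduct V {qs. list_all2 (%z q. q : paths X (fst z) (snd z)) (steps p) qs}
  (%qs. OMap E (map (smd X) qs)) (OMap E (map (Edge (\<G> X)) (steps p))) (%qs. AMap E (map (\<iota> X) qs))"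
  by (rule E_coproduct) (use paths_steps[OF p] \<G>_coproduct[OF X] small_paths[OF X] in auto)
 then show ?thesis
  by (simp add: nested_paths_def nested_obj_def[abs_def] nested_arr_def[abs_def] Gamma_summand_def[of E "\<G> X"] case_prod_beta')
qed

lemmas nested_arr_Hom = V.coproductD(3)[OF nested_coproduct]

lemma \<G>\<G>_coproduct:
 assumes X: "X : Obj GV" and a: "a : Verts X" "b : Verts X"
 shows "is_coproduct V (Sigma (paths X a b) (nested_paths X)) (%(p, qs). nested_obj X qs)
  (Edge (\<G> (\<G> X)) (a, b)) (%(p, qs). \<iota>\<iota> X p qs)"
proof (rule V.coproduct_nested)
 show "is_coproduct V (paths X a b) (smd (\<G> X)) (Edge (\<G> (\<G> X)) (a, b)) (\<iota> (\<G> X))"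
  using \<G>_coproduct[OF \<G>_Obj[OF X]] a by simp
qed (rule nested_coproduct[OF X])

lemma \<G>\<G>_edge_eqI:
 assumes "X : Obj GV" "a : Verts X" "b : Verts X" "h : Hom V (Edge (\<G> (\<G> X)) (a, b)) T"
  "h' : Hom V (Edge (\<G> (\<G> X)) (a, b)) T" "!!p qs. p : paths X a b ==> qs : nested_paths X p ==>
    h ** (\<iota>\<iota> X p qs) = h' ** (\<iota>\<iota> X p qs)"
 shows "h = h'" using V.coproduct_eq[OF \<G>\<G>_coproduct[OF assms(1-3)] assms(4,5)] assms(6) by auto

definition nested_edges :: "('u, 'o) vgraph => 'u list list => 'o list list" where
 "nested_edges X qs = map (%q. map (Edge X) (steps q)) qs"

lemma nested_edges_Obj: "X : Obj GV ==> qs : nested_paths X p ==> nested_edges X qs : lists Seqs"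
 using steps_Obj[OF _ nested_mem] unfolding nested_edges_def in_lists_conv_set[of _ "Seqs"] by auto

lemma sig_nested_Hom:
 assumes X: "X : Obj GV" and p: "p : paths X a b" and qs: "qs : nested_paths X p"
 shows "sig (nested_edges X qs) : Hom V (nested_obj X qs) (smd X (join_paths p qs))"
proof -
 have "map (Edge X) (steps (join_paths p qs)) = concat (nested_edges X qs)"
  using join_steps[OF pathsD(1)[OF p] qs] by (simp add: nested_edges_def map_concat comp_def)
 moreover have "nested_obj X qs = OMap E (map (OMap E) (nested_edges X qs))"
  by (simp add: nested_obj_def nested_edges_def comp_def Gamma_summand_def[abs_def])
 ultimately show ?thesis using sig_Hom[OF nested_edges_Obj[OF X qs]] by (simp add: Gamma_summand_def)
qed

abbreviation \<eta> :: "('u, 'o) vgraph => ('u, 'o, 'a) vgraph_map" where "\<eta> \<equiv> Gamma_unit V E u"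
abbreviation \<mu> :: "('u, 'o) vgraph => ('u, 'o, 'a) vgraph_map" where "\<mu> \<equiv> Gamma_mult V E sig"

text \<open>The summands of nested paths exhibit the homs of the double application as coproducts,
  which makes the definite description in \<open>Gamma_mult\<close> legitimate.\<close>

lemma \<mu>_props:
 assumes X: "X : Obj GV"
 shows "\<mu> X : Hom GV (\<G> (\<G> X)) (\<G> X)" "!!a. a : Verts X ==> VMap (\<mu> X) a = a"
  "!!a b p qs. p : paths X a b ==> qs : nested_paths X p ==>
    EMap (\<mu> X) (a, b) ** (\<iota>\<iota> X p qs) = \<iota> X (join_paths p qs) ** sig (nested_edges X qs)"
proof -
 let ?P = "%a b h. h : Hom V (Edge (\<G> (\<G> X)) (a, b)) (Edge (\<G> X) (a, b)) &
  (ALL p:paths X a b. ALL qs:nested_paths X p. h ** (\<iota> (\<G> X) p ** AMap E (map (\<iota> X) qs)) =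
   \<iota> X (join_paths p qs) ** sig (map (%q. map (Edge X) (steps q)) qs))"
 have ex: "EX! h. ?P a b h" if a: "a : Verts X" "b : Verts X" for a b
 proof -
  let ?f = "%(p, qs). \<iota> X (join_paths p qs) ** sig (nested_edges X qs)"
  have "?f pq : Hom V (case pq of (p, qs) => nested_obj X qs) (Edge (\<G> X) (a, b))"
   if "pq : Sigma (paths X a b) (nested_paths X)" for pq
   using V.comp_Hom[OF sig_nested_Hom[OF X] \<iota>_Hom[OF X join_mem]] that by auto
  then have "EX! h. h : Hom V (Edge (\<G> (\<G> X)) (a, b)) (Edge (\<G> X) (a, b)) &
   (ALL pq:Sigma (paths X a b) (nested_paths X). h ** (case pq of (p, qs) => \<iota>\<iota> X p qs) = ?f pq)"
   using V.coproduct_ex1[OF \<G>\<G>_coproduct[OF X a], of "Edge (\<G> X) (a, b)" ?f] GObjD(2)[OF \<G>_Obj[OF X]] a by simp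
  then show ?thesis by (simp add: nested_arr_def nested_edges_def)
 qed
 have E: "EMap (\<mu> X) (a, b) = (THE h. ?P a b h)" if "a : Verts X" "b : Verts X" for a b
  using that by (simp add: Gamma_mult_def)
 have P: "?P a b (EMap (\<mu> X) (a, b))" if "a : Verts X" "b : Verts X" for a b unfolding E[OF that] using theI'[OF ex[OF that]] .
 show v: "VMap (\<mu> X) a = a" if "a : Verts X" for a using that by (simp add: Gamma_mult_def)
 show "\<mu> X : Hom GV (\<G> (\<G> X)) (\<G> X)" unfolding GHom_iff using P \<G>_Obj X v by (simp add: Gamma_mult_def)
 show "EMap (\<mu> X) (a, b) ** (\<iota>\<iota> X p qs) = \<iota> X (join_paths p qs) ** sig (nested_edges X qs)"
  if p: "p : paths X a b" "qs : nested_paths X p" for p qs a b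
  using P[OF pathsD(5,6)[OF p(1)]] p by (simp add: nested_arr_def nested_edges_def)
qed

lemma edge_path: "a : Verts X ==> b : Verts X ==> [a, b] : paths X a b" by (simp add: paths_def)

lemma smd_edge: "smd X [a, b] = OMap E [Edge X (a, b)]" by (simp add: Gamma_summand_def)

lemma \<eta>_props:
 assumes X: "X : Obj GV"
 shows "\<eta> X : Hom GV X (\<G> X)" "!!a. a : Verts X ==> VMap (\<eta> X) a = a"
  "!!a b. a : Verts X ==> b : Verts X ==> EMap (\<eta> X) (a, b) = \<iota> X [a, b] ** u (Edge X (a, b))"
  "!!a b. a : Verts X ==> b : Verts X ==> u (Edge X (a, b)) : Hom V (Edge X (a, b)) (smd X [a, b])"
proof -
 show u: "u (Edge X (a, b)) : Hom V (Edge X (a, b)) (smd X [a, b])" if "a : Verts X" "b : Verts X" for a b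
  using u_Hom GObjD(2)[OF X that] by (simp add: smd_edge)
 show v: "VMap (\<eta> X) a = a" if "a : Verts X" for a using that by (simp add: Gamma_unit_def)
 show e: "EMap (\<eta> X) (a, b) = \<iota> X [a, b] ** u (Edge X (a, b))" if "a : Verts X" "b : Verts X" for a b
  using that by (simp add: Gamma_unit_def)
 have "\<iota> X [a, b] ** u (Edge X (a, b)) : Hom V (Edge X (a, b)) (Edge (\<G> X) (a, b))"
  if a: "a : Verts X" "b : Verts X" for a b by (rule V.comp_Hom[OF u[OF a] \<iota>_Hom[OF X edge_path[OF a]]])
 then show "\<eta> X : Hom GV X (\<G> X)" unfolding GHom_iff using \<G>_Obj X v e by (simp add: Gamma_unit_def)
qed

end

lemma (in Category) comp_pull:
 "h \<cdot> g = k ==> f : Hom C X Y ==> g : Hom C Y Z ==> h : Hom C Z W ==> h \<cdot> (g \<cdot> f) = k \<cdot> f"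
 using assoc by metis

lemma concat_map_concat: "concat (map f (concat xss)) = concat (map (%xs. concat (map f xs)) xss)" by (induction xss) auto

context Multitensor
begin

definition nested_map :: "('u, 'o, 'a) vgraph_map => 'u list list => 'a" where "nested_map f qs = AMap E (map (path_arr f) qs)"

lemma nested_map_Hom:
 assumes f: "f : Hom GV X Y" and qs: "qs : nested_paths X p"
 shows "nested_map f qs : Hom V (nested_obj X qs) (nested_obj Y (map (map (VMap f)) qs))"
 unfolding nested_map_def nested_obj_def map_map by (rule E_Hom) (use path_arr_Hom[OF f nested_mem[OF qs]] in simp)

lemma path_arr_nested:
 assumes f: "f : Hom GV X Y" and p: "p : paths X a b" and qs: "qs : nested_paths X p"
 shows "path_arr (\<G>m f) p ** nested_arr X qs = nested_arr Y (map (map (VMap f)) qs) ** nested_map f qs"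
proof -
 note D = GHomD[OF f] and F = \<G>m_props[OF f]
 have q: "q : paths X (hd q) (last q)" if "q : set qs" for q using nested_mem[OF qs that] .
 have "path_arr (\<G>m f) p ** nested_arr X qs =
  AMap E (map (%q. EMap (\<G>m f) (hd q, last q)) qs) ** AMap E (map (\<iota> X) qs)"
  by (simp add: path_arr_def nested_arr_def nested_steps[OF qs] comp_def)
 also have "\<dots> = AMap E (map (%q. EMap (\<G>m f) (hd q, last q) ** \<iota> X q) qs)"
  by (rule E_comp[OF \<iota>_Hom[OF D(1) q] GHomD(6)[OF F(1)]]) (use pathsD(5,6)[OF q] in simp_all)
 also have "\<dots> = AMap E (map (%q. \<iota> Y (map (VMap f) q) ** path_arr f q) qs)" using F(3)[OF q] by (simp cong: map_cong)
 also have "\<dots> = AMap E (map (%q. \<iota> Y (map (VMap f) q)) qs) ** AMap E (map (path_arr f) qs)"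
  by (rule E_comp[OF path_arr_Hom[OF f q] \<iota>_Hom[OF D(2) path_map_Hom[OF f q]], symmetric])
 finally show ?thesis by (simp add: nested_arr_def nested_map_def comp_def)
qed

lemma \<G>\<G>_map:
 assumes f: "f : Hom GV X Y" and p: "p : paths X a b" and qs: "qs : nested_paths X p"
 shows "EMap (\<G>m (\<G>m f)) (a, b) ** (\<iota>\<iota> X p qs) =
  (\<iota> (\<G> Y) (map (VMap f) p) ** nested_arr Y (map (map (VMap f)) qs)) ** nested_map f qs"
proof -
 note D = GHomD[OF f] and F = \<G>m_props[OF f] and FF = \<G>m_props[OF \<G>m_props(1)[OF f]]
 have p': "p : paths (\<G> X) a b" using p by simp
 have q': "map (map (VMap f)) qs : nested_paths Y (map (VMap f) p)" by (rule nested_map[OF qs D(5)])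
 have i: "\<iota> (\<G> Y) (map (VMap f) p) : Hom V (smd (\<G> Y) (map (VMap f) p)) (Edge (\<G> (\<G> Y)) (VMap f a, VMap f b))"
  using \<iota>_Hom[OF \<G>_Obj[OF D(2)]] path_map_Hom[OF f p] by simp
 have "EMap (\<G>m (\<G>m f)) (a, b) ** (\<iota>\<iota> X p qs) =
  (\<iota> (\<G> Y) (map (VMap f) p) ** path_arr (\<G>m f) p) ** nested_arr X qs"
  by (rule V.comp_pull[OF _ nested_arr_Hom[OF D(1) p qs] \<iota>_Hom[OF \<G>_Obj[OF D(1)] p'] GHomD(6)[OF FF(1)]])
   (use FF(3)[OF p'] F(2) pathsD[OF p] in simp_all)
 also have "\<dots> = \<iota> (\<G> Y) (map (VMap f) p) ** (path_arr (\<G>m f) p ** nested_arr X qs)"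
  by (rule V.assoc[OF nested_arr_Hom[OF D(1) p qs] path_arr_Hom[OF F(1) p', unfolded F(2)] i])
 also have "\<dots> = \<iota> (\<G> Y) (map (VMap f) p) ** (nested_arr Y (map (map (VMap f)) qs) ** nested_map f qs)"
  unfolding path_arr_nested[OF f p qs] ..
 also have "\<dots> = (\<iota> (\<G> Y) (map (VMap f) p) ** nested_arr Y (map (map (VMap f)) qs)) ** nested_map f qs"
  by (rule V.assoc[OF nested_map_Hom[OF f qs] nested_arr_Hom[OF D(2) path_map_Hom[OF f p] q'] i, symmetric])
 finally show ?thesis .
qed

lemma path_arr_join: "p : paths X a b ==> qs : nested_paths X p ==>
  path_arr f (join_paths p qs) = AMap E (concat (map (%q. map (EMap f) (steps q)) qs))"
 using join_steps[of p qs X] pathsD(1)[of p X a b] by (simp add: path_arr_def map_concat comp_def)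

lemma nested_edges_map:
 assumes f: "f : Hom GV X Y" and qs: "qs : nested_paths X p"
 shows "map (%q. map (EMap f) (steps q)) qs \<in> Hom (seq_cat SV) (nested_edges X qs) (nested_edges Y (map (map (VMap f)) qs))"
 unfolding nested_edges_def map_map by (rule seq_HomI) (use EMap_steps[OF f nested_mem[OF qs]] in simp)

text \<open>Naturality of \<open>sig\<close> at the sequence of sequences of edge maps along the
  inner paths.\<close>

lemma sig_nested_natural:
 assumes f: "f : Hom GV X Y" and p: "p : paths X a b" and qs: "qs : nested_paths X p"
 shows "path_arr f (join_paths p qs) ** sig (nested_edges X qs) = sig (nested_edges Y (map (map (VMap f)) qs)) ** nested_map f qs"
 unfolding path_arr_join[OF p qs] unfolding nested_map_def path_arr_def
 using sig_natural[OF nested_edges_map[OF f qs]] by (simp add: comp_def)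

lemma \<eta>_natural:
 assumes f: "f : Hom GV X Y"
 shows "\<G>m f \<star>GV \<eta> X = \<eta> Y \<star>GV f"
proof -
 note D = GHomD[OF f] and F = \<G>m_props[OF f] and H = \<eta>_props[OF GHomD(1)[OF f]] and H' = \<eta>_props[OF GHomD(2)[OF f]]
 show ?thesis
 proof (rule GHom_eqI[OF GComp_Hom[OF H(1) F(1)] GComp_Hom[OF f H'(1)]])
  fix a assume a: "a : Verts X"
  show "VMap (\<G>m f \<star>GV \<eta> X) a = VMap (\<eta> Y \<star>GV f) a"
   using a D(5) by (simp add: GComp[OF H(1)] GComp[OF f] F(2) H(2) H'(2))
  fix b assume b: "b : Verts X"
  let ?a = "VMap f a" and ?b = "VMap f b"
  have ab: "?a : Verts Y" "?b : Verts Y" using a b D(5) by auto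
  have pth: "[a, b] : paths X a b" "[?a, ?b] : paths Y ?a ?b" by (simp_all add: edge_path a b ab)
  have pe: "path_arr f [a, b] = AMap E [EMap f (a, b)]" by (simp add: path_arr_def)
  have pH: "path_arr f [a, b] : Hom V (smd X [a, b]) (smd Y [?a, ?b])" using path_arr_Hom[OF f pth(1)] by simp
  have G: "EMap (\<G>m f) (a, b) : Hom V (Edge (\<G> X) (a, b)) (Edge (\<G> Y) (?a, ?b))"
   using GHomD(6)[OF F(1), of a b] a b F(2) by simp
  have "EMap (\<G>m f \<star>GV \<eta> X) (a, b) = EMap (\<G>m f) (a, b) ** (\<iota> X [a, b] ** u (Edge X (a, b)))"
   using a b by (simp add: GComp[OF H(1)] H(2,3))
  also have "\<dots> = (\<iota> Y [?a, ?b] ** path_arr f [a, b]) ** u (Edge X (a, b))"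
   by (rule V.comp_pull[OF _ H(4)[OF a b] \<iota>_Hom[OF D(1) pth(1)] G]) (use F(3)[OF pth(1)] in simp)
  also have "\<dots> = \<iota> Y [?a, ?b] ** (path_arr f [a, b] ** u (Edge X (a, b)))"
   by (rule V.assoc[OF H(4)[OF a b] pH \<iota>_Hom[OF D(2) pth(2)]])
  also have "path_arr f [a, b] ** u (Edge X (a, b)) = u (Edge Y (?a, ?b)) ** EMap f (a, b)"
   unfolding pe by (rule u_natural[OF D(6)[OF a b]])
  also have "\<iota> Y [?a, ?b] ** (u (Edge Y (?a, ?b)) ** EMap f (a, b)) = EMap (\<eta> Y \<star>GV f) (a, b)"
   using V.assoc[OF D(6)[OF a b] H'(4)[OF ab] \<iota>_Hom[OF D(2) pth(2)]] a b ab by (simp add: GComp[OF f] H'(3))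
  finally show "EMap (\<G>m f \<star>GV \<eta> X) (a, b) = EMap (\<eta> Y \<star>GV f) (a, b)" .
 qed
qed

lemma \<G>\<G>_inj_Hom:
 assumes "X : Obj GV" "p : paths X a b" "qs : nested_paths X p"
 shows "\<iota>\<iota> X p qs : Hom V (nested_obj X qs) (Edge (\<G> (\<G> X)) (a, b))"
 using V.comp_Hom[OF nested_arr_Hom[OF assms] \<iota>_Hom[OF \<G>_Obj[OF assms(1)]]] assms(2) by simp

lemma \<G>\<G>_eqI:
 assumes "k : Hom GV (\<G> (\<G> X)) T" "k' : Hom GV (\<G> (\<G> X)) T" "X : Obj GV" "!!a. a : Verts X ==> VMap k a = VMap k' a"
  "!!a b p qs. p : paths X a b ==> qs : nested_paths X p ==>
   EMap k (a, b) ** (\<iota>\<iota> X p qs) = EMap k' (a, b) ** (\<iota>\<iota> X p qs)"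
 shows "k = k'"
proof (rule GHom_eqI[OF assms(1,2)])
 show va: "VMap k a = VMap k' a" if "a : Verts (\<G> (\<G> X))" for a using assms(4) that by simp
 fix a b assume a: "a : Verts (\<G> (\<G> X))" "b : Verts (\<G> (\<G> X))"
 show "EMap k (a, b) = EMap k' (a, b)"
  by (rule \<G>\<G>_edge_eqI[OF assms(3)]) (use a GHomD(6)[OF assms(1) a] GHomD(6)[OF assms(2) a] va assms(5) in auto)
qed

lemma \<mu>_natural:
 assumes f: "f : Hom GV X Y"
 shows "\<G>m f \<star>GV \<mu> X = \<mu> Y \<star>GV \<G>m (\<G>m f)"
proof -
 note D = GHomD[OF f] and F = \<G>m_props[OF f] and FF = \<G>m_props[OF \<G>m_props(1)[OF f]]
  and M = \<mu>_props[OF GHomD(1)[OF f]] and M' = \<mu>_props[OF GHomD(2)[OF f]]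
 show ?thesis
 proof (rule \<G>\<G>_eqI[OF GComp_Hom[OF M(1) F(1)] GComp_Hom[OF FF(1) M'(1)] D(1)])
  show "VMap (\<G>m f \<star>GV \<mu> X) a = VMap (\<mu> Y \<star>GV \<G>m (\<G>m f)) a" if "a : Verts X" for a
   using that D(5) by (simp add: GComp[OF M(1)] GComp[OF FF(1)] F(2) FF(2) M(2) M'(2))
  fix a b p qs assume p: "p : paths X a b" and qs: "qs : nested_paths X p"
  note P = pathsD[OF p]
  let ?i = "\<iota>\<iota> X p qs" and ?j = "join_paths p qs"
  let ?fp = "map (VMap f) p" and ?fqs = "map (map (VMap f)) qs"
  have fp: "?fp : paths Y (VMap f a) (VMap f b)" by (rule path_map_Hom[OF f p])
  have fqs: "?fqs : nested_paths Y ?fp" by (rule nested_map[OF qs D(5)])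
  have j: "?j : paths X a b" by (rule join_mem[OF p qs])
  note i = \<G>\<G>_inj_Hom[OF D(1) p qs] and s = sig_nested_Hom[OF D(1) p qs]
   and i' = \<G>\<G>_inj_Hom[OF D(2) fp fqs] and s' = sig_nested_Hom[OF D(2) fp fqs]
  have G: "EMap (\<G>m f) (a, b) : Hom V (Edge (\<G> X) (a, b)) (Edge (\<G> Y) (VMap f a, VMap f b))"
   using GHomD(6)[OF F(1), of a b] P F(2) by simp
  have m: "EMap (\<mu> X) (a, b) : Hom V (Edge (\<G> (\<G> X)) (a, b)) (Edge (\<G> X) (a, b))"
   using GHomD(6)[OF M(1), of a b] P M(2) by simp
  have m': "EMap (\<mu> Y) (VMap f a, VMap f b) : Hom V (Edge (\<G> (\<G> Y)) (VMap f a, VMap f b)) (Edge (\<G> Y) (VMap f a, VMap f b))"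
   using GHomD(6)[OF M'(1), of "VMap f a" "VMap f b"] P D(5) M'(2) by simp
  have GG: "EMap (\<G>m (\<G>m f)) (a, b) : Hom V (Edge (\<G> (\<G> X)) (a, b)) (Edge (\<G> (\<G> Y)) (VMap f a, VMap f b))"
   using GHomD(6)[OF FF(1), of a b] P F(2) FF(2) by simp
  have "EMap (\<G>m f \<star>GV \<mu> X) (a, b) ** ?i = EMap (\<G>m f) (a, b) ** (\<iota> X ?j ** sig (nested_edges X qs))"
   using V.assoc[OF i m G] P M(3)[OF p qs] by (simp add: GComp[OF M(1)] M(2))
  also have "\<dots> = (\<iota> Y (map (VMap f) ?j) ** path_arr f ?j) ** sig (nested_edges X qs)"
   by (rule V.comp_pull[OF F(3)[OF j] s \<iota>_Hom[OF D(1) j] G])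
  also have "\<dots> = \<iota> Y (map (VMap f) ?j) ** (sig (nested_edges Y ?fqs) ** nested_map f qs)"
   using V.assoc[OF s path_arr_Hom[OF f j] \<iota>_Hom[OF D(2) path_map_Hom[OF f j]]] sig_nested_natural[OF f p qs] by simp
  also have "\<dots> = (\<iota> Y (join_paths ?fp ?fqs) ** sig (nested_edges Y ?fqs)) ** nested_map f qs"
   using V.assoc[OF nested_map_Hom[OF f qs] s' \<iota>_Hom[OF D(2) join_mem[OF fp fqs]]] by (simp add: join_map[OF P(1)])
  also have "\<dots> = EMap (\<mu> Y) (VMap f a, VMap f b) ** ((\<iota>\<iota> Y ?fp ?fqs) ** nested_map f qs)"
   by (rule V.comp_pull[OF M'(3)[OF fp fqs] nested_map_Hom[OF f qs] i' m', symmetric])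
  also have "\<dots> = EMap (\<mu> Y \<star>GV \<G>m (\<G>m f)) (a, b) ** ?i"
   using V.assoc[OF i GG m'] P \<G>\<G>_map[OF f p qs] by (simp add: GComp[OF FF(1)] F(2) FF(2))
  finally show "EMap (\<G>m f \<star>GV \<mu> X) (a, b) ** ?i = EMap (\<mu> Y \<star>GV \<G>m (\<G>m f)) (a, b) ** ?i" .
 qed
qed

lemma \<mu>_EMap_Hom:
 assumes X: "X : Obj GV" and a: "a : Verts X" "b : Verts X"
 shows "EMap (\<mu> X) (a, b) : Hom V (Edge (\<G> (\<G> X)) (a, b)) (Edge (\<G> X) (a, b))"
 using GHomD(6)[OF \<mu>_props(1)[OF X], of a b] a \<mu>_props(2)[OF X] by simp

text \<open>On the summand of \<open>p\<close> the unit chooses the outer path \<open>[a, b]\<close>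
  with \<open>p\<close> as its single inner path. Joining gives back \<open>p\<close>, and what
  remains is the first unit law of the multitensor.\<close>

lemma \<mu>_\<eta>_left:
 assumes X: "X : Obj GV"
 shows "\<mu> X \<star>GV \<eta> (\<G> X) = Ide GV (\<G> X)"
proof -
 note M = \<mu>_props[OF X] and H = \<eta>_props[OF \<G>_Obj[OF X]]
 show ?thesis
 proof (rule \<G>m_eqI[OF GComp_Hom[OF H(1) M(1)] GIde_Hom[OF \<G>_Obj[OF X]] X])
  show "VMap (\<mu> X \<star>GV \<eta> (\<G> X)) a = VMap (Ide GV (\<G> X)) a" if "a : Verts X" for a
   using that by (simp add: GComp[OF H(1)] GIde M(2) H(2))
  fix a b p assume p: "p : paths X a b"
  note P = pathsD[OF p]
  have ab: "a : Verts (\<G> X)" "b : Verts (\<G> X)" using P by auto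
  have pth: "[a, b] : paths X a b" using edge_path P by auto
  have pth': "[a, b] : paths (\<G> X) a b" using pth by simp
  have ps: "[p] : nested_paths X [a, b]" using p P by (auto simp: nested_iff)
  have smd: "smd X p = OMap E (map (Edge X) (steps p))" by (simp add: Gamma_summand_def)
  have up: "u (smd X p) : Hom V (smd X p) (nested_obj X [p])" using u_Hom[OF smd_Obj[OF X p]] by (simp add: nested_obj_def)
  have n: "nested_arr X [p] = AMap E [\<iota> X p]" by (simp add: nested_arr_def)
  note nH = nested_arr_Hom[OF X pth ps] and iG = \<iota>_Hom[OF \<G>_Obj[OF X] pth'] and i = \<iota>_Hom[OF X p]
  have eH: "EMap (\<eta> (\<G> X)) (a, b) : Hom V (Edge (\<G> X) (a, b)) (Edge (\<G> (\<G> X)) (a, b))"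
   using GHomD(6)[OF H(1) ab] H(2)[OF ab(1)] H(2)[OF ab(2)] by simp
  note m = \<mu>_EMap_Hom[OF X P(5,6)]
  have "EMap (\<mu> X \<star>GV \<eta> (\<G> X)) (a, b) ** \<iota> X p = (EMap (\<mu> X) (a, b) ** EMap (\<eta> (\<G> X)) (a, b)) ** \<iota> X p"
   using ab by (simp add: GComp[OF H(1)] H(2))
  also have "\<dots> = EMap (\<mu> X) (a, b) ** (EMap (\<eta> (\<G> X)) (a, b) ** \<iota> X p)" by (rule V.assoc[OF i eH m])
  also have "EMap (\<eta> (\<G> X)) (a, b) ** \<iota> X p = \<iota> (\<G> X) [a, b] ** (u (Edge (\<G> X) (a, b)) ** \<iota> X p)"
   unfolding H(3)[OF ab] by (rule V.assoc[OF i H(4)[OF ab] iG])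
  also have "u (Edge (\<G> X) (a, b)) ** \<iota> X p = nested_arr X [p] ** u (smd X p)"
   unfolding n by (rule u_natural[OF i, symmetric])
  also have "\<iota> (\<G> X) [a, b] ** (nested_arr X [p] ** u (smd X p)) = (\<iota> (\<G> X) [a, b] ** nested_arr X [p]) ** u (smd X p)"
   by (rule V.assoc[OF up nH iG, symmetric])
  also have "EMap (\<mu> X) (a, b) ** \<dots> = (\<iota> X (join_paths [a, b] [p]) ** sig (nested_edges X [p])) ** u (smd X p)"
   by (rule V.comp_pull[OF M(3)[OF pth ps] up \<G>\<G>_inj_Hom[OF X pth ps] m])
  also have "\<dots> = \<iota> X p ** (sig (nested_edges X [p]) ** u (smd X p))"
   using V.assoc[OF up sig_nested_Hom[OF X pth ps] \<iota>_Hom[OF X join_mem[OF pth ps]]] join_single[OF p] by simp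
  also have "sig (nested_edges X [p]) ** u (smd X p) = Ide V (smd X p)"
   unfolding smd nested_edges_def using multitensor_laws(1)[OF steps_Obj[OF X p]] by simp
  also have "\<iota> X p ** Ide V (smd X p) = EMap (Ide GV (\<G> X)) (a, b) ** \<iota> X p"
   using V.id_r[OF i] V.id_l[OF i] ab by (simp add: GIde)
  finally show "EMap (\<mu> X \<star>GV \<eta> (\<G> X)) (a, b) ** \<iota> X p = EMap (Ide GV (\<G> X)) (a, b) ** \<iota> X p" .
 qed
qed

text \<open>Each step is regarded as an inner path of length 1. This is the nested path reached when
  \<open>Gamma\<close> is applied to the unit.\<close>

lemma unit_nested:
 assumes "p : paths X a b"
 shows "map (%z. [fst z, snd z]) (steps p) : nested_paths X p" "join_paths p (map (%z. [fst z, snd z]) (steps p)) = p"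
proof -
 show "map (%z. [fst z, snd z]) (steps p) : nested_paths X p" using paths_steps[OF assms] by (auto simp: nested_iff comp_def)
 have "concat (map (tl \<circ> (%z. [fst z, snd z])) (steps p)) = tl p" by (induction p rule: induct_list012) auto
 then show "join_paths p (map (%z. [fst z, snd z]) (steps p)) = p" using pathsD(1)[OF assms] by (simp add: join_paths_def)
qed

lemma \<mu>_\<eta>_right:
 assumes X: "X : Obj GV"
 shows "\<mu> X \<star>GV \<G>m (\<eta> X) = Ide GV (\<G> X)"
proof -
 note M = \<mu>_props[OF X] and H = \<eta>_props[OF X] and G = \<G>m_props[OF \<eta>_props(1)[OF X]]
 show ?thesis
 proof (rule \<G>m_eqI[OF GComp_Hom[OF G(1) M(1)] GIde_Hom[OF \<G>_Obj[OF X]] X])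
  show "VMap (\<mu> X \<star>GV \<G>m (\<eta> X)) a = VMap (Ide GV (\<G> X)) a" if "a : Verts X" for a
   using that by (simp add: GComp[OF G(1)] GIde M(2) H(2) G(2))
  fix a b p assume p: "p : paths X a b"
  note P = pathsD[OF p]
  let ?qs = "map (%z. [fst z, snd z]) (steps p)" and ?us = "AMap E (map u (map (Edge X) (steps p)))"
  note qs = unit_nested[OF p]
  have p': "p : paths (\<G> X) a b" using p by simp
  have st: "fst z : Verts X & snd z : Verts X" if "z : set (steps p)" for z using paths_steps[OF p that] .
  have mp: "map (VMap (\<eta> X)) p = p" using P(2) H(2) by (auto intro!: map_idI)
  note nH = nested_arr_Hom[OF X p qs(1)] and iG = \<iota>_Hom[OF \<G>_Obj[OF X] p'] and i = \<iota>_Hom[OF X p] and m = \<mu>_EMap_Hom[OF X P(5,6)]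
  have us: "?us : Hom V (smd X p) (nested_obj X ?qs)"
  proof -
   have "AMap E (map (u \<circ> Edge X) (steps p)) : Hom V (OMap E (map (Edge X) (steps p)))
    (OMap E (map (smd X \<circ> (%z. [fst z, snd z])) (steps p)))" by (rule E_Hom) (use H(4) st in force)
   then show ?thesis by (simp add: nested_obj_def Gamma_summand_def[of E X p])
  qed
  have "path_arr (\<eta> X) p = AMap E (map (%z. \<iota> X [fst z, snd z] ** u (Edge X z)) (steps p))"
   unfolding path_arr_def using H(3) st by (intro arg_cong[where f = "AMap E"] map_cong) auto
  also have "\<dots> = AMap E (map (%z. \<iota> X [fst z, snd z]) (steps p)) ** AMap E (map (%z. u (Edge X z)) (steps p))"
   by (rule E_comp[symmetric, of _ _ "Edge X" "%z. smd X [fst z, snd z]" _ "Edge (\<G> X)"])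
    (use H(4) st \<iota>_Hom[OF X edge_path] in force)+
  also have "\<dots> = nested_arr X ?qs ** ?us" by (simp add: nested_arr_def comp_def)
  finally have pa: "path_arr (\<eta> X) p = nested_arr X ?qs ** ?us" .
  have Ge: "EMap (\<G>m (\<eta> X)) (a, b) : Hom V (Edge (\<G> X) (a, b)) (Edge (\<G> (\<G> X)) (a, b))"
   using GHomD(6)[OF G(1), of a b] P G(2) H(2) by simp
  have "EMap (\<mu> X \<star>GV \<G>m (\<eta> X)) (a, b) ** \<iota> X p = EMap (\<mu> X) (a, b) ** (EMap (\<G>m (\<eta> X)) (a, b) ** \<iota> X p)"
   using V.assoc[OF i Ge m] P by (simp add: GComp[OF G(1)] G(2) H(2))
  also have "EMap (\<G>m (\<eta> X)) (a, b) ** \<iota> X p = (\<iota>\<iota> X p ?qs) ** ?us"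
   unfolding G(3)[OF p] mp pa by (rule V.assoc[OF us nH iG, symmetric])
  also have "EMap (\<mu> X) (a, b) ** \<dots> = (\<iota> X p ** sig (nested_edges X ?qs)) ** ?us"
   by (rule V.comp_pull[OF _ us \<G>\<G>_inj_Hom[OF X p qs(1)] m]) (use M(3)[OF p qs(1)] qs(2) in simp)
  also have "\<dots> = \<iota> X p ** (sig (nested_edges X ?qs) ** ?us)"
   using V.assoc[OF us sig_nested_Hom[OF X p qs(1)]] i qs(2) by simp
  also have "nested_edges X ?qs = map (%X. [X]) (map (Edge X) (steps p))" by (simp add: nested_edges_def)
  also have "sig \<dots> ** ?us = Ide V (smd X p)" using multitensor_laws(2)[OF steps_Obj[OF X p]] by (simp add: Gamma_summand_def)
  also have "\<iota> X p ** Ide V (smd X p) = EMap (Ide GV (\<G> X)) (a, b) ** \<iota> X p"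
   using V.id_r[OF i] V.id_l[OF i] P by (simp add: GIde)
  finally show "EMap (\<mu> X \<star>GV \<G>m (\<eta> X)) (a, b) ** \<iota> X p = EMap (Ide GV (\<G> X)) (a, b) ** \<iota> X p" .
 qed
qed

text \<open>The combinatorics of associativity: in a triply nested path, joining the outer two
  levels first or the inner two levels first leads to the same path.\<close>

lemma nested_nested:
 assumes p: "p : paths X a b" and qs: "qs : nested_paths X p" and rss: "list_all2 (%q rs. rs : nested_paths X q) qs rss"
 shows "concat rss : nested_paths X (join_paths p qs)" "map2 join_paths qs rss : nested_paths X p"
  "join_paths p (map2 join_paths qs rss) = join_paths (join_paths p qs) (concat rss)"
  "nested_edges X (map2 join_paths qs rss) = map (concat \<circ> nested_edges X) rss"
proof -
 have len: "length rss = length qs" using rss by (simp add: list_all2_lengthD)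
 have n: "rss ! i : nested_paths X (qs ! i)" if "i < length qs" for i using rss that by (auto simp: list_all2_conv_all_nth)
 have q: "qs ! i : paths X (hd (qs ! i)) (last (qs ! i))" if "i < length qs" for i using nested_mem[OF qs] that by simp
 have 1: "map steps qs = map (map (%r. (hd r, last r))) rss" by (rule nth_equalityI) (use len n nested_steps in auto)
 have "rs : set rss ==> r : set rs ==> r ~= [] & set r \<subseteq> Verts X" for rs r
  using n len by (auto simp: in_set_conv_nth[of rs] nested_iff)
 then show "concat rss : nested_paths X (join_paths p qs)"
  using join_steps[OF pathsD(1)[OF p] qs] 1 by (auto simp: nested_iff map_concat comp_def)
 have j: "join_paths (qs ! i) (rss ! i) : paths X (hd (qs ! i)) (last (qs ! i))" if "i < length qs" for i
  using join_mem[OF q n] that by blast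
 show "map2 join_paths qs rss : nested_paths X p"
 proof (rule nestedI)
  show "steps p = map (%q. (hd q, last q)) (map2 join_paths qs rss)"
   unfolding nested_steps[OF qs] by (rule nth_equalityI) (use len pathsD(4)[OF j] in auto)
  fix q assume "q : set (map2 join_paths qs rss)"
  then obtain i where "i < length qs" "q = join_paths (qs ! i) (rss ! i)" using len by (auto simp: in_set_conv_nth)
  then show "q ~= [] & set q \<subseteq> Verts X" using pathsD(1,2)[OF j] by simp
 qed
 have "map tl (map2 join_paths qs rss) = map (%rs. concat (map tl rs)) rss"
  by (rule nth_equalityI) (use len in "auto simp: join_paths_def")
 then show "join_paths p (map2 join_paths qs rss) = join_paths (join_paths p qs) (concat rss)"
  by (simp add: join_paths_def concat_map_concat comp_def)
 show "nested_edges X (map2 join_paths qs rss) = map (concat \<circ> nested_edges X) rss"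
 proof (rule nth_equalityI)
  fix i assume "i < length (nested_edges X (map2 join_paths qs rss))"
  then have i: "i < length qs" using len by (simp add: nested_edges_def)
  show "nested_edges X (map2 join_paths qs rss) ! i = map (concat \<circ> nested_edges X) rss ! i"
   using i len join_steps[OF pathsD(1)[OF q[OF i]] n[OF i]] by (simp add: nested_edges_def map_concat comp_def)
 qed (use len in "simp add: nested_edges_def")
qed

text \<open>Both composites are tested on the summands of triply nested paths, where the claim
  becomes associativity of \<open>sig\<close>.\<close>

lemma \<mu>_assoc:
 assumes X: "X : Obj GV"
 shows "\<mu> X \<star>GV \<mu> (\<G> X) = \<mu> X \<star>GV \<G>m (\<mu> X)"
proof -
 note M = \<mu>_props[OF X] and MG = \<mu>_props[OF \<G>_Obj[OF X]] and G = \<G>m_props[OF \<mu>_props(1)[OF X]]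
 note GX = \<G>_Obj[OF X] and GGX = \<G>_Obj[OF \<G>_Obj[OF X]]
 show ?thesis
 proof (rule \<G>\<G>_eqI[OF GComp_Hom[OF MG(1) M(1)] GComp_Hom[OF G(1) M(1)] GX])
  show "VMap (\<mu> X \<star>GV \<mu> (\<G> X)) a = VMap (\<mu> X \<star>GV \<G>m (\<mu> X)) a" if "a : Verts (\<G> X)" for a
   using that by (simp add: GComp[OF G(1)] GComp[OF MG(1)] M(2) MG(2) G(2))
  fix a b p qs assume p': "p : paths (\<G> X) a b" and qs': "qs : nested_paths (\<G> X) p"
  have p: "p : paths X a b" and qs: "qs : nested_paths X p" using p' qs' by auto
  note P = pathsD[OF p]
  let ?i = "\<iota>\<iota> (\<G> X) p qs"
  note i = \<G>\<G>_inj_Hom[OF GX p' qs']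
  note m = \<mu>_EMap_Hom[OF X P(5,6)]
  have mG: "EMap (\<mu> (\<G> X)) (a, b) : Hom V (Edge (\<G> (\<G> (\<G> X))) (a, b)) (Edge (\<G> (\<G> X)) (a, b))"
   by (rule \<mu>_EMap_Hom[OF GX]) (use P in auto)
  have Gm: "EMap (\<G>m (\<mu> X)) (a, b) : Hom V (Edge (\<G> (\<G> (\<G> X))) (a, b)) (Edge (\<G> (\<G> X)) (a, b))"
   using GHomD(6)[OF G(1), of a b] P G(2) M(2) by simp
  have q: "q : paths X (hd q) (last q)" if "q : set qs" for q using nested_mem[OF qs that] .
  have L: "EMap (\<mu> X \<star>GV \<mu> (\<G> X)) (a, b) = EMap (\<mu> X) (a, b) ** EMap (\<mu> (\<G> X)) (a, b)"
   and R: "EMap (\<mu> X \<star>GV \<G>m (\<mu> X)) (a, b) = EMap (\<mu> X) (a, b) ** EMap (\<G>m (\<mu> X)) (a, b)"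
   using P by (simp_all add: GComp[OF MG(1)] GComp[OF G(1)] MG(2) M(2) G(2))
  \<comment> \<open>The objects left by \<open>\<G>\<G>_eqI\<close> are still \<open>E\<close> of
    coproducts; one more use of distributivity reaches the triply nested summands.\<close>
  have cop: "is_coproduct V {rss. list_all2 (%q rs. rs : nested_paths X q) qs rss}
   (%rss. OMap E (map (nested_obj X) rss)) (nested_obj (\<G> X) qs) (%rss. AMap E (map (nested_arr X) rss))"
   unfolding nested_obj_def[of "\<G> X"] by (rule E_coproduct) (use nested_coproduct[OF X q] small_nested[OF X] in auto)
  show "EMap (\<mu> X \<star>GV \<mu> (\<G> X)) (a, b) ** ?i = EMap (\<mu> X \<star>GV \<G>m (\<mu> X)) (a, b) ** ?i" unfolding L R
  proof (rule V.coproduct_eq[OF cop V.comp_Hom[OF i V.comp_Hom[OF mG m]] V.comp_Hom[OF i V.comp_Hom[OF Gm m]]])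
   fix rss assume "rss : {rss. list_all2 (%q rs. rs : nested_paths X q) qs rss}"
   then have rss: "list_all2 (%q rs. rs : nested_paths X q) qs rss" by simp
   have len: "length rss = length qs" using rss by (simp add: list_all2_lengthD)
   have rs: "rs : nested_paths X q & q : paths X (hd q) (last q)" if "(q, rs) : set (zip qs rss)" for q rs
    using rss that q by (fastforce simp: list_all2_conv_all_nth set_zip)
   note nn = nested_nested[OF p qs rss]
   let ?n = "AMap E (map (nested_arr X) rss)" and ?j = "join_paths p qs" and ?J = "join_paths (join_paths p qs) (concat rss)"
   let ?qs = "map2 join_paths qs rss" and ?S = "map (nested_edges X) rss"
   note n = V.coproductD(3)[OF cop, simplified mem_Collect_eq, OF rss]
   have j: "?j : paths X a b" by (rule join_mem[OF p qs])
   have j': "?j : paths (\<G> X) a b" using j by simp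
   have J: "?J : paths X a b" by (rule join_mem[OF j nn(1)])
   note s1 = sig_nested_Hom[OF GX p' qs'] and s2 = sig_nested_Hom[OF X j nn(1)]
   let ?t = "sig (map (map (smd X)) rss)"
   have fss: "map (map (\<iota> X)) rss : Hom (seq_cat SV) (map (map (smd X)) rss) (nested_edges (\<G> X) qs)"
   proof -
    have "map (%z. map (\<iota> X) (snd z)) (zip qs rss) : Hom (seq_cat SV)
     (map (%z. map (smd X) (snd z)) (zip qs rss)) (map (%z. map (Edge (\<G> X)) (steps (fst z))) (zip qs rss))"
    proof (rule seq_HomI)
     fix z assume "z : set (zip qs rss)"
     then obtain q rs where z: "z = (q, rs)" "rs : nested_paths X q" using rs[of "fst z" "snd z"] that[of "fst z" "snd z"] by simp
     have "map (\<iota> X) rs : Hom SV (map (smd X) rs) (map (%r. Edge (\<G> X) (hd r, last r)) rs)"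
      by (rule seq_HomI) (rule \<iota>_Hom[OF X nested_mem[OF z(2)]])
     then show "map (\<iota> X) (snd z) : Hom SV (map (smd X) (snd z)) (map (Edge (\<G> X)) (steps (fst z)))"
      using nested_steps[OF z(2)] by (simp add: z(1) comp_def)
    qed
    moreover have "map (%z. map (\<iota> X) (snd z)) (zip qs rss) = map (map (\<iota> X)) rss"
     "map (%z. map (smd X) (snd z)) (zip qs rss) = map (map (smd X)) rss"
     "map (%z. map (Edge (\<G> X)) (steps (fst z))) (zip qs rss) = nested_edges (\<G> X) qs"
     using len by (auto simp: nested_edges_def intro!: nth_equalityI)
    ultimately show ?thesis by simp
   qed
   \<comment> \<open>Naturality of \<open>sig\<close> at the inclusions of the innermost summands
     moves the outer multiplication past them.\<close>
   have nat: "nested_arr X (concat rss) ** ?t = sig (nested_edges (\<G> X) qs) ** ?n"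
    using sig_natural[OF fss] by (simp add: nested_arr_def[abs_def] map_concat comp_def)
   have mE: "map (map (OMap E)) ?S = map (map (smd X)) rss" by (simp add: nested_edges_def Gamma_summand_def[abs_def] comp_def)
   have cS: "concat ?S = nested_edges X (concat rss)" by (simp add: nested_edges_def[abs_def] map_concat comp_def)
   have cS': "map concat ?S = nested_edges X ?qs" by (simp add: nn(4))
   have SO: "?S : lists (lists Seqs)"
   proof -
    have "nested_edges X rs : lists Seqs" if rs': "rs : set rss" for rs
    proof -
     obtain i where "i < length qs" "rs = rss ! i" using rs' len by (auto simp: in_set_conv_nth)
     then show ?thesis using nested_edges_Obj[OF X] rss unfolding list_all2_conv_all_nth by blast
    qed
    then show ?thesis unfolding in_lists_conv_set[of "map (nested_edges X) rss"] set_map by blast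
   qed
   have t: "?t : Hom V (OMap E (map (nested_obj X) rss)) (nested_obj X (concat rss))"
   proof -
    have "map (map (smd X)) rss : lists Seqs" using HomD[OF fss] by (auto simp: in_lists_conv_set) (metis V.Dom_Obj)
    from sig_Hom[OF this] show ?thesis by (simp add: nested_obj_def[abs_def] map_concat comp_def)
   qed
   note nc = nested_arr_Hom[OF X j nn(1)] and iG = \<iota>_Hom[OF GX j']
   have "((EMap (\<mu> X) (a, b) ** EMap (\<mu> (\<G> X)) (a, b)) ** ?i) ** ?n =
    EMap (\<mu> X) (a, b) ** ((EMap (\<mu> (\<G> X)) (a, b) ** ?i) ** ?n)"
    using V.assoc[OF i mG m] V.assoc[OF n V.comp_Hom[OF i mG] m] by simp
   also have "(EMap (\<mu> (\<G> X)) (a, b) ** ?i) ** ?n = \<iota> (\<G> X) ?j ** (sig (nested_edges (\<G> X) qs) ** ?n)"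
    unfolding MG(3)[OF p' qs'] by (rule V.assoc[OF n s1 iG])
   also have "\<dots> = (\<iota> (\<G> X) ?j ** nested_arr X (concat rss)) ** ?t"
    unfolding nat[symmetric] by (rule V.assoc[OF t nc iG, symmetric])
   also have "EMap (\<mu> X) (a, b) ** \<dots> = (\<iota> X ?J ** sig (nested_edges X (concat rss))) ** ?t"
    by (rule V.comp_pull[OF M(3)[OF j nn(1)] t \<G>\<G>_inj_Hom[OF X j nn(1)] m])
   also have "\<dots> = \<iota> X ?J ** (sig (concat ?S) ** sig (map (map (OMap E)) ?S))"
    unfolding mE cS by (rule V.assoc[OF t s2 \<iota>_Hom[OF X J]])
   also have "\<dots> = \<iota> X ?J ** (sig (nested_edges X ?qs) ** AMap E (map sig ?S))"
    unfolding multitensor_laws(3)[OF SO] cS' ..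
   finally have left: "((EMap (\<mu> X) (a, b) ** EMap (\<mu> (\<G> X)) (a, b)) ** ?i) ** ?n =
    \<iota> X ?J ** (sig (nested_edges X ?qs) ** AMap E (map sig ?S))" .
   have mp: "map (VMap (\<mu> X)) p = p" using P(2) M(2) by (auto intro!: map_idI)
   have p'': "p : paths (\<G> (\<G> X)) a b" using p by simp
   have pm: "path_arr (\<mu> X) p : Hom V (smd (\<G> (\<G> X)) p) (smd (\<G> X) p)" using path_arr_Hom[OF M(1) p''] mp by simp
   note nG = nested_arr_Hom[OF GX p' qs'] and iGG = \<iota>_Hom[OF GGX p''] and iGp = \<iota>_Hom[OF GX p']
   let ?z = "zip qs rss"
   have fq: "map fst ?z = qs" "map snd ?z = rss" using len by simp_all
   \<comment> \<open>Here the multiplication acts under \<open>E\<close>, separately on each step of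
     \<open>p\<close>; every step contributes the defining equation of \<open>\<mu>\<close> at its
     own nested path.\<close>
   have key: "path_arr (\<mu> X) p ** (nested_arr (\<G> X) qs ** ?n) = nested_arr X ?qs ** AMap E (map sig ?S)"
   proof -
    have A: "EMap (\<mu> X) (hd (fst z), last (fst z)) : Hom V (Edge (\<G> (\<G> X)) (hd (fst z), last (fst z))) (Edge (\<G> X) (hd (fst z), last (fst z)))"
     if "z : set ?z" for z using that rs[of "fst z" "snd z"] pathsD(5,6) by (intro \<mu>_EMap_Hom[OF X]) auto
    have B: "\<iota> (\<G> X) (fst z) ** nested_arr X (snd z) : Hom V (nested_obj X (snd z)) (Edge (\<G> (\<G> X)) (hd (fst z), last (fst z)))"
     if "z : set ?z" for z using that rs[of "fst z" "snd z"] \<G>\<G>_inj_Hom[OF X] by simp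
    have B1: "nested_arr X (snd z) : Hom V (nested_obj X (snd z)) (smd (\<G> X) (fst z))"
     and B2: "\<iota> (\<G> X) (fst z) : Hom V (smd (\<G> X) (fst z)) (Edge (\<G> (\<G> X)) (hd (fst z), last (fst z)))"
     if "z : set ?z" for z using that rs[of "fst z" "snd z"] nested_arr_Hom[OF X, of "fst z"] \<iota>_Hom[OF GX, of "fst z"] by auto
    have "nested_arr (\<G> X) qs ** ?n = AMap E (map (%z. \<iota> (\<G> X) (fst z)) ?z) ** AMap E (map (%z. nested_arr X (snd z)) ?z)"
     using fq by (simp add: nested_arr_def[of "\<G> X"] map_map[symmetric, unfolded comp_def] del: map_map map_fst_zip map_snd_zip)
    also have "\<dots> = AMap E (map (%z. \<iota> (\<G> X) (fst z) ** nested_arr X (snd z)) ?z)" by (rule E_comp[OF B1 B2])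
    finally have nn2: "nested_arr (\<G> X) qs ** ?n = AMap E (map (%z. \<iota> (\<G> X) (fst z) ** nested_arr X (snd z)) ?z)" .
    have "path_arr (\<mu> X) p ** (nested_arr (\<G> X) qs ** ?n) =
     AMap E (map (%z. EMap (\<mu> X) (hd (fst z), last (fst z))) ?z) ** AMap E (map (%z. \<iota> (\<G> X) (fst z) ** nested_arr X (snd z)) ?z)"
    proof -
     have "map (EMap (\<mu> X)) (steps p) = map (%z. EMap (\<mu> X) (hd (fst z), last (fst z))) ?z"
      unfolding nested_steps[OF qs] using len by (auto intro!: nth_equalityI)
     then show ?thesis unfolding nn2 path_arr_def by (simp only:)
    qed
    also have "\<dots> = AMap E (map (%z. EMap (\<mu> X) (hd (fst z), last (fst z)) ** (\<iota> (\<G> X) (fst z) ** nested_arr X (snd z))) ?z)"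
     by (rule E_comp[OF B A])
    also have "\<dots> = AMap E (map (%z. \<iota> X (join_paths (fst z) (snd z)) ** sig (nested_edges X (snd z))) ?z)"
     using M(3) rs by (intro arg_cong[where f = "AMap E"] map_cong) auto
    also have "\<dots> = AMap E (map (%z. \<iota> X (join_paths (fst z) (snd z))) ?z) ** AMap E (map (%z. sig (nested_edges X (snd z))) ?z)"
    proof (rule E_comp[symmetric])
     fix z assume "z : set ?z"
     then have z: "snd z : nested_paths X (fst z)" "fst z : paths X (hd (fst z)) (last (fst z))" using rs[of "fst z" "snd z"] by auto
     show "sig (nested_edges X (snd z)) : Hom V (nested_obj X (snd z)) (smd X (join_paths (fst z) (snd z)))"
      by (rule sig_nested_Hom[OF X z(2,1)])
     show "\<iota> X (join_paths (fst z) (snd z)) : Hom V (smd X (join_paths (fst z) (snd z))) (Edge (\<G> X) (hd (fst z), last (fst z)))"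
      by (rule \<iota>_Hom[OF X join_mem[OF z(2,1)]])
    qed
    also have "\<dots> = nested_arr X ?qs ** AMap E (map sig ?S)"
    proof -
     have "map (%z. sig (nested_edges X (snd z))) ?z = map sig ?S" using len by (auto intro!: nth_equalityI)
     moreover have "map (%z. \<iota> X (join_paths (fst z) (snd z))) ?z = map (\<iota> X) ?qs" by (simp add: case_prod_beta')
     ultimately show ?thesis by (simp only: nested_arr_def)
    qed
    finally show ?thesis .
   qed
   have mS: "AMap E (map sig ?S) : Hom V (OMap E (map (nested_obj X) rss)) (nested_obj X ?qs)"
   proof -
    have "AMap E (map (%z. sig (nested_edges X (snd z))) ?z) : Hom V (OMap E (map (%z. nested_obj X (snd z)) ?z))
     (OMap E (map (%z. smd X (join_paths (fst z) (snd z))) ?z))" using sig_nested_Hom[OF X] rs by (intro E_Hom) fastforce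
    moreover have "map (%z. sig (nested_edges X (snd z))) ?z = map sig ?S"
     "map (%z. nested_obj X (snd z)) ?z = map (nested_obj X) rss" using len by (auto intro!: nth_equalityI)
    moreover have "map (%z. smd X (join_paths (fst z) (snd z))) ?z = map (smd X) ?qs" by (simp add: case_prod_beta')
    ultimately show ?thesis by (simp only: nested_obj_def[of X ?qs])
   qed
   have nq: "nested_arr X ?qs : Hom V (nested_obj X ?qs) (smd (\<G> X) p)" by (rule nested_arr_Hom[OF X p nn(2)])
   have "((EMap (\<mu> X) (a, b) ** EMap (\<G>m (\<mu> X)) (a, b)) ** ?i) ** ?n =
    EMap (\<mu> X) (a, b) ** (EMap (\<G>m (\<mu> X)) (a, b) ** (\<iota> (\<G> (\<G> X)) p ** (nested_arr (\<G> X) qs ** ?n)))"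
    using V.assoc[OF i Gm m] V.assoc[OF n V.comp_Hom[OF i Gm] m] V.assoc[OF n i Gm] V.assoc[OF n nG iGG] by simp
   also have "EMap (\<G>m (\<mu> X)) (a, b) ** (\<iota> (\<G> (\<G> X)) p ** (nested_arr (\<G> X) qs ** ?n)) =
    (\<iota> (\<G> X) p ** path_arr (\<mu> X) p) ** (nested_arr (\<G> X) qs ** ?n)"
    by (rule V.comp_pull[OF _ V.comp_Hom[OF n nG] iGG Gm]) (use G(3)[OF p''] mp in simp)
   also have "\<dots> = \<iota> (\<G> X) p ** (nested_arr X ?qs ** AMap E (map sig ?S))"
    unfolding V.assoc[OF V.comp_Hom[OF n nG] pm iGp] key ..
   also have "\<dots> = (\<iota>\<iota> X p ?qs) ** AMap E (map sig ?S)" by (rule V.assoc[OF mS nq iGp, symmetric])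
   also have "EMap (\<mu> X) (a, b) ** \<dots> = (\<iota> X (join_paths p ?qs) ** sig (nested_edges X ?qs)) ** AMap E (map sig ?S)"
    by (rule V.comp_pull[OF M(3)[OF p nn(2)] mS \<G>\<G>_inj_Hom[OF X p nn(2)] m])
   also have "\<dots> = \<iota> X ?J ** (sig (nested_edges X ?qs) ** AMap E (map sig ?S))"
    using V.assoc[OF mS sig_nested_Hom[OF X p nn(2)] \<iota>_Hom[OF X join_mem[OF p nn(2)]]] nn(3) by simp
   finally show "((EMap (\<mu> X) (a, b) ** EMap (\<mu> (\<G> X)) (a, b)) ** ?i) ** ?n =
    ((EMap (\<mu> X) (a, b) ** EMap (\<G>m (\<mu> X)) (a, b)) ** ?i) ** ?n" unfolding left by (rule sym)
  qed
 qed
qed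

lemma Gamma_sel [simp]: "OMap (Gamma V E) = \<G>" "AMap (Gamma V E) = \<G>m" by (simp_all add: Gamma_def)

lemma monad_\<G>: "monad GV (Gamma V E) \<eta> \<mu>"
proof -
 have Arr: "f : Hom GV (Dom GV f) (Cod GV f)" if "f : Arr GV" for f using that by (simp add: Hom_def)
 show ?thesis unfolding monad_def natural_def
  using functor_\<G> \<eta>_props(1) \<mu>_props(1) \<eta>_natural[OF Arr] \<mu>_natural[OF Arr] \<mu>_\<eta>_left \<mu>_\<eta>_right \<mu>_assoc
  by (simp add: id_ftor_def comp_ftor_def)
qed

end

section \<open>Preservation of coproducts\<close>

context VGraphs
begin

definition edge_index where "edge_index I X inc v w = {(i, a, b). i : I & a : Verts (X i) & b : Verts (X i) &
   VMap (inc i) a = v & VMap (inc i) b = w}"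

text \<open>The arrows of a discrete diagram are identities, which makes the compatibility condition
  of \<open>edge_cocone\<close> vacuous: the hom over \<open>(v, w)\<close> is a plain coproduct
  over the edges above that pair.\<close>

lemma edge_colimit_discrete:
 assumes X: "!!i. i : I ==> inc i : Hom GV (X i) Q" and v: "v : Verts Q" "w : Verts Q" and Q: "Q : Obj GV"
 shows "edge_colimit (discrete I) (discrete_diagram GV X) Q inc v w \<longleftrightarrow>
  is_coproduct V (edge_index I X inc v w) (%(i, a, b). Edge (X i) (a, b)) (Edge Q (v, w)) (%(i, a, b). EMap (inc i) (a, b))"
proof -
 let ?K = "edge_index I X inc v w"
 have ec: "edge_cocone (discrete I) (discrete_diagram GV X) inc v w T f \<longleftrightarrow>
  (ALL (i, a, b):?K. f i a b : Hom V (Edge (X i) (a, b)) T)" for T f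
  by (auto simp: edge_cocone_def edge_index_def GIde) (metis V.id_r)
 have H: "(case k of (i, a, b) => EMap (inc i) (a, b)) : Hom V (case k of (i, a, b) => Edge (X i) (a, b)) (Edge Q (v, w))"
  "(case k of (i, a, b) => Edge (X i) (a, b)) : Obj V" if "k : ?K" for k
  using that GHomD(6)[OF X] GObjD(2)[OF GHomD(1)[OF X]] by (force simp: edge_index_def)+
 have c: "(ALL j:Obj (discrete I). ALL x:Verts (OMap (discrete_diagram GV X) j). ALL y:Verts (OMap (discrete_diagram GV X) j).
   VMap (inc j) x = v --> VMap (inc j) y = w --> h ** EMap (inc j) (x, y) = f j x y) \<longleftrightarrow>
  (ALL k:?K. h ** (case k of (i, a, b) => EMap (inc i) (a, b)) = (case k of (i, a, b) => f i a b))" for h f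
  by (auto simp: edge_index_def)
 \<comment> \<open>\<open>edge_colimit\<close> quantifies over curried families,
   \<open>is_coproduct\<close> over functions of a triple.\<close>
 have curry: "(ALL f. P f) \<longleftrightarrow> (ALL f. P (%(i, a, b). f i a b))" for P :: "('b \<times> 'u \<times> 'u => 'a) => bool"
 proof (intro iffI allI)
  fix f :: "'b \<times> 'u \<times> 'u => 'a" assume *: "ALL f. P (%(i, a, b). f i a b)"
  have "(%(i, a, b). f (i, a, b)) = f" by auto
  then show "P f" using *[rule_format, of "%i a b. f (i, a, b)"] by simp
 qed blast
 have "is_coproduct V ?K (%(i, a, b). Edge (X i) (a, b)) (Edge Q (v, w)) (%(i, a, b). EMap (inc i) (a, b)) \<longleftrightarrow>
  (ALL T:Obj V. ALL f. (ALL k:?K. f k : Hom V (case k of (i, a, b) => Edge (X i) (a, b)) T) -->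
   (EX! h. h : Hom V (Edge Q (v, w)) T & (ALL k:?K. h ** (case k of (i, a, b) => EMap (inc i) (a, b)) = f k)))"
  using H GObjD(2)[OF Q v] unfolding is_coproduct_def by blast
 also have "\<dots> \<longleftrightarrow> (ALL T:Obj V. ALL f. (ALL k:?K. (case k of (i, a, b) => f i a b) : Hom V (case k of (i, a, b) => Edge (X i) (a, b)) T) -->
   (EX! h. h : Hom V (Edge Q (v, w)) T & (ALL k:?K. h ** (case k of (i, a, b) => EMap (inc i) (a, b)) = (case k of (i, a, b) => f i a b))))"
  by (intro ball_cong refl curry)
 also have "\<dots> \<longleftrightarrow> edge_colimit (discrete I) (discrete_diagram GV X) Q inc v w"
  unfolding edge_colimit_def c ec by (simp add: case_prod_beta')
 finally show ?thesis by blast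
qed

lemma graph_colimit_discrete:
 assumes X: "ALL i:I. X i : Obj GV"
 shows "graph_colimit (discrete I) (discrete_diagram GV X) Q inc \<longleftrightarrow>
  Q : Obj GV & (ALL i:I. inc i : Hom GV (X i) Q) & (ALL v:Verts Q. EX i:I. EX x:Verts (X i). VMap (inc i) x = v) &
  (ALL i:I. ALL i':I. ALL x:Verts (X i). ALL x':Verts (X i'). VMap (inc i) x = VMap (inc i') x' --> i = i' & x = x') &
  (ALL v:Verts Q. ALL w:Verts Q. is_coproduct V (edge_index I X inc v w) (%(i, a, b). Edge (X i) (a, b)) (Edge Q (v, w))
   (%(i, a, b). EMap (inc i) (a, b)))"
proof -
 have "(ALL t:I. inc t \<star>GV Ide GV (X t) = inc t)" if "ALL i:I. inc i : Hom GV (X i) Q" using GV.id_r that by blast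
 then have c: "is_cocone (discrete I) GV (discrete_diagram GV X) Q inc \<longleftrightarrow> Q : Obj GV & (ALL i:I. inc i : Hom GV (X i) Q)"
  by (auto simp: is_cocone_def)
 have r: "((i, x), (i', x')) : vertex_rel (discrete I) (discrete_diagram GV X) \<longleftrightarrow> i = i' & x = x'" for i x i' x'
 proof
  assume *: "((i, x), (i', x')) : vertex_rel (discrete I) (discrete_diagram GV X)"
  show "i = i' & x = x'" using vertex_rel_invariant[OF _ *, of "%i x. (i, x)"] by (simp add: GIde)
 qed (auto simp: vertex_rel_def Let_def)
 show ?thesis unfolding graph_colimit_def c r using edge_colimit_discrete[of I inc X Q] by (simp cong: conj_cong)
qed

end

context Multitensor
begin

text \<open>By distributivity a hom of \<open>\<G> Q\<close> is a coproduct over paths of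
  \<open>Q\<close> with a chosen edge of some \<open>X i\<close> above each step. These data amount
  to a path in one of the graphs \<open>X i\<close>, and regrouping by end points gives the homs of
  \<open>\<G> (X i)\<close>.\<close>

theorem preserves_coproducts_\<G>: "preserves_coproducts U GV GV (Gamma V E)" unfolding preserves_coproducts_def
proof (intro allI impI)
 fix I :: "'u set" and X Q inc
 assume I: "small U I" and cop: "is_coproduct GV I X Q inc"
 have XO: "X i : Obj GV" and incH: "inc i : Hom GV (X i) Q" if "i : I" for i using GV.coproductD[OF cop] that by auto
 have XOb: "ALL i:I. X i : Obj GV" using XO by blast
 have QO: "Q : Obj GV" by (rule GV.coproductD(1)[OF cop])
 have "is_colimit (discrete I) GV (discrete_diagram GV X) Q inc" using cop GV.coproduct_iff_colimit[of I X] XO by blast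
 then have "graph_colimit (discrete I) (discrete_diagram GV X) Q inc"
  using colimit_imp_graph_colimit[OF GV.functor_discrete_diagram[OF XO]] I by simp
 then have sur: "!!v. v : Verts Q ==> EX i:I. EX x:Verts (X i). VMap (inc i) x = v"
  and inj: "!!i i' x x'. i : I ==> i' : I ==> x : Verts (X i) ==> x' : Verts (X i') ==>
   VMap (inc i) x = VMap (inc i') x' ==> i = i' & x = x'"
  and ecop: "!!v w. v : Verts Q ==> w : Verts Q ==> is_coproduct V (edge_index I X inc v w)
   (%(i, a, b). Edge (X i) (a, b)) (Edge Q (v, w)) (%(i, a, b). EMap (inc i) (a, b))"
  unfolding graph_colimit_discrete[OF XOb] by blast+
 let ?K = "edge_index I X inc" and ?FE = "%(i, a, b). Edge (X i) (a, b)" and ?FI = "%(i, a, b). EMap (inc i) (a, b)"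
 have smallK: "small U (?K v w)" for v w by (rule small_subset[of U "SIGMA i:I. Verts (X i) \<times> Verts (X i)"])
   (auto simp: edge_index_def intro!: small_Sigma[OF universe I] small_Times[OF universe] GObjD(1)[OF XO])
 note GD = \<G>m_props[OF incH]
 \<comment> \<open>Edges over consecutive steps share a vertex and hence have the same index
   \<open>i\<close>. For a path with a single vertex the index comes from surjectivity on
   vertices.\<close>
 have lift: "EX i p'. i : I & p' ~= [] & set p' \<subseteq> Verts (X i) & map (VMap (inc i)) p' = p & ts = map (Pair i) (steps p')"
  if "p ~= []" "set p \<subseteq> Verts Q" "list_all2 (%z t. t : ?K (fst z) (snd z)) (steps p) ts" for p ts using that
 proof (induction p arbitrary: ts rule: induct_list012)
  case (2 x)
  then have "x : Verts Q" by simp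
  then obtain i a where "i : I" "a : Verts (X i)" "VMap (inc i) a = x" using sur by blast
  then show ?case using 2 by (intro exI[of _ i] exI[of _ "[a]"]) auto
 next
  case (3 x y p)
  from 3(5) obtain t ts' where ts: "ts = t # ts'" "t : ?K x y" "list_all2 (%z t. t : ?K (fst z) (snd z)) (steps (y # p)) ts'"
   by (auto simp: list_all2_Cons1)
  then obtain i a b where t: "t = (i, a, b)" "i : I" "a : Verts (X i)" "b : Verts (X i)" "VMap (inc i) a = x" "VMap (inc i) b = y"
   by (auto simp: edge_index_def)
  obtain i' p' where p': "i' : I" "p' ~= []" "set p' \<subseteq> Verts (X i')" "map (VMap (inc i')) p' = y # p" "ts' = map (Pair i') (steps p')"
   using 3(2)[OF _ _ ts(3)] 3(4) by (metis list.distinct(1) set_subset_Cons subset_trans)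
  obtain b' p'' where b': "p' = b' # p''" using p'(2) by (cases p') auto
  have "i = i' & b = b'" using inj[of i i' b b'] t p' b' by auto
  then show ?case using t p' ts b' by (intro exI[of _ i] exI[of _ "a # p'"]) auto
 qed auto
 have "is_coproduct V (edge_index I (\<G> \<circ> X) (\<G>m \<circ> inc) v w) (%(i, a, b). Edge ((\<G> \<circ> X) i) (a, b)) (Edge (\<G> Q) (v, w))
   (%(i, a, b). EMap ((\<G>m \<circ> inc) i) (a, b))" if v: "v : Verts Q" and w: "w : Verts Q" for v w
 proof -
  let ?L = "%p. {ts. list_all2 (%z t. t : ?K (fst z) (snd z)) (steps p) ts}"
  have c1: "is_coproduct V (?L p) (%ts. OMap E (map ?FE ts)) (smd Q p) (%ts. AMap E (map ?FI ts))" if p: "p : paths Q v w" for p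
   unfolding Gamma_summand_def by (rule E_coproduct) (use ecop paths_steps[OF p] smallK in auto)
  have c2: "is_coproduct V (Sigma (paths Q v w) ?L) (%(p, ts). OMap E (map ?FE ts)) (Edge (\<G> Q) (v, w))
   (%(p, ts). \<iota> Q p ** AMap E (map ?FI ts))" by (rule V.coproduct_nested[OF \<G>_coproduct[OF QO v w] c1])
  let ?M = "SIGMA k:?K v w. case k of (i, a, b) => paths (X i) a b"
  let ?e = "%(k, p'). (map (VMap (inc (fst k))) p', map (Pair (fst k)) (steps p'))"
  have bij: "bij_betw ?e ?M (Sigma (paths Q v w) ?L)" unfolding bij_betw_def
  proof (intro conjI inj_onI set_eqI iffI)
   fix m m' assume m: "m : ?M" "m' : ?M" "?e m = ?e m'"
   obtain i a b p where mm: "m = ((i, a, b), p)" "i : I" "p : paths (X i) a b" using m(1) by (auto simp: edge_index_def)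
   obtain i' a' b' p' where mm': "m' = ((i', a', b'), p')" "i' : I" "p' : paths (X i') a' b'"
    using m(2) by (auto simp: edge_index_def)
   note P = pathsD[OF mm(3)] and P' = pathsD[OF mm'(3)]
   have e: "map (VMap (inc i)) p = map (VMap (inc i')) p'" using m(3) mm(1) mm'(1) by simp
   have "VMap (inc i) a = VMap (inc i') a'" using arg_cong[OF e, of hd] P P' by (simp add: hd_map)
   then have ii: "i = i'" using inj mm mm' P P' by blast
   have "inj_on (VMap (inc i)) (Verts (X i))" using inj mm by (meson inj_onI)
   then have "inj_on (VMap (inc i)) (set p \<union> set p')" using P(2) P'(2) ii by (auto intro: inj_on_subset)
   then have "p = p'" using e ii inj_on_map_eq_map by blast
   then show "m = m'" using mm mm' ii P P' by auto
  next
   fix z assume "z : ?e ` ?M"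
   then obtain i a b p where z: "i : I" "VMap (inc i) a = v" "VMap (inc i) b = w" "p : paths (X i) a b"
    "z = (map (VMap (inc i)) p, map (Pair i) (steps p))" by (auto simp: edge_index_def)
   have "list_all2 (%z t. t : ?K (fst z) (snd z)) (steps (map (VMap (inc i)) p)) (map (Pair i) (steps p))"
    using paths_steps[OF z(4)] z(1) unfolding steps_map by (auto simp: list.rel_map list_all2_same edge_index_def)
   then show "z : Sigma (paths Q v w) ?L" using path_map_Hom[OF incH z(4)] z by auto
  next
   fix z assume "z : Sigma (paths Q v w) ?L"
   then obtain p ts where z: "z = (p, ts)" "p : paths Q v w" "ts : ?L p" by auto
   obtain i p' where p': "i : I" "p' ~= []" "set p' \<subseteq> Verts (X i)" "map (VMap (inc i)) p' = p" "ts = map (Pair i) (steps p')"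
    using lift[of p ts] z pathsD[OF z(2)] by auto
   have "((i, hd p', last p'), p') : ?M" using p' pathsD[OF z(2)] by (auto simp: edge_index_def paths_def hd_map last_map)
   moreover have "z = ?e ((i, hd p', last p'), p')" using z p' by simp
   ultimately show "z : ?e ` ?M" by blast
  qed
  have c3: "is_coproduct V ?M (%(k, p'). smd (X (fst k)) p') (Edge (\<G> Q) (v, w))
   (%(k, p'). \<iota> Q (map (VMap (inc (fst k))) p') ** path_arr (inc (fst k)) p')" by (rule V.coproduct_reindex[OF c2 bij])
    (auto simp: Gamma_summand_def path_arr_def comp_def)
  \<comment> \<open>The coproduct over all paths in the graphs \<open>X i\<close> is grouped by the
    end points of the paths.\<close>
  have "is_coproduct V (?K v w) (%(i, a, b). Edge (\<G> (X i)) (a, b)) (Edge (\<G> Q) (v, w))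
   (%(i, a, b). EMap (\<G>m (inc i)) (a, b))"
  proof (rule V.coproduct_unnest[OF c3])
   fix k assume "k : ?K v w"
   then obtain i a b where k: "k = (i, a, b)" "i : I" "a : Verts (X i)" "b : Verts (X i)"
    "VMap (inc i) a = v" "VMap (inc i) b = w" by (auto simp: edge_index_def)
   show "is_coproduct V (case k of (i, a, b) => paths (X i) a b) (%p. case (k, p) of (k, p') => smd (X (fst k)) p')
    (case k of (i, a, b) => Edge (\<G> (X i)) (a, b)) (\<iota> (X (fst k)))"
    using \<G>_coproduct[OF XO[OF k(2)] k(3,4)] by (simp add: k(1))
   show "(case k of (i, a, b) => EMap (\<G>m (inc i)) (a, b)) : Hom V (case k of (i, a, b) => Edge (\<G> (X i)) (a, b)) (Edge (\<G> Q) (v, w))"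
    using GHomD(6)[OF GD(1)[OF k(2)], of a b] GD(2)[OF k(2)] k by simp
   fix p assume "p : (case k of (i, a, b) => paths (X i) a b)"
   then show "(case (k, p) of (k, p') => \<iota> Q (map (VMap (inc (fst k))) p') ** path_arr (inc (fst k)) p') =
    (case k of (i, a, b) => EMap (\<G>m (inc i)) (a, b)) ** \<iota> (X (fst k)) p" using GD(3)[OF k(2)] by (simp add: k(1))
  qed
  moreover have "edge_index I (\<G> \<circ> X) (\<G>m \<circ> inc) v w = ?K v w" using GD(2) by (auto simp: edge_index_def)
  ultimately show ?thesis by (simp add: case_prod_beta')
 qed
 then have "graph_colimit (discrete I) (discrete_diagram GV (\<G> \<circ> X)) (\<G> Q) (\<G>m \<circ> inc)"
  using XO \<G>_Obj QO GD(1,2) sur inj by (subst graph_colimit_discrete) auto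
 then have "is_colimit (discrete I) GV (discrete_diagram GV (\<G> \<circ> X)) (\<G> Q) (\<G>m \<circ> inc)"
  by (intro graph_colimit_imp_colimit GV.functor_discrete_diagram) (use XO \<G>_Obj in auto)
 then show "is_coproduct GV I (OMap (Gamma V E) \<circ> X) (OMap (Gamma V E) Q) (AMap (Gamma V E) \<circ> inc)"
  using GV.coproduct_iff_colimit[of I "\<G> \<circ> X"] XO \<G>_Obj by simp
qed

end

section \<open>Filtered categories\<close>

text \<open>\<open>filtered\<close>, \<open>accessible\<close> and the like fix the types of objects
  and arrows of a shape. A category is moved along an injection on its arrows, an object being coded
  by its identity, so that one type serves for both.\<close>

definition transport :: "('j, 't) cat => ('t => 'z) => ('z, 'z) cat" where "transport K e = (let d = the_inv_into (Arr K) e in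
   \<lparr>Obj = (%j. e (Ide K j)) ` Obj K, Arr = e ` Arr K,
   Dom = (%z. e (Ide K (Dom K (d z)))), Cod = (%z. e (Ide K (Cod K (d z)))),
   Ide = (%z. z), Comp = (%g f. e (d g \<star>K d f))\<rparr>)"

definition untransport :: "('j, 't) cat => ('t => 'z) => ('z, 'z, 'j, 't) ftor" where
 "untransport K e = \<lparr>OMap = (%z. Dom K (the_inv_into (Arr K) e z)), AMap = the_inv_into (Arr K) e\<rparr>"

context
 fixes K :: "('j, 't) cat" and e :: "'t => 'z"
 assumes K: "category K" and e: "inj_on e (Arr K)"
begin

interpretation K: Category K by unfold_locales (rule K)

lemma transport_inv [simp]: "t : Arr K ==> the_inv_into (Arr K) e (e t) = t" by (rule the_inv_into_f_f[OF e])

lemma transport_sel: "Obj (transport K e) = (%j. e (Ide K j)) ` Obj K" "Arr (transport K e) = e ` Arr K"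
 "t : Arr K ==> Dom (transport K e) (e t) = e (Ide K (Dom K t))" "t : Arr K ==> Cod (transport K e) (e t) = e (Ide K (Cod K t))"
 "Ide (transport K e) z = z" "t : Arr K ==> s : Arr K ==> e s \<star>(transport K e) e t = e (s \<star>K t)"
 by (simp_all add: transport_def Let_def)

lemma untransport_sel: "t : Arr K ==> AMap (untransport K e) (e t) = t" "j : Obj K ==> OMap (untransport K e) (e (Ide K j)) = j"
 by (simp_all add: untransport_def)

lemma transport_Ide_eq: "j : Obj K ==> j' : Obj K ==> e (Ide K j) = e (Ide K j') \<longleftrightarrow> j = j'"
 using e by (metis K.Ide_simps(1,2) inj_onD)

lemma category_transport: "category (transport K e)" unfolding category_def Hom_def using transport_Ide_eq
 by (auto simp: transport_sel K.comp_assoc)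

lemma functor_untransport: "is_functor (transport K e) K (untransport K e)"
 unfolding is_functor_def Hom_def using category_transport K by (auto simp: transport_sel untransport_sel transport_Ide_eq)

lemma cocone_transport: "is_cocone (transport K e) C (comp_ftor D (untransport K e)) L f \<longleftrightarrow>
  is_cocone K C D L (%j. f (e (Ide K j)))" by (auto simp: is_cocone_def transport_sel untransport_sel comp_ftor_def)

lemma cocone_untransport:
 "is_cocone (transport K e) C (comp_ftor D (untransport K e)) L (f \<circ> OMap (untransport K e)) \<longleftrightarrow>
  is_cocone K C D L f" unfolding cocone_transport by (auto simp: is_cocone_def untransport_sel)

lemma colimit_transport:
 "is_colimit (transport K e) C (comp_ftor D (untransport K e)) L (inc \<circ> OMap (untransport K e)) \<longleftrightarrow>
  is_colimit K C D L inc"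
proof -
 let ?U = "%T f. EX! h. h : Hom C L T & (ALL j:Obj K. h \<star>C inc j = f j)"
 have A: "(ALL j:Obj (transport K e). h \<star>C (inc \<circ> OMap (untransport K e)) j = f j) \<longleftrightarrow>
  (ALL j:Obj K. h \<star>C inc j = f (e (Ide K j)))" for h f by (auto simp: transport_sel untransport_sel)
 have "(ALL T f. is_cocone K C D T (%j. f (e (Ide K j))) --> ?U T (%j. f (e (Ide K j)))) \<longleftrightarrow>
  (ALL T f. is_cocone K C D T f --> ?U T f)"
 proof (intro iffI allI impI)
  fix T f assume *: "ALL T f. is_cocone K C D T (%j. f (e (Ide K j))) --> ?U T (%j. f (e (Ide K j)))" and f: "is_cocone K C D T f"
  let ?f = "f \<circ> OMap (untransport K e)"
  have "is_cocone K C D T (%j. ?f (e (Ide K j)))" using f cocone_untransport[of C D T f] cocone_transport[of C D T ?f] by simp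
  then have "?U T (%j. ?f (e (Ide K j)))" using * by blast
  moreover have "(ALL j:Obj K. h \<star>C inc j = ?f (e (Ide K j))) \<longleftrightarrow> (ALL j:Obj K. h \<star>C inc j = f j)" for h
   by (simp add: untransport_sel)
  ultimately show "?U T f" by simp
 qed blast
 then show ?thesis unfolding is_colimit_def A cocone_untransport unfolding cocone_transport by simp
qed

end

lemma finite_ordLess: "Cinfinite lam ==> finite A ==> |A| <o lam"
 by (rule Cfinite_ordLess_Cinfinite) (auto simp: cfinite_def Field_card_of card_of_card_order_on)

text \<open>The definition of \<open>filtered\<close> speaks of shapes in the type underlying
  \<open>lam\<close>; a shape of any type with fewer than \<open>lam\<close> arrows is transported
  there.\<close>

lemma filtered_cocone:
 fixes lam :: "'l rel" and K :: "('x, 'y) cat"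
 assumes J: "filtered lam J" and D: "is_functor K J D" and K: "|Arr K| <o lam" and lam: "Cinfinite lam"
 shows "EX L inc. is_cocone K J D L inc"
proof -
 have "|Arr K| \<le>o |UNIV :: 'l set|"
 proof -
  have "|Arr K| \<le>o lam" using K ordLess_imp_ordLeq by blast
  moreover have "lam =o |Field lam|" using lam card_of_Field_ordIso ordIso_symmetric by blast
  moreover have "|Field lam| \<le>o |UNIV :: 'l set|" by (rule card_of_mono1) simp
  ultimately show ?thesis using ordLeq_ordIso_trans ordLeq_transitive by blast
 qed
 then obtain e :: "'y => 'l" where e: "inj_on e (Arr K)" unfolding card_of_ordLeq[symmetric] by auto
 have cK: "category K" by (rule functorD(1)[OF D])
 have "is_functor (transport K e) J (comp_ftor D (untransport K e))"
  using D functor_untransport[OF cK e] unfolding is_functor_def comp_ftor_def by (auto simp: Hom_def)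
 moreover have "|Arr (transport K e)| <o lam" unfolding transport_sel[OF cK e] using card_of_image K ordLeq_ordLess_trans by blast
 ultimately obtain L f where "is_cocone (transport K e) J (comp_ftor D (untransport K e)) L f"
  using J unfolding filtered_def by blast
 then show ?thesis unfolding cocone_transport[OF cK e] by blast
qed

text \<open>A set \<open>A\<close> of parallel arrows between two objects: a cocone on such a
  diagram coequalizes the whole set at once.\<close>

definition parallel :: "'t set => (bool, bool + 't) cat" where
 "parallel A = \<lparr>Obj = UNIV, Arr = UNIV <+> A, Dom = case_sum (%b. b) (%_. False),
   Cod = case_sum (%b. b) (%_. True), Ide = Inl, Comp = (%g f. case f of Inl _ => g | Inr _ => f)\<rparr>"

lemma category_parallel: "category (parallel A)" unfolding category_def parallel_def Hom_def by auto

locale Filtered =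
 fixes lam :: "'l rel" and J :: "('j, 't) cat" (structure)
 assumes filtered: "filtered lam J" and Cinfinite: "Cinfinite lam"
begin

sublocale Category J by unfold_locales (use filtered in "simp add: filtered_def")

lemma nonempty: "Obj J ~= {}"
proof -
 have "is_functor (discrete {}) J (discrete_diagram J (%_ :: nat. undefined))" by (rule functor_discrete_diagram) simp
 then have "EX L inc. is_cocone (discrete {}) J (discrete_diagram J (%_ :: nat. undefined)) L inc"
  by (rule filtered_cocone[OF filtered _ _ Cinfinite]) (simp add: finite_ordLess[OF Cinfinite])
 then show ?thesis by (auto simp: is_cocone_def)
qed

lemma bound:
 assumes "j : Obj J" "j' : Obj J"
 obtains k t t' where "t : Hom J j k" "t' : Hom J j' k"
proof -
 have "is_functor (discrete (UNIV :: bool set)) J (discrete_diagram J (%b. if b then j else j'))"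
  by (rule functor_discrete_diagram) (use assms in simp)
 then have "EX L inc. is_cocone (discrete (UNIV :: bool set)) J (discrete_diagram J (%b. if b then j else j')) L inc"
  by (rule filtered_cocone[OF filtered _ _ Cinfinite]) (simp add: finite_ordLess[OF Cinfinite])
 then obtain L inc where "is_cocone (discrete (UNIV :: bool set)) J (discrete_diagram J (%b. if b then j else j')) L inc" by blast
 then have "inc b : Hom J (if b then j else j') L" for b by (simp add: is_cocone_def)
 from this[of True] this[of False] show ?thesis using that by simp
qed

lemma coequalize:
 assumes A: "A \<subseteq> Hom J j k" "|A| <o lam" and jk: "j : Obj J" "k : Obj J"
 obtains k' s where "s : Hom J k k'" "!!a b. a : A ==> b : A ==> s \<cdot> a = s \<cdot> b"
proof -
 let ?D = "\<lparr>OMap = (%b. if b then k else j), AMap = case_sum (%b. if b then Ide J k else Ide J j) (%a. a)\<rparr>"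
 have AH: "a : Arr J" "Dom J a = j" "Cod J a = k" if "a : A" for a using A that by (auto simp: Hom_def)
 have "is_functor (parallel A) J ?D" unfolding is_functor_def using category_parallel category jk AH
  by (auto simp: parallel_def Hom_def)
 moreover have "|Arr (parallel A)| <o lam" using card_of_Plus_ordLess_infinite_Field[of lam "UNIV :: bool set" A] A(2) Cinfinite
   finite_ordLess[OF Cinfinite, of "UNIV :: bool set"] by (simp add: parallel_def cinfinite_def)
 ultimately obtain L inc where c: "is_cocone (parallel A) J ?D L inc" using filtered_cocone[OF filtered _ _ Cinfinite] by blast
 have "inc b : Hom J (OMap ?D b) L" for b using c by (simp add: is_cocone_def parallel_def)
 from this[of True] have i: "inc True : Hom J k L" by simp
 have "inc True \<cdot> a = inc False" if "a : A" for a
  using c that by (auto simp: is_cocone_def parallel_def dest: bspec[of _ _ "Inr a"])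
 then show ?thesis using that[OF i] by simp
qed

lemma coequalize2:
 assumes "a : Hom J j k" "b : Hom J j k"
 obtains k' s where "s : Hom J k k'" "s \<cdot> a = s \<cdot> b"
 using coequalize[of "{a, b}" j k] assms finite_ordLess[OF Cinfinite, of "{a, b}"] Hom_Obj
 by (metis bot.extremum finite.emptyI finite_insert insertCI insert_subset)

text \<open>The two targets are bounded first, then the composites from \<open>j\<close> and those
  from \<open>j'\<close> are coequalized one after the other; the first equation survives the second
  step.\<close>

lemma amalgamate:
 assumes t: "t : Hom J j k" "s : Hom J j k'" and t': "t' : Hom J j' k" "s' : Hom J j' k'"
 obtains m r r' where "r : Hom J k m" "r' : Hom J k' m" "r \<cdot> t = r' \<cdot> s" "r \<cdot> t' = r' \<cdot> s'"
proof -
 obtain m a a' where a: "a : Hom J k m" "a' : Hom J k' m" using bound Hom_Obj t by metis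
 obtain m1 b where b: "b : Hom J m m1" "b \<cdot> (a \<cdot> t) = b \<cdot> (a' \<cdot> s)"
  using coequalize2[OF comp_Hom[OF t(1) a(1)] comp_Hom[OF t(2) a(2)]] by metis
 have ba: "b \<cdot> a : Hom J k m1" "b \<cdot> a' : Hom J k' m1" using comp_Hom a b by auto
 obtain m2 c where c: "c : Hom J m1 m2" "c \<cdot> ((b \<cdot> a) \<cdot> t') = c \<cdot> ((b \<cdot> a') \<cdot> s')"
  using coequalize2[OF comp_Hom[OF t'(1) ba(1)] comp_Hom[OF t'(2) ba(2)]] by metis
 show ?thesis
 proof (rule that)
  show "c \<cdot> (b \<cdot> a) : Hom J k m2" "c \<cdot> (b \<cdot> a') : Hom J k' m2" using comp_Hom ba c by auto
  show "(c \<cdot> (b \<cdot> a)) \<cdot> t' = (c \<cdot> (b \<cdot> a')) \<cdot> s'"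
   using assoc[OF t'(1) ba(1) c(1)] assoc[OF t'(2) ba(2) c(1)] c by simp
  show "(c \<cdot> (b \<cdot> a)) \<cdot> t = (c \<cdot> (b \<cdot> a')) \<cdot> s"
   using assoc[OF t(1) ba(1) c(1)] assoc[OF t(2) ba(2) c(1)] assoc[OF t(1) a(1) b(1)] assoc[OF t(2) a(2) b(1)] b by simp
 qed
qed

lemma span:
 assumes "t : Hom J j k" "s : Hom J j k'"
 obtains m r r' where "r : Hom J k m" "r' : Hom J k' m" "r \<cdot> t = r' \<cdot> s" using amalgamate[OF assms assms] by blast

end

text \<open>An arrow \<open>(t, s)\<close> goes from \<open>t\<close> to the composite of
  \<open>t\<close> with \<open>s\<close>, so its target need not be stored. The stages reached from
  \<open>j\<close> are those at which vertices chosen at stage \<open>j\<close> have an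
  image.\<close>

definition coslice :: "('j, 't) cat => 'j => ('t, 't \<times> 't) cat" where
 "coslice J j = \<lparr>Obj = {t : Arr J. Dom J t = j}, Arr = {(t, s). t : Arr J & Dom J t = j & s : Arr J & Dom J s = Cod J t},
   Dom = fst, Cod = (%(t, s). s \<star>J t), Ide = (%t. (t, Ide J (Cod J t))), Comp = (%(_, s') (t, s). (t, s' \<star>J s))\<rparr>"

lemma (in Category) category_coslice: "category (coslice C j)"
 unfolding category_def coslice_def Hom_def by (auto simp: comp_assoc)

context Filtered
begin

text \<open>In \<open>J\<close> the codomains of the diagram have a cocone, but its composites with
  the arrows out of \<open>j\<close> need not agree; there are fewer than \<open>lam\<close> of
  them, so they can be coequalized.\<close>

lemma filtered_coslice:
 assumes j: "j : Obj J"
 shows "filtered lam (coslice J j)" unfolding filtered_def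
proof (intro conjI allI impI)
 show "category (coslice J j)" by (rule category_coslice)
 fix M :: "('l, 'l) cat" and D assume D: "is_functor M (coslice J j) D" and M: "|Arr M| <o lam"
 interpret M: Category M by unfold_locales (rule functorD(1)[OF D])
 have DO: "OMap D m : Hom J j (Cod J (OMap D m))" if "m : Obj M" for m
  using functorD(3)[OF D that] by (simp add: coslice_def Hom_def)
 have DA: "fst (AMap D f) = OMap D (Dom M f)" "snd (AMap D f) : Hom J (Cod J (OMap D (Dom M f))) (Cod J (OMap D (Cod M f)))"
  "snd (AMap D f) \<cdot> OMap D (Dom M f) = OMap D (Cod M f)" if f: "f : Arr M" for f
 proof -
  have "AMap D f : Hom (coslice J j) (OMap D (Dom M f)) (OMap D (Cod M f))"
   by (rule functorD(4)[OF D]) (use f in "simp add: Hom_def")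
  then show "fst (AMap D f) = OMap D (Dom M f)" "snd (AMap D f) : Hom J (Cod J (OMap D (Dom M f))) (Cod J (OMap D (Cod M f)))"
   "snd (AMap D f) \<cdot> OMap D (Dom M f) = OMap D (Cod M f)" by (auto simp: Hom_def coslice_def) (metis comp_simps(3))
 qed
 let ?D = "\<lparr>OMap = (%m. Cod J (OMap D m)), AMap = (%f. snd (AMap D f))\<rparr>"
 have "is_functor M J ?D"
 proof (rule is_functorI)
  show "AMap ?D f : Hom J (OMap ?D X) (OMap ?D Y)" if "f : Hom M X Y" for f X Y using DA(2) that by (auto simp: Hom_def)
  show "AMap ?D (Ide M X) = Ide J (OMap ?D X)" if "X : Obj M" for X using functorD(5)[OF D that] by (simp add: coslice_def)
  show "AMap ?D (g \<star>M f) = AMap ?D g \<cdot> AMap ?D f" if "f : Hom M X Y" "g : Hom M Y Z" for f g X Y Z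
   using functorD(6)[OF D that] by (simp add: coslice_def case_prod_beta')
 qed (use M.category category DO Hom_Obj in auto)
 then obtain k c where c: "is_cocone M J ?D k c" using filtered M unfolding filtered_def by blast
 have k: "k : Obj J" and cH: "c m : Hom J (Cod J (OMap D m)) k" if "m : Obj M" for m using c that by (auto simp: is_cocone_def)
 have k: "k : Obj J" using c by (simp add: is_cocone_def)
 have cc: "c (Cod M f) \<cdot> snd (AMap D f) = c (Dom M f)" if "f : Arr M" for f using c that by (auto simp: is_cocone_def)
 obtain k1 t1 t2 where t: "t1 : Hom J j k1" "t2 : Hom J k k1" using bound[OF j k] by metis
 let ?a = "%m. (t2 \<cdot> c m) \<cdot> OMap D m"
 have a: "?a m : Hom J j k1" if "m : Obj M" for m using comp_Hom[OF DO[OF that] comp_Hom[OF cH[OF that] t(2)]] .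
 \<comment> \<open>Coequalizing \<open>t1\<close> together with the composites provides an arrow out
   of \<open>j\<close> that serves as vertex of the cocone, also when the diagram is empty.\<close>
 let ?A = "insert t1 (?a ` Obj M)"
 have sm: "|?A| <o lam"
 proof -
  have "Obj M \<subseteq> Dom M ` Arr M"
  proof
   fix m assume "m : Obj M"
   then show "m : Dom M ` Arr M" using M.Ide_simps(1,2)[of m] by (metis image_eqI)
  qed
  then have "?a ` Obj M \<subseteq> (%f. ?a (Dom M f)) ` Arr M"
   using image_mono[of "Obj M" "Dom M ` Arr M" ?a] by (simp add: image_image)
  from ordLeq_transitive[OF card_of_mono1[OF this] card_of_image] have "|?a ` Obj M| \<le>o |Arr M|" .
  then have "|?a ` Obj M| <o lam" using M ordLeq_ordLess_trans by blast
  then have "|{t1} <+> ?a ` Obj M| <o lam" using card_of_Plus_ordLess_infinite_Field[of lam "{t1}" "?a ` Obj M"] Cinfinite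
    finite_ordLess[OF Cinfinite, of "{t1}"] by (simp add: cinfinite_def)
  moreover have "|{t1} \<union> ?a ` Obj M| \<le>o |{t1} <+> ?a ` Obj M|" by (rule card_of_Un_Plus_ordLeq)
  ultimately show ?thesis using ordLeq_ordLess_trans by fastforce
 qed
 have sub: "?A \<subseteq> Hom J j k1" using a t by auto
 have k1: "k1 : Obj J" using Hom_Obj[OF t(1)] by blast
 obtain k2 s where s: "s : Hom J k1 k2" "!!a b. a : ?A ==> b : ?A ==> s \<cdot> a = s \<cdot> b"
  by (rule coequalize[OF sub sm j k1], rule that)
 let ?f = "%m. (OMap D m, s \<cdot> (t2 \<cdot> c m))"
 have st: "s \<cdot> (t2 \<cdot> c m) : Hom J (Cod J (OMap D m)) k2" if "m : Obj M" for m
  using comp_Hom[OF comp_Hom[OF cH[OF that] t(2)] s(1)] .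
 have "is_cocone M (coslice J j) D (s \<cdot> t1) ?f" unfolding is_cocone_def
 proof (intro conjI ballI)
  show "s \<cdot> t1 : Obj (coslice J j)" using comp_Hom[OF t(1) s(1)] by (simp add: coslice_def Hom_def)
  fix m assume m: "m : Obj M"
  have "(s \<cdot> (t2 \<cdot> c m)) \<cdot> OMap D m = s \<cdot> t1"
   using assoc[OF DO[OF m] comp_Hom[OF cH[OF m] t(2)] s(1)] s(2)[of t1 "?a m"] m by auto
  then show "?f m : Hom (coslice J j) (OMap D m) (s \<cdot> t1)" using st[OF m] DO[OF m] by (simp add: Hom_def coslice_def)
 next
  fix f assume f: "f : Arr M"
  have "(s \<cdot> (t2 \<cdot> c (Cod M f))) \<cdot> snd (AMap D f) = s \<cdot> (t2 \<cdot> c (Dom M f))"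
   using assoc[OF DA(2)[OF f] comp_Hom[OF cH t(2)] s(1)] assoc[OF DA(2)[OF f] cH t(2)] cc[OF f] f by simp
  then show "?f (Cod M f) \<star>(coslice J j) AMap D f = ?f (Dom M f)" using DA(1)[OF f] by (simp add: coslice_def case_prod_beta')
 qed
 then show "EX L inc. is_cocone M (coslice J j) D L inc" by blast
qed

end

section \<open>Colimits of sequences\<close>

definition component :: "nat => ('j, 't, 'o list, 'a list) ftor => ('j, 't, 'o, 'a) ftor" where
 "component i D = \<lparr>OMap = (%k. OMap D k ! i), AMap = (%t. AMap D t ! i)\<rparr>"

lemma component_sel [simp]: "OMap (component i D) k = OMap D k ! i" "AMap (component i D) t = AMap D t ! i"
 by (simp_all add: component_def)

context Category
begin

lemma seq_coconeD:
 assumes D: "is_functor K SC D" and c: "is_cocone K SC D Ls inc"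
 shows "k : Obj K ==> length (OMap D k) = length Ls" "k : Obj K ==> length (inc k) = length Ls"
  "t : Arr K ==> length (AMap D t) = length Ls" "i < length Ls ==> is_cocone K C (component i D) (Ls ! i) (%k. inc k ! i)"
  "i < length Ls ==> is_functor K C (component i D)"
proof -
 interpret K: Category K by unfold_locales (rule functorD(1)[OF D])
 have i: "inc k : Hom SC (OMap D k) Ls" if "k : Obj K" for k using c that by (simp add: is_cocone_def)
 show l: "length (OMap D k) = length Ls" "length (inc k) = length Ls" if "k : Obj K" for k
  using i[OF that] by (auto simp: seq_Hom_iff)
 have a: "AMap D t : Hom SC (OMap D (Dom K t)) (OMap D (Cod K t))" if "t : Arr K" for t
  by (rule functorD(4)[OF D]) (use that in "simp add: Hom_def")
 show la: "length (AMap D t) = length Ls" if "t : Arr K" for t using a[OF that] l[of "Dom K t"] that by (simp add: seq_Hom_iff)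
 fix i assume il: "i < length Ls"
 show "is_cocone K C (component i D) (Ls ! i) (%k. inc k ! i)" unfolding is_cocone_def
 proof (intro conjI ballI)
  show "Ls ! i : Obj C" using c il by (auto simp: is_cocone_def in_lists_conv_set)
  show "inc k ! i : Hom C (OMap (component i D) k) (Ls ! i)" if "k : Obj K" for k
   using i[OF that] il l[OF that] by (auto simp: seq_Hom_iff)
  fix t assume t: "t : Arr K"
  have "(inc (Cod K t) \<star>SC AMap D t) ! i = inc (Dom K t) ! i" using c t by (simp add: is_cocone_def)
  then show "inc (Cod K t) ! i \<cdot> AMap (component i D) t = inc (Dom K t) ! i" using l[of "Cod K t"] la[OF t] t il by simp
 qed
 show "is_functor K C (component i D)"
 proof (rule is_functorI)
  show "OMap (component i D) X : Obj C" if "X : Obj K" for X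
   using functorD(3)[OF D that] l[OF that] il by (auto simp: in_lists_conv_set)
  show "AMap (component i D) f : Hom C (OMap (component i D) X) (OMap (component i D) Y)" if "f : Hom K X Y" for f X Y
   using functorD(4)[OF D that] l[of X] K.Hom_Obj[OF that] il by (auto simp: seq_Hom_iff)
  show "AMap (component i D) (Ide K X) = Ide C (OMap (component i D) X)" if "X : Obj K" for X
   using functorD(5)[OF D that] l[OF that] il by simp
  show "AMap (component i D) (g \<star>K f) = AMap (component i D) g \<cdot> AMap (component i D) f"
   if "f : Hom K X Y" "g : Hom K Y Z" for f g X Y Z
  proof -
   have "length (AMap D f) = length Ls" "length (AMap D g) = length Ls" using la that by (auto simp: Hom_def)
   then show ?thesis using functorD(6)[OF D that] il by simp
  qed
 qed (use K.category category in auto)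
qed

text \<open>A component is tested by changing the given cocone in that one place.\<close>

lemma seq_colimitD:
 assumes D: "is_functor K SC D" and c: "is_colimit K SC D Ls inc" and i: "i < length Ls"
 shows "is_colimit K C (component i D) (Ls ! i) (%k. inc k ! i)"
proof -
 interpret K: Category K by unfold_locales (rule functorD(1)[OF D])
 have coc: "is_cocone K SC D Ls inc" using c by (simp add: is_colimit_def)
 note S = seq_coconeD[OF D coc]
 note ci = S(4)[OF i]
 have iH: "inc k ! n : Hom C (OMap D k ! n) (Ls ! n)" if "k : Obj K" "n < length Ls" for k n
  using S(4)[OF that(2)] that by (auto simp: is_cocone_def)
 have cn: "inc (Cod K t) ! n \<cdot> AMap D t ! n = inc (Dom K t) ! n" if "t : Arr K" "n < length Ls" for t n
  using S(4)[OF that(2)] that by (auto simp: is_cocone_def)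
 have LO: "Ls ! n : Obj C" if "n < length Ls" for n using S(4)[OF that] by (simp add: is_cocone_def)
 show ?thesis unfolding is_colimit_def
 proof (intro conjI allI impI)
  fix T f assume f: "is_cocone K C (component i D) T f"
  have fH: "f k : Hom C (OMap D k ! i) T" if "k : Obj K" for k using f that by (auto simp: is_cocone_def)
  have fc: "f (Cod K t) \<cdot> AMap D t ! i = f (Dom K t)" if "t : Arr K" for t using f that by (auto simp: is_cocone_def)
  have T: "T : Obj C" using f by (simp add: is_cocone_def)
  have tc: "is_cocone K SC D (Ls[i := T]) (%k. (inc k)[i := f k])" unfolding is_cocone_def
  proof (intro conjI ballI)
   show "Ls[i := T] : Obj SC" using LO T i by (auto simp: in_lists_conv_set in_set_conv_nth nth_list_update)
   show "(inc k)[i := f k] : Hom SC (OMap D k) (Ls[i := T])" if "k : Obj K" for k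
    using that S(1,2)[OF that] iH[OF that] fH[OF that] i by (auto simp: seq_Hom_iff nth_list_update)
   show "(inc (Cod K t))[i := f (Cod K t)] \<star>SC AMap D t = (inc (Dom K t))[i := f (Dom K t)]" if "t : Arr K" for t
    using that S(2)[of "Cod K t"] S(2)[of "Dom K t"] S(3)[OF that] fc cn i by (auto intro!: nth_equalityI simp: nth_list_update)
  qed
  obtain hs where hs: "hs : Hom SC Ls (Ls[i := T])" "!!k. k : Obj K ==> hs \<star>SC inc k = (inc k)[i := f k]"
   using is_colimit_ex[OF c tc] by metis
  have lh: "length hs = length Ls" using hs(1) by (simp add: seq_Hom_iff)
  show "EX! h. h : Hom C (Ls ! i) T & (ALL k:Obj K. h \<cdot> inc k ! i = f k)"
  proof (intro ex1I[of _ "hs ! i"] conjI ballI)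
   show "hs ! i : Hom C (Ls ! i) T" using hs(1) i by (auto simp: seq_Hom_iff)
   show "hs ! i \<cdot> inc k ! i = f k" if k: "k : Obj K" for k
    using arg_cong[OF hs(2)[OF k], of "%l. l ! i"] S(2)[OF k] lh i by simp
   fix h assume h: "h : Hom C (Ls ! i) T & (ALL k:Obj K. h \<cdot> inc k ! i = f k)"
   let ?h = "(map (Ide C) Ls)[i := h]"
   have "?h = hs"
   proof (rule is_colimit_eq[OF category_seq_cat D c _ hs(1)])
    show "?h : Hom SC Ls (Ls[i := T])" using h i LO by (auto simp: seq_Hom_iff nth_list_update Ide_Hom)
    show "?h \<star>SC inc k = hs \<star>SC inc k" if k: "k : Obj K" for k
     unfolding hs(2)[OF k] using h i k S(2)[OF k] id_l[OF iH[OF k]] by (auto intro!: nth_equalityI simp: nth_list_update)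
   qed
   then show "h = hs ! i" using i by auto
  qed
 qed (rule ci)
qed

text \<open>Nonemptiness of the diagram forces all cocones to have vertices of the same length;
  mediating arrows are then chosen componentwise.\<close>

lemma seq_colimitI:
 assumes D: "is_functor K SC D" and coc: "is_cocone K SC D Ls inc" and ne: "Obj K ~= {}"
  and c: "!!i. i < length Ls ==> is_colimit K C (component i D) (Ls ! i) (%k. inc k ! i)"
 shows "is_colimit K SC D Ls inc"
proof -
 interpret K: Category K by unfold_locales (rule functorD(1)[OF D])
 note S = seq_coconeD[OF D coc]
 obtain k0 where k0: "k0 : Obj K" using ne by blast
 show ?thesis unfolding is_colimit_def
 proof (intro conjI allI impI)
  fix Ts f assume f: "is_cocone K SC D Ts f"
  note F = seq_coconeD[OF D f]
  have len: "length Ts = length Ls" using S(1)[OF k0] F(1)[OF k0] by simp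
  have "EX h. h : Hom C (Ls ! i) (Ts ! i) & (ALL k:Obj K. h \<cdot> inc k ! i = f k ! i)" if i: "i < length Ls" for i
   using is_colimit_ex[OF c[OF i] F(4)] i len by metis
  then obtain h where h: "!!i. i < length Ls ==> h i : Hom C (Ls ! i) (Ts ! i)"
   "!!i k. i < length Ls ==> k : Obj K ==> h i \<cdot> inc k ! i = f k ! i" by metis
  let ?h = "map h [0..<length Ls]"
  show "EX! hs. hs : Hom SC Ls Ts & (ALL k:Obj K. hs \<star>SC inc k = f k)"
  proof (intro ex1I[of _ ?h] conjI ballI)
   show "?h : Hom SC Ls Ts" using h len by (simp add: seq_Hom_iff)
   show "?h \<star>SC inc k = f k" if "k : Obj K" for k
    using h(2) that S(2)[OF that] F(2)[OF that] len by (auto intro!: nth_equalityI)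
   fix hs assume hs: "hs : Hom SC Ls Ts & (ALL k:Obj K. hs \<star>SC inc k = f k)"
   then have lh: "length hs = length Ls" by (simp add: seq_Hom_iff)
   show "hs = ?h"
   proof (rule nth_equalityI)
    fix i assume "i < length hs"
    then have i: "i < length Ls" using lh by simp
    have "hs ! i = h i"
    proof (rule is_colimit_eq[OF category S(5)[OF i] c[OF i] _ h(1)[OF i]])
     show "hs ! i : Hom C (Ls ! i) (Ts ! i)" using hs i by (auto simp: seq_Hom_iff)
     show "hs ! i \<cdot> inc k ! i = h i \<cdot> inc k ! i" if k: "k : Obj K" for k
     proof -
      have "(hs \<star>SC inc k) ! i = f k ! i" using hs k by simp
      then show ?thesis using h(2)[OF i k] S(2)[OF k] lh i by simp
     qed
    qed
    then show "hs ! i = ?h ! i" using i by simp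
   qed (use lh in simp)
  qed
 qed (rule coc)
qed

end

section \<open>Accessibility\<close>

lemma filtered_transport:
 fixes lam :: "'l rel"
 assumes K: "filtered lam K" and e: "inj_on e (Arr K)"
 shows "filtered lam (transport K e)"
proof -
 have cK: "category K" using K by (simp add: filtered_def)
 interpret K: Category K by unfold_locales (rule cK)
 note ts = transport_sel[OF cK e] and us = untransport_sel[OF cK e]
 show ?thesis unfolding filtered_def
 proof (intro conjI allI impI)
  fix M :: "('l, 'l) cat" and D assume D: "is_functor M (transport K e) D" and M: "|Arr M| <o lam"
  have "is_functor M K (comp_ftor (untransport K e) D)"
   using D functor_untransport[OF cK e] unfolding is_functor_def comp_ftor_def by (auto simp: Hom_def)
  then obtain L f where c: "is_cocone M K (comp_ftor (untransport K e) D) L f" using K M unfolding filtered_def by blast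
  have "is_cocone M (transport K e) D (e (Ide K L)) (e \<circ> f)" unfolding is_cocone_def
  proof (intro conjI ballI)
   show "e (Ide K L) : Obj (transport K e)" using c by (simp add: is_cocone_def ts)
   fix m assume m: "m : Obj M"
   obtain j where j: "j : Obj K" "OMap D m = e (Ide K j)" using functorD(3)[OF D m] by (auto simp: ts)
   have "f m : Hom K (OMap (untransport K e) (OMap D m)) L" using c m by (simp add: is_cocone_def comp_ftor_def)
   then have "f m : Hom K j L" using j us(2) by simp
   then show "(e \<circ> f) m : Hom (transport K e) (OMap D m) (e (Ide K L))" using j by (auto simp: Hom_def ts)
  next
   fix t assume t: "t : Arr M"
   have "AMap D t : Arr (transport K e)" using D t by (auto simp: is_functor_def Hom_def)
   then obtain s where s: "s : Arr K" "AMap D t = e s" by (auto simp: ts)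
   have f: "f (Cod M t) : Arr K" using c functorD(1)[OF D] t by (auto simp: is_cocone_def Hom_def category_def)
   have "f (Cod M t) \<star>K AMap (untransport K e) (AMap D t) = f (Dom M t)" using c t by (simp add: is_cocone_def comp_ftor_def)
   then have "f (Cod M t) \<star>K s = f (Dom M t)" using s us(1) by simp
   then show "(e \<circ> f) (Cod M t) \<star>(transport K e) AMap D t = (e \<circ> f) (Dom M t)" using s f by (simp add: ts)
  qed
  then show "EX L f. is_cocone M (transport K e) D L f" by blast
 qed (rule category_transport[OF cK e])
qed

text \<open>Transport makes accessibility applicable to shapes of any type, in particular to
  coslices, whose objects are arrows of \<open>J\<close>.\<close>

lemma accessible_small:
 fixes U :: "'u itself" and lam :: "'l rel" and K :: "('j, 't) cat"
 assumes acc: "accessible U lam C D F" and sm: "small U (Arr K)" and fil: "filtered lam K"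
  and G: "is_functor K C G" and colim: "is_colimit K C G L inc"
 shows "is_colimit K D (comp_ftor F G) (OMap F L) (AMap F \<circ> inc)"
proof -
 obtain e :: "'t => 'u" where e: "inj_on e (Arr K)" using small_embedding[OF sm] by blast
 have cK: "category K" using fil by (simp add: filtered_def)
 let ?K = "transport K e" and ?u = "untransport K e"
 have "small_category U ?K"
  unfolding small_category_def transport_sel[OF cK e] using category_transport[OF cK e] small_image[OF sm] by blast
 moreover have "filtered lam ?K" by (rule filtered_transport[OF fil e])
 moreover have "is_functor ?K C (comp_ftor G ?u)"
  using G functor_untransport[OF cK e] unfolding is_functor_def comp_ftor_def by (auto simp: Hom_def)
 moreover have "is_colimit ?K C (comp_ftor G ?u) L (inc \<circ> OMap ?u)" unfolding colimit_transport[OF cK e] by (rule colim)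
 ultimately have "is_colimit ?K D (comp_ftor F (comp_ftor G ?u)) (OMap F L) (AMap F \<circ> (inc \<circ> OMap ?u))"
  using acc unfolding accessible_def by blast
 moreover have "comp_ftor F (comp_ftor G ?u) = comp_ftor (comp_ftor F G) ?u" by (simp add: comp_ftor_def comp_assoc)
 ultimately show ?thesis
  using colimit_transport[OF cK e, of D "comp_ftor F G" "OMap F L" "AMap F \<circ> inc"] by (simp add: comp_assoc)
qed

lemma is_cocone_map:
 assumes F: "is_functor C D F" and G: "is_functor J C G" and c: "is_cocone J C G L inc"
 shows "is_cocone J D (comp_ftor F G) (OMap F L) (AMap F \<circ> inc)" unfolding is_cocone_def
proof (intro conjI ballI)
 interpret J: Category J by unfold_locales (rule functorD(1)[OF G])
 have i: "inc j : Hom C (OMap G j) L" if "j : Obj J" for j using c that by (simp add: is_cocone_def)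
 show "OMap F L : Obj D" using functorD(3)[OF F] c by (simp add: is_cocone_def)
 show "(AMap F \<circ> inc) j : Hom D (OMap (comp_ftor F G) j) (OMap F L)" if "j : Obj J" for j
  using functorD(4)[OF F i[OF that]] by (simp add: comp_ftor_def)
 fix t assume t: "t : Arr J"
 have "AMap G t : Hom C (OMap G (Dom J t)) (OMap G (Cod J t))" by (rule functorD(4)[OF G]) (use t in "simp add: Hom_def")
 from functorD(6)[OF F this i] show "(AMap F \<circ> inc) (Cod J t) \<star>D AMap (comp_ftor F G) t = (AMap F \<circ> inc) (Dom J t)"
  using c t by (simp add: is_cocone_def comp_ftor_def)
qed

lemma is_functor_comp: "is_functor C D F ==> is_functor J C G ==> is_functor J D (comp_ftor F G)"
 unfolding is_functor_def comp_ftor_def by (auto simp: Hom_def)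

section \<open>Filtered colimits of graphs, computed stage by stage\<close>

locale Filtered_Graph_Colimit = VGraphs V U + J: Filtered lam J
 for V :: "('o, 'a) cat" (structure) and U :: "'u itself" and lam :: "'l rel" and J :: "('j, 't) cat" +
 fixes G :: "('j, 't, ('u, 'o) vgraph, ('u, 'o, 'a) vgraph_map) ftor" and L inc
 assumes G: "is_functor J GV G" and graph_colimit: "graph_colimit J G L inc"
begin

lemma cocone: "is_cocone J GV G L inc" using graph_colimit by (simp add: graph_colimit_def)

lemmas L_Obj = GcoconeD(1)[OF G cocone]
lemmas inc_Hom = GcoconeD(2)[OF G cocone]
lemmas G_Hom = functorD(4)[OF G]
lemmas G_Obj = functorD(3)[OF G]

abbreviation gv :: "'t => 'u => 'u" where "gv t \<equiv> VMap (AMap G t)"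

lemma gv_Verts: "t : Hom J j k ==> x : Verts (OMap G j) ==> gv t x : Verts (OMap G k)" using GHomD(5)[OF G_Hom] .

lemma G_comp:
 assumes "t : Hom J j k" "s : Hom J k m" "x : Verts (OMap G j)"
 shows "gv (s \<star>J t) x = gv s (gv t x)"
  "y : Verts (OMap G j) ==> EMap (AMap G (s \<star>J t)) (x, y) = EMap (AMap G s) (gv t x, gv t y) ** EMap (AMap G t) (x, y)"
 unfolding functorD(6)[OF G assms(1,2)] using GComp[OF G_Hom[OF assms(1)] assms(3)] by auto

lemma G_Ide:
 assumes "j : Obj J" "x : Verts (OMap G j)"
 shows "gv (Ide J j) x = x" "y : Verts (OMap G j) ==> EMap (AMap G (Ide J j)) (x, y) = Ide V (Edge (OMap G j) (x, y))"
 unfolding functorD(5)[OF G assms(1)] using GIde[OF assms(2)] by auto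

lemma inc_comp:
 assumes "t : Hom J j k" "x : Verts (OMap G j)"
 shows "VMap (inc k) (gv t x) = VMap (inc j) x"
  "y : Verts (OMap G j) ==> EMap (inc k) (gv t x, gv t y) ** EMap (AMap G t) (x, y) = EMap (inc j) (x, y)"
 using GcoconeD(3,4)[OF G cocone, of t x] assms by (auto simp: Hom_def)

text \<open>Filteredness reduces the generated equivalence to equality at a later stage: a zigzag is
  followed from one end, a forward step being absorbed by completing a span and a backward step by
  composing.\<close>

lemma merge:
 assumes "j : Obj J" "j' : Obj J" "x : Verts (OMap G j)" "x' : Verts (OMap G j')" "VMap (inc j) x = VMap (inc j') x'"
 obtains k t t' where "t : Hom J j k" "t' : Hom J j' k" "gv t x = gv t' x'"
proof -
 let ?S = "%b. fst b : Obj J & snd b : Verts (OMap G (fst b)) &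
  (EX k t t'. t : Hom J j k & t' : Hom J (fst b) k & gv t x = gv t' (snd b))"
 define R where "R = {((Dom J t, x), (Cod J t, gv t x)) | t x. t : Arr J & x : Verts (OMap G (Dom J t))}"
 have "((j, x), (j', x')) : vertex_rel J G" using graph_colimit assms by (auto simp: graph_colimit_def)
 then have "((j, x), (j', x')) : (R \<union> R\<inverse>)\<^sup>*" by (simp add: vertex_rel_def R_def Let_def)
 then have "?S (j', x')"
 proof (induction rule: rtrancl_induct)
  case base
  then show ?case using assms J.Ide_Hom by auto
 next
  case (step b c)
  then obtain k t t' where t: "t : Hom J j k" "t' : Hom J (fst b) k" "gv t x = gv t' (snd b)"
   and b: "fst b : Obj J" "snd b : Verts (OMap G (fst b))" by blast
  from step(2) show ?case
  proof
   assume "(b, c) : R"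
   then obtain a where a: "a : Hom J (fst b) (fst c)" "snd c = gv a (snd b)" by (auto simp: R_def Hom_def)
   obtain m r r' where r: "r : Hom J k m" "r' : Hom J (fst c) m" "r \<star>J t' = r' \<star>J a" using J.span[OF t(2) a(1)] by metis
   have "gv (r \<star>J t) x = gv r' (snd c)"
    using G_comp(1)[OF t(1) r(1) assms(3)] G_comp(1)[OF t(2) r(1) b(2)] G_comp(1)[OF a(1) r(2) b(2)] t(3) a(2) r(3) by simp
   then show ?thesis using J.comp_Hom[OF t(1) r(1)] r(2) a gv_Verts[OF a(1) b(2)] J.Hom_Obj[OF a(1)] by auto
  next
   assume "(b, c) : R\<inverse>"
   then obtain a where a: "a : Hom J (fst c) (fst b)" "snd b = gv a (snd c)" "snd c : Verts (OMap G (fst c))"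
    by (auto simp: R_def Hom_def)
   have "gv t x = gv (t' \<star>J a) (snd c)" using G_comp(1)[OF a(1) t(2) a(3)] t(3) a(2) by simp
   then show ?thesis using J.comp_Hom[OF a(1) t(2)] t(1) a(3) J.Hom_Obj[OF a(1)] by auto
  qed
 qed
 then show ?thesis using that by auto
qed

text \<open>Finitely many vertices can be moved to a common stage by repeated bounding.\<close>

lemma lift_list:
 assumes "set p \<subseteq> Verts L"
 shows "EX j p'. j : Obj J & set p' \<subseteq> Verts (OMap G j) & map (VMap (inc j)) p' = p" using assms
proof (induction p)
 case Nil
 then show ?case using J.nonempty by auto
next
 case (Cons v p)
 then obtain j p' where j: "j : Obj J" "set p' \<subseteq> Verts (OMap G j)" "map (VMap (inc j)) p' = p" by auto
 obtain j' x where j': "j' : Obj J" "x : Verts (OMap G j')" "VMap (inc j') x = v"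
  using graph_colimit Cons.prems by (auto simp: graph_colimit_def)
 obtain k t t' where t: "t : Hom J j k" "t' : Hom J j' k" using J.bound[OF j(1) j'(1)] by metis
 have "map (VMap (inc k)) (gv t' x # map (gv t) p') = v # p"
  using inc_comp(1)[OF t(1) subsetD[OF j(2)]] inc_comp(1)[OF t(2) j'(2)] j(3) j'(3) by auto
 moreover have "set (gv t' x # map (gv t) p') \<subseteq> Verts (OMap G k)" using gv_Verts t j j' by auto
 moreover have "k : Obj J" using J.Hom_Obj[OF t(1)] by blast
 ultimately show ?case by (intro exI[of _ k] exI[of _ "gv t' x # map (gv t) p'"] conjI)
qed

lemma merge_lists:
 assumes "j : Obj J" "j' : Obj J" "set p \<subseteq> Verts (OMap G j)" "set p' \<subseteq> Verts (OMap G j')"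
  "map (VMap (inc j)) p = map (VMap (inc j')) p'"
 shows "EX k t t'. t : Hom J j k & t' : Hom J j' k & map (gv t) p = map (gv t') p'" using assms
proof (induction p arbitrary: p')
 case Nil
 then show ?case using J.bound[OF assms(1,2)] by (metis list.map_disc_iff)
next
 case (Cons x p)
 then obtain x' q where p': "p' = x' # q" by (cases p') auto
 obtain k t t' where t: "t : Hom J j k" "t' : Hom J j' k" "gv t x = gv t' x'"
  by (rule merge[OF assms(1,2), of x x']) (use Cons.prems p' in auto)
 have "EX k' s s'. s : Hom J j k' & s' : Hom J j' k' & map (gv s) p = map (gv s') q"
  by (rule Cons.IH) (use assms(1,2) Cons.prems p' in simp_all)
 then obtain k' s s' where s: "s : Hom J j k'" "s' : Hom J j' k'" "map (gv s) p = map (gv s') q" by blast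
 obtain m r r' where r: "r : Hom J k m" "r' : Hom J k' m" "r \<star>J t = r' \<star>J s" "r \<star>J t' = r' \<star>J s'"
  using J.amalgamate[OF t(1) s(1) t(2) s(2)] by metis
 have "gv (r \<star>J t) x = gv (r \<star>J t') x'"
  using G_comp(1)[OF t(1) r(1)] G_comp(1)[OF t(2) r(1)] t(3) Cons.prems p' by simp
 moreover have "map (gv (r \<star>J t)) p = map (gv (r \<star>J t')) q"
 proof -
  have "map (gv (r' \<star>J s)) p = map (gv r') (map (gv s) p)" using G_comp(1)[OF s(1) r(2)] Cons.prems by auto
  moreover have "map (gv (r' \<star>J s')) q = map (gv r') (map (gv s') q)" using G_comp(1)[OF s(2) r(2)] Cons.prems p' by auto
  ultimately show ?thesis using s(3) r(3,4) by simp
 qed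
 ultimately show ?case
  using J.comp_Hom[OF t(1) r(1)] J.comp_Hom[OF t(2) r(1)] p' by (intro exI[of _ m] exI[of _ "r \<star>J t"] exI[of _ "r \<star>J t'"]) simp
qed

text \<open>Once \<open>x\<close> and \<open>y\<close> are chosen at a stage, the homs between their
  images at later stages form a diagram on the coslice under that stage.\<close>

definition edge_diagram :: "'u => 'u => ('t, 't \<times> 't, 'o, 'a) ftor" where
 "edge_diagram x y = \<lparr>OMap = (%t. Edge (OMap G (Cod J t)) (gv t x, gv t y)),
   AMap = (%(t, s). EMap (AMap G s) (gv t x, gv t y))\<rparr>"

lemma coslice_sel: "t : Obj (coslice J j) \<longleftrightarrow> t : Hom J j (Cod J t)"
 "(t, s) : Arr (coslice J j) \<longleftrightarrow> t : Hom J j (Cod J t) & s : Hom J (Cod J t) (Cod J s)"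
 "Dom (coslice J j) (t, s) = t" "Cod (coslice J j) (t, s) = s \<star>J t"
 "Ide (coslice J j) t = (t, Ide J (Cod J t))" "(t', s') \<star>(coslice J j) (t, s) = (t, s' \<star>J s)"
 by (auto simp: coslice_def Hom_def)

text \<open>\<open>edge_colimit\<close> takes all stages and all preimages of a pair of vertices
  into account. The images of one chosen preimage are cofinal among these, because any other
  preimage meets them at a later stage.\<close>

lemma coslice_colimit:
 assumes j: "j : Obj J" and x: "x : Verts (OMap G j)" and y: "y : Verts (OMap G j)"
 shows "is_colimit (coslice J j) V (edge_diagram x y) (Edge L (VMap (inc j) x, VMap (inc j) y))
  (%t. EMap (inc (Cod J t)) (gv t x, gv t y))"
proof -
 let ?v = "VMap (inc j) x" and ?w = "VMap (inc j) y"
 have vw: "?v : Verts L" "?w : Verts L" using GHomD(5)[OF inc_Hom[OF j]] x y by auto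
 have TO: "Cod J t : Obj J" if "t : Hom J j (Cod J t)" for t using J.Hom_Obj[OF that] by blast
 show ?thesis unfolding is_colimit_def
 proof (intro conjI allI impI)
  show "is_cocone (coslice J j) V (edge_diagram x y) (Edge L (?v, ?w)) (%t. EMap (inc (Cod J t)) (gv t x, gv t y))"
   unfolding is_cocone_def
  proof (intro conjI ballI)
   show "Edge L (?v, ?w) : Obj V" by (rule GObjD(2)[OF L_Obj vw])
   fix t assume "t : Obj (coslice J j)"
   then have t: "t : Hom J j (Cod J t)" by (simp add: coslice_sel)
   show "EMap (inc (Cod J t)) (gv t x, gv t y) : Hom V (OMap (edge_diagram x y) t) (Edge L (?v, ?w))"
    using GHomD(6)[OF inc_Hom[OF TO[OF t]] gv_Verts[OF t x] gv_Verts[OF t y]] inc_comp(1)[OF t x] inc_comp(1)[OF t y]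
    by (simp add: edge_diagram_def)
  next
   fix ts assume "ts : Arr (coslice J j)"
   then obtain t s where ts: "ts = (t, s)" "t : Hom J j (Cod J t)" "s : Hom J (Cod J t) (Cod J s)"
    using coslice_sel(2) by (metis surj_pair)
   have c: "Cod J (s \<star>J t) = Cod J s" using J.comp_Hom[OF ts(2,3)] by (simp add: Hom_def)
   show "EMap (inc (Cod J (Cod (coslice J j) ts))) (gv (Cod (coslice J j) ts) x, gv (Cod (coslice J j) ts) y) \<cdot>
     AMap (edge_diagram x y) ts = EMap (inc (Cod J (Dom (coslice J j) ts))) (gv (Dom (coslice J j) ts) x, gv (Dom (coslice J j) ts) y)"
    using inc_comp(2)[OF ts(3) gv_Verts[OF ts(2) x] gv_Verts[OF ts(2) y]] G_comp(1)[OF ts(2,3) x] G_comp(1)[OF ts(2,3) y]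
    by (simp add: ts(1) coslice_sel edge_diagram_def c)
  qed
  fix T f assume f: "is_cocone (coslice J j) V (edge_diagram x y) T f"
  have T: "T : Obj V" using f by (simp add: is_cocone_def)
  have fH: "f t : Hom V (Edge (OMap G k) (gv t x, gv t y)) T" if "t : Hom J j k" for t k
   using f that by (auto simp: is_cocone_def coslice_sel edge_diagram_def Hom_def)
  have fc: "f (s \<star>J t) ** EMap (AMap G s) (gv t x, gv t y) = f t" if "t : Hom J j k" "s : Hom J k m" for t s k m
  proof -
   have "(t, s) : Arr (coslice J j)" using that by (auto simp: coslice_sel Hom_def)
   then have "f (Cod (coslice J j) (t, s)) ** AMap (edge_diagram x y) (t, s) = f (Dom (coslice J j) (t, s))"
    using f unfolding is_cocone_def by blast
   then show ?thesis by (simp add: coslice_sel edge_diagram_def)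
  qed
  \<comment> \<open>At stage \<open>k\<close> the pair \<open>(a, b)\<close> coming from stage
    \<open>i\<close> has become the image of \<open>(x, y)\<close> under \<open>t\<close>.\<close>
  let ?P = "%i a b k t s. t : Hom J j k & s : Hom J i k & gv s a = gv t x & gv s b = gv t y"
  have ex: "EX k t s. ?P i a b k t s"
   if "i : Obj J" "a : Verts (OMap G i)" "b : Verts (OMap G i)" "VMap (inc i) a = ?v" "VMap (inc i) b = ?w" for i a b
   using merge_lists[OF that(1) j, of "[a, b]" "[x, y]"] that x y by fastforce
  \<comment> \<open>Two meetings of \<open>(a, b)\<close> with \<open>(x, y)\<close> are compared at
    a stage where both pairs of composites agree, provided by \<open>amalgamate\<close>.\<close>
  have indep: "f t ** EMap (AMap G s) (a, b) = f t' ** EMap (AMap G s') (a, b)"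
   if ab: "a : Verts (OMap G i)" "b : Verts (OMap G i)" and P: "?P i a b k t s" and P': "?P i a b k' t' s'" for i a b k t s k' t' s'
  proof -
   obtain m r r' where r: "r : Hom J k m" "r' : Hom J k' m" "r \<star>J t = r' \<star>J t'" "r \<star>J s = r' \<star>J s'"
    using J.amalgamate[of t j k t' k' s i s'] P P' by metis
   have *: "f t ** EMap (AMap G s) (a, b) = f (r \<star>J t) ** EMap (AMap G (r \<star>J s)) (a, b)"
    if P: "?P i a b k t s" and r: "r : Hom J k m" for k t s r
   proof -
    have t: "t : Hom J j k" and s: "s : Hom J i k" and g: "gv s a = gv t x" "gv s b = gv t y" using P by auto
    have "f (r \<star>J t) : Hom V (Edge (OMap G m) (gv r (gv t x), gv r (gv t y))) T"
     using fH[OF J.comp_Hom[OF t r]] G_comp(1)[OF t r] x y by simp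
    from V.assoc[OF GHomD(6)[OF G_Hom[OF s] ab, unfolded g] GHomD(6)[OF G_Hom[OF r] gv_Verts[OF t x] gv_Verts[OF t y]] this]
    show ?thesis using G_comp(2)[OF s r ab] fc[OF t r] g by simp
   qed
   show ?thesis using *[OF P r(1)] *[OF P' r(2)] r(3,4) by simp
  qed
  \<comment> \<open>The cocone on the coslice is extended to every hom over the pair, by passing to
    any stage where it meets the chosen preimage.\<close>
  define g where "g i a b = (let kts = SOME kts. ?P i a b (fst kts) (fst (snd kts)) (snd (snd kts))
   in f (fst (snd kts)) ** EMap (AMap G (snd (snd kts))) (a, b))" for i a b
  have g: "g i a b = f t ** EMap (AMap G s) (a, b)" if ab: "a : Verts (OMap G i)" "b : Verts (OMap G i)" and P: "?P i a b k t s" for i a b k t s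
  proof -
   let ?Q = "%kts. ?P i a b (fst kts) (fst (snd kts)) (snd (snd kts))"
   have "?Q (SOME kts. ?Q kts)" by (rule someI[of ?Q "(k, t, s)"]) (use P in simp)
   from indep[OF ab this P] show ?thesis by (simp add: g_def Let_def)
  qed
  have "edge_cocone J G inc ?v ?w T g" unfolding edge_cocone_def
  proof (intro conjI ballI impI)
   fix i a b assume i: "i : Obj J" "a : Verts (OMap G i)" "b : Verts (OMap G i)" "VMap (inc i) a = ?v" "VMap (inc i) b = ?w"
   obtain k t s where P: "?P i a b k t s" using ex[OF i] by blast
   then show "g i a b : Hom V (Edge (OMap G i) (a, b)) T"
    using g[OF i(2,3) P] V.comp_Hom[OF GHomD(6)[OF G_Hom[of s i k] i(2,3)], of "f t" T] fH[of t k] by simp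
  next
   fix t0 a b assume t0: "t0 : Arr J" and a: "a : Verts (OMap G (Dom J t0))" "b : Verts (OMap G (Dom J t0))"
    and va: "VMap (inc (Dom J t0)) a = ?v" "VMap (inc (Dom J t0)) b = ?w"
   have t0H: "t0 : Hom J (Dom J t0) (Cod J t0)" using t0 by (simp add: Hom_def)
   note a' = gv_Verts[OF t0H a(1)] gv_Verts[OF t0H a(2)]
   have va': "VMap (inc (Cod J t0)) (gv t0 a) = ?v" "VMap (inc (Cod J t0)) (gv t0 b) = ?w" using inc_comp(1)[OF t0H] a va by auto
   obtain k t s where P: "?P (Cod J t0) (gv t0 a) (gv t0 b) k t s" using ex[OF _ a' va'] t0 by auto
   then have s: "s : Hom J (Cod J t0) k" and t: "t : Hom J j k" by auto
   have P': "?P (Dom J t0) a b k t (s \<star>J t0)" using P J.comp_Hom[OF t0H s] G_comp(1)[OF t0H s] a by auto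
   have ft: "f t : Hom V (Edge (OMap G k) (gv s (gv t0 a), gv s (gv t0 b))) T" using fH[OF t] P by simp
   show "g (Cod J t0) (gv t0 a) (gv t0 b) ** EMap (AMap G t0) (a, b) = g (Dom J t0) a b"
    using g[OF a' P] g[OF a P'] G_comp(2)[OF t0H s a] V.assoc[OF GHomD(6)[OF G_Hom[OF t0H] a] GHomD(6)[OF G_Hom[OF s] a'] ft] by simp
  qed
  moreover have ec: "edge_colimit J G L inc ?v ?w" using graph_colimit vw by (auto simp: graph_colimit_def)
  ultimately have ex1: "EX! h. h : Hom V (Edge L (?v, ?w)) T & (ALL i:Obj J. ALL a:Verts (OMap G i). ALL b:Verts (OMap G i).
      VMap (inc i) a = ?v --> VMap (inc i) b = ?w --> h ** EMap (inc i) (a, b) = g i a b)" using T unfolding edge_colimit_def by blast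
  have eqv: "(ALL t:Obj (coslice J j). h ** EMap (inc (Cod J t)) (gv t x, gv t y) = f t) \<longleftrightarrow>
   (ALL i:Obj J. ALL a:Verts (OMap G i). ALL b:Verts (OMap G i).
      VMap (inc i) a = ?v --> VMap (inc i) b = ?w --> h ** EMap (inc i) (a, b) = g i a b)" if h: "h : Hom V (Edge L (?v, ?w)) T" for h
  proof (intro iffI ballI impI)
   fix i a b assume *: "ALL t:Obj (coslice J j). h ** EMap (inc (Cod J t)) (gv t x, gv t y) = f t"
    and i: "i : Obj J" "a : Verts (OMap G i)" "b : Verts (OMap G i)" "VMap (inc i) a = ?v" "VMap (inc i) b = ?w"
   obtain k t s where P: "?P i a b k t s" using ex[OF i] by blast
   then have t: "t : Hom J j k" and s: "s : Hom J i k" and gs: "gv s a = gv t x" "gv s b = gv t y" by auto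
   have ct: "Cod J t = k" using t by (simp add: Hom_def)
   have "h ** EMap (inc k) (gv t x, gv t y) = f t" using *[rule_format, of t] t by (simp add: coslice_sel ct)
   moreover have e: "EMap (inc k) (gv t x, gv t y) : Hom V (Edge (OMap G k) (gv s a, gv s b)) (Edge L (?v, ?w))"
    using GHomD(6)[OF inc_Hom gv_Verts[OF t x] gv_Verts[OF t y]] J.Hom_Obj[OF t] inc_comp(1)[OF t] x y gs by simp
   have "(h ** EMap (inc k) (gv t x, gv t y)) ** EMap (AMap G s) (a, b) = h ** EMap (inc i) (a, b)"
    using V.assoc[OF GHomD(6)[OF G_Hom[OF s] i(2,3)] e h] inc_comp(2)[OF s i(2,3)] gs by simp
   ultimately show "h ** EMap (inc i) (a, b) = g i a b" using g[OF i(2,3) P] by simp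
  next
   fix t assume *: "ALL i:Obj J. ALL a:Verts (OMap G i). ALL b:Verts (OMap G i).
      VMap (inc i) a = ?v --> VMap (inc i) b = ?w --> h ** EMap (inc i) (a, b) = g i a b" and "t : Obj (coslice J j)"
   then have t: "t : Hom J j (Cod J t)" by (simp add: coslice_sel)
   note xy = gv_Verts[OF t x] gv_Verts[OF t y]
   have k: "Cod J t : Obj J" using J.Hom_Obj[OF t] by blast
   have "?P (Cod J t) (gv t x) (gv t y) (Cod J t) t (Ide J (Cod J t))" using t J.Ide_Hom[OF k] G_Ide(1)[OF k] xy by simp
   from g[OF xy this] have "g (Cod J t) (gv t x) (gv t y) = f t" using G_Ide(2)[OF k xy] V.id_r[OF fH[OF t]] by simp
   then show "h ** EMap (inc (Cod J t)) (gv t x, gv t y) = f t" using *[rule_format, OF k xy] inc_comp(1)[OF t] x y by simp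
  qed
  have "(%h. h : Hom V (Edge L (?v, ?w)) T & (ALL t:Obj (coslice J j). h ** EMap (inc (Cod J t)) (gv t x, gv t y) = f t)) =
   (%h. h : Hom V (Edge L (?v, ?w)) T & (ALL i:Obj J. ALL a:Verts (OMap G i). ALL b:Verts (OMap G i).
      VMap (inc i) a = ?v --> VMap (inc i) b = ?w --> h ** EMap (inc i) (a, b) = g i a b))" by (rule ext) (rule conj_cong[OF refl eqv])
  from iffD2[OF arg_cong[OF this, of Ex1] ex1]
  show "EX! h. h : Hom V (Edge L (?v, ?w)) T & (ALL t:Obj (coslice J j). h ** EMap (inc (Cod J t)) (gv t x, gv t y) = f t)" .
 qed
qed

definition path_diagram :: "'u list => ('t, 't \<times> 't, 'o list, 'a list) ftor" where
 "path_diagram p = \<lparr>OMap = (%t. map (Edge (OMap G (Cod J t))) (steps (map (gv t) p))),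
   AMap = (%(t, s). map (EMap (AMap G s)) (steps (map (gv t) p)))\<rparr>"

text \<open>Componentwise these are the diagrams of the single steps of \<open>p\<close>, and the
  coslice is nonempty, containing the identity of \<open>j\<close>; so \<open>seq_colimitI\<close>
  applies.\<close>

lemma path_diagram_colimit:
 assumes j: "j : Obj J" and p: "set p \<subseteq> Verts (OMap G j)"
 shows "is_functor (coslice J j) SV (path_diagram p)"
  "is_colimit (coslice J j) SV (path_diagram p) (map (Edge L) (steps (map (VMap (inc j)) p)))
   (%t. map (EMap (inc (Cod J t))) (steps (map (gv t) p)))"
proof -
 have pn: "p ! i : Verts (OMap G j)" if "i < length p" for i using p that by auto
 have comp: "component i (path_diagram p) = edge_diagram (p ! i) (p ! Suc i)" if "i < length p - 1" for i
  using that by (auto simp: component_def path_diagram_def edge_diagram_def fun_eq_iff nth_steps length_steps)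
 note colim = coslice_colimit[OF j pn pn]
 have H: "map (EMap (AMap G s)) (steps (map (gv t) p)) \<in>
  Hom SV (map (Edge (OMap G k)) (steps (map (gv t) p))) (map (Edge (OMap G m)) (steps (map (gv (s \<star>J t)) p)))"
  if t: "t : Hom J j k" and s: "s : Hom J k m" for t s k m unfolding seq_Hom_iff
  using GHomD(6)[OF G_Hom[OF s] gv_Verts[OF t] gv_Verts[OF t]] G_comp(1)[OF t s] pn by (simp add: length_steps nth_steps)
 show F: "is_functor (coslice J j) SV (path_diagram p)"
 proof (rule is_functorI[OF J.category_coslice V.category_seq_cat])
  fix t assume "t : Obj (coslice J j)"
  then have t: "t : Hom J j (Cod J t)" by (simp add: coslice_sel)
  have k: "Cod J t : Obj J" using J.Hom_Obj[OF t] by blast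
  show "OMap (path_diagram p) t : Obj SV" using GObjD(2)[OF G_Obj[OF k] gv_Verts[OF t] gv_Verts[OF t]] pn
   by (auto simp: path_diagram_def in_lists_conv_set in_set_conv_nth length_steps nth_steps)
  show "AMap (path_diagram p) (Ide (coslice J j) t) = Ide SV (OMap (path_diagram p) t)"
   using G_Ide(2)[OF k gv_Verts[OF t] gv_Verts[OF t]] pn
   by (intro nth_equalityI) (simp_all add: path_diagram_def coslice_sel length_steps nth_steps)
 next
  fix ts t t' assume "ts : Hom (coslice J j) t t'"
  then obtain s where ts: "ts = (t, s)" "t : Hom J j (Cod J t)" "s : Hom J (Cod J t) (Cod J s)" "t' = s \<star>J t"
   by (cases ts) (auto simp: Hom_def coslice_def)
  have "Cod J (s \<star>J t) = Cod J s" using J.comp_Hom[OF ts(2,3)] by (simp add: Hom_def)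
  then show "AMap (path_diagram p) ts : Hom SV (OMap (path_diagram p) t) (OMap (path_diagram p) t')"
   using H[OF ts(2,3)] by (simp add: ts(1,4) path_diagram_def)
  fix ts' t'' assume "ts' : Hom (coslice J j) t' t''"
  then obtain s' where ts': "ts' = (t', s')" "s' : Hom J (Cod J t') (Cod J s')" by (cases ts') (auto simp: Hom_def coslice_def)
  have s': "s' : Hom J (Cod J s) (Cod J s')" using ts'(2) ts(4) \<open>Cod J (s \<star>J t) = Cod J s\<close> by simp
  show "AMap (path_diagram p) (ts' \<star>(coslice J j) ts) = AMap (path_diagram p) ts' \<star>SV AMap (path_diagram p) ts"
   using G_comp(2)[OF ts(3) s' gv_Verts[OF ts(2)] gv_Verts[OF ts(2)]] G_comp(1)[OF ts(2,3)] pn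
   by (auto simp: path_diagram_def ts ts' coslice_sel length_steps nth_steps intro!: nth_equalityI)
 qed
 have jj: "Ide J j : Obj (coslice J j)" using J.Ide_Hom[OF j] by (simp add: coslice_sel Hom_def)
 have coc: "is_cocone (coslice J j) SV (path_diagram p) (map (Edge L) (steps (map (VMap (inc j)) p)))
   (%t. map (EMap (inc (Cod J t))) (steps (map (gv t) p)))" unfolding is_cocone_def
 proof (intro conjI ballI)
  show "map (Edge L) (steps (map (VMap (inc j)) p)) : Obj SV"
   using GObjD(2)[OF L_Obj GHomD(5)[OF inc_Hom[OF j]] GHomD(5)[OF inc_Hom[OF j]]] pn
   by (auto simp: in_lists_conv_set in_set_conv_nth length_steps nth_steps)
  fix t assume "t : Obj (coslice J j)"
  then have t: "t : Hom J j (Cod J t)" by (simp add: coslice_sel)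
  have k: "Cod J t : Obj J" using J.Hom_Obj[OF t] by blast
  show "map (EMap (inc (Cod J t))) (steps (map (gv t) p)) : Hom SV (OMap (path_diagram p) t)
   (map (Edge L) (steps (map (VMap (inc j)) p)))" using GHomD(6)[OF inc_Hom[OF k] gv_Verts[OF t] gv_Verts[OF t]] inc_comp(1)[OF t] pn
   by (simp add: seq_Hom_iff path_diagram_def length_steps nth_steps)
 next
  fix ts assume "ts : Arr (coslice J j)"
  then obtain t s where ts: "ts = (t, s)" "t : Hom J j (Cod J t)" "s : Hom J (Cod J t) (Cod J s)"
   using coslice_sel(2) by (metis surj_pair)
  have c: "Cod J (s \<star>J t) = Cod J s" using J.comp_Hom[OF ts(2,3)] by (simp add: Hom_def)
  show "map (EMap (inc (Cod J (Cod (coslice J j) ts)))) (steps (map (gv (Cod (coslice J j) ts)) p)) \<star>SV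
    AMap (path_diagram p) ts = map (EMap (inc (Cod J (Dom (coslice J j) ts)))) (steps (map (gv (Dom (coslice J j) ts)) p))"
   using inc_comp(2)[OF ts(3) gv_Verts[OF ts(2)] gv_Verts[OF ts(2)]] G_comp(1)[OF ts(2,3)] pn
   by (auto simp: path_diagram_def ts(1) coslice_sel c length_steps nth_steps intro!: nth_equalityI)
 qed
 show "is_colimit (coslice J j) SV (path_diagram p) (map (Edge L) (steps (map (VMap (inc j)) p)))
   (%t. map (EMap (inc (Cod J t))) (steps (map (gv t) p)))"
 proof (rule V.seq_colimitI[OF F coc])
  show "Obj (coslice J j) ~= {}" using jj by blast
  fix i assume "i < length (map (Edge L) (steps (map (VMap (inc j)) p)))"
  then have i: "i < length p - 1" by (simp add: length_steps)
  have "(%k. map (EMap (inc (Cod J k))) (steps (map (gv k) p)) ! i) = (%t. EMap (inc (Cod J t)) (gv t (p ! i), gv t (p ! Suc i)))"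
   using i by (auto simp: fun_eq_iff length_steps nth_steps)
  then show "is_colimit (coslice J j) V (component i (path_diagram p)) (map (Edge L) (steps (map (VMap (inc j)) p)) ! i)
   (%k. map (EMap (inc (Cod J k))) (steps (map (gv k) p)) ! i)"
   using colim[of i "Suc i"] i comp[OF i] by (simp add: length_steps nth_steps)
 qed
qed

end

lemma VMap_Gamma_map [simp]: "VMap (Gamma_map V E f) = VMap f" by (simp add: Gamma_map_def)

context Multitensor
begin

lemma vertex_rel_\<G>:
 fixes G :: "('j, 't, ('u, 'o) vgraph, ('u, 'o, 'a) vgraph_map) ftor"
 shows "vertex_rel J (comp_ftor (Gamma V E) G) = vertex_rel J G" by (simp add: vertex_rel_def comp_ftor_def)

lemma \<G>m_EMap_Hom:
 assumes f: "f : Hom GV X Y" and a: "a : Verts X" "b : Verts X"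
 shows "EMap (\<G>m f) (a, b) : Hom V (Edge (\<G> X) (a, b)) (Edge (\<G> Y) (VMap f a, VMap f b))"
 using GHomD(6)[OF \<G>m_props(1)[OF f], of a b] a by simp

text \<open>\<open>Gamma\<close> leaves vertices unchanged, so only homs are at stake. By
  accessibility of \<open>E\<close> the summand of a path of \<open>L\<close> is the colimit, over
  the coslice under a stage where the path lifts, of the summands of the images of that lift; the
  resulting arrows are assembled along the coproduct over paths.\<close>

lemma \<G>_graph_colimit:
 fixes J :: "('j, 't) cat"
 assumes acc: "accessible U lam SV V E" and J: "small_category U J" "filtered lam J"
  and lam: "Cinfinite lam" and G: "is_functor J GV G" and gc: "graph_colimit J G L inc"
 shows "graph_colimit J (comp_ftor (Gamma V E) G) (\<G> L) (\<G>m \<circ> inc)"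
proof -
 interpret F: Filtered_Graph_Colimit V U lam J G L inc by unfold_locales (use J(2) lam G gc in auto)
 note fc = is_functor_comp[OF functor_\<G> G]
 have "small U (Arr J)" using J(1) by (simp add: small_category_def)
 have "edge_colimit J (comp_ftor (Gamma V E) G) (\<G> L) (\<G>m \<circ> inc) v w" if v: "v : Verts L" and w: "w : Verts L" for v w
  unfolding edge_colimit_def
 proof (intro ballI allI impI)
  fix T f assume T: "T : Obj V" and f0: "edge_cocone J (comp_ftor (Gamma V E) G) (\<G>m \<circ> inc) v w T f"
  have f: "f j x y : Hom V (Edge (\<G> (OMap G j)) (x, y)) T"
   if "j : Obj J" "x : Verts (OMap G j)" "y : Verts (OMap G j)" "VMap (inc j) x = v" "VMap (inc j) y = w" for j x y
   using f0 that by (simp add: edge_cocone_def comp_ftor_def)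
  have fn: "f k (F.gv t x) (F.gv t y) ** EMap (\<G>m (AMap G t)) (x, y) = f j x y"
   if "t : Hom J j k" "x : Verts (OMap G j)" "y : Verts (OMap G j)" "VMap (inc j) x = v" "VMap (inc j) y = w" for t j k x y
   using f0 that by (auto simp: edge_cocone_def comp_ftor_def Hom_def)
  \<comment> \<open>The cocone condition of \<open>f\<close>, restricted to the summand of one
    path.\<close>
  have fp: "(f k (F.gv t (hd p)) (F.gv t (last p)) ** \<iota> (OMap G k) (map (F.gv t) p)) ** path_arr (AMap G t) p =
    f j (hd p) (last p) ** \<iota> (OMap G j) p"
   if t: "t : Hom J j k" and p: "p : paths (OMap G j) x y" and xy: "VMap (inc j) x = v" "VMap (inc j) y = w" for t j k p x y
  proof -
   note P = pathsD[OF p] and Gt = F.G_Hom[OF t]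
   have k: "k : Obj J" using F.J.Hom_Obj[OF t] by blast
   note p' = path_map_Hom[OF Gt p]
   have fk: "f k (F.gv t x) (F.gv t y) : Hom V (Edge (\<G> (OMap G k)) (F.gv t x, F.gv t y)) T"
    by (rule f[OF k]) (use P F.gv_Verts[OF t] F.inc_comp(1)[OF t] xy in auto)
   have "(f k (F.gv t x) (F.gv t y) ** \<iota> (OMap G k) (map (F.gv t) p)) ** path_arr (AMap G t) p =
    f k (F.gv t x) (F.gv t y) ** (EMap (\<G>m (AMap G t)) (x, y) ** \<iota> (OMap G j) p)"
    unfolding \<G>m_props(3)[OF Gt p] by (rule V.assoc[OF path_arr_Hom[OF Gt p] \<iota>_Hom[OF F.G_Obj[OF k] p'] fk])
   also have "\<dots> = f j x y ** \<iota> (OMap G j) p"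
    by (rule V.comp_pull[OF fn[OF t P(5,6) xy] \<iota>_Hom[OF GHomD(1)[OF Gt] p] \<G>m_EMap_Hom[OF Gt P(5,6)] fk])
   finally show ?thesis using P by simp
  qed
  \<comment> \<open>\<open>p'\<close> is a lift of the path \<open>p\<close> to stage
    \<open>j\<close>.\<close>
  let ?X = "%p j p'. j : Obj J & set p' \<subseteq> Verts (OMap G j) & map (VMap (inc j)) p' = p"
  have pathX: "p' : paths (OMap G j) (hd p') (last p') & VMap (inc j) (hd p') = v & VMap (inc j) (last p') = w"
   if "?X p j p'" "p : paths L v w" for p j p' using that pathsD[OF that(2)] by (auto simp: paths_def hd_map last_map)
  have colim: "is_colimit (coslice J j) V (comp_ftor E (F.path_diagram p')) (smd L p)
   (AMap E \<circ> (%t. map (EMap (inc (Cod J t))) (steps (map (F.gv t) p'))))"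
   "is_functor (coslice J j) V (comp_ftor E (F.path_diagram p'))" if X: "?X p j p'" for p j p'
  proof -
   have j: "j : Obj J" "set p' \<subseteq> Verts (OMap G j)" and m: "map (VMap (inc j)) p' = p" using X by auto
   note pc = F.path_diagram_colimit[OF j]
   have "small U (Arr (coslice J j))"
   proof (rule small_subset)
    show "small U (Arr J \<times> Arr J)" using \<open>small U (Arr J)\<close> by (rule small_Times[OF universe]) fact
    show "Arr (coslice J j) \<subseteq> Arr J \<times> Arr J" by (auto simp: coslice_def)
   qed
   from accessible_small[OF acc this F.J.filtered_coslice[OF j(1)] pc]
   show "is_colimit (coslice J j) V (comp_ftor E (F.path_diagram p')) (smd L p)
    (AMap E \<circ> (%t. map (EMap (inc (Cod J t))) (steps (map (F.gv t) p'))))" by (simp add: m Gamma_summand_def)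
   show "is_functor (coslice J j) V (comp_ftor E (F.path_diagram p'))" by (rule is_functor_comp[OF functor_E pc(1)])
  qed
  have leg: "(AMap E \<circ> (%t. map (EMap (inc (Cod J t))) (steps (map (F.gv t) p')))) t = path_arr (inc (Cod J t)) (map (F.gv t) p')" for t p'
   by (simp add: path_arr_def)
  have pa: "path_arr (inc j) p' = path_arr (inc k) (map (F.gv t) p') ** path_arr (AMap G t) p'"
   if t: "t : Hom J j k" and p': "p' : paths (OMap G j) x y" for t j k p' x y
  proof -
   have jk: "j : Obj J" "k : Obj J" using F.J.Hom_Obj[OF t] by auto
   have "inc k \<star>GV AMap G t = inc j" using F.cocone t by (auto simp: is_cocone_def Hom_def)
   then show ?thesis using path_arr_comp[OF F.G_Hom[OF t] F.inc_Hom[OF jk(2)] p'] by simp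
  qed
  \<comment> \<open>The arrow on a summand is built from one lift \<open>p1\<close>. It is
    compatible with every other lift because two lifts of a path agree at some later stage.\<close>
  have ex: "EX h. h : Hom V (smd L p) T & (ALL j p'. ?X p j p' -->
    h ** path_arr (inc j) p' = f j (hd p') (last p') ** \<iota> (OMap G j) p')" if p: "p : paths L v w" for p
  proof -
   obtain j1 p1 where X1: "?X p j1 p1" using F.lift_list[OF pathsD(2)[OF p]] by blast
   note p1 = pathX[OF X1 p]
   have q1: "hd p1 : Verts (OMap G j1)" "last p1 : Verts (OMap G j1)" using pathsD(5,6)[OF conjunct1[OF p1]] .
   have j1: "j1 : Obj J" using X1 by blast
   let ?g = "%t. f (Cod J t) (hd (map (F.gv t) p1)) (last (map (F.gv t) p1)) ** \<iota> (OMap G (Cod J t)) (map (F.gv t) p1)"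
   have n1: "p1 ~= []" using p1 by (simp add: paths_def)
   have tp: "map (F.gv t) p1 : paths (OMap G k) (F.gv t (hd p1)) (F.gv t (last p1))" if "t : Hom J j1 k" for t k
    using path_map_Hom[OF F.G_Hom[OF that]] p1 by blast
   have g: "?g t : Hom V (smd (OMap G (Cod J t)) (map (F.gv t) p1)) T" if t: "t : Hom J j1 (Cod J t)" for t
   proof -
    have k: "Cod J t : Obj J" using F.J.Hom_Obj[OF t] by blast
    have "f (Cod J t) (hd (map (F.gv t) p1)) (last (map (F.gv t) p1)) \<in>
     Hom V (Edge (\<G> (OMap G (Cod J t))) (F.gv t (hd p1), F.gv t (last p1))) T"
     using f[OF k, of "F.gv t (hd p1)" "F.gv t (last p1)"] p1 n1 F.gv_Verts[OF t] F.inc_comp(1)[OF t] q1 by (simp add: hd_map last_map)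
    from V.comp_Hom[OF \<iota>_Hom[OF F.G_Obj[OF k] tp[OF t]] this] show ?thesis .
   qed
   have "is_cocone (coslice J j1) V (comp_ftor E (F.path_diagram p1)) T ?g" unfolding is_cocone_def
   proof (intro conjI ballI)
    fix t assume "t : Obj (coslice J j1)"
    then have t: "t : Hom J j1 (Cod J t)" by (simp add: F.coslice_sel)
    show "?g t : Hom V (OMap (comp_ftor E (F.path_diagram p1)) t) T"
     using g[OF t] by (simp add: comp_ftor_def F.path_diagram_def Gamma_summand_def)
   next
    fix ts assume "ts : Arr (coslice J j1)"
    then obtain t s where ts: "ts = (t, s)" "t : Hom J j1 (Cod J t)" "s : Hom J (Cod J t) (Cod J s)"
     using F.coslice_sel(2) by (metis surj_pair)
    have c: "Cod J (s \<star>J t) = Cod J s" using F.J.comp_Hom[OF ts(2,3)] by (simp add: Hom_def)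
    have mc: "map (F.gv (s \<star>J t)) p1 = map (F.gv s) (map (F.gv t) p1)" using F.G_comp(1)[OF ts(2,3)] X1 by auto
    have "?g (s \<star>J t) ** path_arr (AMap G s) (map (F.gv t) p1) = ?g t" unfolding c mc
     using fp[OF ts(3) tp[OF ts(2)]] F.inc_comp(1)[OF ts(2)] p1 n1 q1 by (simp add: hd_map last_map)
    then show "?g (Cod (coslice J j1) ts) ** AMap (comp_ftor E (F.path_diagram p1)) ts = ?g (Dom (coslice J j1) ts)"
     by (simp add: ts(1) F.coslice_sel comp_ftor_def F.path_diagram_def path_arr_def)
   qed (rule T)
   from is_colimit_ex[OF colim(1)[OF X1] this] obtain h where h: "h : Hom V (smd L p) T"
    "!!t. t : Obj (coslice J j1) ==> h ** path_arr (inc (Cod J t)) (map (F.gv t) p1) = ?g t" unfolding leg by metis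
   have "h ** path_arr (inc j) p' = f j (hd p') (last p') ** \<iota> (OMap G j) p'" if X: "?X p j p'" for j p'
   proof -
    note p' = pathX[OF X p]
    have j: "j : Obj J" using X by blast
    obtain k t s where t: "t : Hom J j1 k" and s: "s : Hom J j k" and e: "map (F.gv t) p1 = map (F.gv s) p'"
     using F.merge_lists[OF j1 j, of p1 p'] X1 X by metis
    have ct: "Cod J t = k" using t by (simp add: Hom_def)
    have k: "k : Obj J" using F.J.Hom_Obj[OF t] by blast
    have P': "p' : paths (OMap G j) (hd p') (last p')" using p' by blast
    have sp: "map (F.gv s) p' : paths (OMap G k) (F.gv s (hd p')) (F.gv s (last p'))" using path_map_Hom[OF F.G_Hom[OF s] P'] .
    have ik: "path_arr (inc k) (map (F.gv s) p') : Hom V (smd (OMap G k) (map (F.gv s) p')) (smd L p)"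
    proof -
     have "map (VMap (inc k)) (map (F.gv s) p') = p" using X by (auto simp: subset_iff F.inc_comp(1)[OF s])
     then show ?thesis using path_arr_Hom[OF F.inc_Hom[OF k] sp] by simp
    qed
    have "h ** path_arr (inc j) p' = (h ** path_arr (inc k) (map (F.gv s) p')) ** path_arr (AMap G s) p'"
     unfolding pa[OF s P'] by (rule V.assoc[OF path_arr_Hom[OF F.G_Hom[OF s] P'] ik h(1), symmetric])
    also have "h ** path_arr (inc k) (map (F.gv s) p') = ?g t" using h(2)[of t] t ct by (simp add: F.coslice_sel e)
    also have "?g t = f k (F.gv s (hd p')) (F.gv s (last p')) ** \<iota> (OMap G k) (map (F.gv s) p')"
     unfolding e ct using P' by (simp add: hd_map last_map paths_def)
    also have "\<dots> ** path_arr (AMap G s) p' = f j (hd p') (last p') ** \<iota> (OMap G j) p'"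
     by (rule fp[OF s P']) (use p' in auto)
    finally show ?thesis .
   qed
   then show ?thesis using h(1) by blast
  qed
  then obtain hp where hp: "!!p. p : paths L v w ==> hp p : Hom V (smd L p) T"
   "!!p j p'. p : paths L v w ==> ?X p j p' ==> hp p ** path_arr (inc j) p' = f j (hd p') (last p') ** \<iota> (OMap G j) p'"
   by metis
  obtain h where h: "h : Hom V (Edge (\<G> L) (v, w)) T" "!!p. p : paths L v w ==> h ** \<iota> L p = hp p"
   by (rule V.coproduct_ex[OF \<G>_coproduct[OF F.L_Obj v w] T, of hp]) (use hp in auto)
  \<comment> \<open>Restricted to the summand of a lifted path, an arrow out of the hom of
    \<open>\<G> L\<close> depends only on its restriction to the summand of the image path.\<close>
  have push: "k ** (EMap (\<G>m (inc j)) (x, y) ** \<iota> (OMap G j) p') = (k ** \<iota> L (map (VMap (inc j)) p')) ** path_arr (inc j) p'"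
   if k: "k : Hom V (Edge (\<G> L) (v, w)) T" and j: "j : Obj J" and p': "p' : paths (OMap G j) x y"
    and xy: "VMap (inc j) x = v" "VMap (inc j) y = w" for k j x y p' unfolding \<G>m_props(3)[OF F.inc_Hom[OF j] p']
   using V.assoc[OF path_arr_Hom[OF F.inc_Hom[OF j] p'] \<iota>_Hom[OF F.L_Obj path_map_Hom[OF F.inc_Hom[OF j] p']]] k xy by simp
  show "EX! h. h : Hom V (Edge (\<G> L) (v, w)) T &
   (ALL j:Obj J. ALL x:Verts (OMap (comp_ftor (Gamma V E) G) j). ALL y:Verts (OMap (comp_ftor (Gamma V E) G) j).
     VMap ((\<G>m \<circ> inc) j) x = v --> VMap ((\<G>m \<circ> inc) j) y = w --> h ** EMap ((\<G>m \<circ> inc) j) (x, y) = f j x y)"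
  proof (intro ex1I[of _ h] conjI ballI impI)
   show "h : Hom V (Edge (\<G> L) (v, w)) T" by (rule h)
   fix j x y assume j: "j : Obj J" and "x : Verts (OMap (comp_ftor (Gamma V E) G) j)" "y : Verts (OMap (comp_ftor (Gamma V E) G) j)"
    and "VMap ((\<G>m \<circ> inc) j) x = v" "VMap ((\<G>m \<circ> inc) j) y = w"
   then have x: "x : Verts (OMap G j)" "y : Verts (OMap G j)" and xv: "VMap (inc j) x = v" "VMap (inc j) y = w"
    by (simp_all add: comp_ftor_def)
   have i: "EMap (\<G>m (inc j)) (x, y) : Hom V (Edge (\<G> (OMap G j)) (x, y)) (Edge (\<G> L) (v, w))"
    using \<G>m_EMap_Hom[OF F.inc_Hom[OF j] x] xv by simp
   have "h ** EMap (\<G>m (inc j)) (x, y) = f j x y"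
   proof (rule \<G>_edge_eqI[OF F.G_Obj[OF j] x V.comp_Hom[OF i h(1)] f[OF j x xv]])
    fix p' assume p': "p' : paths (OMap G j) x y"
    let ?p = "map (VMap (inc j)) p'"
    have p: "?p : paths L v w" using path_map_Hom[OF F.inc_Hom[OF j] p'] xv by simp
    have X: "?X ?p j p'" using j pathsD[OF p'] by simp
    show "(h ** EMap (\<G>m (inc j)) (x, y)) ** \<iota> (OMap G j) p' = f j x y ** \<iota> (OMap G j) p'"
     using V.assoc[OF \<iota>_Hom[OF F.G_Obj[OF j] p'] i h(1)] push[OF h(1) j p' xv] h(2)[OF p] hp(2)[OF p X] pathsD[OF p'] by simp
   qed
   then show "h ** EMap ((\<G>m \<circ> inc) j) (x, y) = f j x y" by simp
  next
   fix k assume k0: "k : Hom V (Edge (\<G> L) (v, w)) T &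
    (ALL j:Obj J. ALL x:Verts (OMap (comp_ftor (Gamma V E) G) j). ALL y:Verts (OMap (comp_ftor (Gamma V E) G) j).
     VMap ((\<G>m \<circ> inc) j) x = v --> VMap ((\<G>m \<circ> inc) j) y = w --> k ** EMap ((\<G>m \<circ> inc) j) (x, y) = f j x y)"
   then have k: "k : Hom V (Edge (\<G> L) (v, w)) T" by blast
   have kf: "k ** EMap (\<G>m (inc j)) (x, y) = f j x y" if "j : Obj J" "x : Verts (OMap G j)" "y : Verts (OMap G j)"
    "VMap (inc j) x = v" "VMap (inc j) y = w" for j x y using k0 that by (simp add: comp_ftor_def)
   show "k = h"
   proof (rule \<G>_edge_eqI[OF F.L_Obj v w k h(1)])
    fix p assume p: "p : paths L v w"
    obtain j1 p1 where X1: "?X p j1 p1" using F.lift_list[OF pathsD(2)[OF p]] by blast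
    note p1 = pathX[OF X1 p]
    note i = \<iota>_Hom[OF F.L_Obj p]
    show "k ** \<iota> L p = h ** \<iota> L p"
    proof (rule is_colimit_eq[OF V.category colim(2)[OF X1] colim(1)[OF X1] V.comp_Hom[OF i k] V.comp_Hom[OF i h(1)]])
     fix t assume "t : Obj (coslice J j1)"
     then have t: "t : Hom J j1 (Cod J t)" by (simp add: F.coslice_sel)
     have j: "Cod J t : Obj J" using F.J.Hom_Obj[OF t] by blast
     let ?p = "map (F.gv t) p1"
     have tp: "?p : paths (OMap G (Cod J t)) (F.gv t (hd p1)) (F.gv t (last p1))" using path_map_Hom[OF F.G_Hom[OF t]] p1 by blast
     have xv: "VMap (inc (Cod J t)) (F.gv t (hd p1)) = v" "VMap (inc (Cod J t)) (F.gv t (last p1)) = w"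
      using F.inc_comp(1)[OF t] p1 pathsD(5,6)[OF conjunct1[OF p1]] by auto
     have X: "?X p (Cod J t) ?p" using j pathsD(2)[OF tp] X1 by (auto simp: subset_iff F.inc_comp(1)[OF t])
     have i': "EMap (\<G>m (inc (Cod J t))) (F.gv t (hd p1), F.gv t (last p1)) \<in>
       Hom V (Edge (\<G> (OMap G (Cod J t))) (F.gv t (hd p1), F.gv t (last p1))) (Edge (\<G> L) (v, w))"
      using \<G>m_EMap_Hom[OF F.inc_Hom[OF j] pathsD(5,6)[OF tp]] xv by simp
     have "(k ** \<iota> L p) ** path_arr (inc (Cod J t)) ?p = (f (Cod J t) (F.gv t (hd p1)) (F.gv t (last p1))) ** \<iota> (OMap G (Cod J t)) ?p"
      using push[OF k j tp xv] X V.assoc[OF \<iota>_Hom[OF F.G_Obj[OF j] tp] i' k] kf[OF j pathsD(5,6)[OF tp] xv] by simp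
     also have "\<dots> = (h ** \<iota> L p) ** path_arr (inc (Cod J t)) ?p"
      unfolding h(2)[OF p] hp(2)[OF p X] using pathsD[OF tp] by simp
     finally show "(k ** \<iota> L p) ** (AMap E \<circ> (%t. map (EMap (inc (Cod J t))) (steps (map (F.gv t) p1)))) t =
      (h ** \<iota> L p) ** (AMap E \<circ> (%t. map (EMap (inc (Cod J t))) (steps (map (F.gv t) p1)))) t" unfolding leg .
    qed
   qed
  qed
 qed
 moreover have "is_cocone J GV (comp_ftor (Gamma V E) G) (\<G> L) (\<G>m \<circ> inc)"
  using is_cocone_map[OF functor_\<G> G F.cocone] by simp
 ultimately show ?thesis using gc unfolding graph_colimit_def vertex_rel_\<G> by (simp add: comp_ftor_def)
qed

lemma small_category_Obj: "small_category U J ==> small U (Obj J)"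
proof -
 assume J: "small_category U J"
 interpret J: Category J by unfold_locales (use J in "simp add: small_category_def")
 show ?thesis by (rule J.small_Obj) (use J in "simp add: small_category_def")
qed

theorem accessible_\<G>:
 assumes acc: "accessible U lam SV V E" and lam: "Cinfinite lam"
 shows "accessible U lam GV GV (Gamma V E)" unfolding accessible_def
proof (intro allI impI)
 fix J :: "('u, 'u) cat" and G L inc
 assume J: "small_category U J" "filtered lam J" and G: "is_functor J GV G" and c: "is_colimit J GV G L inc"
 have "graph_colimit J G L inc" by (rule colimit_imp_graph_colimit[OF G small_category_Obj[OF J(1)] c])
 from \<G>_graph_colimit[OF acc J lam G this]
 show "is_colimit J GV (comp_ftor (Gamma V E) G) (OMap (Gamma V E) L) (AMap (Gamma V E) \<circ> inc)"
  using graph_colimit_imp_colimit[OF is_functor_comp[OF functor_\<G> G]] by simp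
qed

section \<open>Graphs of sequences\<close>

definition line :: "nat => nat => 'u list" where "line m n = map vtx [m..<Suc (m + n)]"

lemma line_simps: "line m 0 = [vtx m]" "line m (Suc n) = vtx m # line (Suc m) n" by (simp_all add: line_def upt_rec[of m])

lemma line_ends: "line m n ~= []" "hd (line m n) = vtx m" "last (line m n) = vtx (m + n)"
 by (simp_all add: line_def hd_map last_map del: upt_Suc)

lemma steps_line: "steps (line m n) = map (%i. (vtx i, vtx (Suc i))) [m..<m + n]"
proof (induction n arbitrary: m)
 case (Suc n)
 have "steps (line m (Suc n)) = (vtx m, vtx (Suc m)) # steps (line (Suc m) n)" by (cases n) (simp_all add: line_simps)
 then show ?case using Suc by (simp add: upt_rec[of m])
qed (simp add: line_simps)

lemma line_path: "m + n \<le> length Xs ==> line m n : paths (seq_graph Xs) (vtx m) (vtx (m + n))"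
 using line_ends[of m n] by (auto simp: paths_def line_def Verts_seq_graph)

lemma line_edges: "m + n \<le> length Xs ==> map (Edge (seq_graph Xs)) (steps (line m n)) = take n (drop m Xs)"
 by (rule nth_equalityI) (auto simp: steps_line Edge_seq_graph)

lemma line_edges_all: "map (Edge (seq_graph Xs)) (steps (line 0 (length Xs))) = Xs" using line_edges[of 0 "length Xs" Xs] by simp

text \<open>Each step raises the index of the vertex by one, so apart from its start only the length
  of the path is free.\<close>

lemma line_unique:
 assumes "p ~= []" "hd p = vtx m" "ALL z:set (steps p). EX i. z = (vtx i, vtx (Suc i))"
 shows "p = line m (length p - 1)" using assms
proof (induction p arbitrary: m rule: induct_list012)
 case (3 x y p)
 then have "y = vtx (Suc m)" by auto
 then have "y # p = line (Suc m) (length (y # p) - 1)" by (intro 3(2)) (use 3(5) in auto)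
 then have "x # y # p = vtx m # line (Suc m) (length p)" using 3(4) by simp
 moreover have "line m (length (x # y # p) - 1) = vtx m # line (Suc m) (length p)" by (simp add: line_simps)
 ultimately show ?case by (rule trans[OF _ sym])
qed (auto simp: line_simps)

text \<open>Distributivity for the empty coproduct in a single variable.\<close>

lemma E_initial:
 assumes "Xs : Seqs" "i < length Xs" "V.initial (Xs ! i)"
 shows "V.initial (OMap E Xs)"
proof -
 have "preserves_coproducts U V V (nth_variable V E Xs i)"
  using distributive assms(1,2) by (simp add: distributive_multitensor_def)
 from V.preserves_coproducts_small[OF this small_finite[OF universe] assms(3)[unfolded V.initial_def] V.category]
 have "is_coproduct V {} (OMap (nth_variable V E Xs i) \<circ> (%_. undefined)) (OMap E Xs) (AMap (nth_variable V E Xs i) \<circ> (%_::unit. undefined))"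
  by (simp add: nth_variable_def)
 then show ?thesis using V.initial_coproduct by blast
qed

text \<open>A path with these end points other than the straight one has a step not of the form
  \<open>vtx i\<close> to \<open>vtx (Suc i)\<close>, and the hom at that step is initial.\<close>

lemma other_path_initial:
 assumes X: "Xs : Seqs" and p: "p : paths (seq_graph Xs) (vtx m) (vtx (m + n))" and ne: "p ~= line m n"
 shows "V.initial (smd (seq_graph Xs) p)"
proof -
 note P = pathsD[OF p]
 have "EX z:set (steps p). \<not> (EX i. z = (vtx i, vtx (Suc i)))"
 proof (rule ccontr)
  assume "\<not> ?thesis"
  then have e: "p = line m (length p - 1)" by (intro line_unique) (use P in auto)
  then have "last p = vtx (m + (length p - 1))" using line_ends(3) by metis
  then have "length p - 1 = n" using P by simp
  then show False using e ne by simp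
 qed
 then obtain z where z: "z : set (steps p)" "\<not> (EX i. z = (vtx i, vtx (Suc i)))" by blast
 obtain a b where ab: "z = (vtx a, vtx b)" "a \<le> length Xs" "b \<le> length Xs"
  using paths_steps[OF p z(1)] by (cases z) (auto simp: Verts_seq_graph)
 have "Edge (seq_graph Xs) z = Zero" using z(2) ab by (simp add: Edge_seq_graph)
 moreover obtain i where "i < length (steps p)" "steps p ! i = z" using z(1) by (auto simp: in_set_conv_nth)
 ultimately show ?thesis unfolding Gamma_summand_def
  by (intro E_initial[of _ i] steps_Obj[OF seq_graph_Obj[OF X] p]) (auto simp: initial_Zero)
qed

lemma smd_line: "smd (seq_graph Xs) (line 0 (length Xs)) = OMap E Xs" by (simp add: Gamma_summand_def line_edges_all)

lemma line_path0: "line 0 (length Xs) : paths (seq_graph Xs) (vtx 0) (vtx (length Xs))"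
 using line_path[of 0 "length Xs" Xs] by simp

text \<open>The summands of the other paths are initial, so the inclusion of the straight path is invertible.\<close>

lemma line_retract:
 assumes X: "Xs : Seqs"
 obtains r where "r : Hom V (Edge (\<G> (seq_graph Xs)) (ends Xs)) (OMap E Xs)"
  "r ** \<iota> (seq_graph Xs) (line 0 (length Xs)) = Ide V (OMap E Xs)"
  "!!T h h'. h : Hom V (Edge (\<G> (seq_graph Xs)) (ends Xs)) T ==> h' : Hom V (Edge (\<G> (seq_graph Xs)) (ends Xs)) T ==>
   h ** \<iota> (seq_graph Xs) (line 0 (length Xs)) = h' ** \<iota> (seq_graph Xs) (line 0 (length Xs)) ==> h = h'"
proof -
 let ?X = "seq_graph Xs" and ?l = "line 0 (length Xs)" and ?P = "paths (seq_graph Xs) (vtx 0) (vtx (length Xs))"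
 have XO: "?X : Obj GV" by (rule seq_graph_Obj[OF X])
 have v: "vtx 0 : Verts ?X" "vtx (length Xs) : Verts ?X" by auto
 note cop = \<G>_coproduct[OF XO v]
 have EO: "OMap E Xs : Obj V" by (rule E_Obj[OF X])
 have ini: "V.initial (smd ?X p)" if "p : ?P" "p ~= ?l" for p using other_path_initial[OF X, of p 0 "length Xs"] that by simp
 have "EX f. f : Hom V (smd ?X p) (OMap E Xs) & (p = ?l --> f = Ide V (OMap E Xs))" if p: "p : ?P" for p
 proof (cases "p = ?l")
  case True
  then show ?thesis using V.Ide_Hom[OF EO] smd_line by auto
 next
  case False
  then show ?thesis using V.initialD(2)[OF ini[OF p False] EO] by blast
 qed
 then obtain f where f: "!!p. p : ?P ==> f p : Hom V (smd ?X p) (OMap E Xs)"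
  "!!p. p : ?P ==> p = ?l ==> f p = Ide V (OMap E Xs)" by metis
 obtain r where r: "r : Hom V (Edge (\<G> ?X) (ends Xs)) (OMap E Xs)" "!!p. p : ?P ==> r ** \<iota> ?X p = f p"
  by (rule V.coproduct_ex[OF cop EO, of f]) (use f in auto)
 show ?thesis
 proof (rule that[OF r(1)])
  show "r ** \<iota> ?X ?l = Ide V (OMap E Xs)" using r(2) f(2) line_path0 by simp
  fix T h h' assume h: "h : Hom V (Edge (\<G> ?X) (ends Xs)) T" "h' : Hom V (Edge (\<G> ?X) (ends Xs)) T"
   "h ** \<iota> ?X ?l = h' ** \<iota> ?X ?l"
  show "h = h'"
  proof (rule V.coproduct_eq[OF cop h(1,2)])
   fix p assume p: "p : ?P"
   show "h ** \<iota> ?X p = h' ** \<iota> ?X p"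
   proof (cases "p = ?l")
    case False
    note i = \<iota>_Hom[OF XO p]
    show ?thesis by (rule V.initialD(3)[OF ini[OF p False] V.comp_Hom[OF i h(1)] V.comp_Hom[OF i h(2)]])
   qed (use h in simp)
  qed
 qed
qed

definition seq_graph_map :: "'o list => 'o list => 'a list => ('u, 'o, 'a) vgraph_map" where
 "seq_graph_map Xs Ys fs = seq_map Xs (seq_graph Ys) vtx ((!) fs)"

lemma seq_graph_map:
 assumes f: "fs : Hom SV Xs Ys"
 shows "seq_graph_map Xs Ys fs : Hom GV (seq_graph Xs) (seq_graph Ys)"
  "i \<le> length Xs ==> VMap (seq_graph_map Xs Ys fs) (vtx i) = vtx i"
  "i < length Xs ==> EMap (seq_graph_map Xs Ys fs) (vtx i, vtx (Suc i)) = fs ! i"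
  "m + n \<le> length Xs ==> map (VMap (seq_graph_map Xs Ys fs)) (line m n) = line m n"
  "m + n \<le> length Xs ==> map (EMap (seq_graph_map Xs Ys fs)) (steps (line m n)) = take n (drop m fs)"
  "path_arr (seq_graph_map Xs Ys fs) (line 0 (length Xs)) = AMap E fs"
proof -
 interpret S: Category "SV" by unfold_locales (rule V.category_seq_cat)
 have XY: "Xs : Seqs" "Ys : Seqs" using S.Hom_Obj[OF f] by auto
 have l: "length fs = length Xs" "length Ys = length Xs" using f by (auto simp: seq_Hom_iff)
 show "seq_graph_map Xs Ys fs : Hom GV (seq_graph Xs) (seq_graph Ys)" unfolding seq_graph_map_def
  by (rule seq_map_Hom[OF XY(1) seq_graph_Obj[OF XY(2)]]) (use f l in "auto simp: seq_Hom_iff Edge_seq_graph")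
 show v: "VMap (seq_graph_map Xs Ys fs) (vtx i) = vtx i" if "i \<le> length Xs" for i
  using that by (simp add: seq_graph_map_def seq_map_simps)
 show e: "EMap (seq_graph_map Xs Ys fs) (vtx i, vtx (Suc i)) = fs ! i" if "i < length Xs" for i
  using that by (simp add: seq_graph_map_def seq_map_simps)
 show "map (VMap (seq_graph_map Xs Ys fs)) (line m n) = line m n" if "m + n \<le> length Xs" for m n
  using that v by (auto simp: line_def)
 show t: "map (EMap (seq_graph_map Xs Ys fs)) (steps (line m n)) = take n (drop m fs)" if "m + n \<le> length Xs" for m n
  by (rule nth_equalityI) (use that e l in "auto simp: steps_line")
 show "path_arr (seq_graph_map Xs Ys fs) (line 0 (length Xs)) = AMap E fs" using t[of 0 "length Xs"] l by (simp add: path_arr_def)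
qed

end

section \<open>Cartesian multitensors\<close>

text \<open>A vertex map preserves lengths, so a preimage of a joined path can be cut at the same
  places. This lifts nested paths in the square for the multiplication.\<close>

lemma split_join:
 assumes "p ~= []" "qs : nested_paths Y p" "map f r = join_paths p qs" "set r \<subseteq> Verts X"
 shows "EX p' qs'. p' ~= [] & set p' \<subseteq> Verts X & qs' : nested_paths X p' & map f p' = p &
  map (map f) qs' = qs & join_paths p' qs' = r" using assms
proof (induction p arbitrary: qs r rule: induct_list012)
 case (2 x)
 then have "qs = []" by (simp add: nested_Nil)
 moreover then obtain r0 where "r = [r0]" using 2 by (auto simp: join_paths_def)
 ultimately show ?case using 2 by (intro exI[of _ "[r0]"] exI[of _ "[]"]) (auto simp: nested_Nil join_paths_def)
next
 case (3 x y p)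
 then obtain q qs1 where qs: "qs = q # qs1" and q: "q : paths Y x y" and qs1: "qs1 : nested_paths Y (y # p)"
  by (auto simp: nested_Cons)
 note Q = pathsD[OF q]
 let ?J = "join_paths (y # p) qs1"
 have "map f r = q @ tl ?J" using 3(5) join_Cons[of q x y p qs1] Q qs by simp
 then obtain r1 r2 where r: "r = r1 @ r2" "map f r1 = q" "map f r2 = tl ?J" by (auto simp: map_eq_append_conv)
 have r1: "r1 ~= []" using r(2) Q by auto
 have fl: "f (last r1) = y" using r(2) Q r1 by (metis last_map)
 have m1: "map f (last r1 # r2) = ?J" using r(3) fl by (metis join_nonempty list.collapse list.sel(1) list.simps(9))
 have m2: "set (last r1 # r2) \<subseteq> Verts X" using 3(6) r(1) r1 by auto
 from 3(2)[OF list.distinct(2) qs1 m1 m2]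
 obtain p' qs' where IH: "p' ~= []" "set p' \<subseteq> Verts X" "qs' : nested_paths X p'" "map f p' = y # p"
  "map (map f) qs' = qs1" "join_paths p' qs' = last r1 # r2" by (elim exE conjE)
 have "hd p' = last r1" using IH(6) by (metis join_nonempty(2) list.sel(1))
 then obtain p'' where p': "p' = last r1 # p''" using IH(1) by (cases p') auto
 have "r1 # qs' : nested_paths X (hd r1 # p')" unfolding p' nested_Cons using IH(3) p' r1 3(6) r(1) by (auto simp: paths_def)
 moreover have "map f (hd r1 # p') = x # y # p" using IH(4) r(2) r1 Q by (auto simp: hd_map)
 moreover have "join_paths (hd r1 # p') (r1 # qs') = r" using join_Cons[of r1 "hd r1" "last r1" p'' qs'] r1 IH(6) p' r(1) by simp
 moreover have "map (map f) (r1 # qs') = qs" using IH(5) r(2) qs by simp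
 moreover have "set (hd r1 # p') \<subseteq> Verts X" using IH(2) 3(6) r(1) r1 by auto
 ultimately show ?case by (intro exI[of _ "hd r1 # p'"] exI[of _ "r1 # qs'"] conjI list.distinct(2))
qed auto

text \<open>The lengths of the pieces determine where a joined path is cut. Lengths survive vertex
  maps, which is how nested paths with the same image are compared.\<close>

lemma split_join_unique:
 assumes "p ~= []" "p' ~= []" "qs : nested_paths X p" "qs' : nested_paths X p'"
  "join_paths p qs = join_paths p' qs'" "map length qs = map length qs'"
 shows "p = p' & qs = qs'" using assms
proof (induction qs arbitrary: p p' qs')
 case Nil
 have "length p = 1" "length p' = 1" using nested_steps[OF Nil(3)] nested_steps[OF Nil(4)] Nil
   length_steps[of p] length_steps[of p'] by (auto simp: Suc_le_eq le_antisym)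
 then show ?case using Nil by (auto simp: length_Suc_conv join_paths_def)
next
 case (Cons q qs)
 obtain q' qs1 where qs': "qs' = q' # qs1" using Cons.prems(6) by (cases qs') auto
 have n: "steps p = (hd q, last q) # map (%q. (hd q, last q)) qs" "steps p' = (hd q', last q') # map (%q. (hd q, last q)) qs1"
  using nested_steps[OF Cons.prems(3)] nested_steps[OF Cons.prems(4)] qs' by auto
 obtain x y p1 where p: "p = x # y # p1" using n(1) by (cases p; cases "tl p") auto
 obtain x' y' p1' where p': "p' = x' # y' # p1'" using n(2) by (cases p'; cases "tl p'") auto
 have q: "q : paths X x y" "qs : nested_paths X (y # p1)" using Cons.prems(3) p by (auto simp: nested_Cons)
 have q': "q' : paths X x' y'" "qs1 : nested_paths X (y' # p1')" using Cons.prems(4) p' qs' by (auto simp: nested_Cons)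
 note Q = pathsD[OF q(1)] and Q' = pathsD[OF q'(1)]
 have "q @ tl (join_paths (y # p1) qs) = q' @ tl (join_paths (y' # p1') qs1)"
  using Cons.prems(5) join_Cons[of q x y p1 qs] join_Cons[of q' x' y' p1' qs1] Q Q' p p' qs' by simp
 moreover have "length q = length q'" using Cons.prems(6) qs' by simp
 ultimately have qq: "q = q'" and t: "tl (join_paths (y # p1) qs) = tl (join_paths (y' # p1') qs1)" by auto
 have yy: "y = y'" "x = x'" using qq Q Q' by auto
 have "join_paths (y # p1) qs = join_paths (y' # p1') qs1" using t yy by (metis join_nonempty list.collapse list.sel(1))
 then have "y # p1 = y' # p1' & qs = qs1" by (intro Cons.IH) (use q q' Cons.prems(6) qs' in auto)
 then show ?case using p p' qs' qq yy by simp
qed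

context Multitensor
begin

section \<open>Arrows from connected objects, and preservation of pullbacks\<close>

lemma connected_\<G>_ex:
 assumes T: "conn T" and X: "X : Obj GV" "a : Verts X" "b : Verts X" and f: "f : Hom V T (Edge (\<G> X) (a, b))"
 obtains p g where "p : paths X a b" "g : Hom V T (smd X p)" "f = \<iota> X p ** g"
 using V.connected_ex[OF T small_paths[OF X(1)] \<G>_coproduct[OF X] f] by metis

lemma connected_\<G>_eq:
 assumes T: "conn T" and X: "X : Obj GV" and p: "p : paths X a b" "g : Hom V T (smd X p)"
  and p': "p' : paths X a b" "g' : Hom V T (smd X p')" and e: "\<iota> X p ** g = \<iota> X p' ** g'"
 shows "p = p' & g = g'" by (rule V.connected_eq[OF T small_paths[OF X] \<G>_coproduct[OF X pathsD(5,6)[OF p(1)]] p p' e])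

lemma small_nested_index: "X : Obj GV ==> small U (Sigma (paths X a b) (nested_paths X))"
 by (intro small_Sigma[OF universe] small_paths small_nested)

lemma connected_\<G>\<G>_ex:
 assumes T: "conn T" and X: "X : Obj GV" "a : Verts X" "b : Verts X" and f: "f : Hom V T (Edge (\<G> (\<G> X)) (a, b))"
 obtains p qs g where "p : paths X a b" "qs : nested_paths X p" "g : Hom V T (nested_obj X qs)" "f = (\<iota>\<iota> X p qs) ** g"
proof -
 obtain pq g where pq: "pq : Sigma (paths X a b) (nested_paths X)" "g : Hom V T (case pq of (p, qs) => nested_obj X qs)"
  "f = (case pq of (p, qs) => \<iota>\<iota> X p qs) ** g"
  by (rule V.connected_ex[OF T small_nested_index[OF X(1)] \<G>\<G>_coproduct[OF X] f])
 obtain p qs where "pq = (p, qs)" by fastforce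
 then show ?thesis using that[of p qs g] pq by simp
qed

lemma connected_\<G>\<G>_eq:
 assumes T: "conn T" and X: "X : Obj GV" and p: "p : paths X a b" "qs : nested_paths X p" "g : Hom V T (nested_obj X qs)"
  and p': "p' : paths X a b" "qs' : nested_paths X p'" "g' : Hom V T (nested_obj X qs')"
  and e: "(\<iota>\<iota> X p qs) ** g = (\<iota>\<iota> X p' qs') ** g'"
 shows "p = p' & qs = qs' & g = g'"
 using V.connected_eq[OF T small_nested_index[OF X] \<G>\<G>_coproduct[OF X pathsD(5,6)[OF p(1)]], of "(p, qs)" g "(p', qs')" g'] p p' e
 by auto

text \<open>A path together with an arrow into its summand is handled like an element of a hom of
  \<open>\<G> X\<close>; this is the action of \<open>\<G>m f\<close> on it.\<close>

lemma \<G>m_point: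
 assumes f: "f : Hom GV X Y" and p: "p : paths X a b" and g: "g : Hom V T (smd X p)"
 shows "EMap (\<G>m f) (a, b) ** (\<iota> X p ** g) = \<iota> Y (map (VMap f) p) ** (path_arr f p ** g)"
 using V.comp_pull[OF \<G>m_props(3)[OF f p] g \<iota>_Hom[OF GHomD(1)[OF f] p] \<G>m_EMap_Hom[OF f pathsD(5,6)[OF p]]]
  V.assoc[OF g path_arr_Hom[OF f p] \<iota>_Hom[OF GHomD(2)[OF f] path_map_Hom[OF f p]]] by simp

lemma \<G>\<G>_EMap_Hom:
 assumes f: "f : Hom GV X Y" and a: "a : Verts X" "b : Verts X"
 shows "EMap (\<G>m (\<G>m f)) (a, b) : Hom V (Edge (\<G> (\<G> X)) (a, b)) (Edge (\<G> (\<G> Y)) (VMap f a, VMap f b))"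
 using \<G>m_EMap_Hom[OF \<G>m_props(1)[OF f], of a b] a by simp

lemma \<G>\<G>_point:
 assumes f: "f : Hom GV X Y" and p: "p : paths X a b" and qs: "qs : nested_paths X p" and g: "g : Hom V T (nested_obj X qs)"
 shows "EMap (\<G>m (\<G>m f)) (a, b) ** ((\<iota>\<iota> X p qs) ** g) =
  (\<iota> (\<G> Y) (map (VMap f) p) ** nested_arr Y (map (map (VMap f)) qs)) ** (nested_map f qs ** g)"
 using V.comp_pull[OF \<G>\<G>_map[OF f p qs] g \<G>\<G>_inj_Hom[OF GHomD(1)[OF f] p qs] \<G>\<G>_EMap_Hom[OF f pathsD(5,6)[OF p]]]
  V.assoc[OF g nested_map_Hom[OF f qs] \<G>\<G>_inj_Hom[OF GHomD(2)[OF f] path_map_Hom[OF f p] nested_map[OF qs GHomD(5)[OF f]]]]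
 by simp

lemma \<mu>_point:
 assumes X: "X : Obj GV" and p: "p : paths X a b" and qs: "qs : nested_paths X p" and g: "g : Hom V T (nested_obj X qs)"
 shows "EMap (\<mu> X) (a, b) ** ((\<iota>\<iota> X p qs) ** g) = \<iota> X (join_paths p qs) ** (sig (nested_edges X qs) ** g)"
 using V.comp_pull[OF \<mu>_props(3)[OF X p qs] g \<G>\<G>_inj_Hom[OF X p qs] \<mu>_EMap_Hom[OF X pathsD(5,6)[OF p]]]
  V.assoc[OF g sig_nested_Hom[OF X p qs] \<iota>_Hom[OF X join_mem[OF p qs]]] by simp

text \<open>Along the steps of \<open>r\<close> the hom squares form a componentwise pullback of
  sequences, to which \<open>E\<close> is applied.\<close>

lemma path_pullback:
 assumes E: "preserves_pullbacks SV V E" and pb: "is_pullback GV p q f g" and p: "p : Hom GV P X" and q: "q : Hom GV P Y"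
  and f: "f : Hom GV X Z" and g: "g : Hom GV Y Z" and r: "r : paths P c d"
 shows "is_pullback V (path_arr p r) (path_arr q r) (path_arr f (map (VMap p) r)) (path_arr g (map (VMap q) r))"
proof -
 note D = GV_pullbackD[OF pb p q f g]
 note pr = path_map_Hom[OF p r] and qr = path_map_Hom[OF q r]
 have e: "map (VMap f) (map (VMap p) r) = map (VMap g) (map (VMap q) r)" using D(1) pathsD(2)[OF r] by auto
 note H = EMap_steps[OF p r] EMap_steps[OF q r] EMap_steps[OF f pr] EMap_steps[OF g qr, folded e]
 have "is_pullback SV (map (EMap p) (steps r)) (map (EMap q) (steps r))
  (map (EMap f) (steps (map (VMap p) r))) (map (EMap g) (steps (map (VMap q) r)))" unfolding V.seq_pullback_iff[OF H]
 proof (intro allI impI)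
  fix i assume "i < length (map (Edge P) (steps r))"
  then have i: "i < length (steps r)" by simp
  obtain x y where xy: "steps r ! i = (x, y)" by fastforce
  have "x : Verts P" "y : Verts P" using paths_steps[OF r nth_mem[OF i]] xy by auto
  from D(4)[OF this] show "is_pullback V (map (EMap p) (steps r) ! i) (map (EMap q) (steps r) ! i)
   (map (EMap f) (steps (map (VMap p) r)) ! i) (map (EMap g) (steps (map (VMap q) r)) ! i)" using i xy by (simp add: steps_map)
 qed
 then show ?thesis using E unfolding preserves_pullbacks_def path_arr_def by blast
qed

text \<open>The squares of homs are tested on connected objects. Paths of \<open>P\<close> form the
  pullback of the sets of paths, and over a fixed path \<open>path_pullback\<close> applies.\<close>

lemma preserves_pullbacks_\<G>:
 assumes cc: "coproducts_of_connected U V" and E: "preserves_pullbacks SV V E"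
 shows "preserves_pullbacks GV GV (Gamma V E)" unfolding preserves_pullbacks_def
proof (intro allI impI)
 fix p q f g assume pb: "is_pullback GV p q f g"
 define P X Y Z where "P = Dom GV p" and "X = Dom GV f" and "Y = Dom GV g" and "Z = Cod GV f"
 note pq = GV.pullbackD[OF pb, folded P_def X_def Y_def Z_def]
 note p = pq(1) and q = pq(2) and f = pq(3) and g = pq(4)
 note D = GV_pullbackD[OF pb p q f g]
 note PO = GHomD(1)[OF p] and XO = GHomD(1)[OF f] and YO = GHomD(1)[OF g] and ZO = GHomD(2)[OF f]
 \<comment> \<open>Two paths with the same image in \<open>Z\<close> lift vertex by vertex; the end
   points are the prescribed ones because a vertex of \<open>P\<close> is determined by its two
   projections.\<close>
 have lift: "EX r:paths P c d. map (VMap p) r = a & map (VMap q) r = b"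
  if c: "c : Verts P" "d : Verts P" and a: "a : paths X (VMap p c) (VMap p d)" and b: "b : paths Y (VMap q c) (VMap q d)"
   and e: "map (VMap f) a = map (VMap g) b" for c d a b
 proof -
  have len: "length a = length b" using e by (metis length_map)
  have fi: "VMap f (a ! i) = VMap g (b ! i)" if "i < length a" for i
  proof -
   have "map (VMap f) a ! i = map (VMap g) b ! i" using e by simp
   then show ?thesis using that len by simp
  qed
  have "EX x. x : Verts P & VMap p x = a ! i & VMap q x = b ! i" if i: "i < length a" for i
  proof -
   have "a ! i : Verts X" "b ! i : Verts Y"
    using subsetD[OF pathsD(2)[OF a] nth_mem[OF i]] subsetD[OF pathsD(2)[OF b] nth_mem[of i b]] i len by auto
   then show ?thesis using D(2) fi[OF i] by blast
  qed
  then obtain h where h: "!!i. i < length a ==> h i : Verts P & VMap p (h i) = a ! i & VMap q (h i) = b ! i" by metis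
  let ?r = "map h [0..<length a]"
  have r: "map (VMap p) ?r = a" "map (VMap q) ?r = b" using h len by (auto intro!: nth_equalityI)
  have ne: "?r ~= []" and rP: "set ?r \<subseteq> Verts P" using pathsD(1)[OF a] h by auto
  have "hd ?r : Verts P" "last ?r : Verts P" using rP hd_in_set[OF ne] last_in_set[OF ne] by blast+
  moreover have "VMap p (hd ?r) = VMap p c" "VMap q (hd ?r) = VMap q c" "VMap p (last ?r) = VMap p d" "VMap q (last ?r) = VMap q d"
   using pathsD(3,4)[OF a] pathsD(3,4)[OF b] r ne by (metis hd_map last_map)+
  ultimately have "hd ?r = c" "last ?r = d" using D(3) c by blast+
  then have "?r : paths P c d" using ne rP by (simp add: paths_def)
  then show ?thesis using r by blast
 qed
 have "is_pullback GV (\<G>m p) (\<G>m q) (\<G>m f) (\<G>m g)"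
 proof (rule GV_pullbackI[OF \<G>m_props(1)[OF p] \<G>m_props(1)[OF q] \<G>m_props(1)[OF f] \<G>m_props(1)[OF g]])
  fix c d assume "c : Verts (\<G> P)" "d : Verts (\<G> P)"
  then have c: "c : Verts P" "d : Verts P" by auto
  note pc = GHomD(5)[OF p c(1)] GHomD(5)[OF p c(2)] and qc = GHomD(5)[OF q c(1)] GHomD(5)[OF q c(2)]
  have gZ: "EMap (\<G>m g) (VMap q c, VMap q d) : Hom V (Edge (\<G> Y) (VMap q c, VMap q d))
   (Edge (\<G> Z) (VMap f (VMap p c), VMap f (VMap p d)))" using \<G>m_EMap_Hom[OF g qc] D(1) c by simp
  have com: "EMap (\<G>m f) (VMap p c, VMap p d) ** EMap (\<G>m p) (c, d) = EMap (\<G>m g) (VMap q c, VMap q d) ** EMap (\<G>m q) (c, d)"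
  proof -
   have "\<G>m f \<star>GV \<G>m p = \<G>m g \<star>GV \<G>m q" using \<G>m_comp[OF p f] \<G>m_comp[OF q g] pq(5) by simp
   then show ?thesis
    using GComp(2)[OF \<G>m_props(1)[OF p], of c d "\<G>m f"] GComp(2)[OF \<G>m_props(1)[OF q], of c d "\<G>m g"] c by simp
  qed
  have "is_pullback V (EMap (\<G>m p) (c, d)) (EMap (\<G>m q) (c, d)) (EMap (\<G>m f) (VMap p c, VMap p d)) (EMap (\<G>m g) (VMap q c, VMap q d))"
  proof (rule V.pullback_on_connected[OF cc \<G>m_EMap_Hom[OF p c] \<G>m_EMap_Hom[OF q c] \<G>m_EMap_Hom[OF f pc] gZ com])
   fix T x y assume T: "conn T" and x: "x : Hom V T (Edge (\<G> X) (VMap p c, VMap p d))"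
    and y: "y : Hom V T (Edge (\<G> Y) (VMap q c, VMap q d))"
    and e: "EMap (\<G>m f) (VMap p c, VMap p d) ** x = EMap (\<G>m g) (VMap q c, VMap q d) ** y"
   obtain a x' where a: "a : paths X (VMap p c) (VMap p d)" "x' : Hom V T (smd X a)" "x = \<iota> X a ** x'"
    by (rule connected_\<G>_ex[OF T XO pc x])
   obtain b y' where b: "b : paths Y (VMap q c) (VMap q d)" "y' : Hom V T (smd Y b)" "y = \<iota> Y b ** y'"
    by (rule connected_\<G>_ex[OF T YO qc y])
   have gb: "map (VMap g) b : paths Z (VMap f (VMap p c)) (VMap f (VMap p d))" using path_map_Hom[OF g b(1)] D(1) c by simp
   have "map (VMap f) a = map (VMap g) b & path_arr f a ** x' = path_arr g b ** y'"
    by (rule connected_\<G>_eq[OF T ZO path_map_Hom[OF f a(1)] V.comp_Hom[OF a(2) path_arr_Hom[OF f a(1)]]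
       gb V.comp_Hom[OF b(2) path_arr_Hom[OF g b(1)]]]) (use e \<G>m_point[OF f a(1,2)] \<G>m_point[OF g b(1,2)] a(3) b(3) in simp)
   then have ab: "map (VMap f) a = map (VMap g) b" and xy: "path_arr f a ** x' = path_arr g b ** y'" by auto
   obtain r where r: "r : paths P c d" "map (VMap p) r = a" "map (VMap q) r = b" using lift[OF c a(1) b(1) ab] by blast
   have pb': "is_pullback V (path_arr p r) (path_arr q r) (path_arr f a) (path_arr g b)"
    using path_pullback[OF E pb p q f g r(1)] r(2,3) by simp
   obtain h where h: "h : Hom V T (Dom V (path_arr p r))" "path_arr p r ** h = x'" "path_arr q r ** h = y'"
    by (rule V.pullback_ex[OF pb']) (use a(2) b(2) xy HomD(2)[OF path_arr_Hom[OF f a(1)]] HomD(2)[OF path_arr_Hom[OF g b(1)]] in auto)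
   have h': "h : Hom V T (smd P r)" using h(1) HomD(2)[OF path_arr_Hom[OF p r(1)]] by simp
   show "EX h. h : Hom V T (Edge (\<G> P) (c, d)) & EMap (\<G>m p) (c, d) ** h = x & EMap (\<G>m q) (c, d) ** h = y"
    using V.comp_Hom[OF h' \<iota>_Hom[OF PO r(1)]] \<G>m_point[OF p r(1) h'] \<G>m_point[OF q r(1) h'] h(2,3) r(2,3) a(3) b(3)
    by (intro exI[of _ "\<iota> P r ** h"]) simp
  next
   fix T h h' assume T: "conn T" and h0: "h : Hom V T (Edge (\<G> P) (c, d))" "h' : Hom V T (Edge (\<G> P) (c, d))"
    and e: "EMap (\<G>m p) (c, d) ** h = EMap (\<G>m p) (c, d) ** h'" "EMap (\<G>m q) (c, d) ** h = EMap (\<G>m q) (c, d) ** h'"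
   obtain r k where r: "r : paths P c d" "k : Hom V T (smd P r)" "h = \<iota> P r ** k" by (rule connected_\<G>_ex[OF T PO c h0(1)])
   obtain r' k' where r': "r' : paths P c d" "k' : Hom V T (smd P r')" "h' = \<iota> P r' ** k'"
    by (rule connected_\<G>_ex[OF T PO c h0(2)])
   have 1: "map (VMap p) r = map (VMap p) r' & path_arr p r ** k = path_arr p r' ** k'"
    by (rule connected_\<G>_eq[OF T XO path_map_Hom[OF p r(1)] V.comp_Hom[OF r(2) path_arr_Hom[OF p r(1)]]
       path_map_Hom[OF p r'(1)] V.comp_Hom[OF r'(2) path_arr_Hom[OF p r'(1)]]])
     (use e(1) \<G>m_point[OF p r(1,2)] \<G>m_point[OF p r'(1,2)] r(3) r'(3) in simp)
   have 2: "map (VMap q) r = map (VMap q) r' & path_arr q r ** k = path_arr q r' ** k'"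
    by (rule connected_\<G>_eq[OF T YO path_map_Hom[OF q r(1)] V.comp_Hom[OF r(2) path_arr_Hom[OF q r(1)]]
       path_map_Hom[OF q r'(1)] V.comp_Hom[OF r'(2) path_arr_Hom[OF q r'(1)]]])
     (use e(2) \<G>m_point[OF q r(1,2)] \<G>m_point[OF q r'(1,2)] r(3) r'(3) in simp)
   \<comment> \<open>As a vertex of \<open>P\<close> is determined by its projections, so is a
     path.\<close>
   have rr: "r = r'"
   proof (rule nth_equalityI)
    show l: "length r = length r'" using 1 by (metis length_map)
    fix i assume i: "i < length r"
    have "map (VMap p) r ! i = map (VMap p) r' ! i" "map (VMap q) r ! i = map (VMap q) r' ! i" using 1 2 by auto
    moreover have "r ! i : Verts P" "r' ! i : Verts P" using pathsD(2)[OF r(1)] pathsD(2)[OF r'(1)] i l nth_mem by (metis subsetD)+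
    ultimately show "r ! i = r' ! i" using D(3) i l by simp
   qed
   have "k = k'" by (rule V.pullback_eq[OF path_pullback[OF E pb p q f g r(1)]])
     (use 1 2 rr r(2) r'(2) HomD(2)[OF path_arr_Hom[OF p r(1)]] in auto)
   then show "h = h'" using r r' rr by simp
  qed
  then show "is_pullback V (EMap (\<G>m p) (c, d)) (EMap (\<G>m q) (c, d)) (EMap (\<G>m f) (VMap (\<G>m p) c, VMap (\<G>m p) d))
   (EMap (\<G>m g) (VMap (\<G>m q) c, VMap (\<G>m q) d))" by simp
 qed (use D in auto)
 then show "is_pullback GV (AMap (Gamma V E) p) (AMap (Gamma V E) q) (AMap (Gamma V E) f) (AMap (Gamma V E) g)" by simp
qed

lemma pullback_Zero:
 assumes "p : Hom V Zero Zero" "q : Hom V Zero Zero" "f : Hom V Zero Zero" "g : Hom V Zero Zero"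
 shows "is_pullback V p q f g"
proof -
 have i: "k = Ide V Zero" if "k : Hom V Zero Zero" for k using Zero_eq[OF that V.Ide_Hom] by simp
 show ?thesis unfolding i[OF assms(1)] i[OF assms(2)] i[OF assms(3)] i[OF assms(4)]
  by (rule V.pullbackI[where P = Zero and A = Zero and B = Zero and D = Zero]) (auto simp: V.Ide_Hom V.id_l)
qed

text \<open>Away from the edges that carry the given arrows all four homs are \<open>Zero\<close>,
  and every square of endomorphisms of \<open>Zero\<close> is a pullback.\<close>

lemma seq_graph_pullback:
 assumes pb: "is_pullback SV ps qs fs gs" and p: "ps : Hom SV Ps As" and q: "qs : Hom SV Ps Bs"
  and f: "fs : Hom SV As Ds" and g: "gs : Hom SV Bs Ds"
 shows "is_pullback GV (seq_graph_map Ps As ps) (seq_graph_map Ps Bs qs) (seq_graph_map As Ds fs) (seq_graph_map Bs Ds gs)"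
proof -
 have l: "length As = length Ps" "length Bs = length Ps" "length Ds = length Ps" using p q f by (auto simp: seq_Hom_iff)
 note P = seq_graph_map[OF p] and Q = seq_graph_map[OF q] and F = seq_graph_map[OF f] and G = seq_graph_map[OF g]
 show ?thesis
 proof (rule GV_pullbackI[OF P(1) Q(1) F(1) G(1)])
  fix c d assume "c : Verts (seq_graph Ps)" "d : Verts (seq_graph Ps)"
  then obtain i j where ij: "c = vtx i" "d = vtx j" "i \<le> length Ps" "j \<le> length Ps" by (auto simp: Verts_seq_graph)
  show "is_pullback V (EMap (seq_graph_map Ps As ps) (c, d)) (EMap (seq_graph_map Ps Bs qs) (c, d))
   (EMap (seq_graph_map As Ds fs) (VMap (seq_graph_map Ps As ps) c, VMap (seq_graph_map Ps As ps) d))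
   (EMap (seq_graph_map Bs Ds gs) (VMap (seq_graph_map Ps Bs qs) c, VMap (seq_graph_map Ps Bs qs) d))"
  proof (cases "j = Suc i")
   case True
   then show ?thesis using pb ij l P(2,3) Q(2,3) F(3) G(3) unfolding V.seq_pullback_iff[OF p q f g] by simp
  next
   case False
   have v: "vtx i : Verts (seq_graph Xs)" "vtx j : Verts (seq_graph Xs)" if "length Xs = length Ps" for Xs using ij that by auto
   show ?thesis by (rule pullback_Zero)
     (use GHomD(6)[OF P(1) v(1) v(2)] GHomD(6)[OF Q(1) v(1) v(2)] GHomD(6)[OF F(1) v(1) v(2)] GHomD(6)[OF G(1) v(1) v(2)] False ij l P(2) Q(2) F(2) G(2)
      in "simp_all add: Edge_seq_graph")
  qed
 qed (use P(2) Q(2) F(2) G(2) l in "auto simp: Verts_seq_graph")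
qed

lemma seq_graph_map_id:
 assumes f: "fs : Hom SV Xs Ys" and p: "set p \<subseteq> Verts (seq_graph Xs)"
 shows "map (VMap (seq_graph_map Xs Ys fs)) p = p" using p seq_graph_map(2)[OF f] by (intro map_idI) (auto simp: Verts_seq_graph)

lemma line_inj_Hom: "Xs : Seqs ==>
  \<iota> (seq_graph Xs) (line 0 (length Xs)) : Hom V (OMap E Xs) (Edge (\<G> (seq_graph Xs)) (ends Xs))"
 using \<iota>_Hom[OF seq_graph_Obj line_path0] by (simp add: smd_line)

lemma seq_Obj: "fs : Hom SV Xs Ys ==> Xs : Seqs & Ys : Seqs & length Ys = length Xs"
 using Category.Hom_Obj[of "SV" fs Xs Ys] V.category_seq_cat by (auto simp: Category_def seq_Hom_iff)

lemma seq_point: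
 assumes f: "fs : Hom SV Xs Ys" and x: "x : Hom V T (OMap E Xs)"
 shows "EMap (\<G>m (seq_graph_map Xs Ys fs)) (ends Xs) ** (\<iota> (seq_graph Xs) (line 0 (length Xs)) ** x) =
  \<iota> (seq_graph Ys) (line 0 (length Xs)) ** (AMap E fs ** x)"
 using \<G>m_point[OF seq_graph_map(1)[OF f] line_path0, of x T] x seq_graph_map(4,6)[OF f] by (simp add: smd_line)

lemma seq_\<G>_EMap_Hom:
 assumes f: "fs : Hom SV Xs Ys"
 shows "EMap (\<G>m (seq_graph_map Xs Ys fs)) (ends Xs) \<in>
  Hom V (Edge (\<G> (seq_graph Xs)) (ends Xs)) (Edge (\<G> (seq_graph Ys)) (ends Xs))"
 using \<G>m_EMap_Hom[OF seq_graph_map(1)[OF f], of "vtx 0" "vtx (length Xs)"] seq_graph_map(2)[OF f] by simp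

lemma connected_line_eq:
 assumes T: "conn T" and X: "Xs : Seqs" and x: "x : Hom V T (OMap E Xs)" "x' : Hom V T (OMap E Xs)"
  and e: "\<iota> (seq_graph Xs) (line 0 (length Xs)) ** x = \<iota> (seq_graph Xs) (line 0 (length Xs)) ** x'"
 shows "x = x'" using connected_\<G>_eq[OF T seq_graph_Obj[OF X] line_path0 _ line_path0] x e by (simp add: smd_line)

text \<open>A pullback of sequences becomes a pullback of linear graphs, preserved by
  \<open>Gamma\<close>. On the hom from the first to the last vertex, the square in question is
  found at the summand of the straight path.\<close>

lemma preserves_pullbacks_E:
 assumes cc: "coproducts_of_connected U V" and G: "preserves_pullbacks GV GV (Gamma V E)"
 shows "preserves_pullbacks SV V E" unfolding preserves_pullbacks_def
proof (intro allI impI)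
 fix ps qs fs gs assume pb: "is_pullback SV ps qs fs gs"
 interpret S: Category "SV" by unfold_locales (rule V.category_seq_cat)
 define Ps As Bs Ds where "Ps = Dom SV ps" and "As = Dom SV fs" and "Bs = Dom SV gs" and "Ds = Cod SV fs"
 note pq = S.pullbackD[OF pb, folded Ps_def As_def Bs_def Ds_def]
 note p = pq(1) and q = pq(2) and f = pq(3) and g = pq(4)
 have L: "Ps : Seqs" "As : Seqs" "Bs : Seqs" "Ds : Seqs"
  and l: "length As = length Ps" "length Bs = length Ps" "length Ds = length Ps"
  using seq_Obj[OF p] seq_Obj[OF q] seq_Obj[OF f] by auto
 let ?n = "length Ps" and ?l = "line 0 (length Ps)"
 let ?p = "seq_graph_map Ps As ps" and ?q = "seq_graph_map Ps Bs qs" and ?f = "seq_graph_map As Ds fs" and ?g = "seq_graph_map Bs Ds gs"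
 note P = seq_graph_map[OF p] and Q = seq_graph_map[OF q] and F = seq_graph_map[OF f] and Gm = seq_graph_map[OF g]
 have pbG: "is_pullback GV (\<G>m ?p) (\<G>m ?q) (\<G>m ?f) (\<G>m ?g)"
  using G seq_graph_pullback[OF pb p q f g] unfolding preserves_pullbacks_def by simp
 have v: "vtx 0 : Verts (seq_graph Ps)" "vtx ?n : Verts (seq_graph Ps)" by auto
 have pbV: "is_pullback V (EMap (\<G>m ?p) (vtx 0, vtx ?n)) (EMap (\<G>m ?q) (vtx 0, vtx ?n))
  (EMap (\<G>m ?f) (vtx 0, vtx ?n)) (EMap (\<G>m ?g) (vtx 0, vtx ?n))"
  using GV_pullbackD(4)[OF pbG \<G>m_props(1)[OF P(1)] \<G>m_props(1)[OF Q(1)] \<G>m_props(1)[OF F(1)] \<G>m_props(1)[OF Gm(1)], of "vtx 0" "vtx ?n"]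
   v P(2) Q(2) by simp
 have iA: "\<iota> (seq_graph As) ?l : Hom V (OMap E As) (Edge (\<G> (seq_graph As)) (vtx 0, vtx ?n))"
  and iB: "\<iota> (seq_graph Bs) ?l : Hom V (OMap E Bs) (Edge (\<G> (seq_graph Bs)) (vtx 0, vtx ?n))"
  and iP: "\<iota> (seq_graph Ps) ?l : Hom V (OMap E Ps) (Edge (\<G> (seq_graph Ps)) (vtx 0, vtx ?n))"
  using line_inj_Hom[OF L(2)] line_inj_Hom[OF L(3)] line_inj_Hom[OF L(1)] l by simp_all
 have com: "AMap E fs ** AMap E ps = AMap E gs ** AMap E qs" using E_comp_seq[OF p f] E_comp_seq[OF q g] pq(5) by simp
 have lp: "?l : paths (seq_graph Xs) (vtx 0) (vtx ?n)" if "length Xs = ?n" for Xs using line_path0[of Xs] that by simp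
 show "is_pullback V (AMap E ps) (AMap E qs) (AMap E fs) (AMap E gs)"
 proof (rule V.pullback_on_connected[OF cc E_Hom_seq[OF p] E_Hom_seq[OF q] E_Hom_seq[OF f] E_Hom_seq[OF g] com])
  fix T x y assume T: "conn T" and x: "x : Hom V T (OMap E As)" and y: "y : Hom V T (OMap E Bs)"
   and e: "AMap E fs ** x = AMap E gs ** y"
  obtain h where h: "h : Hom V T (Dom V (EMap (\<G>m ?p) (vtx 0, vtx ?n)))"
   "EMap (\<G>m ?p) (vtx 0, vtx ?n) ** h = \<iota> (seq_graph As) ?l ** x" "EMap (\<G>m ?q) (vtx 0, vtx ?n) ** h = \<iota> (seq_graph Bs) ?l ** y"
  proof (rule V.pullback_ex[OF pbV])
   show "\<iota> (seq_graph As) ?l ** x : Hom V T (Dom V (EMap (\<G>m ?f) (vtx 0, vtx ?n)))"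
    using V.comp_Hom[OF x iA] HomD(2)[OF seq_\<G>_EMap_Hom[OF f]] l by simp
   show "\<iota> (seq_graph Bs) ?l ** y : Hom V T (Dom V (EMap (\<G>m ?g) (vtx 0, vtx ?n)))"
    using V.comp_Hom[OF y iB] HomD(2)[OF seq_\<G>_EMap_Hom[OF g]] l by simp
   show "EMap (\<G>m ?f) (vtx 0, vtx ?n) ** (\<iota> (seq_graph As) ?l ** x) = EMap (\<G>m ?g) (vtx 0, vtx ?n) ** (\<iota> (seq_graph Bs) ?l ** y)"
    using seq_point[OF f x] seq_point[OF g y] e l by simp
  qed
  have h': "h : Hom V T (Edge (\<G> (seq_graph Ps)) (vtx 0, vtx ?n))" using h(1) HomD(2)[OF seq_\<G>_EMap_Hom[OF p]] by simp
  obtain r k where r: "r : paths (seq_graph Ps) (vtx 0) (vtx ?n)" "k : Hom V T (smd (seq_graph Ps) r)" "h = \<iota> (seq_graph Ps) r ** k"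
   by (rule connected_\<G>_ex[OF T seq_graph_Obj[OF L(1)] v h'])
  have "map (VMap ?p) r = ?l & path_arr ?p r ** k = x"
   by (rule connected_\<G>_eq[OF T seq_graph_Obj[OF L(2)] path_map_Hom[OF P(1) r(1), unfolded P(2)[OF le0] P(2)[OF le_refl]]
      V.comp_Hom[OF r(2) path_arr_Hom[OF P(1) r(1)]] lp[OF l(1)]])
    (use h(2) \<G>m_point[OF P(1) r(1,2)] r(3) x smd_line[of As] l in simp_all)
  \<comment> \<open>Morphisms between linear graphs of sequences fix all vertices, so
    \<open>r\<close> equals its image, the straight path.\<close>
  then have rl: "r = ?l" and kx: "path_arr ?p r ** k = x" using seq_graph_map_id[OF p pathsD(2)[OF r(1)]] by auto
  have "map (VMap ?q) r = ?l & path_arr ?q r ** k = y"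
   by (rule connected_\<G>_eq[OF T seq_graph_Obj[OF L(3)] path_map_Hom[OF Q(1) r(1), unfolded Q(2)[OF le0] Q(2)[OF le_refl]]
      V.comp_Hom[OF r(2) path_arr_Hom[OF Q(1) r(1)]] lp[OF l(2)]])
    (use h(3) \<G>m_point[OF Q(1) r(1,2)] r(3) y smd_line[of Bs] l in simp_all)
  then show "EX h. h : Hom V T (OMap E Ps) & AMap E ps ** h = x & AMap E qs ** h = y"
   using kx r(2) P(6) Q(6) unfolding rl by (auto simp: smd_line)
 next
  fix T h h' assume T: "conn T" and h: "h : Hom V T (OMap E Ps)" "h' : Hom V T (OMap E Ps)"
   and e: "AMap E ps ** h = AMap E ps ** h'" "AMap E qs ** h = AMap E qs ** h'"
  have "\<iota> (seq_graph Ps) ?l ** h = \<iota> (seq_graph Ps) ?l ** h'" by (rule V.pullback_eq[OF pbV])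
    (use V.comp_Hom[OF h(1) iP] V.comp_Hom[OF h(2) iP] HomD(2)[OF seq_\<G>_EMap_Hom[OF p]] seq_point[OF p h(1)] seq_point[OF p h(2)]
     seq_point[OF q h(1)] seq_point[OF q h(2)] e in auto)
  then show "h = h'" by (rule connected_line_eq[OF T L(1) h])
 qed
qed

section \<open>Cartesianness of the unit and the multiplication\<close>

abbreviation cartesian_u :: bool where "cartesian_u \<equiv> cartesian_transformation V V id_ftor (unary_part E) u"

abbreviation cartesian_sig :: bool where "cartesian_sig \<equiv> cartesian_transformation (seq_cat SV) V
   (comp_ftor E (map_ftor E)) (comp_ftor E concat_ftor) sig"

abbreviation cartesian_\<eta> :: bool where "cartesian_\<eta> \<equiv> cartesian_transformation GV GV id_ftor (Gamma V E) \<eta>"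

abbreviation cartesian_\<mu> :: bool where
 "cartesian_\<mu> \<equiv> cartesian_transformation GV GV (comp_ftor (Gamma V E) (Gamma V E)) (Gamma V E) \<mu>"

lemma cartesian_u_iff: "cartesian_u \<longleftrightarrow> (ALL f A B. f : Hom V A B --> is_pullback V (u A) f (AMap E [f]) (u B))"
 using multitensor by (auto simp: cartesian_transformation_def multitensor_def id_ftor_def unary_part_def Hom_def)

lemma cartesian_sig_iff: "cartesian_sig \<longleftrightarrow> (ALL fss XSS YSS. fss : Hom (seq_cat SV) XSS YSS -->
   is_pullback V (sig XSS) (AMap E (map (AMap E) fss)) (AMap E (concat fss)) (sig YSS))" using multitensor
 by (auto simp: cartesian_transformation_def multitensor_def comp_ftor_def map_ftor_def concat_ftor_def Hom_def)

lemma cartesian_\<eta>_iff: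
 "cartesian_\<eta> \<longleftrightarrow> (ALL f X Y. f : Hom GV X Y --> is_pullback GV (\<eta> X) f (\<G>m f) (\<eta> Y))"
 using monad_\<G> by (auto simp: cartesian_transformation_def monad_def id_ftor_def Hom_def)

lemma cartesian_\<mu>_iff:
 "cartesian_\<mu> \<longleftrightarrow> (ALL f X Y. f : Hom GV X Y --> is_pullback GV (\<mu> X) (\<G>m (\<G>m f)) (\<G>m f) (\<mu> Y))"
 using monad_\<G> by (auto simp: cartesian_transformation_def monad_def comp_ftor_def Hom_def)

lemma \<eta>_EMap_Hom:
 assumes X: "X : Obj GV" and a: "a : Verts X" "b : Verts X"
 shows "EMap (\<eta> X) (a, b) : Hom V (Edge X (a, b)) (Edge (\<G> X) (a, b))"
 using GHomD(6)[OF \<eta>_props(1)[OF X] a] a \<eta>_props(2)[OF X] by simp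

lemma \<eta>_point:
 assumes X: "X : Obj GV" and a: "a : Verts X" "b : Verts X" and g: "g : Hom V T (Edge X (a, b))"
 shows "EMap (\<eta> X) (a, b) ** g = \<iota> X [a, b] ** (u (Edge X (a, b)) ** g)"
 unfolding \<eta>_props(3)[OF X a] by (rule V.assoc[OF g \<eta>_props(4)[OF X a] \<iota>_Hom[OF X edge_path[OF a]]])

lemma cartesian_\<eta>:
 assumes cc: "coproducts_of_connected U V" and u: cartesian_u
 shows cartesian_\<eta> unfolding cartesian_\<eta>_iff
proof (intro allI impI)
 fix f X Y assume f: "f : Hom GV X Y"
 note D = GHomD[OF f]
 note H = \<eta>_props[OF D(1)] and H' = \<eta>_props[OF D(2)]
 show "is_pullback GV (\<eta> X) f (\<G>m f) (\<eta> Y)"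
 proof (rule GV_pullbackI[OF H(1) f \<G>m_props(1)[OF f] H'(1)])
  fix c d assume c: "c : Verts X" "d : Verts X"
  note fc = D(5)[OF c(1)] D(5)[OF c(2)]
  have upb: "is_pullback V (u (Edge X (c, d))) (EMap f (c, d)) (path_arr f [c, d]) (u (Edge Y (VMap f c, VMap f d)))"
   using u D(6)[OF c] unfolding cartesian_u_iff path_arr_def by simp
  have com: "EMap (\<G>m f) (c, d) ** EMap (\<eta> X) (c, d) = EMap (\<eta> Y) (VMap f c, VMap f d) ** EMap f (c, d)"
   using \<eta>_natural[OF f] GComp(2)[OF H(1) c, of "\<G>m f"] GComp(2)[OF f c, of "\<eta> Y"] H(2) c by simp
  have "is_pullback V (EMap (\<eta> X) (c, d)) (EMap f (c, d)) (EMap (\<G>m f) (c, d)) (EMap (\<eta> Y) (VMap f c, VMap f d))"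
  proof (rule V.pullback_on_connected[OF cc \<eta>_EMap_Hom[OF D(1) c] D(6)[OF c] \<G>m_EMap_Hom[OF f c] \<eta>_EMap_Hom[OF D(2) fc] com])
   fix T x y assume T: "conn T" and x: "x : Hom V T (Edge (\<G> X) (c, d))" and y: "y : Hom V T (Edge Y (VMap f c, VMap f d))"
    and e: "EMap (\<G>m f) (c, d) ** x = EMap (\<eta> Y) (VMap f c, VMap f d) ** y"
   obtain a x' where a: "a : paths X c d" "x' : Hom V T (smd X a)" "x = \<iota> X a ** x'" by (rule connected_\<G>_ex[OF T D(1) c x])
   have "map (VMap f) a = [VMap f c, VMap f d] & path_arr f a ** x' = u (Edge Y (VMap f c, VMap f d)) ** y"
    by (rule connected_\<G>_eq[OF T D(2) path_map_Hom[OF f a(1)] V.comp_Hom[OF a(2) path_arr_Hom[OF f a(1)]]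
       edge_path[OF fc] V.comp_Hom[OF y H'(4)[OF fc]]]) (use e \<G>m_point[OF f a(1,2)] \<eta>_point[OF D(2) fc y] a(3) in simp)
   then have m: "map (VMap f) a = [VMap f c, VMap f d]" and eq: "path_arr f a ** x' = u (Edge Y (VMap f c, VMap f d)) ** y" by auto
   \<comment> \<open>A vertex map preserves lengths, so a path lying over a single step is itself
     the step \<open>[c, d]\<close>.\<close>
   have "length a = 2" using arg_cong[OF m, of length] by simp
   then have acd: "a = [c, d]" using pathsD[OF a(1)] by (auto simp: length_Suc_conv numeral_2_eq_2)
   obtain h where h: "h : Hom V T (Dom V (u (Edge X (c, d))))" "u (Edge X (c, d)) ** h = x'" "EMap f (c, d) ** h = y"
    by (rule V.pullback_ex[OF upb])
     (use a(2) acd y eq HomD(2)[OF path_arr_Hom[OF f edge_path[OF c]]] HomD(2)[OF H'(4)[OF fc]] in auto)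
   have h': "h : Hom V T (Edge X (c, d))" using h(1) HomD(2)[OF H(4)[OF c]] by simp
   show "EX h. h : Hom V T (Edge X (c, d)) & EMap (\<eta> X) (c, d) ** h = x & EMap f (c, d) ** h = y"
    using h' h \<eta>_point[OF D(1) c h'] a(3) acd by auto
  next
   fix T h h' assume T: "conn T" and h: "h : Hom V T (Edge X (c, d))" "h' : Hom V T (Edge X (c, d))"
    and e: "EMap (\<eta> X) (c, d) ** h = EMap (\<eta> X) (c, d) ** h'" "EMap f (c, d) ** h = EMap f (c, d) ** h'"
   note uH = H(4)[OF c]
   have "u (Edge X (c, d)) ** h = u (Edge X (c, d)) ** h'"
    using connected_\<G>_eq[OF T D(1) edge_path[OF c] V.comp_Hom[OF h(1) uH] edge_path[OF c] V.comp_Hom[OF h(2) uH]]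
     e(1) \<eta>_point[OF D(1) c] h by simp
   note uu = this
   show "h = h'" by (rule V.pullback_eq[OF upb]) (use uu h e HomD(2)[OF uH] in auto)
  qed
  then show "is_pullback V (EMap (\<eta> X) (c, d)) (EMap f (c, d)) (EMap (\<G>m f) (VMap (\<eta> X) c, VMap (\<eta> X) d))
   (EMap (\<eta> Y) (VMap f c, VMap f d))" using H(2) c by simp
 qed (use H(2) H'(2) D(5) in auto)
qed

text \<open>In the graph with one edge labelled \<open>A\<close>, the unit at that edge is
  \<open>u A\<close> followed by the inclusion of the straight path; this inclusion can be cancelled
  on arrows from connected objects.\<close>

lemma cartesian_u:
 assumes cc: "coproducts_of_connected U V" and e: cartesian_\<eta>
 shows cartesian_u unfolding cartesian_u_iff
proof (intro allI impI)
 fix f A B assume f: "f : Hom V A B"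
 have AB: "A : Obj V" "B : Obj V" using V.Hom_Obj[OF f] by auto
 have fs: "[f] : Hom SV [A] [B]" using f by (simp add: seq_Hom_iff)
 let ?X = "seq_graph [A]" and ?Y = "seq_graph [B]" and ?f = "seq_graph_map [A] [B] [f]"
 note F = seq_graph_map[OF fs]
 note D = GHomD[OF F(1)] and F1 = F(1)
 note H = \<eta>_props[OF D(1)] and H' = \<eta>_props[OF D(2)]
 have v: "vtx 0 : Verts ?X" "vtx (Suc 0) : Verts ?X" and v': "vtx 0 : Verts ?Y" "vtx (Suc 0) : Verts ?Y" by auto
 have EX: "Edge ?X e01 = A" "Edge ?Y e01 = B" by (simp_all add: Edge_seq_graph)
 have Fv: "VMap ?f (vtx 0) = vtx 0" "VMap ?f (vtx (Suc 0)) = vtx (Suc 0)" "EMap ?f e01 = f" using F(2,3) by auto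
 have l: "line 0 (Suc 0) = [vtx 0, vtx (Suc 0)]" by (simp add: line_simps)
 have "is_pullback GV (\<eta> ?X) ?f (\<G>m ?f) (\<eta> ?Y)" using e F(1) unfolding cartesian_\<eta>_iff by blast
 from GV_pullbackD(4)[OF this H(1) F(1) \<G>m_props(1)[OF F(1)] H'(1), OF v]
 have pb: "is_pullback V (EMap (\<eta> ?X) e01) f (EMap (\<G>m ?f) e01) (EMap (\<eta> ?Y) e01)" using H(2) v Fv by simp
 note etaX = \<eta>_EMap_Hom[OF D(1) v, unfolded EX] and etaY = \<eta>_EMap_Hom[OF D(2) v', unfolded EX]
 note pX = \<eta>_point[OF D(1) v, unfolded EX] and pY = \<eta>_point[OF D(2) v', unfolded EX]
 have EH: "AMap E [f] : Hom V (OMap E [A]) (OMap E [B])" by (rule E_Hom_seq[OF fs])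
 have iX: "\<iota> ?X [vtx 0, vtx (Suc 0)] : Hom V (OMap E [A]) (Edge (\<G> ?X) e01)" using line_inj_Hom[of "[A]"] AB l by simp
 have sp: "EMap (\<G>m ?f) e01 ** (\<iota> ?X [vtx 0, vtx (Suc 0)] ** x) = \<iota> ?Y [vtx 0, vtx (Suc 0)] ** (AMap E [f] ** x)"
  if "x : Hom V T (OMap E [A])" for x T using seq_point[OF fs that] l by simp
 have GfH: "EMap (\<G>m ?f) e01 : Hom V (Edge (\<G> ?X) e01) (Edge (\<G> ?Y) e01)" using seq_\<G>_EMap_Hom[OF fs] by simp
 show "is_pullback V (u A) f (AMap E [f]) (u B)"
 proof (rule V.pullback_on_connected[OF cc u_Hom[OF AB(1)] f EH u_Hom[OF AB(2)] u_natural[OF f]])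
  fix T x y assume T: "conn T" and x: "x : Hom V T (OMap E [A])" and y: "y : Hom V T B" and e: "AMap E [f] ** x = u B ** y"
  obtain h where h: "h : Hom V T (Dom V (EMap (\<eta> ?X) e01))"
   "EMap (\<eta> ?X) e01 ** h = \<iota> ?X [vtx 0, vtx (Suc 0)] ** x" "f ** h = y" by (rule V.pullback_ex[OF pb])
    (use V.comp_Hom[OF x iX] y HomD(2)[OF GfH] HomD(2)[OF etaY] sp[OF x] pY[OF y] e in auto)
  have h': "h : Hom V T A" using h(1) HomD(2)[OF etaX] by simp
  have "u A ** h = x" using connected_line_eq[OF T _ V.comp_Hom[OF h' u_Hom[OF AB(1)]] x] h(2) pX[OF h'] AB l by simp
  then show "EX h. h : Hom V T A & u A ** h = x & f ** h = y" using h' h(3) by blast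
 next
  fix T h h' assume T: "conn T" and h: "h : Hom V T A" "h' : Hom V T A" and e: "u A ** h = u A ** h'" "f ** h = f ** h'"
  show "h = h'" by (rule V.pullback_eq[OF pb]) (use h e pX[OF h(1)] pX[OF h(2)] HomD(2)[OF etaX] in auto)
 qed
qed

text \<open>A nesting of the image of a path lifts by \<open>split_join\<close>, and over one nested
  path the square to be checked is a naturality square of \<open>sig\<close>.\<close>

lemma cartesian_\<mu>:
 assumes cc: "coproducts_of_connected U V" and s: cartesian_sig
 shows cartesian_\<mu> unfolding cartesian_\<mu>_iff
proof (intro allI impI)
 fix f X Y assume f: "f : Hom GV X Y"
 note D = GHomD[OF f]
 note M = \<mu>_props[OF D(1)] and M' = \<mu>_props[OF D(2)] and FF = \<G>m_props(1)[OF \<G>m_props(1)[OF f]]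
 have spb: "is_pullback V (sig (nested_edges X qs)) (nested_map f qs) (path_arr f (join_paths p qs))
   (sig (nested_edges Y (map (map (VMap f)) qs)))" if "p : paths X a b" "qs : nested_paths X p" for p qs a b
 proof -
  have "is_pullback V (sig (nested_edges X qs)) (AMap E (map (AMap E) (map (%q. map (EMap f) (steps q)) qs)))
   (AMap E (concat (map (%q. map (EMap f) (steps q)) qs))) (sig (nested_edges Y (map (map (VMap f)) qs)))"
   using s nested_edges_map[OF f that(2)] unfolding cartesian_sig_iff by blast
  then show ?thesis unfolding path_arr_join[OF that] unfolding nested_map_def path_arr_def by (simp add: comp_def)
 qed
 show "is_pullback GV (\<mu> X) (\<G>m (\<G>m f)) (\<G>m f) (\<mu> Y)"
 proof (rule GV_pullbackI[OF M(1) FF \<G>m_props(1)[OF f] M'(1)])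
  fix c d assume "c : Verts (\<G> (\<G> X))" "d : Verts (\<G> (\<G> X))"
  then have c: "c : Verts X" "d : Verts X" by auto
  note fc = D(5)[OF c(1)] D(5)[OF c(2)]
  have com: "EMap (\<G>m f) (c, d) ** EMap (\<mu> X) (c, d) = EMap (\<mu> Y) (VMap f c, VMap f d) ** EMap (\<G>m (\<G>m f)) (c, d)"
   using \<mu>_natural[OF f] GComp(2)[OF M(1), of c d "\<G>m f"] GComp(2)[OF FF, of c d "\<mu> Y"] M(2) c by simp
  have "is_pullback V (EMap (\<mu> X) (c, d)) (EMap (\<G>m (\<G>m f)) (c, d)) (EMap (\<G>m f) (c, d)) (EMap (\<mu> Y) (VMap f c, VMap f d))"
  proof (rule V.pullback_on_connected[OF cc \<mu>_EMap_Hom[OF D(1) c] \<G>\<G>_EMap_Hom[OF f c] \<G>m_EMap_Hom[OF f c] \<mu>_EMap_Hom[OF D(2) fc] com])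
   fix T x y assume T: "conn T" and x: "x : Hom V T (Edge (\<G> X) (c, d))"
    and y: "y : Hom V T (Edge (\<G> (\<G> Y)) (VMap f c, VMap f d))"
    and e: "EMap (\<G>m f) (c, d) ** x = EMap (\<mu> Y) (VMap f c, VMap f d) ** y"
   obtain r x' where r: "r : paths X c d" "x' : Hom V T (smd X r)" "x = \<iota> X r ** x'" by (rule connected_\<G>_ex[OF T D(1) c x])
   obtain p qs y' where p: "p : paths Y (VMap f c) (VMap f d)" "qs : nested_paths Y p" "y' : Hom V T (nested_obj Y qs)"
    "y = (\<iota>\<iota> Y p qs) ** y'" by (rule connected_\<G>\<G>_ex[OF T D(2) fc y])
   have "map (VMap f) r = join_paths p qs & path_arr f r ** x' = sig (nested_edges Y qs) ** y'"
    by (rule connected_\<G>_eq[OF T D(2) path_map_Hom[OF f r(1)] V.comp_Hom[OF r(2) path_arr_Hom[OF f r(1)]]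
       join_mem[OF p(1,2)] V.comp_Hom[OF p(3) sig_nested_Hom[OF D(2) p(1,2)]]])
     (use e \<G>m_point[OF f r(1,2)] \<mu>_point[OF D(2) p(1-3)] r(3) p(4) in simp)
   then have m: "map (VMap f) r = join_paths p qs" and eq: "path_arr f r ** x' = sig (nested_edges Y qs) ** y'" by auto
   obtain p' qs' where p': "p' ~= []" "set p' \<subseteq> Verts X" "qs' : nested_paths X p'" "map (VMap f) p' = p"
    "map (map (VMap f)) qs' = qs" "join_paths p' qs' = r"
    using split_join[OF pathsD(1)[OF p(1)] p(2) m pathsD(2)[OF r(1)]] by (elim exE conjE)
   have "hd p' = c" using p'(6) join_nonempty(2)[of p' qs'] pathsD(3)[OF r(1)] by simp
   moreover have "last p' = d" using p'(6) join_steps[OF p'(1,3)] pathsD(4)[OF r(1)] by simp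
   ultimately have pp: "p' : paths X c d" using p'(1,2) by (simp add: paths_def)
   note pb = spb[OF pp p'(3), unfolded p'(5,6)]
   obtain h where h: "h : Hom V T (Dom V (sig (nested_edges X qs')))" "sig (nested_edges X qs') ** h = x'" "nested_map f qs' ** h = y'"
    by (rule V.pullback_ex[OF pb])
     (use r(2) p(3) eq HomD(2)[OF path_arr_Hom[OF f r(1)]] HomD(2)[OF sig_nested_Hom[OF D(2) p(1,2)]] in auto)
   have h': "h : Hom V T (nested_obj X qs')" using h(1) HomD(2)[OF sig_nested_Hom[OF D(1) pp p'(3)]] by simp
   show "EX h. h : Hom V T (Edge (\<G> (\<G> X)) (c, d)) & EMap (\<mu> X) (c, d) ** h = x & EMap (\<G>m (\<G>m f)) (c, d) ** h = y"
    using V.comp_Hom[OF h' \<G>\<G>_inj_Hom[OF D(1) pp p'(3)]] \<mu>_point[OF D(1) pp p'(3) h'] \<G>\<G>_point[OF f pp p'(3) h']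
     h(2,3) p'(4-6) r(3) p(4) by (intro exI[of _ "(\<iota>\<iota> X p' qs') ** h"]) simp
  next
   fix T h h' assume T: "conn T" and h: "h : Hom V T (Edge (\<G> (\<G> X)) (c, d))" "h' : Hom V T (Edge (\<G> (\<G> X)) (c, d))"
    and e: "EMap (\<mu> X) (c, d) ** h = EMap (\<mu> X) (c, d) ** h'" "EMap (\<G>m (\<G>m f)) (c, d) ** h = EMap (\<G>m (\<G>m f)) (c, d) ** h'"
   obtain p qs k where p: "p : paths X c d" "qs : nested_paths X p" "k : Hom V T (nested_obj X qs)"
    "h = (\<iota>\<iota> X p qs) ** k" by (rule connected_\<G>\<G>_ex[OF T D(1) c h(1)])
   obtain p' qs' k' where p': "p' : paths X c d" "qs' : nested_paths X p'" "k' : Hom V T (nested_obj X qs')"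
    "h' = (\<iota>\<iota> X p' qs') ** k'" by (rule connected_\<G>\<G>_ex[OF T D(1) c h(2)])
   have 1: "join_paths p qs = join_paths p' qs' & sig (nested_edges X qs) ** k = sig (nested_edges X qs') ** k'"
    by (rule connected_\<G>_eq[OF T D(1) join_mem[OF p(1,2)] V.comp_Hom[OF p(3) sig_nested_Hom[OF D(1) p(1,2)]]
       join_mem[OF p'(1,2)] V.comp_Hom[OF p'(3) sig_nested_Hom[OF D(1) p'(1,2)]]])
     (use e(1) \<mu>_point[OF D(1) p(1-3)] \<mu>_point[OF D(1) p'(1-3)] p(4) p'(4) in simp)
   have 2: "map (VMap f) p = map (VMap f) p' & map (map (VMap f)) qs = map (map (VMap f)) qs' & nested_map f qs ** k = nested_map f qs' ** k'"
    by (rule connected_\<G>\<G>_eq[OF T D(2) path_map_Hom[OF f p(1)] nested_map[OF p(2) D(5)] V.comp_Hom[OF p(3) nested_map_Hom[OF f p(2)]]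
       path_map_Hom[OF f p'(1)] nested_map[OF p'(2) D(5)] V.comp_Hom[OF p'(3) nested_map_Hom[OF f p'(2)]]])
     (use e(2) \<G>\<G>_point[OF f p(1-3)] \<G>\<G>_point[OF f p'(1-3)] p(4) p'(4) in simp_all)
   \<comment> \<open>Equal images force equal lengths of the inner paths, so the two nestings of the
     common joined path coincide.\<close>
   have "map length (map (map (VMap f)) qs) = map length (map (map (VMap f)) qs')" using 2 by simp
   then have "map length qs = map length qs'" by (simp add: comp_def)
   then have pq: "p = p' & qs = qs'" using split_join_unique[OF pathsD(1)[OF p(1)] pathsD(1)[OF p'(1)] p(2) p'(2)] 1 by blast
   have "k = k'" by (rule V.pullback_eq[OF spb[OF p(1,2)]])
     (use 1 2 pq p(3) p'(3) HomD(2)[OF sig_nested_Hom[OF D(1) p(1,2)]] in auto)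
   then show "h = h'" using p p' pq by simp
  qed
  then show "is_pullback V (EMap (\<mu> X) (c, d)) (EMap (\<G>m (\<G>m f)) (c, d)) (EMap (\<G>m f) (VMap (\<mu> X) c, VMap (\<mu> X) d))
   (EMap (\<mu> Y) (VMap (\<G>m (\<G>m f)) c, VMap (\<G>m (\<G>m f)) d))" using M(2) c by simp
 qed (use M(2) M'(2) D(5) in auto)
qed

text \<open>The inner paths that encode a sequence of sequences: the straight path cut into
  consecutive pieces of the given lengths, where length 0 is allowed. \<open>block_path\<close> runs
  through the cut points.\<close>

fun blocks :: "nat => nat list => 'u list list" where "blocks m [] = []"
| "blocks m (n # ns) = line m n # blocks (m + n) ns"

definition block_path :: "nat => nat list => 'u list" where "block_path m ns = vtx m # map last (blocks m ns)"

lemma blocks_nested: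
 assumes "m + sum_list ns \<le> length Xs"
 shows "block_path m ns : paths (seq_graph Xs) (vtx m) (vtx (m + sum_list ns)) &
  blocks m ns : nested_paths (seq_graph Xs) (block_path m ns) & join_paths (block_path m ns) (blocks m ns) = line m (sum_list ns)"
 using assms
proof (induction ns arbitrary: m)
 case Nil
 then show ?case by (auto simp: block_path_def paths_def nested_Nil join_paths_def line_simps Verts_seq_graph)
next
 case (Cons n ns)
 then have IH: "block_path (m + n) ns : paths (seq_graph Xs) (vtx (m + n)) (vtx (m + n + sum_list ns))"
  "blocks (m + n) ns : nested_paths (seq_graph Xs) (block_path (m + n) ns)"
  "join_paths (block_path (m + n) ns) (blocks (m + n) ns) = line (m + n) (sum_list ns)" by auto
 have b: "block_path m (n # ns) = vtx m # block_path (m + n) ns" by (simp add: block_path_def line_ends)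
 have ln: "line m n : paths (seq_graph Xs) (vtx m) (vtx (m + n))" by (rule line_path) (use Cons.prems in simp)
 have "block_path m (n # ns) : paths (seq_graph Xs) (vtx m) (vtx (m + sum_list (n # ns)))"
  unfolding b using IH(1) Cons.prems by (auto simp: paths_def add.assoc Verts_seq_graph)
 moreover have "blocks m (n # ns) : nested_paths (seq_graph Xs) (block_path m (n # ns))"
  unfolding b using IH(2) ln by (auto simp: block_path_def nested_Cons)
 moreover have "join_paths (block_path m (n # ns)) (blocks m (n # ns)) = line m n @ tl (line (m + n) (sum_list ns))"
  unfolding b using join_Cons[of "line m n" "vtx m" "vtx (m + n)" "map last (blocks (m + n) ns)" "blocks (m + n) ns"] IH(3)
  by (simp add: block_path_def line_ends)
 moreover have "line m n @ tl (line (m + n) k) = line m (n + k)" for k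
 proof (induction n arbitrary: m)
  case 0
  show ?case using list.collapse[OF line_ends(1), of m k] line_ends(2)[of m k] by (simp add: line_simps(1))
 next
  case (Suc n)
  show ?case using Suc[of "Suc m"] by (simp add: line_simps(2))
 qed
 ultimately show ?case by simp
qed

text \<open>Reading labels along the blocks recovers the sequence of sequences; \<open>pre\<close>
  is the part already passed in the induction.\<close>

lemma blocks_map:
 assumes "!!m n. m + n \<le> length ls ==> h (line m n) = take n (drop m ls)" "ls = pre @ concat xss"
 shows "map h (blocks (length pre) (map length xss)) = xss" using assms(2)
proof (induction xss arbitrary: pre)
 case (Cons xs xss)
 have "map h (blocks (length (pre @ xs)) (map length xss)) = xss" by (rule Cons.IH) (use Cons.prems in simp)
 moreover have "h (line (length pre) (length xs)) = xs" using assms(1)[of "length pre" "length xs"] Cons.prems by simp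
 ultimately show ?case by simp
qed simp

text \<open>The sequence of sequences is flattened to one linear graph, and \<open>blocks\<close>
  remembers the bracketing. On the summand of that nested path the multiplication is
  \<open>sig XSS\<close>.\<close>

lemma cartesian_sig:
 assumes cc: "coproducts_of_connected U V" and m: cartesian_\<mu>
 shows cartesian_sig unfolding cartesian_sig_iff
proof (intro allI impI)
 fix fss XSS YSS assume fss: "fss : Hom (seq_cat SV) XSS YSS"
 interpret SS: Category "seq_cat SV" by unfold_locales (rule Category.category_seq_cat, unfold_locales, rule V.category_seq_cat)
 have XO: "XSS : lists Seqs" "YSS : lists Seqs" using SS.Hom_Obj[OF fss] by auto
 have XY: "XSS = map (map (Dom V)) fss" "YSS = map (map (Cod V)) fss" "fss : lists (lists (Arr V))"
  using fss by (auto simp: Hom_def)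
 define Xs Ys fs where "Xs = concat XSS" and "Ys = concat YSS" and "fs = concat fss"
 have fs: "fs : Hom SV Xs Ys" using XY unfolding Xs_def Ys_def fs_def by (auto simp: Hom_def map_concat in_lists_conv_set)
 have L: "Xs : Seqs" "Ys : Seqs" "length Ys = length Xs" using seq_Obj[OF fs] by auto
 let ?X = "seq_graph Xs" and ?Y = "seq_graph Ys" and ?F = "seq_graph_map Xs Ys fs" and ?n = "length Xs"
 note F = seq_graph_map[OF fs]
 define ns where "ns = map length XSS"
 have ns: "ns = map length YSS" "ns = map length fss" by (simp_all add: ns_def XY comp_def)
 have sn: "sum_list ns = ?n" by (simp add: ns_def Xs_def length_concat)
 let ?p = "block_path 0 ns" and ?qs = "blocks 0 ns" and ?l = "line 0 ?n"
 have pX: "?p : paths ?X (vtx 0) (vtx ?n)" "?qs : nested_paths ?X ?p" "join_paths ?p ?qs = ?l"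
  using blocks_nested[of 0 ns Xs] sn by auto
 have pY: "?p : paths ?Y (vtx 0) (vtx ?n)" "?qs : nested_paths ?Y ?p" using blocks_nested[of 0 ns Ys] sn L by auto
 have eX: "nested_edges ?X ?qs = XSS"
  unfolding nested_edges_def ns_def using blocks_map[of Xs "%q. map (Edge ?X) (steps q)" "[]" XSS] line_edges[of _ _ Xs]
  by (simp add: Xs_def)
 have eY: "nested_edges ?Y ?qs = YSS"
  unfolding nested_edges_def ns(1) using blocks_map[of Ys "%q. map (Edge ?Y) (steps q)" "[]" YSS] line_edges[of _ _ Ys]
  by (simp add: Ys_def)
 have eF: "map (%q. map (EMap ?F) (steps q)) ?qs = fss"
 proof -
  have lf: "length fs = length Xs" using fs by (simp add: seq_Hom_iff)
  have "map (%q. map (EMap ?F) (steps q)) (blocks (length ([] :: 'a list)) (map length fss)) = fss"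
   by (rule blocks_map[of fs]) (use F(5) lf in simp, simp add: fs_def)
  then show ?thesis by (simp add: ns(2))
 qed
 have nF: "nested_map ?F ?qs = AMap E (map (AMap E) fss)"
  unfolding nested_map_def path_arr_def[abs_def] eF[symmetric] by (simp add: comp_def)
 have oX: "nested_obj ?X ?qs = OMap E (map (OMap E) XSS)" and oY: "nested_obj ?Y ?qs = OMap E (map (OMap E) YSS)"
  unfolding nested_obj_def Gamma_summand_def[abs_def] eX[symmetric] eY[symmetric] nested_edges_def by (simp_all add: comp_def)
 note XO' = seq_graph_Obj[OF L(1)] and YO' = seq_graph_Obj[OF L(2)]
 note M = \<mu>_props[OF XO'] and M' = \<mu>_props[OF YO']
 note FF = \<G>m_props(1)[OF \<G>m_props(1)[OF F(1)]]
 have v: "vtx 0 : Verts ?X" "vtx ?n : Verts ?X" and v': "vtx 0 : Verts ?Y" "vtx ?n : Verts ?Y" using L by auto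
 have Fv: "VMap ?F (vtx 0) = vtx 0" "VMap ?F (vtx ?n) = vtx ?n" using F(2) by auto
 have "is_pullback GV (\<mu> ?X) (\<G>m (\<G>m ?F)) (\<G>m ?F) (\<mu> ?Y)" using m F(1) unfolding cartesian_\<mu>_iff by blast
 from GV_pullbackD(4)[OF this M(1) FF \<G>m_props(1)[OF F(1)] M'(1), of "vtx 0" "vtx ?n"]
 have pb: "is_pullback V (EMap (\<mu> ?X) (vtx 0, vtx ?n)) (EMap (\<G>m (\<G>m ?F)) (vtx 0, vtx ?n))
  (EMap (\<G>m ?F) (vtx 0, vtx ?n)) (EMap (\<mu> ?Y) (vtx 0, vtx ?n))" using v M(2) Fv by simp
 have muX: "EMap (\<mu> ?X) (vtx 0, vtx ?n) : Hom V (Edge (\<G> (\<G> ?X)) (vtx 0, vtx ?n)) (Edge (\<G> ?X) (vtx 0, vtx ?n))" by (rule \<mu>_EMap_Hom[OF XO' v])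
 have muY: "EMap (\<mu> ?Y) (vtx 0, vtx ?n) : Hom V (Edge (\<G> (\<G> ?Y)) (vtx 0, vtx ?n)) (Edge (\<G> ?Y) (vtx 0, vtx ?n))" by (rule \<mu>_EMap_Hom[OF YO' v'])
 have iX: "\<iota> ?X ?l : Hom V (OMap E Xs) (Edge (\<G> ?X) (vtx 0, vtx ?n))" by (rule line_inj_Hom[OF L(1)])
 have nY: "\<iota>\<iota> ?Y ?p ?qs : Hom V (OMap E (map (OMap E) YSS)) (Edge (\<G> (\<G> ?Y)) (vtx 0, vtx ?n))"
  using \<G>\<G>_inj_Hom[OF YO' pY] oY by simp
 have nX: "\<iota>\<iota> ?X ?p ?qs : Hom V (OMap E (map (OMap E) XSS)) (Edge (\<G> (\<G> ?X)) (vtx 0, vtx ?n))"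
  using \<G>\<G>_inj_Hom[OF XO' pX(1,2)] oX by simp
 have sX: "sig XSS : Hom V (OMap E (map (OMap E) XSS)) (OMap E Xs)" and sY: "sig YSS : Hom V (OMap E (map (OMap E) YSS)) (OMap E Ys)"
  using sig_Hom XO by (simp_all add: Xs_def Ys_def)
 have vid: "map (map (VMap ?F)) qs = qs" if "qs : nested_paths ?X p" for qs p
  by (rule map_idI, rule seq_graph_map_id[OF fs], rule pathsD(2)[OF nested_mem[OF that]])
 have EE: "AMap E (map (AMap E) fss) : Hom V (OMap E (map (OMap E) XSS)) (OMap E (map (OMap E) YSS))"
  using nested_map_Hom[OF F(1) pX(2)] vid[OF pX(2)] oX oY nF by simp
 have pid: "map (VMap ?F) p = p" if "p : paths ?X a b" for p a b using seq_graph_map_id[OF fs pathsD(2)[OF that]] .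
 have GGX: "EMap (\<G>m (\<G>m ?F)) (vtx 0, vtx ?n) ** ((\<iota>\<iota> ?X p qs) ** k) = (\<iota>\<iota> ?Y p qs) ** (nested_map ?F qs ** k)"
  if "p : paths ?X (vtx 0) (vtx ?n)" "qs : nested_paths ?X p" "k : Hom V T (nested_obj ?X qs)" for p qs k T
  using \<G>\<G>_point[OF F(1) that] pid[OF that(1)] vid[OF that(2)] by simp
 have mX: "EMap (\<mu> ?X) (vtx 0, vtx ?n) ** ((\<iota>\<iota> ?X ?p ?qs) ** k) = \<iota> ?X ?l ** (sig XSS ** k)"
  if "k : Hom V T (OMap E (map (OMap E) XSS))" for k T using \<mu>_point[OF XO' pX(1,2), of k T] that by (simp add: oX eX pX(3))
 have mY: "EMap (\<mu> ?Y) (vtx 0, vtx ?n) ** ((\<iota>\<iota> ?Y ?p ?qs) ** k) = \<iota> ?Y ?l ** (sig YSS ** k)"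
  if "k : Hom V T (OMap E (map (OMap E) YSS))" for k T using \<mu>_point[OF YO' pY, of k T] that by (simp add: oY eY pX(3))
 have "AMap E fs ** sig XSS = sig YSS ** AMap E (map (AMap E) fss)" unfolding fs_def by (rule sig_natural[OF fss])
 then have "is_pullback V (sig XSS) (AMap E (map (AMap E) fss)) (AMap E fs) (sig YSS)"
 proof (rule V.pullback_on_connected[OF cc sX EE E_Hom_seq[OF fs] sY])
  fix T x y assume T: "conn T" and x: "x : Hom V T (OMap E Xs)" and y: "y : Hom V T (OMap E (map (OMap E) YSS))"
   and e: "AMap E fs ** x = sig YSS ** y"
  obtain h where h: "h : Hom V T (Dom V (EMap (\<mu> ?X) (vtx 0, vtx ?n)))" "EMap (\<mu> ?X) (vtx 0, vtx ?n) ** h = \<iota> ?X ?l ** x"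
   "EMap (\<G>m (\<G>m ?F)) (vtx 0, vtx ?n) ** h = (\<iota>\<iota> ?Y ?p ?qs) ** y" by (rule V.pullback_ex[OF pb])
    (use V.comp_Hom[OF x iX] V.comp_Hom[OF y nY] HomD(2)[OF seq_\<G>_EMap_Hom[OF fs]] HomD(2)[OF muY] seq_point[OF fs x] mY[OF y] e in auto)
  have h': "h : Hom V T (Edge (\<G> (\<G> ?X)) (vtx 0, vtx ?n))" using h(1) HomD(2)[OF muX] by simp
  obtain p qs k where p: "p : paths ?X (vtx 0) (vtx ?n)" "qs : nested_paths ?X p" "k : Hom V T (nested_obj ?X qs)"
   "h = (\<iota>\<iota> ?X p qs) ** k" by (rule connected_\<G>\<G>_ex[OF T XO' v h'])
  have pY': "p : paths ?Y (vtx 0) (vtx ?n)" "qs : nested_paths ?Y p"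
   using path_map_Hom[OF F(1) p(1)] nested_map[where f = "VMap ?F" and Y = ?Y, OF p(2) GHomD(5)[OF F(1)]] pid[OF p(1)] vid[OF p(2)] Fv by simp_all
  have nk: "nested_map ?F qs ** k : Hom V T (nested_obj ?Y qs)"
   using V.comp_Hom[OF p(3) nested_map_Hom[OF F(1) p(2)]] vid[OF p(2)] by simp
  \<comment> \<open>The connected object might go through another nesting, but vertices are fixed by
    \<open>?F\<close>, so the nesting is determined by its image, which is that of
    \<open>y\<close>.\<close>
  have "p = ?p & qs = ?qs & nested_map ?F qs ** k = y"
   by (rule connected_\<G>\<G>_eq[OF T YO' pY' nk pY]) (use y oY h(3) GGX[OF p(1-3)] p(4) in auto)
  then have pq: "p = ?p" "qs = ?qs" and ky: "AMap E (map (AMap E) fss) ** k = y" using nF by auto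
  have k: "k : Hom V T (OMap E (map (OMap E) XSS))" using p(3) pq oX by simp
  have "sig XSS ** k = x" by (rule connected_line_eq[OF T L(1) V.comp_Hom[OF k sX] x]) (use mX[OF k] h(2) p(4) pq in simp)
  then show "EX h. h : Hom V T (OMap E (map (OMap E) XSS)) & sig XSS ** h = x & AMap E (map (AMap E) fss) ** h = y"
   using k ky by blast
 next
  fix T h h' assume T: "conn T" and h: "h : Hom V T (OMap E (map (OMap E) XSS))" "h' : Hom V T (OMap E (map (OMap E) XSS))"
   and e: "sig XSS ** h = sig XSS ** h'" "AMap E (map (AMap E) fss) ** h = AMap E (map (AMap E) fss) ** h'"
  have hX: "h : Hom V T (nested_obj ?X ?qs)" "h' : Hom V T (nested_obj ?X ?qs)" using h oX by auto
  have "(\<iota>\<iota> ?X ?p ?qs) ** h = (\<iota>\<iota> ?X ?p ?qs) ** h'" by (rule V.pullback_eq[OF pb])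
    (use V.comp_Hom[OF h(1) nX] V.comp_Hom[OF h(2) nX] HomD(2)[OF muX] mX[OF h(1)] mX[OF h(2)]
     GGX[OF pX(1,2) hX(1)] GGX[OF pX(1,2) hX(2)] nF e in auto)
  then show "h = h'" using connected_\<G>\<G>_eq[OF T XO' pX(1,2) hX(1) pX(1,2) hX(2)] by blast
 qed
 then show "is_pullback V (sig XSS) (AMap E (map (AMap E) fss)) (AMap E (concat fss)) (sig YSS)" by (simp add: fs_def)
qed

theorem cartesian_iff:
 assumes cc: "coproducts_of_connected U V"
 shows "cartesian_multitensor V E u sig \<longleftrightarrow> cartesian_monad GV (Gamma V E) \<eta> \<mu>"
 unfolding cartesian_multitensor_def cartesian_monad_def
 using multitensor monad_\<G> preserves_pullbacks_\<G>[OF cc] preserves_pullbacks_E[OF cc]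
  cartesian_\<eta>[OF cc] cartesian_u[OF cc] cartesian_\<mu>[OF cc] cartesian_sig[OF cc] by blast

end

section \<open>Locally c-presentable categories\<close>

lemma component_invariant:
 assumes t: "!!t. t : Arr J ==> \<phi> (Dom J t) = \<phi> (Cod J t)" and r: "(j, j') : component_rel J"
 shows "\<phi> j = \<phi> j'"
proof -
 let ?R = "{(Dom J t, Cod J t) | t. t : Arr J}"
 have "(j, j') : (?R \<union> ?R\<inverse>)\<^sup>*" using r by (simp add: component_rel_def Let_def)
 then show ?thesis by (induction rule: rtrancl_induct) (use t in auto)
qed

text \<open>Representatives serve as indices of the components, which keeps the index set in the
  type of objects.\<close>

lemma component_representatives:
 assumes J: "category J"
 obtains r where "!!j. j : Obj J ==> (j, r j) : component_rel J" "!!j. j : Obj J ==> r j : Obj J"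
  "!!t. t : Arr J ==> r (Dom J t) = r (Cod J t)" "!!j. j : Obj J ==> r (r j) = r j"
proof -
 interpret J: Category J by unfold_locales (rule J)
 let ?R = "{(Dom J t, Cod J t) | t. t : Arr J}"
 define Q where "Q = (?R \<union> ?R\<inverse>)\<^sup>*"
 have c: "component_rel J = Q \<inter> Obj J \<times> Obj J" by (simp add: component_rel_def Let_def Q_def)
 have sym: "(a, b) : Q ==> (b, a) : Q" for a b unfolding Q_def by (rule symD[OF sym_rtrancl]) (auto intro: symI)
 have tr: "(a, b) : Q ==> (b, c) : Q ==> (a, c) : Q" for a b c unfolding Q_def by simp
 define r where "r j = (SOME j'. (j, j') : component_rel J)" for j
 have 1: "(j, r j) : component_rel J" if "j : Obj J" for j
  unfolding r_def by (rule someI[of _ j]) (use that in "simp add: c Q_def")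
 have 2: "r a = r b" if "(a, b) : Q" "a : Obj J" "b : Obj J" for a b
 proof -
  have "((a, j) : component_rel J) = ((b, j) : component_rel J)" for j unfolding c using sym tr that by blast
  then show ?thesis by (simp add: r_def)
 qed
 show ?thesis
 proof (rule that[of r, OF 1])
  fix j assume "j : Obj J"
  from 1[OF this] show "r j : Obj J" "r (r j) = r j" using 2[of j "r j"] by (auto simp: c)
 next
  fix t assume "t : Arr J"
  moreover from this have "(Dom J t, Cod J t) : Q" unfolding Q_def by blast
  ultimately show "r (Dom J t) = r (Cod J t)" using 2 by simp
 qed simp_all
qed

lemma full_subcategory_simps [simp]:
 "Obj (full_subcategory J S) = S" "Dom (full_subcategory J S) = Dom J" "Cod (full_subcategory J S) = Cod J"
 "Ide (full_subcategory J S) = Ide J" "Comp (full_subcategory J S) = Comp J"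
 "Arr (full_subcategory J S) = {t : Arr J. Dom J t : S & Cod J t : S}" by (simp_all add: full_subcategory_def)

lemma category_full_subcategory: "category J ==> S \<subseteq> Obj J ==> category (full_subcategory J S)"
 unfolding category_def Hom_def full_subcategory_simps by auto

lemma functor_full_subcategory:
 assumes "is_functor J C D" "S \<subseteq> Obj J"
 shows "is_functor (full_subcategory J S) C D" using assms category_full_subcategory[OF functorD(1)[OF assms(1)] assms(2)]
 unfolding is_functor_def by auto

context Category
begin

text \<open>An arrow from the colimit to a coproduct chooses a summand at every stage, and the
  choices agree along arrows, so they are constant. Connectedness of the shape is expressed by
  functions into \<open>'u\<close>, the type of the index sets.\<close>

lemma connected_colimit:
 fixes U :: "'u itself" and J :: "('j, 't) cat"
 assumes D: "is_functor J C D" and col: "is_colimit J C D L inc" and con: "!!j. j : Obj J ==> connected_object U C (OMap D j)"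
  and j0: "j0 : Obj J"
  and J: "!!\<phi> :: 'j => 'u. (!!t. t : Arr J ==> \<phi> (Dom J t) = \<phi> (Cod J t)) ==> ALL j:Obj J. \<phi> j = \<phi> j0"
 shows "connected_object U C L"
proof -
 interpret J: Category J by unfold_locales (rule functorD(1)[OF D])
 have L: "L : Obj C" and inc: "!!j. j : Obj J ==> inc j : Hom C (OMap D j) L"
  "!!t. t : Arr J ==> inc (Cod J t) \<cdot> AMap D t = inc (Dom J t)" using col unfolding is_colimit_def is_cocone_def by auto
 note eq = is_colimit_eq[OF category D col]
 show ?thesis unfolding connected_object_def
 proof (intro conjI L allI impI bij_betw_imageI inj_onI)
  fix I :: "'u set" and X Q k assume I: "small U I" and Q: "is_coproduct C I X Q k"
  note QD = coproductD[OF Q]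
  { fix a b assume a: "a : (SIGMA i:I. Hom C L (X i))" and b: "b : (SIGMA i:I. Hom C L (X i))"
    and e: "(case a of (i, f) => k i \<cdot> f) = (case b of (i, f) => k i \<cdot> f)"
   obtain i f i' f' where ab: "a = (i, f)" "b = (i', f')" by fastforce
   then have f: "i : I" "f : Hom C L (X i)" "i' : I" "f' : Hom C L (X i')" and e: "k i \<cdot> f = k i' \<cdot> f'" using a b e by auto
   have *: "i = i' & f \<cdot> inc j = f' \<cdot> inc j" if j: "j : Obj J" for j
   proof (rule connected_eq[OF con[OF j] I Q f(1) comp_Hom[OF inc(1)[OF j] f(2)] f(3) comp_Hom[OF inc(1)[OF j] f(4)]])
    show "k i \<cdot> (f \<cdot> inc j) = k i' \<cdot> (f' \<cdot> inc j)"
     using e assoc[OF inc(1)[OF j] f(2) QD(3)[OF f(1)]] assoc[OF inc(1)[OF j] f(4) QD(3)[OF f(3)]] by simp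
   qed
   then have "i = i'" using j0 by blast
   moreover have "f = f'" by (rule eq[of _ "X i"]) (use f * j0 in auto)
   ultimately show "a = b" using ab by simp }
  show "(%(i, f). k i \<cdot> f) ` (SIGMA i:I. Hom C L (X i)) = Hom C L Q"
  proof (intro equalityI subsetI)
   fix g assume g: "g : Hom C L Q"
   have "EX i x. i : I & x : Hom C (OMap D j) (X i) & g \<cdot> inc j = k i \<cdot> x" if j: "j : Obj J" for j
    using connected_ex[OF con[OF j] I Q comp_Hom[OF inc(1)[OF j] g]] by metis
   then obtain \<phi> x where \<phi>: "!!j. j : Obj J ==> \<phi> j : I"
    and x: "!!j. j : Obj J ==> x j : Hom C (OMap D j) (X (\<phi> j))" "!!j. j : Obj J ==> g \<cdot> inc j = k (\<phi> j) \<cdot> x j" by metis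
   have st: "\<phi> (Dom J t) = \<phi> (Cod J t) & x (Dom J t) = x (Cod J t) \<cdot> AMap D t" if t: "t : Arr J" for t
   proof -
    have d: "Dom J t : Obj J" "Cod J t : Obj J" using t by auto
    note Dt = functorD(4)[OF D HomI[OF t refl refl]]
    show ?thesis
    proof (rule connected_eq[OF con[OF d(1)] I Q \<phi>[OF d(1)] x(1)[OF d(1)] \<phi>[OF d(2)] comp_Hom[OF Dt x(1)[OF d(2)]]])
     show "k (\<phi> (Dom J t)) \<cdot> x (Dom J t) = k (\<phi> (Cod J t)) \<cdot> (x (Cod J t) \<cdot> AMap D t)"
      using x(2)[OF d(1)] x(2)[OF d(2)] inc(2)[OF t] assoc[OF Dt inc(1)[OF d(2)] g]
       assoc[OF Dt x(1)[OF d(2)] QD(3)[OF \<phi>[OF d(2)]]] by simp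
    qed
   qed
   have \<phi>0: "\<phi> j = \<phi> j0" if "j : Obj J" for j using J[of \<phi>] st that by blast
   have "is_cocone J C D (X (\<phi> j0)) x" unfolding is_cocone_def using QD(2)[OF \<phi>[OF j0]] x(1) \<phi>0 st by fastforce
   then obtain h where h: "h : Hom C L (X (\<phi> j0))" "!!j. j : Obj J ==> h \<cdot> inc j = x j"
    using is_colimit_ex[OF col] by metis
   have "g = k (\<phi> j0) \<cdot> h"
   proof (rule eq[OF g comp_Hom[OF h(1) QD(3)[OF \<phi>[OF j0]]]])
    fix j assume j: "j : Obj J"
    show "g \<cdot> inc j = k (\<phi> j0) \<cdot> h \<cdot> inc j"
     using x(2)[OF j] \<phi>0[OF j] h(2)[OF j] assoc[OF inc(1)[OF j] h(1) QD(3)[OF \<phi>[OF j0]]] by simp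
   qed
   then show "g : (%(i, f). k i \<cdot> f) ` (SIGMA i:I. Hom C L (X i))" using \<phi>[OF j0] h(1) by force
  qed (use QD(3) comp_Hom in auto)
 qed
qed

text \<open>A colimit is the coproduct, over the components of the shape, of the colimits of the
  restricted diagrams. These exist by cocompleteness and are connected, being connected colimits of
  connected objects.\<close>

lemma lcp_coproducts_of_connected:
 fixes U :: "'u itself"
 assumes "locally_c_presentable U lam C"
 shows "coproducts_of_connected U C" unfolding coproducts_of_connected_def
proof
 fix Q assume "Q : Obj C"
 then obtain J :: "('u, 'u) cat" and D inc where J: "small_category U J" and D: "is_functor J C D"
  and con: "!!j. j : Obj J ==> connected_object U C (OMap D j)" and col: "is_colimit J C D Q inc"
  using assms unfolding locally_c_presentable_def by meson
 have cc: "cocomplete U C" using assms unfolding locally_c_presentable_def by blast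
 have cJ: "category J" and sJ: "small U (Arr J)" using J by (auto simp: small_category_def)
 interpret J: Category J by unfold_locales (rule cJ)
 obtain r where r: "!!j. j : Obj J ==> (j, r j) : component_rel J" "!!j. j : Obj J ==> r j : Obj J"
  "!!t. t : Arr J ==> r (Dom J t) = r (Cod J t)" "!!j. j : Obj J ==> r (r j) = r j" using component_representatives[OF cJ] by metis
 define K where "K i = full_subcategory J {j : Obj J. r j = i}" for i
 have DK: "is_functor (K i) C D" for i unfolding K_def by (rule functor_full_subcategory[OF D]) auto
 have sK: "small_category U (K i)" for i
  using functorD(1)[OF DK[of i]] small_subset[OF sJ, of "Arr (K i)"] by (auto simp: small_category_def K_def)
 have "EX L k. is_colimit (K i) C D L k" for i using cc DK sK unfolding cocomplete_def by blast
 then obtain L k where k: "!!i. is_colimit (K i) C D (L i) (k i)" by metis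
 have L: "L i : Obj C" and kH: "!!j. j : Obj J ==> k (r j) j : Hom C (OMap D j) (L (r j))" for i
  using k unfolding is_colimit_def is_cocone_def K_def by auto
 have kt: "k (r (Cod J t)) (Cod J t) \<cdot> AMap D t = k (r (Dom J t)) (Dom J t)" if t: "t : Arr J" for t
  using k[of "r (Dom J t)"] r(3)[OF t] t unfolding is_colimit_def is_cocone_def K_def by auto
 have inc: "!!j. j : Obj J ==> inc j : Hom C (OMap D j) Q" "!!t. t : Arr J ==> inc (Cod J t) \<cdot> AMap D t = inc (Dom J t)"
  and Q: "Q : Obj C" using col unfolding is_colimit_def is_cocone_def by auto
 have "EX m. m : Hom C (L i) Q & (ALL j:Obj J. r j = i --> m \<cdot> k i j = inc j)" for i
 proof -
  have "is_cocone (K i) C D Q inc" using inc Q unfolding is_cocone_def K_def by auto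
  then show ?thesis by (rule is_colimit_ex[OF k]) (auto simp: K_def)
 qed
 then obtain m where m: "!!i. m i : Hom C (L i) Q" and mk: "!!j. j : Obj J ==> m (r j) \<cdot> k (r j) j = inc j" by metis
 have "is_coproduct C (r ` Obj J) L Q m"
 proof (rule coproductI[OF Q m])
  fix T f assume f: "T : Obj C" "!!i. i : r ` Obj J ==> f i : Hom C (L i) T"
  have coc: "is_cocone J C D T (%j. f (r j) \<cdot> k (r j) j)" unfolding is_cocone_def
  proof (intro conjI ballI f(1))
   fix t assume t: "t : Arr J"
   have c: "Cod J t : Obj J" using t by simp
   show "f (r (Cod J t)) \<cdot> k (r (Cod J t)) (Cod J t) \<cdot> AMap D t = f (r (Dom J t)) \<cdot> k (r (Dom J t)) (Dom J t)"
    using assoc[OF functorD(4)[OF D HomI[OF t refl refl]] kH[OF c] f(2)] c kt[OF t] r(3)[OF t] by simp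
  qed (rule comp_Hom[OF kH f(2)], simp_all)
  obtain h where h: "h : Hom C Q T" "!!j. j : Obj J ==> h \<cdot> inc j = f (r j) \<cdot> k (r j) j"
   using is_colimit_ex[OF col coc] by metis
  have "h \<cdot> m i = f i" if i: "i : r ` Obj J" for i
  proof (rule is_colimit_eq[OF category DK k comp_Hom[OF m h(1)] f(2)[OF i]])
   fix j assume "j : Obj (K i)"
   then have j: "j : Obj J" "i = r j" by (auto simp: K_def)
   show "h \<cdot> m i \<cdot> k i j = f i \<cdot> k i j" using assoc[OF kH[OF j(1)] m h(1)] mk[OF j(1)] h(2)[OF j(1)] j(2) by simp
  qed
  then show "EX h. h : Hom C Q T & (ALL i:r ` Obj J. h \<cdot> m i = f i)" using h(1) by blast
 next
  fix T h h' assume h: "h : Hom C Q T" "h' : Hom C Q T" "!!i. i : r ` Obj J ==> h \<cdot> m i = h' \<cdot> m i"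
  show "h = h'"
  proof (rule is_colimit_eq[OF category D col h(1,2)])
   fix j assume j: "j : Obj J"
   show "h \<cdot> inc j = h' \<cdot> inc j"
    using assoc[OF kH[OF j] m h(1)] assoc[OF kH[OF j] m h(2)] h(3)[of "r j"] mk[OF j] j by simp
  qed
 qed
 moreover have "connected_object U C (L i)" if i: "i : r ` Obj J" for i
 proof (rule connected_colimit[OF DK k])
  have ri: "i : Obj J" "r i = i" using i r by auto
  show "i : Obj (K i)" using ri by (simp add: K_def)
  show "connected_object U C (OMap D j)" if "j : Obj (K i)" for j using that con by (auto simp: K_def)
  fix \<phi> :: "'u => 'u" assume \<phi>: "!!t. t : Arr (K i) ==> \<phi> (Dom (K i) t) = \<phi> (Cod (K i) t)"
  show "ALL j:Obj (K i). \<phi> j = \<phi> i"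
  proof
   fix j assume "j : Obj (K i)"
   then have j: "j : Obj J" "r j = i" by (auto simp: K_def)
   \<comment> \<open>Extending \<open>\<phi>\<close> by a constant outside the component makes it
     invariant under all arrows of \<open>J\<close>, as \<open>component_invariant\<close>
     requires.\<close>
   have "(if r j = i then \<phi> j else \<phi> i) = (if r i = i then \<phi> i else \<phi> i)"
    by (rule component_invariant[of J "%j. if r j = i then \<phi> j else \<phi> i"])
     (use \<phi> r(1)[OF j(1)] j(2) r(3) in "auto simp: K_def")
   then show "\<phi> j = \<phi> i" using j(2) by simp
  qed
 qed
 moreover have "small U (r ` Obj J)" by (rule small_image[OF J.small_Obj[OF sJ]])
 ultimately show "EX I X inc. small U (I :: 'u set) & (ALL i:I. connected_object U C (X i)) & is_coproduct C I X Q inc" by blast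
qed

end

section \<open>Generic factorizations\<close>

definition generic :: "('o, 'a) cat => ('p, 'b) cat => ('o, 'a, 'p, 'b) ftor => 'o => 'p => 'b => 'o => 'a => 'b => bool" where
 "generic C D F X B f A g e \<longleftrightarrow> g : Hom C A X & e : Hom D B (OMap F A) & AMap F g \<star>D e = f &
   (ALL A' k m. k : Hom C A' X --> m : Hom D B (OMap F A') --> AMap F k \<star>D m = f -->
    (EX! h. h : Hom C A A' & k \<star>C h = g & AMap F h \<star>D e = m))"

lemma genericD:
 assumes "generic C D F X B f A g e"
 shows "g : Hom C A X" "e : Hom D B (OMap F A)" "AMap F g \<star>D e = f"
  "k : Hom C A' X ==> m : Hom D B (OMap F A') ==> AMap F k \<star>D m = f ==>
    EX h. h : Hom C A A' & k \<star>C h = g & AMap F h \<star>D e = m"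
  "k : Hom C A' X ==> m : Hom D B (OMap F A') ==> AMap F k \<star>D m = f ==>
    h : Hom C A A' ==> k \<star>C h = g ==> AMap F h \<star>D e = m ==>
    h' : Hom C A A' ==> k \<star>C h' = g ==> AMap F h' \<star>D e = m ==> h = h'" using assms unfolding generic_def by blast+

lemma genericI:
 assumes "g : Hom C A X" "e : Hom D B (OMap F A)" "AMap F g \<star>D e = f"
  "!!A' k m. k : Hom C A' X ==> m : Hom D B (OMap F A') ==> AMap F k \<star>D m = f ==>
    EX h. h : Hom C A A' & k \<star>C h = g & AMap F h \<star>D e = m"
  "!!A' k m h h'. k : Hom C A' X ==> m : Hom D B (OMap F A') ==> AMap F k \<star>D m = f ==>
    h : Hom C A A' ==> k \<star>C h = g ==> AMap F h \<star>D e = m ==>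
    h' : Hom C A A' ==> k \<star>C h' = g ==> AMap F h' \<star>D e = m ==> h = h'"
 shows "generic C D F X B f A g e" unfolding generic_def
proof (intro conjI allI impI)
 fix A' k m assume k: "k : Hom C A' X" "m : Hom D B (OMap F A')" "AMap F k \<star>D m = f"
 from assms(4)[OF this] obtain h where "h : Hom C A A' & k \<star>C h = g & AMap F h \<star>D e = m" ..
 then show "EX! h. h : Hom C A A' & k \<star>C h = g & AMap F h \<star>D e = m" using assms(5)[OF k] by blast
qed (fact assms)+

lemma right_adjoint_universal:
 assumes G: "is_right_adjoint A B G" and Y: "Y : Obj B"
 shows "EX L:Obj A. EX e:Hom B Y (OMap G L). ALL X:Obj A. ALL g:Hom B Y (OMap G X). EX! h. h : Hom A L X & AMap G h \<star>B e = g"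
proof -
 obtain F \<eta> \<epsilon> where GF: "is_functor A B G" and F: "is_functor B A F" and \<eta>: "natural B B id_ftor (comp_ftor G F) \<eta>"
  and \<epsilon>: "natural A A (comp_ftor F G) id_ftor \<epsilon>"
  and t: "!!Y. Y : Obj B ==> \<epsilon> (OMap F Y) \<star>A AMap F (\<eta> Y) = Ide A (OMap F Y)"
   "!!X. X : Obj A ==> AMap G (\<epsilon> X) \<star>B \<eta> (OMap G X) = Ide B (OMap G X)"
  using G unfolding is_right_adjoint_def by blast
 interpret A: Category A by unfold_locales (rule functorD(1)[OF GF])
 interpret B: Category B by unfold_locales (rule functorD(2)[OF GF])
 note FH = functorD(4)[OF F] and GH = functorD(4)[OF GF]
 have eH: "\<eta> Y : Hom B Y (OMap G (OMap F Y))" if "Y : Obj B" for Y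
  using \<eta> that by (simp add: natural_def id_ftor_def comp_ftor_def)
 have cH: "\<epsilon> X : Hom A (OMap F (OMap G X)) X" if "X : Obj A" for X
  using \<epsilon> that by (simp add: natural_def id_ftor_def comp_ftor_def)
 have en: "AMap G (AMap F f) \<star>B \<eta> X = \<eta> Z \<star>B f" if "f : Hom B X Z" for f X Z
  using \<eta> that by (auto simp: natural_def id_ftor_def comp_ftor_def Hom_def)
 have cn: "f \<star>A \<epsilon> X = \<epsilon> Z \<star>A AMap F (AMap G f)" if "f : Hom A X Z" for f X Z
  using \<epsilon> that by (auto simp: natural_def id_ftor_def comp_ftor_def Hom_def)
 show ?thesis
 proof (rule bexI[of _ "OMap F Y"], rule bexI[of _ "\<eta> Y"], intro ballI)
  show L: "OMap F Y : Obj A" by (rule functorD(3)[OF F Y])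
  show "\<eta> Y : Hom B Y (OMap G (OMap F Y))" by (rule eH[OF Y])
  fix X g assume X: "X : Obj A" and g: "g : Hom B Y (OMap G X)"
  have GX: "OMap G X : Obj B" by (rule functorD(3)[OF GF X])
  show "EX! h. h : Hom A (OMap F Y) X & AMap G h \<star>B \<eta> Y = g"
  proof (rule ex1I[of _ "\<epsilon> X \<star>A AMap F g"], intro conjI)
   show "\<epsilon> X \<star>A AMap F g : Hom A (OMap F Y) X" by (rule A.comp_Hom[OF FH[OF g] cH[OF X]])
   have "AMap G (\<epsilon> X \<star>A AMap F g) \<star>B \<eta> Y = AMap G (\<epsilon> X) \<star>B (AMap G (AMap F g) \<star>B \<eta> Y)"
    using functorD(6)[OF GF FH[OF g] cH[OF X]] B.assoc[OF eH[OF Y] GH[OF FH[OF g]] GH[OF cH[OF X]]] by simp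
   also have "\<dots> = (AMap G (\<epsilon> X) \<star>B \<eta> (OMap G X)) \<star>B g"
    using en[OF g] B.assoc[OF g eH[OF GX] GH[OF cH[OF X]]] by simp
   also have "\<dots> = g" using t(2)[OF X] B.id_l[OF g] by simp
   finally show "AMap G (\<epsilon> X \<star>A AMap F g) \<star>B \<eta> Y = g" .
  next
   fix h assume h: "h : Hom A (OMap F Y) X & AMap G h \<star>B \<eta> Y = g"
   then have hH: "h : Hom A (OMap F Y) X" by simp
   have "\<epsilon> X \<star>A AMap F g = \<epsilon> X \<star>A (AMap F (AMap G h) \<star>A AMap F (\<eta> Y))"
    using h functorD(6)[OF F eH[OF Y] GH[OF hH]] by simp
   also have "\<dots> = (\<epsilon> X \<star>A AMap F (AMap G h)) \<star>A AMap F (\<eta> Y)"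
    using A.assoc[OF FH[OF eH[OF Y]] FH[OF GH[OF hH]] cH[OF X]] by simp
   also have "\<dots> = h \<star>A (\<epsilon> (OMap F Y) \<star>A AMap F (\<eta> Y))"
    using cn[OF hH] A.assoc[OF FH[OF eH[OF Y]] cH[OF L] hH] by simp
   also have "\<dots> = h" using t(1)[OF Y] A.id_r[OF hH] by simp
   finally show "h = \<epsilon> X \<star>A AMap F g" by simp
  qed
 qed
qed

text \<open>The left adjoint and the counit are defined from chosen universal arrows; functoriality,
  naturality of the counit and one triangle identity follow from uniqueness, by composing with
  \<open>\<eta>\<close>.\<close>

lemma universal_right_adjoint:
 assumes G: "is_functor A B G"
  and univ: "!!Y. Y : Obj B ==> EX L:Obj A. EX e:Hom B Y (OMap G L). ALL X:Obj A. ALL g:Hom B Y (OMap G X).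
   EX! h. h : Hom A L X & AMap G h \<star>B e = g"
 shows "is_right_adjoint A B G"
proof -
 interpret A: Category A by unfold_locales (rule functorD(1)[OF G])
 interpret B: Category B by unfold_locales (rule functorD(2)[OF G])
 note GH = functorD(4)[OF G]
 obtain L \<eta> where L: "!!Y. Y : Obj B ==> L Y : Obj A" and \<eta>: "!!Y. Y : Obj B ==> \<eta> Y : Hom B Y (OMap G (L Y))"
  and u: "!!Y X g. Y : Obj B ==> X : Obj A ==> g : Hom B Y (OMap G X) ==> EX! h. h : Hom A (L Y) X & AMap G h \<star>B \<eta> Y = g"
  using univ by metis
 define t where "t Y X g = (THE h. h : Hom A (L Y) X & AMap G h \<star>B \<eta> Y = g)" for Y X g
 have t: "t Y X g : Hom A (L Y) X" "AMap G (t Y X g) \<star>B \<eta> Y = g"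
  if "Y : Obj B" "X : Obj A" "g : Hom B Y (OMap G X)" for Y X g unfolding t_def using theI'[OF u[OF that]] by auto
 have eq: "h = h'" if "h : Hom A (L Y) X" "h' : Hom A (L Y) X" "AMap G h \<star>B \<eta> Y = AMap G h' \<star>B \<eta> Y" "Y : Obj B" for h h' Y X
  using u[OF that(4) conjunct2[OF A.Hom_Obj[OF that(1)]] B.comp_Hom[OF \<eta>[OF that(4)] GH[OF that(2)]]] that by blast
 define F where "F = \<lparr>OMap = L, AMap = (%f. t (Dom B f) (L (Cod B f)) (\<eta> (Cod B f) \<star>B f))\<rparr>"
 define \<epsilon> where "\<epsilon> X = t (OMap G X) X (Ide B (OMap G X))" for X
 have Fs [simp]: "OMap F = L" by (simp add: F_def)
 have F: "AMap F f : Hom A (L Y) (L Z)" "AMap G (AMap F f) \<star>B \<eta> Y = \<eta> Z \<star>B f" if f: "f : Hom B Y Z" for f Y Z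
  using t[of Y "L Z" "\<eta> Z \<star>B f"] B.Hom_Obj[OF f] L B.comp_Hom[OF f \<eta>] HomD[OF f] by (auto simp: F_def)
 have E: "\<epsilon> X : Hom A (L (OMap G X)) X" "AMap G (\<epsilon> X) \<star>B \<eta> (OMap G X) = Ide B (OMap G X)" if "X : Obj A" for X
  using t[of "OMap G X" X "Ide B (OMap G X)"] functorD(3)[OF G that] that by (auto simp: \<epsilon>_def B.Ide_Hom)
 have fF: "is_functor B A F"
 proof (rule is_functorI[OF B.category A.category])
  show "OMap F Y : Obj A" if "Y : Obj B" for Y using L[OF that] by simp
  show "AMap F f : Hom A (OMap F Y) (OMap F Z)" if "f : Hom B Y Z" for f Y Z using F(1)[OF that] by simp
  show "AMap F (Ide B Y) = Ide A (OMap F Y)" if Y: "Y : Obj B" for Y by (rule eq[OF F(1)[OF B.Ide_Hom[OF Y]] _ _ Y])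
    (use F(2)[OF B.Ide_Hom[OF Y]] A.Ide_Hom[OF L[OF Y]] functorD(5)[OF G L[OF Y]] B.id_l[OF \<eta>[OF Y]] B.id_r[OF \<eta>[OF Y]] in auto)
  fix f g X Y Z assume f: "f : Hom B X Y" and g: "g : Hom B Y Z"
  have O: "X : Obj B" "Y : Obj B" "Z : Obj B" using B.Hom_Obj f g by auto
  note gf = B.comp_Hom[OF f g]
  have "AMap G (AMap F g \<star>A AMap F f) \<star>B \<eta> X = AMap G (AMap F g) \<star>B (\<eta> Y \<star>B f)"
   using functorD(6)[OF G F(1)[OF f] F(1)[OF g]] B.assoc[OF \<eta>[OF O(1)] GH[OF F(1)[OF f]] GH[OF F(1)[OF g]]] F(2)[OF f] by simp
  also have "\<dots> = \<eta> Z \<star>B (g \<star>B f)"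
   using B.assoc[OF f \<eta>[OF O(2)] GH[OF F(1)[OF g]]] F(2)[OF g] B.assoc[OF f g \<eta>[OF O(3)]] by simp
  finally show "AMap F (g \<star>B f) = AMap F g \<star>A AMap F f"
   using eq[OF F(1)[OF gf] A.comp_Hom[OF F(1)[OF f] F(1)[OF g]] _ O(1)] F(2)[OF gf] by simp
 qed
 have n1: "natural B B id_ftor (comp_ftor G F) \<eta>"
  unfolding natural_def using \<eta> F(2)[OF HomI[OF _ refl refl]] by (simp add: id_ftor_def comp_ftor_def)
 have n2: "f \<star>A \<epsilon> X = \<epsilon> Z \<star>A AMap F (AMap G f)" if f: "f : Hom A X Z" for f X Z
 proof -
  have O: "X : Obj A" "Z : Obj A" and GO: "OMap G X : Obj B" "OMap G Z : Obj B" using A.Hom_Obj[OF f] functorD(3)[OF G] by auto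
  note Gf = GH[OF f] and FG = F(1)[OF GH[OF f]]
  have "AMap G (f \<star>A \<epsilon> X) \<star>B \<eta> (OMap G X) = AMap G f"
   using functorD(6)[OF G E(1)[OF O(1)] f] B.assoc[OF \<eta>[OF GO(1)] GH[OF E(1)[OF O(1)]] Gf] E(2)[OF O(1)] B.id_r[OF Gf] by simp
  moreover have "AMap G (\<epsilon> Z \<star>A AMap F (AMap G f)) \<star>B \<eta> (OMap G X) = AMap G f"
   using functorD(6)[OF G FG E(1)[OF O(2)]] B.assoc[OF \<eta>[OF GO(1)] GH[OF FG] GH[OF E(1)[OF O(2)]]]
    F(2)[OF Gf] B.assoc[OF Gf \<eta>[OF GO(2)] GH[OF E(1)[OF O(2)]]] E(2)[OF O(2)] B.id_l[OF Gf] by simp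
  ultimately show ?thesis using eq[OF A.comp_Hom[OF E(1)[OF O(1)] f] A.comp_Hom[OF FG E(1)[OF O(2)]] _ GO(1)] by simp
 qed
 have n2': "natural A A (comp_ftor F G) id_ftor \<epsilon>"
  unfolding natural_def using E(1) n2[OF HomI[OF _ refl refl]] by (simp add: id_ftor_def comp_ftor_def)
 have tr: "\<epsilon> (L Y) \<star>A AMap F (\<eta> Y) = Ide A (L Y)" if Y: "Y : Obj B" for Y
 proof -
  note e = \<eta>[OF Y] and LY = L[OF Y]
  note GL = functorD(3)[OF G LY] and Fe = F(1)[OF \<eta>[OF Y]]
  have "AMap G (\<epsilon> (L Y) \<star>A AMap F (\<eta> Y)) \<star>B \<eta> Y = \<eta> Y"
   using functorD(6)[OF G Fe E(1)[OF LY]] B.assoc[OF e GH[OF Fe] GH[OF E(1)[OF LY]]]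
    F(2)[OF e] B.assoc[OF e \<eta>[OF GL] GH[OF E(1)[OF LY]]] E(2)[OF LY] B.id_l[OF e] by simp
  then show ?thesis using eq[OF A.comp_Hom[OF Fe E(1)[OF LY]] A.Ide_Hom[OF LY] _ Y] functorD(5)[OF G LY] B.id_l[OF e] by simp
 qed
 show ?thesis unfolding is_right_adjoint_def
  by (intro conjI G exI[of _ F] exI[of _ \<eta>] exI[of _ \<epsilon>] fF n1 n2') (use tr E(2) in auto)
qed

lemma slice_simps [simp]:
 "Obj (slice C X) = {f : Arr C. Cod C f = X}" "Dom (slice C X) (f, h, g) = f" "Cod (slice C X) (f, h, g) = g"
 "Ide (slice C X) f = (f, Ide C (Dom C f), f)" "(f', k, l) \<star>(slice C X) (f, h, g) = (f, k \<star>C h, l)"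
 by (simp_all add: slice_def)

lemma slice_Hom: "z : Hom (slice C X) f g \<longleftrightarrow>
  (EX h. z = (f, h, g) & f : Hom C (Dom C f) X & g : Hom C (Dom C g) X & h : Hom C (Dom C f) (Dom C g) & g \<star>C h = f)"
 by (cases z) (auto simp: slice_def Hom_def)

lemma (in Category) category_slice: "category (slice C X)"
proof -
 have 1: "z : Hom (slice C X) (Dom (slice C X) z) (Cod (slice C X) z)" if "z : Arr (slice C X)" for z using that by (simp add: Hom_def)
 have 2: "Dom (slice C X) z : Obj (slice C X) & Cod (slice C X) z : Obj (slice C X)" if "z : Arr (slice C X)" for z
  using that by (auto simp: slice_def)
 have 3: "w \<star>(slice C X) z : Hom (slice C X) f k" if "z : Hom (slice C X) f g" "w : Hom (slice C X) g k" for f g k z w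
  using that unfolding slice_Hom by (auto intro: comp_Hom simp: assoc[symmetric])
 have 4: "z \<star>(slice C X) Ide (slice C X) f = z & Ide (slice C X) g \<star>(slice C X) z = z" if "z : Hom (slice C X) f g" for f g z
  using that unfolding slice_Hom by (auto simp: id_l id_r)
 have 5: "y \<star>(slice C X) (w \<star>(slice C X) z) = (y \<star>(slice C X) w) \<star>(slice C X) z"
  if zwy: "z : Hom (slice C X) f g" "w : Hom (slice C X) g k" "y : Hom (slice C X) k l" for f g k l z w y
 proof -
  obtain a b c where "z = (f, a, g)" "w = (g, b, k)" "y = (k, c, l)" "a : Hom C (Dom C f) (Dom C g)"
   "b : Hom C (Dom C g) (Dom C k)" "c : Hom C (Dom C k) (Dom C l)" using zwy unfolding slice_Hom by blast
  then show ?thesis by (simp add: assoc)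
 qed
 have 6: "Ide (slice C X) f : Hom (slice C X) f f" if "f : Obj (slice C X)" for f
  using that unfolding slice_Hom by (auto simp: Hom_def)
 show ?thesis unfolding category_def
 proof (intro conjI ballI impI)
  fix z w assume z: "z : Arr (slice C X)" and w: "w : Arr (slice C X)" and zw: "Cod (slice C X) z = Dom (slice C X) w"
  note z' = 1[OF z, unfolded zw]
  show "w \<star>(slice C X) z : Hom (slice C X) (Dom (slice C X) z) (Cod (slice C X) w)" by (rule 3[OF z' 1[OF w]])
  fix y assume y: "y : Arr (slice C X)" and wy: "Cod (slice C X) w = Dom (slice C X) y"
  show "y \<star>(slice C X) (w \<star>(slice C X) z) = (y \<star>(slice C X) w) \<star>(slice C X) z"
   by (rule 5[OF z' 1[OF w, unfolded wy] 1[OF y]])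
 qed (use 2 4[OF 1] 6 in blast)+
qed

lemma functor_slice:
 assumes F: "is_functor C D F"
 shows "is_functor (slice C X) (slice D (OMap F X)) (slice_ftor F)"
proof -
 interpret C: Category C by unfold_locales (rule functorD(1)[OF F])
 interpret D: Category D by unfold_locales (rule functorD(2)[OF F])
 have FA: "AMap F f : Arr D & Dom D (AMap F f) = OMap F (Dom C f) & Cod D (AMap F f) = OMap F (Cod C f)" if "f : Arr C" for f
  using functorD(4)[OF F HomI[OF that refl refl]] by (simp add: Hom_def)
 show ?thesis
 proof (rule is_functorI[OF C.category_slice D.category_slice])
  show "OMap (slice_ftor F) f : Obj (slice D (OMap F X))" if "f : Obj (slice C X)" for f
   using that FA by (auto simp: slice_ftor_def)
  show "AMap (slice_ftor F) (Ide (slice C X) f) = Ide (slice D (OMap F X)) (OMap (slice_ftor F) f)" if "f : Obj (slice C X)" for f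
   using that FA functorD(5)[OF F] by (auto simp: slice_ftor_def)
  show "AMap (slice_ftor F) z : Hom (slice D (OMap F X)) (OMap (slice_ftor F) f) (OMap (slice_ftor F) g)" if "z : Hom (slice C X) f g" for z f g
  proof -
   obtain h where h: "z = (f, h, g)" "f : Hom C (Dom C f) X" "g : Hom C (Dom C g) X" "h : Hom C (Dom C f) (Dom C g)"
    "g \<star>C h = f" using \<open>z : Hom (slice C X) f g\<close> unfolding slice_Hom by blast
   show ?thesis unfolding slice_Hom
    using functorD(4)[OF F h(2)] functorD(4)[OF F h(3)] functorD(4)[OF F h(4)] functorD(6)[OF F h(4,3)] h(1,5)
    by (simp add: slice_ftor_def Hom_def)
  qed
  show "AMap (slice_ftor F) (w \<star>(slice C X) z) = AMap (slice_ftor F) w \<star>(slice D (OMap F X)) AMap (slice_ftor F) z"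
   if "z : Hom (slice C X) f g" "w : Hom (slice C X) g k" for z w f g k
   using that functorD(6)[OF F] unfolding slice_Hom by (auto simp: slice_ftor_def)
 qed
qed

text \<open>A universal arrow from \<open>f\<close> to the functor induced on slices over
  \<open>X\<close> is the same as a generic factorization of \<open>f\<close>.\<close>

lemma local_right_adjoint_iff_generic: "local_right_adjoint C D F \<longleftrightarrow> is_functor C D F &
  (ALL X:Obj C. ALL B. ALL f:Hom D B (OMap F X). EX A g e. generic C D F X B f A g e)"
proof (intro iffI conjI ballI allI)
 assume "local_right_adjoint C D F"
 then have F: "is_functor C D F" and ra: "!!X. X : Obj C ==> is_right_adjoint (slice C X) (slice D (OMap F X)) (slice_ftor F)"
  unfolding local_right_adjoint_def by auto
 show "is_functor C D F" by (rule F)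
 fix X B f assume X: "X : Obj C" and f: "f : Hom D B (OMap F X)"
 have fO: "f : Obj (slice D (OMap F X))" and df: "Dom D f = B" using f by (auto simp: Hom_def)
 obtain g z where g: "g : Obj (slice C X)" and z: "z : Hom (slice D (OMap F X)) f (OMap (slice_ftor F) g)"
  and u: "!!k w. k : Obj (slice C X) ==> w : Hom (slice D (OMap F X)) f (OMap (slice_ftor F) k) ==>
   EX! h. h : Hom (slice C X) g k & AMap (slice_ftor F) h \<star>(slice D (OMap F X)) z = w"
  using right_adjoint_universal[OF ra[OF X] fO] by blast
 have FD: "Dom D (AMap F k) = OMap F (Dom C k)" if "k : Arr C" for k
  using functorD(4)[OF F HomI[OF that refl refl]] by (simp add: Hom_def)
 obtain e where e: "z = (f, e, AMap F g)" "e : Hom D B (OMap F (Dom C g))" "AMap F g \<star>D e = f"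
  using z df FD[of g] g unfolding slice_Hom by (auto simp: slice_ftor_def)
 have gH: "g : Hom C (Dom C g) X" using g by (simp add: Hom_def)
 have "generic C D F X B f (Dom C g) g e" unfolding generic_def
 proof (intro conjI allI impI gH e(2,3))
  fix A' k m assume k: "k : Hom C A' X" and m: "m : Hom D B (OMap F A')" and km: "AMap F k \<star>D m = f"
  have kO: "k : Obj (slice C X)" and dk: "Dom C k = A'" "k : Arr C" using k by (auto simp: Hom_def)
  have "(f, m, AMap F k) : Hom (slice D (OMap F X)) f (OMap (slice_ftor F) k)"
   using f m km df FD[OF dk(2)] dk functorD(4)[OF F k] unfolding slice_Hom by (auto simp: slice_ftor_def)
  from u[OF kO this] obtain z' where z': "z' : Hom (slice C X) g k" "AMap (slice_ftor F) z' \<star>(slice D (OMap F X)) z = (f, m, AMap F k)"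
   and uz: "!!y. y : Hom (slice C X) g k & AMap (slice_ftor F) y \<star>(slice D (OMap F X)) z = (f, m, AMap F k) ==> y = z'" by (elim ex1E) blast
  \<comment> \<open>Arrows of a slice are triples with prescribed outer entries, so the universal
    property only concerns the middle one.\<close>
  have eqv: "((g, h, k) : Hom (slice C X) g k & AMap (slice_ftor F) (g, h, k) \<star>(slice D (OMap F X)) z = (f, m, AMap F k)) \<longleftrightarrow>
    h : Hom C (Dom C g) A' & k \<star>C h = g & AMap F h \<star>D e = m" for h
   unfolding slice_Hom using gH k dk(1) by (simp add: slice_ftor_def e(1))
  obtain h where h: "z' = (g, h, k)" using z'(1) unfolding slice_Hom by blast
  show "EX! h. h : Hom C (Dom C g) A' & k \<star>C h = g & AMap F h \<star>D e = m"
  proof (rule ex1I[of _ h])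
   fix h' assume "h' : Hom C (Dom C g) A' & k \<star>C h' = g & AMap F h' \<star>D e = m"
   then show "h' = h" using uz[of "(g, h', k)"] eqv[of h'] h by simp
  qed (use z' h eqv[of h] in simp)
 qed
 then show "EX A g e. generic C D F X B f A g e" by blast
next
 assume "is_functor C D F & (ALL X:Obj C. ALL B. ALL f:Hom D B (OMap F X). EX A g e. generic C D F X B f A g e)"
 then have F: "is_functor C D F" and gen: "!!X B f. X : Obj C ==> f : Hom D B (OMap F X) ==>
   EX A g e. generic C D F X B f A g e" by auto
 have FD: "Dom D (AMap F k) = OMap F (Dom C k)" if "k : Arr C" for k
  using functorD(4)[OF F HomI[OF that refl refl]] by (simp add: Hom_def)
 show "local_right_adjoint C D F" unfolding local_right_adjoint_def
 proof (intro conjI ballI F universal_right_adjoint functor_slice)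
  fix X f assume X: "X : Obj C" and "f : Obj (slice D (OMap F X))"
  then have f: "f : Hom D (Dom D f) (OMap F X)" by (simp add: Hom_def)
  obtain A g e where G: "generic C D F X (Dom D f) f A g e" using gen[OF X f] by blast
  note g = genericD(1-3)[OF G]
  have gA: "g : Arr C" "Dom C g = A" "Cod C g = X" using g(1) by (auto simp: Hom_def)
  show "EX L:Obj (slice C X). EX z:Hom (slice D (OMap F X)) f (OMap (slice_ftor F) L).
    ALL k:Obj (slice C X). ALL w:Hom (slice D (OMap F X)) f (OMap (slice_ftor F) k).
     EX! h. h : Hom (slice C X) L k & AMap (slice_ftor F) h \<star>(slice D (OMap F X)) z = w"
  proof (rule bexI[of _ g], rule bexI[of _ "(f, e, AMap F g)"], intro ballI)
   show "g : Obj (slice C X)" using gA by simp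
   show "(f, e, AMap F g) : Hom (slice D (OMap F X)) f (OMap (slice_ftor F) g)"
    using g f gA FD functorD(4)[OF F g(1)] unfolding slice_Hom by (auto simp: slice_ftor_def)
   fix k w assume "k : Obj (slice C X)" and w: "w : Hom (slice D (OMap F X)) f (OMap (slice_ftor F) k)"
   then have k: "k : Hom C (Dom C k) X" "k : Arr C" by (auto simp: Hom_def)
   obtain m where m: "w = (f, m, AMap F k)" "m : Hom D (Dom D f) (OMap F (Dom C k))" "AMap F k \<star>D m = f"
    using w FD[OF k(2)] unfolding slice_Hom by (auto simp: slice_ftor_def)
   have eqv: "((g, h, k) : Hom (slice C X) g k & AMap (slice_ftor F) (g, h, k) \<star>(slice D (OMap F X)) (f, e, AMap F g) = w) \<longleftrightarrow>
     h : Hom C A (Dom C k) & k \<star>C h = g & AMap F h \<star>D e = m" for h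
    unfolding slice_Hom using g(1) k gA(2) m(1) by (simp add: slice_ftor_def)
   obtain h where h: "h : Hom C A (Dom C k) & k \<star>C h = g & AMap F h \<star>D e = m"
    using genericD(4)[OF G k(1) m(2,3)] by blast
   show "EX! h. h : Hom (slice C X) g k & AMap (slice_ftor F) h \<star>(slice D (OMap F X)) (f, e, AMap F g) = w"
   proof (rule ex1I[of _ "(g, h, k)"])
    show "(g, h, k) : Hom (slice C X) g k & AMap (slice_ftor F) (g, h, k) \<star>(slice D (OMap F X)) (f, e, AMap F g) = w"
     using eqv h by blast
    fix y assume y: "y : Hom (slice C X) g k & AMap (slice_ftor F) y \<star>(slice D (OMap F X)) (f, e, AMap F g) = w"
    then obtain h' where h': "y = (g, h', k)" unfolding slice_Hom by blast
    then have "h' : Hom C A (Dom C k) & k \<star>C h' = g & AMap F h' \<star>D e = m" using y eqv by blast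
    then show "y = (g, h, k)" using genericD(5)[OF G k(1) m(2,3)] h h' by blast
   qed
  qed
 qed
qed

section \<open>Graphs presented by paths, and generic factorizations for the monad\<close>

lemma quotient_embedding:
 fixes U :: "'u itself" and R :: "'w rel"
 assumes "small U W"
 shows "EX q :: 'w => 'u. ALL w:W. ALL w':W. q w = q w' \<longleftrightarrow> (w, w') : (R \<union> R\<inverse>)\<^sup>*"
proof -
 let ?Q = "(R \<union> R\<inverse>)\<^sup>*"
 have sym: "(a, b) : ?Q ==> (b, a) : ?Q" for a b by (rule symD[OF sym_rtrancl]) (auto intro: symI)
 obtain e :: "'w => 'u" where e: "inj_on e W" using small_embedding[OF assms] by blast
 \<comment> \<open>A representative inside \<open>W\<close> for each class; its code under the
   embedding names the class by an element of \<open>'u\<close>.\<close>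
 define r where "r w = (SOME x. x : W & (w, x) : ?Q)" for w
 have r: "r w : W & (w, r w) : ?Q" if "w : W" for w unfolding r_def by (rule someI[of _ w]) (use that in simp)
 have "r w = r w'" if "(w, w') : ?Q" for w w'
 proof -
  have "((w, x) : ?Q) = ((w', x) : ?Q)" for x using that sym by (meson rtrancl_trans)
  then show ?thesis by (simp add: r_def)
 qed
 moreover have "(w, w') : ?Q" if "w : W" "w' : W" "r w = r w'" for w w'
  using r[OF that(1)] r[OF that(2)] that(3) sym by (metis rtrancl_trans)
 ultimately show ?thesis using r inj_onD[OF e] by (intro exI[of _ "e \<circ> r"] ballI) (metis comp_apply)
qed

lemma steps_upt: "steps (map f [0..<Suc n]) = map (%m. (f m, f (Suc m))) [0..<n]"
 by (rule nth_equalityI) (auto simp: length_steps nth_steps simp del: upt_Suc)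

context VGraphs
begin

text \<open>The free graph with a vertex for each element of \<open>W\<close> and, for each
  \<open>k\<close>, a path from \<open>s k\<close> to \<open>t k\<close> whose steps receive the
  sequence \<open>As k\<close>: linear graphs glued at their end points, using nothing but
  coproducts in \<open>V\<close>. An empty \<open>As k\<close> identifies \<open>s k\<close> with
  \<open>t k\<close>. The last two conclusions are existence and uniqueness in its universal
  property.\<close>

lemma path_presented_graph:
 fixes W :: "'w set" and K :: "'k set"
 assumes B: "small U W" and K: "small U K" and st: "!!k. k : K ==> s k : W & t k : W" and As: "!!k. k : K ==> As k : Seqs"
 obtains A q P J where "A : Obj GV" "!!a. a : W ==> q a : Verts A" "!!k. k : K ==> P k : paths A (q (s k)) (q (t k))"
  "!!k. k : K ==> J k : Hom SV (As k) (map (Edge A) (steps (P k)))"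
  "ALL Y:Obj GV. ALL \<phi> p hs. (ALL a:W. \<phi> a : Verts Y) --> (ALL k:K. p k : paths Y (\<phi> (s k)) (\<phi> (t k))) -->
    (ALL k:K. hs k : Hom SV (As k) (map (Edge Y) (steps (p k)))) -->
    (EX h:Hom GV A Y. (ALL a:W. VMap h (q a) = \<phi> a) & (ALL k:K. map (VMap h) (P k) = p k &
     map (EMap h) (steps (P k)) \<star>SV J k = hs k))"
  "ALL Y. ALL h:Hom GV A Y. ALL h':Hom GV A Y. (ALL a:W. VMap h (q a) = VMap h' (q a)) -->
    (ALL k:K. map (VMap h) (P k) = map (VMap h') (P k) &
     map (EMap h) (steps (P k)) \<star>SV J k = map (EMap h') (steps (P k)) \<star>SV J k) --> h = h'"
proof -
 define n where "n k = length (As k)" for k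
 \<comment> \<open>The given vertices and the vertices of all paths, before identification;
   \<open>?S\<close> lists the steps.\<close>
 let ?W = "Inl ` W \<union> Inr ` (SIGMA k:K. {..n k}) :: ('w + 'k \<times> nat) set" and ?S = "SIGMA k:K. {..<n k}"
 let ?R = "{(Inl (s k), Inr (k, 0)) | k. k : K} \<union> {(Inl (t k), Inr (k, n k)) | k. k : K} :: ('w + 'k \<times> nat) rel"
 have W: "small U ?W"
 proof -
  have "small U (SIGMA k:K. {..n k})" by (rule small_Sigma[OF universe K]) (simp add: small_finite[OF universe])
  then have "small U (\<Union>b\<in>{True, False}. if b then Inl ` W else Inr ` (SIGMA k:K. {..n k}))"
   by (intro small_UN[OF universe small_finite[OF universe]]) (auto intro: small_image B)
  then show ?thesis by (rule small_subset) auto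
 qed
 have S: "small U ?S" by (rule small_Sigma[OF universe K]) (simp add: small_finite[OF universe])
 obtain q :: "'w + 'k \<times> nat => 'u" where "ALL w:?W. ALL w':?W. q w = q w' \<longleftrightarrow> (w, w') : (?R \<union> ?R\<inverse>)\<^sup>*"
  using quotient_embedding[OF W, of ?R] by (elim exE)
 note q = this[rule_format]
 define st where "st = (%(k, m). (q (Inr (k, m)), q (Inr (k, Suc m))))"
 \<comment> \<open>All steps with end points \<open>z\<close>. After gluing there may be several,
   and the hom is the coproduct of their labels.\<close>
 define F where "F z = {x : ?S. st x = z}" for z
 define Z where "Z = (%(k, m). As k ! m)"
 define A where "A = mk_graph (q ` ?W) (%z. coproduct_obj V (F z) Z)"
 define j where "j x = coproduct_inj V (F (st x)) Z x" for x
 have Z: "Z x : Obj V" if "x : ?S" for x using that As by (auto simp: n_def in_lists_conv_set Z_def)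
 have cp: "is_coproduct V (F z) Z (coproduct_obj V (F z) Z) (coproduct_inj V (F z) Z)" for z
  by (rule V.coproduct_chosen[OF has_coproducts small_subset[OF S]]) (auto simp: F_def Z)
 have A: "A : Obj GV" unfolding A_def by (rule mk_graph_Obj[OF small_image[OF W] V.coproductD(1)[OF cp]])
 have VA: "Verts A = q ` ?W" by (simp add: A_def)
 have EA: "is_coproduct V (F (v, w)) Z (Edge A (v, w)) j" if "v : Verts A" "w : Verts A" for v w
 proof -
  have "Edge A (v, w) = coproduct_obj V (F (v, w)) Z" using that by (simp add: A_def)
  moreover have "is_coproduct V (F (v, w)) Z (coproduct_obj V (F (v, w)) Z) j"
   by (rule V.coproduct_reindex[OF cp, of id]) (auto simp: j_def F_def)
  ultimately show ?thesis by simp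
 qed
 have qA: "q w : Verts A" if "w : ?W" for w using that by (simp add: VA)
 have qr: "q (Inr (k, m)) : Verts A" if "k : K" "m \<le> n k" for k m using qA that by auto
 have jH: "j (k, m) : Hom V (As k ! m) (Edge A (q (Inr (k, m)), q (Inr (k, Suc m))))" if "k : K" "m < n k" for k m
  using V.coproductD(3)[OF EA[OF qr qr], of k m k "Suc m" "(k, m)"] that by (simp add: F_def st_def Z_def)
 define P where "P k = map (%m. q (Inr (k, m))) [0..<Suc (n k)]" for k
 define J where "J k = map (%m. j (k, m)) [0..<n k]" for k
 have sP: "steps (P k) = map (%m. (q (Inr (k, m)), q (Inr (k, Suc m)))) [0..<n k]" for k unfolding P_def by (rule steps_upt)
 have mJ: "map (EMap h) (steps (P k)) \<star>SV J k = map (%m. EMap h (q (Inr (k, m)), q (Inr (k, Suc m))) ** j (k, m)) [0..<n k]" for h k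
  unfolding sP J_def by (rule nth_equalityI) auto
 have mP: "map (VMap h) (P k) = map (%m. VMap h (q (Inr (k, m)))) [0..<Suc (n k)]" for h k by (simp add: P_def)
 show ?thesis
 proof (rule that[OF A, of "%a. q (Inl a)" P J])
  show "q (Inl a) : Verts A" if "a : W" for a using qA that by auto
  show "P k : paths A (q (Inl (s k))) (q (Inl (t k)))" if k: "k : K" for k
  proof -
   have "(Inl (s k), Inr (k, 0)) : (?R \<union> ?R\<inverse>)\<^sup>*" "(Inl (t k), Inr (k, n k)) : (?R \<union> ?R\<inverse>)\<^sup>*" using k by blast+
   then have e: "q (Inl (s k)) = q (Inr (k, 0))" "q (Inl (t k)) = q (Inr (k, n k))"
    using q[of "Inl (s k)" "Inr (k, 0)"] q[of "Inl (t k)" "Inr (k, n k)"] st[OF k] k by auto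
   have "set (P k) \<subseteq> Verts A" using qr[OF k] unfolding P_def by (auto simp del: upt_Suc)
   then show ?thesis unfolding paths_def e by (auto simp: P_def hd_map last_map simp del: upt_Suc)
  qed
  show "J k : Hom SV (As k) (map (Edge A) (steps (P k)))" if k: "k : K" for k
   unfolding sP seq_Hom_iff J_def using jH[OF k] by (simp add: n_def)
 next
  show "ALL Y:Obj GV. ALL \<phi> p hs. (ALL a:W. \<phi> a : Verts Y) --> (ALL k:K. p k : paths Y (\<phi> (s k)) (\<phi> (t k))) -->
    (ALL k:K. hs k : Hom SV (As k) (map (Edge Y) (steps (p k)))) -->
    (EX h:Hom GV A Y. (ALL a:W. VMap h (q (Inl a)) = \<phi> a) & (ALL k:K. map (VMap h) (P k) = p k &
     map (EMap h) (steps (P k)) \<star>SV J k = hs k))"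
  proof (intro ballI allI impI)
  fix Y \<phi> p hs assume Y: "Y : Obj GV" and \<phi>: "ALL a:W. \<phi> a : Verts Y"
   and p: "ALL k:K. p k : paths Y (\<phi> (s k)) (\<phi> (t k))" and hs: "ALL k:K. hs k : Hom SV (As k) (map (Edge Y) (steps (p k)))"
  have lp: "length (p k) = Suc (n k)" "length (hs k) = n k" if "k : K" for k
   using bspec[OF hs that] pathsD(1)[OF bspec[OF p that]] by (cases "p k"; auto simp: seq_Hom_iff length_steps n_def)+
  let ?\<phi> = "case_sum \<phi> (%(k, m). p k ! m)"
  have pe: "p k ! 0 = \<phi> (s k)" "p k ! n k = \<phi> (t k)" if "k : K" for k
   using pathsD(1,3,4)[OF bspec[OF p that]] lp(1)[OF that] by (auto simp: hd_conv_nth last_conv_nth)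
  have pV: "p k ! m : Verts Y" if "k : K" "m \<le> n k" for k m
   using pathsD(2)[OF bspec[OF p that(1)]] nth_mem[of m "p k"] lp(1)[OF that(1)] that(2) by auto
  have \<phi>V: "?\<phi> w : Verts Y" if "w : ?W" for w using that \<phi> pV by auto
  have \<phi>q: "?\<phi> w = ?\<phi> w'" if "w : ?W" "w' : ?W" "q w = q w'" for w w'
  proof -
   have "(w, w') : (?R \<union> ?R\<inverse>)\<^sup>*" using that q by blast
   then show ?thesis by (induction rule: rtrancl_induct) (use pe in auto)
  qed
  define \<phi>' where "\<phi>' v = ?\<phi> (SOME w. w : ?W & q w = v)" for v
  have \<phi>': "\<phi>' (q w) = ?\<phi> w" if "w : ?W" for w
  proof -
   have "(SOME w'. w' : ?W & q w' = q w) : ?W & q (SOME w'. w' : ?W & q w' = q w) = q w" by (rule someI[of _ w]) (simp only: that simp_thms)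
   then show ?thesis unfolding \<phi>'_def using \<phi>q[OF _ that] by blast
  qed
  have \<phi>r: "\<phi>' (q (Inr (k, m))) = p k ! m" if "k : K" "m \<le> n k" for k m using \<phi>'[of "Inr (k, m)"] that by simp
  have v': "\<phi>' v : Verts Y" if "v : Verts A" for v using that unfolding VA by (elim imageE) (simp only: \<phi>' \<phi>V)
  have hH: "hs k ! m : Hom V (As k ! m) (Edge Y (p k ! m, p k ! Suc m))" if "k : K" "m < n k" for k m
  proof -
   have "hs k ! m : Hom V (As k ! m) (map (Edge Y) (steps (p k)) ! m)"
    using bspec[OF hs that(1)] that(2) unfolding seq_Hom_iff n_def by blast
   then show ?thesis using that(2) lp(1)[OF that(1)] by (simp add: length_steps nth_steps)
  qed
  have "EX k. k : Hom V (Edge A z) (Edge Y (\<phi>' (fst z), \<phi>' (snd z))) & (ALL x:F z. k ** j x = (case x of (k, m) => hs k ! m))"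
   if z: "z : Verts A \<times> Verts A" for z
  proof -
   obtain v w where zz: "z = (v, w)" "v : Verts A" "w : Verts A" using z by auto
   have "(case x of (k, m) => hs k ! m) : Hom V (Z x) (Edge Y (\<phi>' v, \<phi>' w))" if x: "x : F (v, w)" for x
   proof -
    obtain k m where x': "x = (k, m)" "k : K" "m < n k" "v = q (Inr (k, m))" "w = q (Inr (k, Suc m))"
     using x by (auto simp: F_def st_def)
    then show ?thesis using hH[OF x'(2,3)] \<phi>r[OF x'(2), of m] \<phi>r[OF x'(2), of "Suc m"] by (simp add: Z_def)
   qed
   from V.coproduct_ex1[OF EA[OF zz(2,3)] GObjD(2)[OF Y v'[OF zz(2)] v'[OF zz(3)]] this] show ?thesis using zz(1) by auto
  qed
  then obtain e where e: "!!z. z : Verts A \<times> Verts A ==> e z : Hom V (Edge A z) (Edge Y (\<phi>' (fst z), \<phi>' (snd z)))"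
   "!!z x. z : Verts A \<times> Verts A ==> x : F z ==> e z ** j x = (case x of (k, m) => hs k ! m)" by metis
  let ?h = "mk_map A Y \<phi>' e"
  have h: "?h : Hom GV A Y" by (rule mk_map_Hom[OF A Y v']) (use e(1) in auto)
  have hP: "map (VMap ?h) (P k) = p k" if k: "k : K" for k
   unfolding mP by (rule nth_equalityI) (use lp(1)[OF k] qr[OF k] \<phi>r[OF k] in "auto simp del: upt_Suc")
  have hJ: "map (EMap ?h) (steps (P k)) \<star>SV J k = hs k" if k: "k : K" for k
   unfolding mJ by (rule nth_equalityI) (use lp(2)[OF k] qr[OF k] e(2)[of _ "(k, _)"] k in "auto simp: F_def st_def")
  have hI: "VMap ?h (q (Inl a)) = \<phi> a" if "a : W" for a using \<phi>'[of "Inl a"] qA[of "Inl a"] that by simp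
  show "EX h:Hom GV A Y. (ALL a:W. VMap h (q (Inl a)) = \<phi> a) & (ALL k:K. map (VMap h) (P k) = p k &
     map (EMap h) (steps (P k)) \<star>SV J k = hs k)" by (intro bexI[of _ ?h] conjI ballI h) (rule hI hP hJ; assumption)+
  qed
 next
  show "ALL Y. ALL h:Hom GV A Y. ALL h':Hom GV A Y. (ALL a:W. VMap h (q (Inl a)) = VMap h' (q (Inl a))) -->
    (ALL k:K. map (VMap h) (P k) = map (VMap h') (P k) &
     map (EMap h) (steps (P k)) \<star>SV J k = map (EMap h') (steps (P k)) \<star>SV J k) --> h = h'"
  proof (intro ballI allI impI)
  fix Y h h' assume h: "h : Hom GV A Y" "h' : Hom GV A Y" and v: "ALL a:W. VMap h (q (Inl a)) = VMap h' (q (Inl a))"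
   and e: "ALL k:K. map (VMap h) (P k) = map (VMap h') (P k) &
     map (EMap h) (steps (P k)) \<star>SV J k = map (EMap h') (steps (P k)) \<star>SV J k"
  have vr: "VMap h (q (Inr (k, m))) = VMap h' (q (Inr (k, m)))" if "k : K" "m \<le> n k" for k m
   using arg_cong[OF conjunct1[OF bspec[OF e that(1)]], of "%z. z ! m"] that(2) unfolding mP by (simp del: upt_Suc)
  have er: "EMap h (st x) ** j x = EMap h' (st x) ** j x" if x0: "x : ?S" for x
  proof -
   obtain k m where x: "x = (k, m)" "k : K" "m < n k" using x0 by auto
   then show ?thesis using arg_cong[OF conjunct2[OF bspec[OF e x(2)]], of "%z. z ! m"] unfolding mJ by (simp add: st_def)
  qed
  have v': "VMap h a = VMap h' a" if "a : Verts A" for a using that v vr by (auto simp: VA)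
  show "h = h'"
  proof (rule GHom_eqI[OF h v'])
   fix a b assume ab: "a : Verts A" "b : Verts A"
   show "EMap h (a, b) = EMap h' (a, b)"
   proof (rule V.coproduct_eq[OF EA[OF ab] GHomD(6)[OF h(1) ab]])
    show "EMap h' (a, b) : Hom V (Edge A (a, b)) (Edge Y (VMap h a, VMap h b))" using GHomD(6)[OF h(2) ab] v' ab by simp
    show "EMap h (a, b) ** j x = EMap h' (a, b) ** j x" if "x : F (a, b)" for x using er[of x] that by (simp add: F_def)
   qed
  qed
  qed
 qed
qed

end

context Multitensor
begin

interpretation SV: Category "SV" by unfold_locales (rule V.category_seq_cat)

lemma EMap_steps_comp:
 assumes h: "h : Hom GV X Y" and p: "p : paths X a b"
 shows "map (EMap (k \<star>GV h)) (steps p) = map (EMap k) (steps (map (VMap h) p)) \<star>SV map (EMap h) (steps p)"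
proof (rule nth_equalityI)
 fix i assume "i < length (map (EMap (k \<star>GV h)) (steps p))"
 then have i: "i < length (steps p)" by simp
 have v: "fst (steps p ! i) : Verts X" "snd (steps p ! i) : Verts X" using paths_steps[OF p] i nth_mem by blast+
 show "map (EMap (k \<star>GV h)) (steps p) ! i = (map (EMap k) (steps (map (VMap h) p)) \<star>SV map (EMap h) (steps p)) ! i"
  using i GComp(2)[OF h v, of k] by (simp add: steps_map map_prod_def case_prod_beta)
qed (simp add: steps_map)

text \<open>On each connected summand of a hom of \<open>B\<close> the arrow \<open>f\<close> is a
  path of \<open>X\<close> with an arrow into its summand, and the latter has a generic
  factorization for \<open>E\<close>. The graph \<open>A\<close> is presented by paths carrying the
  sequences of these factorizations.\<close>

lemma local_right_adjoint_\<G>: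
 assumes cc: "coproducts_of_connected U V" and lra: "local_right_adjoint SV V E"
 shows "local_right_adjoint GV GV (Gamma V E)" unfolding local_right_adjoint_iff_generic
proof (intro conjI functor_\<G> ballI allI)
 fix X B f assume X: "X : Obj GV" and "f : Hom GV B (OMap (Gamma V E) X)"
 then have f: "f : Hom GV B (\<G> X)" by (simp add: Gamma_def)
 note D = GHomD[OF f] and B = GHomD(1)[OF f]
 have fV: "VMap f a : Verts X" if "a : Verts B" for a using D(5)[OF that] by simp
 have "EX I C inc. small U (I :: 'u set) & (ALL i:I. conn (C i)) & is_coproduct V I C (Edge B z) inc"
  if "z : Verts B \<times> Verts B" for z using cc GObjD(2)[OF B] that unfolding coproducts_of_connected_def by blast
 then obtain I :: "_ => 'u set" and C inc where I: "!!z. z : Verts B \<times> Verts B ==> small U (I z)"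
  "!!z i. z : Verts B \<times> Verts B ==> i : I z ==> conn (C z i)"
  "!!z. z : Verts B \<times> Verts B ==> is_coproduct V (I z) (C z) (Edge B z) (inc z)" by metis
 \<comment> \<open>All connected summands of all homs of \<open>B\<close>; below, \<open>s\<close>
   and \<open>t\<close> are the end points, \<open>c\<close> the summand and \<open>j\<close> its
   inclusion.\<close>
 define K where "K = Sigma (Verts B \<times> Verts B) I"
 define s t c j where "s k = fst (fst k)" and "t k = snd (fst k)" and "c k = C (fst k) (snd k)" and "j k = inc (fst k) (snd k)"
  for k :: "('u \<times> 'u) \<times> 'u"
 have st: "s k : Verts B" "t k : Verts B" if "k : K" for k using that by (auto simp: K_def s_def t_def)
 have c: "conn (c k)" if "k : K" for k using that I(2) by (auto simp: K_def c_def)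
 have jH: "j k : Hom V (c k) (Edge B (s k, t k))" if "k : K" for k
  using that V.coproductD(3)[OF I(3)] by (auto simp: K_def c_def j_def s_def t_def)
 have smK: "small U K" unfolding K_def using small_Sigma[OF universe small_Times[OF universe]] GObjD(1)[OF B] I(1) by blast
 have B_eq: "m = m'" if m: "m : Hom GV B Z" "m' : Hom GV B Z" and v: "!!a. a : Verts B ==> VMap m a = VMap m' a"
  and e: "!!k. k : K ==> EMap m (s k, t k) ** j k = EMap m' (s k, t k) ** j k" for m m' Z
 proof (rule GHom_eqI[OF m v])
  fix a b assume ab: "a : Verts B" "b : Verts B"
  show "EMap m (a, b) = EMap m' (a, b)"
  proof (rule V.coproduct_eq[OF I(3) GHomD(6)[OF m(1) ab]])
   show "EMap m' (a, b) : Hom V (Edge B (a, b)) (Edge Z (VMap m a, VMap m b))" using GHomD(6)[OF m(2) ab] v ab by simp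
   show "EMap m (a, b) ** inc (a, b) i = EMap m' (a, b) ** inc (a, b) i" if "i : I (a, b)" for i
    using e[of "((a, b), i)"] that ab by (simp add: K_def s_def t_def j_def)
  qed (use ab in simp)
 qed
 have "EX p x As gs e. p : paths X (VMap f (s k)) (VMap f (t k)) & EMap f (s k, t k) ** j k = \<iota> X p ** x & x : Hom V (c k) (smd X p) &
   generic SV V E (map (Edge X) (steps p)) (c k) x As gs e" if k: "k : K" for k
 proof -
  have "EMap f (s k, t k) ** j k : Hom V (c k) (Edge (\<G> X) (VMap f (s k), VMap f (t k)))"
   by (rule V.comp_Hom[OF jH[OF k] D(6)[OF st[OF k]]])
  then obtain p x where p: "p : paths X (VMap f (s k)) (VMap f (t k))" "x : Hom V (c k) (smd X p)" "EMap f (s k, t k) ** j k = \<iota> X p ** x"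
   using connected_\<G>_ex[OF c[OF k] X fV[OF st(1)[OF k]] fV[OF st(2)[OF k]]] by metis
  have "EX As gs e. generic SV V E (map (Edge X) (steps p)) (c k) x As gs e"
   using lra p(2) steps_Obj[OF X p(1)] unfolding local_right_adjoint_iff_generic Gamma_summand_def by auto
  then show ?thesis using p by blast
 qed
 then obtain p x As gs e where p: "!!k. k : K ==> p k : paths X (VMap f (s k)) (VMap f (t k))"
  and x: "!!k. k : K ==> EMap f (s k, t k) ** j k = \<iota> X (p k) ** x k" "!!k. k : K ==> x k : Hom V (c k) (smd X (p k))"
  and G: "!!k. k : K ==> generic SV V E (map (Edge X) (steps (p k))) (c k) (x k) (As k) (gs k) (e k)" by metis
 note gs = genericD(1)[OF G] and eH = genericD(2)[OF G] and ge = genericD(3)[OF G]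
 have As: "As k : Seqs" if "k : K" for k using SV.Hom_Obj[OF gs[OF that]] by simp
 obtain A q P J where A: "A : Obj GV" and q: "!!a. a : Verts B ==> q a : Verts A"
  and P: "!!k. k : K ==> P k : paths A (q (s k)) (q (t k))" and J: "!!k. k : K ==> J k : Hom SV (As k) (map (Edge A) (steps (P k)))"
  and ex: "ALL Y:Obj GV. ALL \<phi> p hs. (ALL a:Verts B. \<phi> a : Verts Y) --> (ALL k:K. p k : paths Y (\<phi> (s k)) (\<phi> (t k))) -->
    (ALL k:K. hs k : Hom SV (As k) (map (Edge Y) (steps (p k)))) -->
    (EX h:Hom GV A Y. (ALL a:Verts B. VMap h (q a) = \<phi> a) & (ALL k:K. map (VMap h) (P k) = p k &
     map (EMap h) (steps (P k)) \<star>SV J k = hs k))"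
  and un: "ALL Y. ALL h:Hom GV A Y. ALL h':Hom GV A Y. (ALL a:Verts B. VMap h (q a) = VMap h' (q a)) -->
    (ALL k:K. map (VMap h) (P k) = map (VMap h') (P k) &
     map (EMap h) (steps (P k)) \<star>SV J k = map (EMap h') (steps (P k)) \<star>SV J k) --> h = h'"
  by (rule path_presented_graph[OF GObjD(1)[OF B] smK, of s t As]) (use st As in auto)
 \<comment> \<open>The arrows that a morphism out of \<open>A\<close> assigns to the generating
   labels of the \<open>k\<close>-th path.\<close>
 define r where "r h k = map (EMap h) (steps (P k)) \<star>SV J k" for h :: "('u, 'o, 'a) vgraph_map" and k
 have rH: "r h k : Hom SV (As k) (map (Edge Y) (steps (map (VMap h) (P k))))" if "h : Hom GV A Y" "k : K" for h k Y
  unfolding r_def by (rule SV.comp_Hom[OF J[OF that(2)] EMap_steps[OF that(1) P[OF that(2)]]])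
 have rc: "r (k' \<star>GV h) k = map (EMap k') (steps (map (VMap h) (P k))) \<star>SV r h k"
  if h: "h : Hom GV A Y" and k': "k' : Hom GV Y Z" and k: "k : K" for h k k' Y Z unfolding r_def EMap_steps_comp[OF h P[OF k]]
  by (rule SV.assoc[OF J[OF k] EMap_steps[OF h P[OF k]] EMap_steps[OF k' path_map_Hom[OF h P[OF k]]]])
 have vc: "map (VMap (k' \<star>GV h)) (P k) = map (VMap k') (map (VMap h) (P k))" if h: "h : Hom GV A Y" and k: "k : K" for h k k' Y
  using pathsD(2)[OF P[OF k]] by (auto simp: GComp(1)[OF h])
 have JH: "AMap E (J k) ** e k : Hom V (c k) (smd A (P k))" if k: "k : K" for k
  using V.comp_Hom[OF eH[OF k] E_Hom_seq[OF J[OF k]]] by (simp add: Gamma_summand_def)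
 \<comment> \<open>The generic arrow on a hom of \<open>B\<close>: each summand goes through its own
   generic arrow \<open>e\<close> and the inclusion \<open>J\<close> of labels to the summand of the
   presented path.\<close>
 have "EX h. h : Hom V (Edge B z) (Edge (\<G> A) (q (fst z), q (snd z))) &
   (ALL i:I z. h ** inc z i = \<iota> A (P (z, i)) ** (AMap E (J (z, i)) ** e (z, i)))" if z: "z : Verts B \<times> Verts B" for z
 proof -
  have T: "Edge (\<G> A) (q (fst z), q (snd z)) : Obj V" using GObjD(2)[OF \<G>_Obj[OF A]] q z by auto
  have "\<iota> A (P (z, i)) ** (AMap E (J (z, i)) ** e (z, i)) : Hom V (C z i) (Edge (\<G> A) (q (fst z), q (snd z)))" if "i : I z" for i
  proof -
   have k: "(z, i) : K" using z that by (simp add: K_def)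
   show ?thesis using V.comp_Hom[OF JH[OF k] \<iota>_Hom[OF A P[OF k]]] by (simp add: c_def s_def t_def)
  qed
  from V.coproduct_ex1[OF I(3)[OF z] T this] show ?thesis by blast
 qed
 then obtain d where d: "!!z. z : Verts B \<times> Verts B ==> d z : Hom V (Edge B z) (Edge (\<G> A) (q (fst z), q (snd z)))"
  "!!z i. z : Verts B \<times> Verts B ==> i : I z ==> d z ** inc z i = \<iota> A (P (z, i)) ** (AMap E (J (z, i)) ** e (z, i))" by metis
 define ee where "ee = mk_map B (\<G> A) q d"
 have ee: "ee : Hom GV B (\<G> A)" unfolding ee_def by (rule mk_map_Hom[OF B \<G>_Obj[OF A]]) (use q d(1) in auto)
 have eV: "VMap ee a = q a" if "a : Verts B" for a using that by (simp add: ee_def)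
 have ej: "EMap ee (s k, t k) ** j k = \<iota> A (P k) ** (AMap E (J k) ** e k)" if "k : K" for k
  using d(2)[of "(s k, t k)" "snd k"] that by (auto simp: ee_def K_def s_def t_def j_def)
 \<comment> \<open>On the \<open>k\<close>-th summand the composite with \<open>ee\<close> consists
   of the image of the path \<open>P k\<close> and of \<open>e k\<close> followed by
   \<open>E\<close> of \<open>r h k\<close>. Comparing morphisms of graphs thereby becomes comparing
   factorizations for \<open>E\<close>.\<close>
 have main: "EMap (\<G>m h \<star>GV ee) (s k, t k) ** j k = \<iota> Y (map (VMap h) (P k)) ** (AMap E (r h k) ** e k)"
  if h: "h : Hom GV A Y" and k: "k : K" for h k Y
 proof -
  note Gh = GHomD(6)[OF \<G>m_props(1)[OF h], of "q (s k)" "q (t k)"]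
  have "EMap (\<G>m h \<star>GV ee) (s k, t k) ** j k = EMap (\<G>m h) (q (s k), q (t k)) ** (EMap ee (s k, t k) ** j k)"
   using GComp(2)[OF ee st[OF k], of "\<G>m h"] eV st[OF k] q Gh
    V.assoc[OF jH[OF k] GHomD(6)[OF ee st[OF k]], of "EMap (\<G>m h) (q (s k), q (t k))"] by simp
  also have "\<dots> = \<iota> Y (map (VMap h) (P k)) ** (path_arr h (P k) ** (AMap E (J k) ** e k))"
   unfolding ej[OF k] by (rule \<G>m_point[OF h P[OF k] JH[OF k]])
  also have "path_arr h (P k) ** (AMap E (J k) ** e k) = AMap E (r h k) ** e k"
   unfolding r_def path_arr_def E_comp_seq[OF J[OF k] EMap_steps[OF h P[OF k]]]
   by (rule V.assoc[OF eH[OF k] E_Hom_seq[OF J[OF k]] E_Hom_seq[OF EMap_steps[OF h P[OF k]]], symmetric])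
  finally show ?thesis .
 qed
 have mainV: "VMap (\<G>m h \<star>GV ee) a = VMap h (q a)" if "a : Verts B" for a h using GComp(1)[OF ee that] eV[OF that] by simp
 \<comment> \<open>The labels of \<open>g\<close> are the arrows \<open>gs k\<close>, which makes
   the composite with \<open>ee\<close> agree with \<open>f\<close> on every summand.\<close>
 obtain g where g: "g : Hom GV A X" and gV: "!!a. a : Verts B ==> VMap g (q a) = VMap f a"
  and gp: "!!k. k : K ==> map (VMap g) (P k) = p k" and gr: "!!k. k : K ==> r g k = gs k"
  using bspec[OF ex X, rule_format, of "VMap f" p gs] fV p gs unfolding r_def by blast
 have ge': "\<G>m g \<star>GV ee = f"
  by (rule B_eq[OF GV.comp_Hom[OF ee \<G>m_props(1)[OF g]] f]) (use mainV gV main[OF g] gp gr ge x(1) in auto)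
 have "generic GV GV (Gamma V E) X B f A g ee"
 proof (rule genericI)
  show "g : Hom GV A X" by (rule g)
  show "ee : Hom GV B (OMap (Gamma V E) A)" "AMap (Gamma V E) g \<star>GV ee = f" using ee ge' by (simp_all add: Gamma_def)
 next
  fix A' k' m assume k': "k' : Hom GV A' X" and "m : Hom GV B (OMap (Gamma V E) A')" "AMap (Gamma V E) k' \<star>GV m = f"
  then have m: "m : Hom GV B (\<G> A')" and km: "\<G>m k' \<star>GV m = f" by (simp_all add: Gamma_def)
  note A' = GHomD(1)[OF k']
  have mV: "VMap m a : Verts A'" "VMap k' (VMap m a) = VMap f a" if "a : Verts B" for a
   using GHomD(5)[OF m that] GComp(1)[OF m that, of "\<G>m k'"] km by auto
  \<comment> \<open>A competing factorization chooses a path \<open>p'\<close>, whose image in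
    \<open>X\<close> must be \<open>p k\<close> as the connected summand chooses only one path
    there. Genericity for \<open>E\<close> then supplies the labels \<open>hs\<close>.\<close>
  have "EX p' hs. p' : paths A' (VMap m (s k)) (VMap m (t k)) & EMap m (s k, t k) ** j k = \<iota> A' p' ** (AMap E hs ** e k) &
    map (VMap k') p' = p k & hs : Hom SV (As k) (map (Edge A') (steps p')) & map (EMap k') (steps p') \<star>SV hs = gs k"
   if k: "k : K" for k
  proof -
   note mjH = GHomD(6)[OF m st[OF k]]
   obtain p' x' where p': "p' : paths A' (VMap m (s k)) (VMap m (t k))" "x' : Hom V (c k) (smd A' p')" "EMap m (s k, t k) ** j k = \<iota> A' p' ** x'"
    using connected_\<G>_ex[OF c[OF k] A' mV(1)[OF st(1)[OF k]] mV(1)[OF st(2)[OF k]] V.comp_Hom[OF jH[OF k] mjH]] by metis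
   have kp: "map (VMap k') p' : paths X (VMap f (s k)) (VMap f (t k))" using path_map_Hom[OF k' p'(1)] mV(2) st[OF k] by simp
   have "EMap f (s k, t k) ** j k = EMap (\<G>m k') (VMap m (s k), VMap m (t k)) ** (EMap m (s k, t k) ** j k)"
    using V.assoc[OF jH[OF k] mjH \<G>m_EMap_Hom[OF k' mV(1)[OF st(1)[OF k]] mV(1)[OF st(2)[OF k]]]]
    unfolding km[symmetric] GComp(2)[OF m st[OF k]] .
   also have "\<dots> = \<iota> X (map (VMap k') p') ** (path_arr k' p' ** x')" unfolding p'(3) by (rule \<G>m_point[OF k' p'(1,2)])
   finally have "\<iota> X (map (VMap k') p') ** (path_arr k' p' ** x') = \<iota> X (p k) ** x k" unfolding x(1)[OF k] by (rule sym)
   from connected_\<G>_eq[OF c[OF k] X kp V.comp_Hom[OF p'(2) path_arr_Hom[OF k' p'(1)]] p[OF k] x(2)[OF k] this]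
   have "map (VMap k') p' = p k & path_arr k' p' ** x' = x k" .
   then have kk: "map (VMap k') p' = p k" "AMap E (map (EMap k') (steps p')) ** x' = x k" by (auto simp: path_arr_def)
   have ks: "map (EMap k') (steps p') : Hom SV (map (Edge A') (steps p')) (map (Edge X) (steps (p k)))"
    using EMap_steps[OF k' p'(1)] kk(1) by simp
   have "EX hs. hs : Hom SV (As k) (map (Edge A') (steps p')) & map (EMap k') (steps p') \<star>SV hs = gs k & AMap E hs ** e k = x'"
    by (rule genericD(4)[OF G[OF k] ks _ kk(2)]) (use p'(2) in "simp add: Gamma_summand_def")
   then show ?thesis using p'(1,3) kk(1) by blast
  qed
  then obtain p' hs where p': "!!k. k : K ==> p' k : paths A' (VMap m (s k)) (VMap m (t k))"
   "!!k. k : K ==> EMap m (s k, t k) ** j k = \<iota> A' (p' k) ** (AMap E (hs k) ** e k)" "!!k. k : K ==> map (VMap k') (p' k) = p k"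
   and hs: "!!k. k : K ==> hs k : Hom SV (As k) (map (Edge A') (steps (p' k)))"
   "!!k. k : K ==> map (EMap k') (steps (p' k)) \<star>SV hs k = gs k" by metis
  obtain h where h: "h : Hom GV A A'" "!!a. a : Verts B ==> VMap h (q a) = VMap m a"
   "!!k. k : K ==> map (VMap h) (P k) = p' k" "!!k. k : K ==> r h k = hs k"
   using bspec[OF ex A', rule_format, of "VMap m" p' hs] mV(1) p'(1) hs(1) unfolding r_def by blast
  have "k' \<star>GV h = g"
  proof (rule un[rule_format, OF GV.comp_Hom[OF h(1) k'] g])
   show "VMap (k' \<star>GV h) (q a) = VMap g (q a)" if a: "a : Verts B" for a
    using GComp(1)[OF h(1) q[OF a]] h(2)[OF a] mV(2)[OF a] gV[OF a] by simp
   show "map (VMap (k' \<star>GV h)) (P k) = map (VMap g) (P k) & map (EMap (k' \<star>GV h)) (steps (P k)) \<star>SV J k =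
     map (EMap g) (steps (P k)) \<star>SV J k" if k: "k : K" for k
    using vc[OF h(1) k, of k'] rc[OF h(1) k' k] h(3,4)[OF k] p'(3)[OF k] hs(2)[OF k] gp[OF k] gr[OF k] unfolding r_def by simp
  qed
  moreover have "\<G>m h \<star>GV ee = m" by (rule B_eq[OF GV.comp_Hom[OF ee \<G>m_props(1)[OF h(1)]] m])
    (use mainV h(2) main[OF h(1)] h(3,4) p'(2) in auto)
  ultimately show "EX h. h : Hom GV A A' & k' \<star>GV h = g & AMap (Gamma V E) h \<star>GV ee = m"
   using h(1) by (auto simp: Gamma_def)
 next
  fix A' k' m h h' assume k': "k' : Hom GV A' X" and h: "h : Hom GV A A'" "k' \<star>GV h = g" "AMap (Gamma V E) h \<star>GV ee = m"
   and h': "h' : Hom GV A A'" "k' \<star>GV h' = g" "AMap (Gamma V E) h' \<star>GV ee = m"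
  have eq: "\<G>m h \<star>GV ee = \<G>m h' \<star>GV ee" using h(3) h'(3) by (simp add: Gamma_def)
  have vq: "VMap h (q a) = VMap h' (q a)" if a: "a : Verts B" for a using mainV[OF a, of h] mainV[OF a, of h'] eq by simp
  show "h = h'"
  proof (rule un[rule_format, OF h(1) h'(1) vq])
   fix k assume k: "k : K"
   have hP: "map (VMap h) (P k) : paths A' (VMap h (q (s k))) (VMap h (q (t k)))" by (rule path_map_Hom[OF h(1) P[OF k]])
   have hP': "map (VMap h') (P k) : paths A' (VMap h (q (s k))) (VMap h (q (t k)))"
    using path_map_Hom[OF h'(1) P[OF k]] vq st[OF k] by simp
   have xH: "AMap E (r w k) ** e k : Hom V (c k) (smd A' (map (VMap w) (P k)))" if "w : Hom GV A A'" for w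
    using V.comp_Hom[OF eH[OF k] E_Hom_seq[OF rH[OF that k]]] by (simp add: Gamma_summand_def)
   have "map (VMap h) (P k) = map (VMap h') (P k) & AMap E (r h k) ** e k = AMap E (r h' k) ** e k"
    by (rule connected_\<G>_eq[OF c[OF k] GHomD(1)[OF k'] hP xH[OF h(1)] hP' xH[OF h'(1)]])
     (use main[OF h(1) k] main[OF h'(1) k] eq in simp)
   then have PP: "map (VMap h) (P k) = map (VMap h') (P k)" and EE: "AMap E (r h k) ** e k = AMap E (r h' k) ** e k" by auto
   let ?ks = "map (EMap k') (steps (map (VMap h) (P k)))"
   have kg: "?ks \<star>SV r h k = gs k" "?ks \<star>SV r h' k = gs k" by (rule rc[OF h(1) k' k, unfolded h(2) gr[OF k], symmetric],
     rule rc[OF h'(1) k' k, unfolded h'(2) gr[OF k], folded PP, symmetric])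
   have ksH: "?ks : Hom SV (map (Edge A') (steps (map (VMap h) (P k)))) (map (Edge X) (steps (p k)))"
    using EMap_steps[OF k' hP] vc[OF h(1) k, of k'] h(2) gp[OF k] by simp
   have kx: "AMap E ?ks ** (AMap E (r h k) ** e k) = x k"
    using V.assoc[OF eH[OF k] E_Hom_seq[OF rH[OF h(1) k]] E_Hom_seq[OF ksH]] E_comp_seq[OF rH[OF h(1) k] ksH] kg(1) ge[OF k] by simp
   have eh: "AMap E (r h k) ** e k : Hom V (c k) (OMap E (map (Edge A') (steps (map (VMap h) (P k)))))"
    using xH[OF h(1)] by (simp add: Gamma_summand_def)
   \<comment> \<open>Once the images of the path agree, uniqueness for the generic factorization at
     \<open>k\<close> applies.\<close>
   have "r h k = r h' k" by (rule genericD(5)[OF G[OF k] ksH eh kx rH[OF h(1) k] kg(1) refl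
       rH[OF h'(1) k, folded PP] kg(2) EE[symmetric]])
   then show "map (VMap h) (P k) = map (VMap h') (P k) & map (EMap h) (steps (P k)) \<star>SV J k =
     map (EMap h') (steps (P k)) \<star>SV J k" using PP by (simp add: r_def)
  qed
 qed
 then show "EX A g e. generic GV GV (Gamma V E) X B f A g e" by blast
qed

end

section \<open>Accessibility of a multitensor\<close>

context Multitensor
begin

interpretation SV: Category "SV" by unfold_locales (rule V.category_seq_cat)

lemma seq_graph_map_comp:
 assumes f: "fs : Hom SV Xs Ys" and g: "gs : Hom SV Ys Zs"
 shows "seq_graph_map Ys Zs gs \<star>GV seq_graph_map Xs Ys fs = seq_graph_map Xs Zs (gs \<star>SV fs)"
proof -
 have L: "Xs : Seqs" "length Ys = length Xs" "length fs = length Xs" "length gs = length Xs"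
  using seq_Obj[OF f] f g by (auto simp: seq_Hom_iff)
 show ?thesis unfolding seq_graph_map_def[of Xs] by (rule seq_map_comp[OF L(1) seq_graph_map(1)[OF g]])
   (use L f seq_graph_map(2,3)[OF g] in "auto simp: seq_Hom_iff Edge_seq_graph")
qed

definition seq_graph_ftor where
 "seq_graph_ftor = \<lparr>OMap = seq_graph, AMap = (%fs. seq_graph_map (map (Dom V) fs) (map (Cod V) fs) fs)\<rparr>"

lemma seq_graph_ftor_simps [simp]:
 "OMap seq_graph_ftor = seq_graph" "fs : Hom SV Xs Ys ==> AMap seq_graph_ftor fs = seq_graph_map Xs Ys fs"
 by (auto simp: seq_graph_ftor_def Hom_def)

lemma functor_seq_graph: "is_functor SV GV seq_graph_ftor"
proof (rule is_functorI[OF SV.category category_GV])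
 fix Xs assume X: "Xs : Obj SV"
 then have XO: "Xs : Seqs" by simp
 show "OMap seq_graph_ftor Xs : Obj GV" by (simp add: seq_graph_Obj[OF XO])
 note I = seq_graph_map[OF SV.Ide_Hom[OF X]]
 have "seq_graph_map Xs Xs (Ide SV Xs) = Ide GV (seq_graph Xs)"
  by (rule seq_graph_eqI[OF I(1) GIde_Hom[OF seq_graph_Obj[OF XO]]]) (use I(2,3) in "auto simp: GIde Edge_seq_graph")
 then show "AMap seq_graph_ftor (Ide SV Xs) = Ide GV (OMap seq_graph_ftor Xs)" using SV.Ide_Hom[OF X] by simp
next
 fix fs gs Xs Ys Zs assume "fs : Hom SV Xs Ys" "gs : Hom SV Ys Zs"
 note fg = this and c = SV.comp_Hom[OF this]
 show "AMap seq_graph_ftor (gs \<star>SV fs) = AMap seq_graph_ftor gs \<star>GV AMap seq_graph_ftor fs"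
  unfolding seq_graph_ftor_simps(2)[OF c] seq_graph_ftor_simps(2)[OF fg(1)] seq_graph_ftor_simps(2)[OF fg(2)] seq_graph_map_comp[OF fg] ..
qed (simp add: seq_graph_map(1))

text \<open>A filtered category is nonempty and any two of its objects have a bound, so the constant
  vertices need no identification; the edges are handled by the componentwise colimits.\<close>

lemma colimit_seq_graph:
 assumes "filtered lam J" "Cinfinite lam" and D: "is_functor J SV D" and c: "is_colimit J SV D Ls inc"
 shows "is_colimit J GV (comp_ftor seq_graph_ftor D) (seq_graph Ls) (%j. seq_graph_map (OMap D j) Ls (inc j))"
proof -
 interpret J: Filtered lam J by unfold_locales (rule assms)+
 let ?g = "%j. seq_graph_map (OMap D j) Ls (inc j)"
 have coc: "is_cocone J SV D Ls inc" using c by (simp add: is_colimit_def)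
 have LO: "Ls : Seqs" and iH: "!!j. j : Obj J ==> inc j : Hom SV (OMap D j) Ls" using coc by (auto simp: is_cocone_def)
 note DH = functorD(4)[OF D] and gH = seq_graph_map[OF iH]
 have len: "length (OMap D j) = length Ls" if "j : Obj J" for j using seq_Obj[OF iH[OF that]] by simp
 have "is_cocone J GV (comp_ftor seq_graph_ftor D) (seq_graph Ls) ?g"
 proof -
  have "AMap seq_graph_ftor (inc j) = ?g j" if "j : Obj J" for j by (rule seq_graph_ftor_simps(2)[OF iH[OF that]])
  then show ?thesis using is_cocone_map[OF functor_seq_graph D coc] gH(1) unfolding is_cocone_def by (simp add: comp_ftor_def)
 qed
 moreover have "EX! h. h : Hom GV (seq_graph Ls) Y & (ALL j:Obj J. h \<star>GV ?g j = k j)"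
  if k: "is_cocone J GV (comp_ftor seq_graph_ftor D) Y k" for Y k
 proof -
  have Y: "Y : Obj GV" and kH: "!!j. j : Obj J ==> k j : Hom GV (seq_graph (OMap D j)) Y"
   using k by (auto simp: is_cocone_def comp_ftor_def)
  have kt: "k m \<star>GV seq_graph_map (OMap D j) (OMap D m) (AMap D t) = k j" if "t : Hom J j m" for t j m
   using k seq_graph_ftor_simps(2)[OF DH[OF that]] HomD[OF that] by (auto simp: is_cocone_def comp_ftor_def)
  obtain j0 where j0: "j0 : Obj J" using J.nonempty by blast
  \<comment> \<open>The images of the vertices, read off at one stage; \<open>kv\<close> shows that
    every stage gives the same.\<close>
  define q where "q i = VMap (k j0) (vtx i)" for i
  have kvt: "VMap (k m) (vtx i) = VMap (k j) (vtx i)" if t: "t : Hom J j m" and i: "i \<le> length Ls" for t j m i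
   using arg_cong[OF kt[OF t], of "%w. VMap w (vtx i)"] GComp(1)[OF seq_graph_map(1)[OF DH[OF t]], of "vtx i" "k m"]
    seq_graph_map(2)[OF DH[OF t]] i len J.Hom_Obj[OF t] by simp
  have kv: "VMap (k j) (vtx i) = q i" if j: "j : Obj J" and i: "i \<le> length Ls" for j i
   using J.bound[OF j j0] kvt[OF _ i] unfolding q_def by metis
  have qV: "q i : Verts Y" if "i \<le> length Ls" for i
   using GHomD(5)[OF kH[OF j0], of "vtx i"] that len[OF j0] by (simp add: q_def)
  have kE: "EMap (k j) (vtx i, vtx (Suc i)) : Hom V (OMap D j ! i) (Edge Y (q i, q (Suc i)))" if j: "j : Obj J" and i: "i < length Ls" for j i
   using GHomD(6)[OF kH[OF j], of "vtx i" "vtx (Suc i)"] kv[OF j] i len[OF j] by (simp add: Edge_seq_graph)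
  have "EX e. e : Hom V (Ls ! i) (Edge Y (q i, q (Suc i))) & (ALL j:Obj J. e ** inc j ! i = EMap (k j) (vtx i, vtx (Suc i)))"
   if i: "i < length Ls" for i
  proof -
   have "is_cocone J V (component i D) (Edge Y (q i, q (Suc i))) (%j. EMap (k j) (vtx i, vtx (Suc i)))" unfolding is_cocone_def
   proof (intro conjI ballI)
    show "Edge Y (q i, q (Suc i)) : Obj V" using GObjD(2)[OF Y] qV i by simp
    fix t assume t: "t : Arr J"
    then have tH: "t : Hom J (Dom J t) (Cod J t)" and d: "Dom J t : Obj J" by (auto simp: Hom_def)
    have v: "vtx i : Verts (seq_graph (OMap D (Dom J t)))" "vtx (Suc i) : Verts (seq_graph (OMap D (Dom J t)))" using i len[OF d] by auto
    show "EMap (k (Cod J t)) (vtx i, vtx (Suc i)) ** AMap (component i D) t = EMap (k (Dom J t)) (vtx i, vtx (Suc i))"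
     using arg_cong[OF kt[OF tH], of "%w. EMap w (vtx i, vtx (Suc i))"] GComp(2)[OF seq_graph_map(1)[OF DH[OF tH]] v, of "k (Cod J t)"]
      seq_graph_map(2,3)[OF DH[OF tH]] i len[OF d] by simp
   qed (use kE[OF _ i] in simp)
   then show ?thesis using V.seq_colimitD[OF D c i] unfolding is_colimit_def by blast
  qed
  then obtain e where e: "!!i. i < length Ls ==> e i : Hom V (Ls ! i) (Edge Y (q i, q (Suc i)))"
   "!!i j. i < length Ls ==> j : Obj J ==> e i ** inc j ! i = EMap (k j) (vtx i, vtx (Suc i))" by metis
  have hH: "seq_map Ls Y q e : Hom GV (seq_graph Ls) Y" by (rule seq_map_Hom[OF LO Y qV e(1)])
  have gc: "VMap (h \<star>GV ?g j) (vtx i) = VMap h (vtx i)"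
   "i < length Ls ==> EMap (h \<star>GV ?g j) (vtx i, vtx (Suc i)) = EMap h (vtx i, vtx (Suc i)) ** inc j ! i"
   if "j : Obj J" "i \<le> length Ls" for h j i
   using GComp[OF gH(1)[OF that(1)], of "vtx i"] gH(2,3)[OF that(1)] len[OF that(1)] that(2) by auto
  show ?thesis
  proof (rule ex1I[of _ "seq_map Ls Y q e"], intro conjI ballI hH)
   fix j assume j: "j : Obj J"
   show "seq_map Ls Y q e \<star>GV ?g j = k j" by (rule seq_graph_eqI[OF GComp_Hom[OF gH(1)[OF j] hH] kH[OF j]])
     (use gc[OF j] kv[OF j] e(2)[OF _ j] len[OF j] in "auto simp: seq_map_simps")
  next
   fix h assume h: "h : Hom GV (seq_graph Ls) Y & (ALL j:Obj J. h \<star>GV ?g j = k j)"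
   then have hH': "h : Hom GV (seq_graph Ls) Y" by simp
   have hv: "VMap h (vtx i) = q i" if "i \<le> length Ls" for i using gc(1)[OF j0 that, of h] h j0 kv[OF j0 that] by simp
   show "h = seq_map Ls Y q e"
   proof (rule seq_graph_eqI[OF hH' hH])
    fix i assume i: "i < length Ls"
    have "EMap h (vtx i, vtx (Suc i)) = e i"
    proof (rule is_colimit_eq[OF V.category V.seq_coconeD(5)[OF D coc i] V.seq_colimitD[OF D c i] _ e(1)[OF i]])
     show "EMap h (vtx i, vtx (Suc i)) : Hom V (Ls ! i) (Edge Y (q i, q (Suc i)))"
      using GHomD(6)[OF hH', of "vtx i" "vtx (Suc i)"] hv i by (simp add: Edge_seq_graph)
     show "EMap h (vtx i, vtx (Suc i)) ** inc j ! i = e i ** inc j ! i" if "j : Obj J" for j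
      using gc(2)[OF that, of i h] h that e(2)[OF i that] i by simp
    qed
    then show "EMap h (vtx i, vtx (Suc i)) = EMap (seq_map Ls Y q e) (vtx i, vtx (Suc i))" using i by (simp add: seq_map_simps)
   qed (simp add: hv seq_map_simps)
  qed
 qed
 ultimately show ?thesis unfolding is_colimit_def by blast
qed

text \<open>A simultaneous choice of the inverses of the straight-path inclusions. It is natural
  because these inclusions can be cancelled.\<close>

lemma line_iso:
 obtains r where "!!Xs. Xs : Seqs ==> r Xs : Hom V (Edge (\<G> (seq_graph Xs)) (ends Xs)) (OMap E Xs)"
  "!!Xs T x. Xs : Seqs ==> x : Hom V (OMap E Xs) T ==> (x ** r Xs) ** \<iota> (seq_graph Xs) (line 0 (length Xs)) = x"
  "!!fs Xs Ys. fs : Hom SV Xs Ys ==> r Ys ** EMap (\<G>m (seq_graph_map Xs Ys fs)) (ends Xs) = AMap E fs ** r Xs"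
proof -
 have "EX r. r : Hom V (Edge (\<G> (seq_graph Xs)) (ends Xs)) (OMap E Xs) &
  r ** \<iota> (seq_graph Xs) (line 0 (length Xs)) = Ide V (OMap E Xs)" if "Xs : Seqs" for Xs using line_retract[OF that] by metis
 then obtain r where r: "!!Xs. Xs : Seqs ==> r Xs : Hom V (Edge (\<G> (seq_graph Xs)) (ends Xs)) (OMap E Xs)"
  "!!Xs. Xs : Seqs ==> r Xs ** \<iota> (seq_graph Xs) (line 0 (length Xs)) = Ide V (OMap E Xs)" by metis
 show ?thesis
 proof (rule that[OF r(1)])
  show x: "(x ** r Xs) ** \<iota> (seq_graph Xs) (line 0 (length Xs)) = x" if "Xs : Seqs" "x : Hom V (OMap E Xs) T" for Xs T x
   using V.assoc[OF line_inj_Hom[OF that(1)] r(1)[OF that(1)] that(2)] r(2)[OF that(1)] V.id_r[OF that(2)] by simp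
  fix fs Xs Ys assume f: "fs : Hom SV Xs Ys"
  have O: "Xs : Seqs" "Ys : Seqs" "length Ys = length Xs" using seq_Obj[OF f] by auto
  note i = line_inj_Hom[OF O(1)] and g = seq_\<G>_EMap_Hom[OF f] and Ef = E_Hom_seq[OF f] and rY = r(1)[OF O(2), unfolded O(3)]
  have "EMap (\<G>m (seq_graph_map Xs Ys fs)) (ends Xs) ** \<iota> (seq_graph Xs) (line 0 (length Xs)) =
   \<iota> (seq_graph Ys) (line 0 (length Xs)) ** AMap E fs"
   using seq_point[OF f V.Ide_Hom[OF E_Obj[OF O(1)]]] V.id_r[OF i] V.id_r[OF Ef] by simp
  then have "(r Ys ** EMap (\<G>m (seq_graph_map Xs Ys fs)) (ends Xs)) ** \<iota> (seq_graph Xs) (line 0 (length Xs)) = AMap E fs"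
   using V.assoc[OF i g rY] V.assoc[OF Ef line_inj_Hom[OF O(2), unfolded O(3)] rY] r(2)[OF O(2)] V.id_l[OF Ef] O(3) by simp
  then show "r Ys ** EMap (\<G>m (seq_graph_map Xs Ys fs)) (ends Xs) = AMap E fs ** r Xs"
   using line_retract[OF O(1)] V.comp_Hom[OF g rY] V.comp_Hom[OF r(1)[OF O(1)] Ef] x[OF O(1) Ef] by metis
 qed
qed

text \<open>A filtered colimit of sequences is one of linear graphs, preserved by
  \<open>Gamma\<close>. The hom from the first to the last vertex of its image is \<open>E\<close>
  of the colimit, up to the natural isomorphism \<open>r\<close>.\<close>

theorem accessible_E:
 assumes acc: "accessible U lam GV GV (Gamma V E)" and lam: "Cinfinite lam"
 shows "accessible U lam SV V E" unfolding accessible_def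
proof (intro allI impI)
 fix J :: "('u, 'u) cat" and D Ls inc
 assume J: "small_category U J" "filtered lam J" and D: "is_functor J SV D" and c: "is_colimit J SV D Ls inc"
 interpret J: Filtered lam J by unfold_locales (rule J(2), rule lam)
 have coc: "is_cocone J SV D Ls inc" using c by (simp add: is_colimit_def)
 have LO: "Ls : Seqs" and iH: "!!j. j : Obj J ==> inc j : Hom SV (OMap D j) Ls" using coc by (auto simp: is_cocone_def)
 have DO: "OMap D j : Seqs" "length (OMap D j) = length Ls" if "j : Obj J" for j using seq_Obj[OF iH[OF that]] by auto
 let ?G = "comp_ftor seq_graph_ftor D" and ?g = "%j. seq_graph_map (OMap D j) Ls (inc j)"
 let ?H = "comp_ftor (Gamma V E) ?G" and ?ab = "ends Ls"
 note G = is_functor_comp[OF functor_seq_graph D]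
 have "is_colimit J GV ?H (\<G> (seq_graph Ls)) (\<G>m \<circ> ?g)"
  using acc J G colimit_seq_graph[OF J(2) lam D c] unfolding accessible_def by fastforce
 then have ec: "edge_colimit J ?H (\<G> (seq_graph Ls)) (\<G>m \<circ> ?g) (vtx 0) (vtx (length Ls))"
  using colimit_imp_graph_colimit[OF is_functor_comp[OF functor_\<G> G] small_category_Obj[OF J(1)]] LO
  by (auto simp: graph_colimit_def)
 have gv: "x : Verts (OMap ?H j) & VMap ((\<G>m \<circ> ?g) j) x = vtx i \<longleftrightarrow> x = vtx i" if "j : Obj J" "i \<le> length Ls" for j x i
  using seq_graph_map(2)[OF iH[OF that(1)]] DO(2)[OF that(1)] that(2) by (auto simp: comp_ftor_def Verts_seq_graph)
 obtain r where r: "!!Xs. Xs : Seqs ==> r Xs : Hom V (Edge (\<G> (seq_graph Xs)) (ends Xs)) (OMap E Xs)"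
  "!!Xs T x. Xs : Seqs ==> x : Hom V (OMap E Xs) T ==> (x ** r Xs) ** \<iota> (seq_graph Xs) (line 0 (length Xs)) = x"
  "!!fs Xs Ys. fs : Hom SV Xs Ys ==> r Ys ** EMap (\<G>m (seq_graph_map Xs Ys fs)) (ends Xs) = AMap E fs ** r Xs"
  using line_iso by metis
 have rH: "r (OMap D j) : Hom V (Edge (\<G> (seq_graph (OMap D j))) ?ab) (OMap E (OMap D j))" if "j : Obj J" for j
  using r(1)[OF DO(1)[OF that]] DO(2)[OF that] by simp
 have gE: "EMap (\<G>m (?g j)) ?ab : Hom V (Edge (\<G> (seq_graph (OMap D j))) ?ab) (Edge (\<G> (seq_graph Ls)) ?ab)" if "j : Obj J" for j
  using seq_\<G>_EMap_Hom[OF iH[OF that]] DO(2)[OF that] by simp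
 note iL = line_inj_Hom[OF LO]
 show "is_colimit J V (comp_ftor E D) (OMap E Ls) (AMap E \<circ> inc)" unfolding is_colimit_def
 proof (intro conjI allI impI)
  show "is_cocone J V (comp_ftor E D) (OMap E Ls) (AMap E \<circ> inc)" by (rule is_cocone_map[OF functor_E D coc])
  fix T f assume f: "is_cocone J V (comp_ftor E D) T f"
  have T: "T : Obj V" and fH: "!!j. j : Obj J ==> f j : Hom V (OMap E (OMap D j)) T"
   using f by (auto simp: is_cocone_def comp_ftor_def)
  have fr: "f j ** r (OMap D j) : Hom V (Edge (\<G> (seq_graph (OMap D j))) ?ab) T" if "j : Obj J" for j
   by (rule V.comp_Hom[OF rH[OF that] fH[OF that]])
  have ft: "(f (Cod J t) ** r (OMap D (Cod J t))) ** EMap (AMap ?H t) ?ab = f (Dom J t) ** r (OMap D (Dom J t))" if t: "t : Arr J" for t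
  proof -
   have d: "Dom J t : Obj J" "Cod J t : Obj J" using t by auto
   have Dt: "AMap D t : Hom SV (OMap D (Dom J t)) (OMap D (Cod J t))" by (rule functorD(4)[OF D HomI[OF t refl refl]])
   note E = seq_\<G>_EMap_Hom[OF Dt, unfolded DO(2)[OF d(1)]]
   have "(f (Cod J t) ** r (OMap D (Cod J t))) ** EMap (AMap ?H t) ?ab = f (Cod J t) ** (AMap E (AMap D t) ** r (OMap D (Dom J t)))"
    using V.assoc[OF E rH[OF d(2)] fH[OF d(2)]] r(3)[OF Dt] DO(2)[OF d(1)] Dt by (simp add: comp_ftor_def Gamma_def)
   also have "\<dots> = f (Dom J t) ** r (OMap D (Dom J t))"
    using V.assoc[OF rH[OF d(1)] E_Hom_seq[OF Dt] fH[OF d(2)]] f t by (simp add: is_cocone_def comp_ftor_def)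
   finally show ?thesis .
  qed
  have "EX! h. h : Hom V (Edge (\<G> (seq_graph Ls)) ?ab) T & (ALL j:Obj J. h ** EMap (\<G>m (?g j)) ?ab = f j ** r (OMap D j))"
  proof -
   have v: "x = vtx 0" "y = vtx (length Ls)" if "j : Obj J" "x : Verts (OMap ?H j)" "y : Verts (OMap ?H j)"
    "VMap ((\<G>m \<circ> ?g) j) x = vtx 0" "VMap ((\<G>m \<circ> ?g) j) y = vtx (length Ls)" for j x y
    using gv[OF that(1), of 0 x] gv[OF that(1), of "length Ls" y] that by auto
   have Hv: "VMap (AMap ?H t) (vtx i) = vtx i" if "t : Arr J" "i \<le> length Ls" for t i
    using seq_graph_map(2)[OF functorD(4)[OF D HomI[OF that(1) refl refl]]] functorD(4)[OF D HomI[OF that(1) refl refl]]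
     DO(2)[of "Dom J t"] that by (simp add: comp_ftor_def Gamma_def)
   have ecc: "edge_cocone J ?H (\<G>m \<circ> ?g) (vtx 0) (vtx (length Ls)) T (%j _ _. f j ** r (OMap D j))"
    unfolding edge_cocone_def
   proof (intro conjI ballI impI)
    fix j x y assume j: "j : Obj J" and xy: "x : Verts (OMap ?H j)" "y : Verts (OMap ?H j)"
     "VMap ((\<G>m \<circ> ?g) j) x = vtx 0" "VMap ((\<G>m \<circ> ?g) j) y = vtx (length Ls)"
    show "f j ** r (OMap D j) : Hom V (Edge (OMap ?H j) (x, y)) T" using fr[OF j] v[OF j xy] by (simp add: comp_ftor_def Gamma_def)
   next
    fix t x y assume t: "t : Arr J" and xy: "x : Verts (OMap ?H (Dom J t))" "y : Verts (OMap ?H (Dom J t))"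
     "VMap ((\<G>m \<circ> ?g) (Dom J t)) x = vtx 0" "VMap ((\<G>m \<circ> ?g) (Dom J t)) y = vtx (length Ls)"
    show "(f (Cod J t) ** r (OMap D (Cod J t))) ** EMap (AMap ?H t) (x, y) = f (Dom J t) ** r (OMap D (Dom J t))"
     using ft[OF t] v[OF _ xy] t by simp
   qed
   \<comment> \<open>Each end vertex has exactly one preimage at every stage, so the quantification
     over preimages in \<open>edge_colimit\<close> collapses.\<close>
   have eq: "(ALL j:Obj J. ALL x:Verts (OMap ?H j). ALL y:Verts (OMap ?H j). VMap ((\<G>m \<circ> ?g) j) x = vtx 0 -->
     VMap ((\<G>m \<circ> ?g) j) y = vtx (length Ls) --> h ** EMap ((\<G>m \<circ> ?g) j) (x, y) = f j ** r (OMap D j)) \<longleftrightarrow>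
     (ALL j:Obj J. h ** EMap (\<G>m (?g j)) ?ab = f j ** r (OMap D j))" for h
   proof (intro iffI ballI impI)
    fix j assume "ALL j:Obj J. ALL x:Verts (OMap ?H j). ALL y:Verts (OMap ?H j). VMap ((\<G>m \<circ> ?g) j) x = vtx 0 -->
     VMap ((\<G>m \<circ> ?g) j) y = vtx (length Ls) --> h ** EMap ((\<G>m \<circ> ?g) j) (x, y) = f j ** r (OMap D j)" "j : Obj J"
    then show "h ** EMap (\<G>m (?g j)) ?ab = f j ** r (OMap D j)"
     using gv[of j 0 "vtx 0"] gv[of j "length Ls" "vtx (length Ls)"] by simp
   next
    fix j x y assume A: "ALL j:Obj J. h ** EMap (\<G>m (?g j)) ?ab = f j ** r (OMap D j)" "j : Obj J" "x : Verts (OMap ?H j)"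
     "y : Verts (OMap ?H j)" "VMap ((\<G>m \<circ> ?g) j) x = vtx 0" "VMap ((\<G>m \<circ> ?g) j) y = vtx (length Ls)"
    show "h ** EMap ((\<G>m \<circ> ?g) j) (x, y) = f j ** r (OMap D j)" using A(1,2) v[OF A(2-6)] by simp
   qed
   from mp[OF spec[OF bspec[OF ec[unfolded edge_colimit_def] T]] ecc] show ?thesis unfolding eq .
  qed
  then obtain h where h: "h : Hom V (Edge (\<G> (seq_graph Ls)) ?ab) T" "!!j. j : Obj J ==> h ** EMap (\<G>m (?g j)) ?ab = f j ** r (OMap D j)"
   and hu: "!!h'. h' : Hom V (Edge (\<G> (seq_graph Ls)) ?ab) T & (ALL j:Obj J. h' ** EMap (\<G>m (?g j)) ?ab = f j ** r (OMap D j)) ==> h' = h"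
   by (elim ex1E) blast
  let ?i = "\<iota> (seq_graph Ls) (line 0 (length Ls))"
  show "EX! h. h : Hom V (OMap E Ls) T & (ALL j:Obj J. h ** (AMap E \<circ> inc) j = f j)"
  proof (intro ex1I[of _ "h ** ?i"] conjI ballI)
   show "h ** ?i : Hom V (OMap E Ls) T" by (rule V.comp_Hom[OF iL h(1)])
   fix j assume j: "j : Obj J"
   note ij = line_inj_Hom[OF DO(1)[OF j], unfolded DO(2)[OF j]] and Ei = E_Hom_seq[OF iH[OF j]]
   have "?i ** AMap E (inc j) = EMap (\<G>m (?g j)) ?ab ** \<iota> (seq_graph (OMap D j)) (line 0 (length Ls))"
    using seq_point[OF iH[OF j] V.Ide_Hom[OF E_Obj[OF DO(1)[OF j]]]] V.id_r[OF ij] V.id_r[OF Ei] DO(2)[OF j] by simp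
   then show "(h ** ?i) ** (AMap E \<circ> inc) j = f j"
    using V.assoc[OF Ei iL h(1)] V.assoc[OF ij gE[OF j] h(1)] h(2)[OF j] r(2)[OF DO(1)[OF j] fH[OF j]] DO(2)[OF j] by simp
  next
   fix k assume "k : Hom V (OMap E Ls) T & (ALL j:Obj J. k ** (AMap E \<circ> inc) j = f j)"
   then have k: "k : Hom V (OMap E Ls) T" and kf: "!!j. j : Obj J ==> k ** AMap E (inc j) = f j" by auto
   have "(k ** r Ls) ** EMap (\<G>m (?g j)) ?ab = f j ** r (OMap D j)" if j: "j : Obj J" for j
    using V.assoc[OF gE[OF j] r(1)[OF LO] k] r(3)[OF iH[OF j]] DO(2)[OF j] V.assoc[OF rH[OF j] E_Hom_seq[OF iH[OF j]] k] kf[OF j] by simp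
   then have "k ** r Ls = h" using hu V.comp_Hom[OF r(1)[OF LO] k] by blast
   then show "k = h ** ?i" using r(2)[OF LO k] by simp
  qed
 qed
qed

section \<open>Generic factorizations for the multitensor\<close>

lemma seq_coproduct:
 assumes I: "small U I" and As: "!!i. i : I ==> As i : Seqs & length (As i) = n"
 obtains A inc where "A : Seqs" "length A = n" "!!i. i : I ==> inc i : Hom SV (As i) A"
  "ALL A' hs. A' : Seqs --> length A' = n --> (ALL i:I. hs i : Hom SV (As i) A') -->
    (EX h:Hom SV A A'. ALL i:I. h \<star>SV inc i = hs i)" "ALL A'. ALL h:Hom SV A A'. ALL h':Hom SV A A'.
    (ALL i:I. h \<star>SV inc i = h' \<star>SV inc i) --> h = h'"
proof -
 have "EX Q j. is_coproduct V I (%i. As i ! l) Q j" if "l < n" for l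
  by (rule V.coproduct_exists[OF has_coproducts I]) (use As that in "auto simp: in_lists_conv_set")
 then obtain Q j where Q: "!!l. l < n ==> is_coproduct V I (%i. As i ! l) (Q l) (j l)" by metis
 define A where "A = map Q [0..<n]"
 define inc where "inc i = map (%l. j l i) [0..<n]" for i
 have lA: "length A = n" "!!l. l < n ==> A ! l = Q l" by (simp_all add: A_def)
 have li: "length (inc i) = n" "!!l. l < n ==> inc i ! l = j l i" for i by (simp_all add: inc_def)
 show ?thesis
 proof (rule that[of A inc])
  show "A : Seqs" using V.coproductD(1)[OF Q] by (auto simp: A_def)
  \<comment> \<open>For an empty family the length is determined by \<open>n\<close> alone.\<close>
  show "length A = n" by (rule lA)
  show "inc i : Hom SV (As i) A" if "i : I" for i unfolding seq_Hom_iff using V.coproductD(3)[OF Q that] As[OF that] lA li by simp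
  show "ALL A' hs. A' : Seqs --> length A' = n --> (ALL i:I. hs i : Hom SV (As i) A') -->
    (EX h:Hom SV A A'. ALL i:I. h \<star>SV inc i = hs i)"
  proof (intro allI impI)
   fix A' hs assume A': "A' : Seqs" "length A' = n" and hs: "ALL i:I. hs i : Hom SV (As i) A'"
   have hl: "length (hs i) = n" "!!l. l < n ==> hs i ! l : Hom V (As i ! l) (A' ! l)" if "i : I" for i
    using bspec[OF hs that] As[OF that] unfolding seq_Hom_iff by auto
   have "EX h. h : Hom V (Q l) (A' ! l) & (ALL i:I. h ** j l i = hs i ! l)" if l: "l < n" for l
   proof -
    have "A' ! l : Obj V" using A' l by (auto simp: in_lists_conv_set)
    from V.coproduct_ex1[OF Q[OF l] this hl(2)[OF _ l]] show ?thesis by blast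
   qed
   then obtain h where h: "!!l. l < n ==> h l : Hom V (Q l) (A' ! l)" "!!l i. l < n ==> i : I ==> h l ** j l i = hs i ! l" by metis
   have "map h [0..<n] : Hom SV A A'" unfolding seq_Hom_iff using h(1) lA A'(2) by simp
   moreover have "map h [0..<n] \<star>SV inc i = hs i" if "i : I" for i
    by (rule nth_equalityI) (use li hl(1)[OF that] h(2)[OF _ that] in auto)
   ultimately show "EX h:Hom SV A A'. ALL i:I. h \<star>SV inc i = hs i" by blast
  qed
  show "ALL A'. ALL h:Hom SV A A'. ALL h':Hom SV A A'. (ALL i:I. h \<star>SV inc i = h' \<star>SV inc i) --> h = h'"
  proof (intro allI ballI impI)
   fix A' h h' assume h: "h : Hom SV A A'" "h' : Hom SV A A'" and e: "ALL i:I. h \<star>SV inc i = h' \<star>SV inc i"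
   have l: "length h = n" "length h' = n" using h lA by (auto simp: seq_Hom_iff)
   show "h = h'"
   proof (rule nth_equalityI)
    fix m assume "m < length h"
    then have m: "m < n" using l by simp
    show "h ! m = h' ! m"
    proof (rule V.coproduct_eq[OF Q[OF m]])
     show "h ! m : Hom V (Q m) (A' ! m)" "h' ! m : Hom V (Q m) (A' ! m)" using h m lA by (auto simp: seq_Hom_iff)
     fix i assume "i : I"
     then have "(h \<star>SV inc i) ! m = (h' \<star>SV inc i) ! m" using e by metis
     then show "h ! m ** j m i = h' ! m ** j m i" using l li m by simp
    qed
   qed (simp add: l)
  qed
 qed
qed

text \<open>An arrow out of \<open>B\<close> is a family over the summands. The sequences of their
  generic factorizations all have the length of \<open>Xs\<close>, so they have a componentwise
  coproduct, which is generic for the whole family.\<close>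

lemma generic_coproduct:
 assumes I: "small U I" and Q: "is_coproduct V I C B j" and Xs: "Xs : Seqs" and f: "f : Hom V B (OMap E Xs)"
  and G: "!!i. i : I ==> generic SV V E Xs (C i) (f ** j i) (As i) (gs i) (e i)"
 shows "EX A g e. generic SV V E Xs B f A g e"
proof -
 note gH = genericD(1)[OF G] and eH = genericD(2)[OF G] and ge = genericD(3)[OF G]
 have As: "As i : Seqs & length (As i) = length Xs" if "i : I" for i using seq_Obj[OF gH[OF that]] by simp
 obtain A inc where A: "A : Seqs" "length A = length Xs" and inc: "!!i. i : I ==> inc i : Hom SV (As i) A"
  and ex: "ALL A' hs. A' : Seqs --> length A' = length Xs --> (ALL i:I. hs i : Hom SV (As i) A') -->
    (EX h:Hom SV A A'. ALL i:I. h \<star>SV inc i = hs i)" and un: "ALL A'. ALL h:Hom SV A A'. ALL h':Hom SV A A'.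
    (ALL i:I. h \<star>SV inc i = h' \<star>SV inc i) --> h = h'" by (rule seq_coproduct[OF I, of As "length Xs"]) (use As in auto)
 note jH = V.coproductD(3)[OF Q]
 obtain g where g: "g : Hom SV A Xs" and gi: "!!i. i : I ==> g \<star>SV inc i = gs i" using ex Xs gH by blast
 have iH: "AMap E (inc i) ** e i : Hom V (C i) (OMap E A)" if "i : I" for i
  by (rule V.comp_Hom[OF eH[OF that] E_Hom_seq[OF inc[OF that]]])
 obtain ee where ee: "ee : Hom V B (OMap E A)" "!!i. i : I ==> ee ** j i = AMap E (inc i) ** e i"
  using V.coproduct_ex1[OF Q E_Obj[OF A(1)] iH] by blast
 have he: "AMap E h ** ee ** j i = AMap E (h \<star>SV inc i) ** e i" if i: "i : I" and h: "h : Hom SV A Y" for h i Y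
  using V.assoc[OF jH[OF i] ee(1) E_Hom_seq[OF h]] ee(2)[OF i] V.assoc[OF eH[OF i] E_Hom_seq[OF inc[OF i]] E_Hom_seq[OF h]]
   E_comp_seq[OF inc[OF i] h] by simp
 have "generic SV V E Xs B f A g ee"
 proof (rule genericI[OF g ee(1)])
  show "AMap E g ** ee = f"
   by (rule V.coproduct_eq[OF Q V.comp_Hom[OF ee(1) E_Hom_seq[OF g]] f]) (use he[OF _ g] gi ge in "simp del: seq_cat_simps")
 next
  fix A' k m assume k: "k : Hom SV A' Xs" and m: "m : Hom V B (OMap E A')" and km: "AMap E k ** m = f"
  have A': "A' : Seqs" "length A' = length Xs" using seq_Obj[OF k] by auto
  have "EX h. h : Hom SV (As i) A' & k \<star>SV h = gs i & AMap E h ** e i = m ** j i" if i: "i : I" for i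
  proof (rule genericD(4)[OF G[OF i] k V.comp_Hom[OF jH[OF i] m]])
   show "AMap E k ** (m ** j i) = f ** j i" using V.assoc[OF jH[OF i] m E_Hom_seq[OF k]] km by simp
  qed
  then obtain hs where hs: "!!i. i : I ==> hs i : Hom SV (As i) A'" "!!i. i : I ==> k \<star>SV hs i = gs i"
   "!!i. i : I ==> AMap E (hs i) ** e i = m ** j i" by metis
  obtain h where h: "h : Hom SV A A'" "!!i. i : I ==> h \<star>SV inc i = hs i" using ex A' hs(1) by blast
  have "k \<star>SV h = g" by (rule un[rule_format, OF SV.comp_Hom[OF h(1) k] g])
    (use SV.assoc[OF inc h(1) k] h(2) hs(2) gi in "simp del: seq_cat_simps")
  moreover have "AMap E h ** ee = m"
   by (rule V.coproduct_eq[OF Q V.comp_Hom[OF ee(1) E_Hom_seq[OF h(1)]] m]) (use he[OF _ h(1)] h(2) hs(3) in "simp del: seq_cat_simps")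
  ultimately show "EX h. h : Hom SV A A' & k \<star>SV h = g & AMap E h ** ee = m" using h(1) by blast
 next
  fix A' k m h h' assume k: "k : Hom SV A' Xs" and m: "m : Hom V B (OMap E A')" and km: "AMap E k ** m = f"
   and h: "h : Hom SV A A'" "k \<star>SV h = g" "AMap E h ** ee = m"
   and h': "h' : Hom SV A A'" "k \<star>SV h' = g" "AMap E h' ** ee = m"
  show "h = h'"
  proof (rule un[rule_format, OF h(1) h'(1)])
   fix i assume i: "i : I"
   show "h \<star>SV inc i = h' \<star>SV inc i"
   proof (rule genericD(5)[OF G[OF i] k V.comp_Hom[OF jH[OF i] m]])
    show "AMap E k ** (m ** j i) = f ** j i" using V.assoc[OF jH[OF i] m E_Hom_seq[OF k]] km by simp
    show "h \<star>SV inc i : Hom SV (As i) A'" "h' \<star>SV inc i : Hom SV (As i) A'"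
     using SV.comp_Hom[OF inc[OF i]] h(1) h'(1) by blast+
    show "k \<star>SV (h \<star>SV inc i) = gs i" using SV.assoc[OF inc[OF i] h(1) k] h(2) gi[OF i] by (simp del: seq_cat_simps)
    show "k \<star>SV (h' \<star>SV inc i) = gs i" using SV.assoc[OF inc[OF i] h'(1) k] h'(2) gi[OF i] by (simp del: seq_cat_simps)
    show "AMap E (h \<star>SV inc i) ** e i = m ** j i" using he[OF i h(1)] h(3) by (simp del: seq_cat_simps)
    show "AMap E (h' \<star>SV inc i) ** e i = m ** j i" using he[OF i h'(1)] h'(3) by (simp del: seq_cat_simps)
   qed
  qed
 qed
 then show ?thesis by blast
qed

text \<open>An arrow from \<open>B\<close> to a hom, regarded as a morphism out of the graph with
  one edge labelled \<open>B\<close>.\<close>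

definition edge_map :: "'o => ('u, 'o) vgraph => 'u => 'u => 'a => ('u, 'o, 'a) vgraph_map" where
 "edge_map B Z c d x = seq_map [B] Z (%i. if i = 0 then c else d) (%_. x)"

lemma edge_map:
 assumes B: "B : Obj V" and Z: "Z : Obj GV" "c : Verts Z" "d : Verts Z" and x: "x : Hom V B (Edge Z (c, d))"
 shows "edge_map B Z c d x : Hom GV (seq_graph [B]) Z"
  "VMap (edge_map B Z c d x) (vtx 0) = c" "VMap (edge_map B Z c d x) (vtx (Suc 0)) = d" "EMap (edge_map B Z c d x) e01 = x"
proof -
 show "edge_map B Z c d x : Hom GV (seq_graph [B]) Z" unfolding edge_map_def by (rule seq_map_Hom) (use assms in auto)
qed (simp_all add: edge_map_def seq_map_simps)

lemma edge_map_eqI: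
 assumes "k : Hom GV (seq_graph [B]) Z" "k' : Hom GV (seq_graph [B]) Z" "VMap k (vtx 0) = VMap k' (vtx 0)"
  "VMap k (vtx (Suc 0)) = VMap k' (vtx (Suc 0))" "EMap k e01 = EMap k' e01"
 shows "k = k'"
proof (rule seq_graph_eqI[OF assms(1,2)])
 show "VMap k (vtx i) = VMap k' (vtx i)" if "i \<le> length [B]" for i using that assms(3,4) by (cases i) auto
qed (use assms(5) in simp)

lemma comp_edge_map:
 assumes B: "B : Obj V" and Z: "Z : Obj GV" "c : Verts Z" "d : Verts Z" and x: "x : Hom V B (Edge Z (c, d))" and k: "k : Hom GV Z Z'"
 shows "k \<star>GV edge_map B Z c d x = edge_map B Z' (VMap k c) (VMap k d) (EMap k (c, d) ** x)"
 unfolding edge_map_def by (rule seq_map_comp) (use assms in auto)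

text \<open>Genericity for \<open>Gamma\<close> is applied to the arrow into
  \<open>\<G> (seq_graph Xs)\<close> that \<open>f\<close> gives on the straight path. In the graph
  \<open>A\<close> obtained, the connected object \<open>B\<close> chooses a path \<open>p\<close>,
  and the labels along \<open>p\<close> form the sequence sought.\<close>

lemma generic_connected:
 assumes lra: "local_right_adjoint GV GV (Gamma V E)" and T: "conn B" and Xs: "Xs : Seqs" and f: "f : Hom V B (OMap E Xs)"
 shows "EX As gs e. generic SV V E Xs B f As gs e"
proof -
 have B: "B : Obj V" using T by (simp add: connected_object_def)
 define n where "n = length Xs"
 let ?X = "seq_graph Xs" and ?l = "line 0 n"
 have lp: "?l : paths (seq_graph As) (vtx 0) (vtx n)" "vtx 0 : Verts (seq_graph As)" "vtx n : Verts (seq_graph As)"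
  if "length As = n" for As using line_path[of 0 n As] that by auto
 have le: "map (Edge (seq_graph As)) (steps ?l) = As" if "length As = n" for As using line_edges_all[of As] that by simp
 note XO = seq_graph_Obj[OF Xs]
 \<comment> \<open>The arrow \<open>m\<close> into \<open>E\<close> of \<open>As\<close>, placed on
   the straight path of the linear graph, as a morphism from the one-edge graph.\<close>
 define em where "em As m = edge_map B (\<G> (seq_graph As)) (vtx 0) (vtx n) (\<iota> (seq_graph As) ?l ** m)" for As m
 have lH: "\<iota> (seq_graph As) ?l ** m : Hom V B (Edge (\<G> (seq_graph As)) (vtx 0, vtx n))"
  if "As : Seqs" "length As = n" "m : Hom V B (OMap E As)" for As m
  using V.comp_Hom[OF that(3) line_inj_Hom[OF that(1)]] that(2) by simp
 have em: "em As m : Hom GV (seq_graph [B]) (\<G> (seq_graph As))" "VMap (em As m) (vtx 0) = vtx 0" "VMap (em As m) (vtx (Suc 0)) = vtx n"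
  "EMap (em As m) e01 = \<iota> (seq_graph As) ?l ** m" if "As : Seqs" "length As = n" "m : Hom V B (OMap E As)" for As m
  using edge_map[OF B \<G>_Obj[OF seq_graph_Obj[OF that(1)]] _ _ lH[OF that]] that(2) by (auto simp: em_def)
 have emc: "\<G>m (seq_graph_map As Ys hs) \<star>GV em As m = em Ys (AMap E hs ** m)"
  if h: "hs : Hom SV As Ys" and l: "length As = n" and m: "m : Hom V B (OMap E As)" for As Ys hs m
 proof -
  have O: "As : Seqs" "length Ys = n" using seq_Obj[OF h] l by auto
  show ?thesis unfolding em_def
   using comp_edge_map[OF B \<G>_Obj[OF seq_graph_Obj[OF O(1)]] _ _ lH[OF O(1) l m] \<G>m_props(1)[OF seq_graph_map(1)[OF h]]]
    seq_point[OF h m] seq_graph_map(2)[OF h] l by simp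
 qed
 have "em Xs f : Hom GV (seq_graph [B]) (OMap (Gamma V E) ?X)" using em(1)[OF Xs _ f] by (simp add: n_def Gamma_def)
 then obtain A g e where G: "generic GV GV (Gamma V E) ?X (seq_graph [B]) (em Xs f) A g e"
  using lra XO unfolding local_right_adjoint_iff_generic by blast
 have g: "g : Hom GV A ?X" and e: "e : Hom GV (seq_graph [B]) (\<G> A)" and ge: "\<G>m g \<star>GV e = em Xs f"
  using genericD(1-3)[OF G] by (simp_all add: Gamma_def)
 have A: "A : Obj GV" using GHomD[OF g] by simp
 let ?c = "VMap e (vtx 0)" and ?d = "VMap e (vtx (Suc 0))"
 have v01: "vtx 0 : Verts (seq_graph [B])" "vtx (Suc 0) : Verts (seq_graph [B])" by auto
 have cd: "?c : Verts A" "?d : Verts A" using GHomD(5)[OF e v01(1)] GHomD(5)[OF e v01(2)] by auto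
 have "EMap e e01 : Hom V B (Edge (\<G> A) (?c, ?d))" using GHomD(6)[OF e v01] by (simp add: Edge_seq_graph)
 then obtain p \<phi> where p: "p : paths A ?c ?d" and \<phi>: "\<phi> : Hom V B (smd A p)" and ep: "EMap e e01 = \<iota> A p ** \<phi>"
  using connected_\<G>_ex[OF T A cd] by metis
 have hE: "EMap (\<G>m h \<star>GV e) e01 = \<iota> Y (map (VMap h) p) ** (path_arr h p ** \<phi>)" if "h : Hom GV A Y" for h Y
  unfolding GComp(2)[OF e v01] ep by (rule \<G>m_point[OF that p \<phi>])
 have hV: "VMap (\<G>m h \<star>GV e) (vtx 0) = VMap h ?c" "VMap (\<G>m h \<star>GV e) (vtx (Suc 0)) = VMap h ?d" for h
  using GComp(1)[OF e v01(1)] GComp(1)[OF e v01(2)] by simp_all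
 \<comment> \<open>A morphism from \<open>A\<close> to a linear graph that carries \<open>e\<close>
   to \<open>em As m\<close> sends \<open>p\<close> to the straight path, because the connected
   object \<open>B\<close> chooses a unique path there.\<close>
 have key: "map (VMap h) p = ?l & path_arr h p ** \<phi> = m"
  if h: "h : Hom GV A (seq_graph As)" and O: "As : Seqs" "length As = n" and m: "m : Hom V B (OMap E As)"
   and he: "\<G>m h \<star>GV e = em As m" for h As m
 proof -
  have hp: "map (VMap h) p : paths (seq_graph As) (vtx 0) (vtx n)" using path_map_Hom[OF h p] hV[of h] em(2,3)[OF O m] he by simp
  have mm: "m : Hom V B (smd (seq_graph As) ?l)" using m le[OF O(2)] by (simp add: Gamma_summand_def)
  show ?thesis
   by (rule connected_\<G>_eq[OF T seq_graph_Obj[OF O(1)] hp V.comp_Hom[OF \<phi> path_arr_Hom[OF h p]] lp(1)[OF O(2)] mm])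
    (use hE[OF h] em(4)[OF O m] he in simp)
 qed
 define As gs where "As = map (Edge A) (steps p)" and "gs = map (EMap g) (steps p)"
 have gl: "map (VMap g) p = ?l" and gf: "AMap E gs ** \<phi> = f"
  using key[OF g Xs _ f ge] by (auto simp: n_def gs_def path_arr_def)
 have AsO: "As : Seqs" unfolding As_def by (rule steps_Obj[OF A p])
 have gsH: "gs : Hom SV As Xs" using EMap_steps[OF g p] gl le[of Xs] by (simp add: As_def gs_def n_def)
 have lAs: "length As = n" using seq_Obj[OF gsH] by (simp add: n_def)
 have lpn: "length p = Suc n" using gl by (metis length_map diff_zero length_upt line_def add_0)
 have \<phi>': "\<phi> : Hom V B (OMap E As)" using \<phi> by (simp add: Gamma_summand_def As_def)
 let ?S = "seq_graph As"
 have lift: "EX h. h : Hom GV A (seq_graph Ys) & seq_graph_map Ys Xs ks \<star>GV h = g & \<G>m h \<star>GV e = em Ys m"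
  if ks: "ks : Hom SV Ys Xs" and m: "m : Hom V B (OMap E Ys)" and km: "AMap E ks ** m = f" for Ys ks m
 proof -
  have O: "Ys : Seqs" "length Ys = n" using seq_Obj[OF ks] by (auto simp: n_def)
  show ?thesis using genericD(4)[OF G seq_graph_map(1)[OF ks], of "em Ys m"] em(1)[OF O m] emc[OF ks O(2) m] km
   by (simp add: Gamma_def)
 qed
 have pst: "steps p ! i = (p ! i, p ! Suc i)" "p ! i : Verts A" "p ! Suc i : Verts A" if "i < n" for i
  using that lpn pathsD(2)[OF p] nth_mem[of i p] nth_mem[of "Suc i" p] by (auto simp: nth_steps)
 have lst: "length (steps p) = n" by (simp add: length_steps lpn)
 \<comment> \<open>Only the edges of \<open>A\<close> along the path \<open>p\<close> matter: \<open>A\<close> is a retract of the linear graph on \<open>As\<close>, by genericity.\<close>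
 obtain r where r: "r : Hom GV A ?S" "seq_graph_map As Xs gs \<star>GV r = g" "\<G>m r \<star>GV e = em As \<phi>"
  using lift[OF gsH \<phi>' gf] by blast
 have rl: "map (VMap r) p = ?l" using key[OF r(1) AsO lAs \<phi>' r(3)] by simp
 have rv: "VMap r (p ! i) = vtx i" if "i \<le> n" for i
  using arg_cong[OF rl, of "%z. z ! i"] that lpn by (simp add: line_def del: upt_Suc)
 \<comment> \<open>It traverses \<open>p\<close> with identity labels; together with
   \<open>r\<close> it will exhibit \<open>A\<close> as the retract.\<close>
 define s where "s = seq_map As A (%i. p ! i) (%i. Ide V (As ! i))"
 have AsE: "As ! i = Edge A (p ! i, p ! Suc i)" if "i < n" for i using pst(1)[OF that] that lst by (simp add: As_def)
 have AsI: "As ! i : Obj V" if "i < n" for i using AsO lAs that by (auto simp: in_lists_conv_set)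
 have pV: "p ! i : Verts A" if "i \<le> n" for i using that lpn pathsD(2)[OF p] nth_mem[of i p] by auto
 have sH: "s : Hom GV ?S A" unfolding s_def by (rule seq_map_Hom[OF AsO A]) (use lAs pV AsE V.Ide_Hom[OF AsI] in auto)
 have sv: "VMap s (vtx i) = p ! i" if "i \<le> n" for i using seq_map_simps(1)[of i As] that lAs by (simp add: s_def)
 have se: "EMap s (vtx i, vtx (Suc i)) = Ide V (As ! i)" if "i < n" for i using seq_map_simps(2)[of i As] that lAs by (simp add: s_def)
 have sl: "map (VMap s) ?l = p" by (rule nth_equalityI) (use sv lpn in "auto simp: line_def simp del: upt_Suc")
 have sa: "map (EMap s) (steps ?l) = map (Ide V) As" by (rule nth_equalityI) (use se lAs in "auto simp: steps_line")
 have gs': "g \<star>GV s = seq_graph_map As Xs gs" unfolding s_def seq_graph_map_def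
 proof (rule seq_map_comp[OF AsO g])
  show "vtx i = VMap g (p ! i)" if "i \<le> length As" for i
   using arg_cong[OF gl, of "%z. z ! i"] that lpn lAs by (simp add: line_def del: upt_Suc)
  show "gs ! i = EMap g (p ! i, p ! Suc i) ** Ide V (As ! i)" if "i < length As" for i
  proof -
   have i: "i < n" using that lAs by simp
   show ?thesis using V.id_r[OF GHomD(6)[OF g pst(2,3)[OF i]]] pst(1)[OF i] i lst AsE[OF i] by (simp add: gs_def)
  qed
 qed (use pV lAs AsE V.Ide_Hom[OF AsI] in auto)
 have sem: "\<G>m s \<star>GV em As \<phi> = e"
 proof (rule edge_map_eqI[OF GV.comp_Hom[OF em(1)[OF AsO lAs \<phi>'] \<G>m_props(1)[OF sH]] e])
  have ends: "p ! 0 = ?c" "p ! n = ?d" using pathsD(1,3,4)[OF p] lpn by (auto simp: hd_conv_nth last_conv_nth)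
  show "VMap (\<G>m s \<star>GV em As \<phi>) (vtx 0) = ?c" "VMap (\<G>m s \<star>GV em As \<phi>) (vtx (Suc 0)) = ?d"
   using GComp(1)[OF em(1)[OF AsO lAs \<phi>'] v01(1), of "\<G>m s"] GComp(1)[OF em(1)[OF AsO lAs \<phi>'] v01(2), of "\<G>m s"]
    em(2,3)[OF AsO lAs \<phi>'] sv[of 0] sv[of n] ends by simp_all
  have \<phi>l: "\<phi> : Hom V B (smd ?S ?l)" using \<phi>' le[OF lAs] by (simp add: Gamma_summand_def)
  have "EMap (\<G>m s \<star>GV em As \<phi>) e01 = EMap (\<G>m s) (vtx 0, vtx n) ** (\<iota> ?S ?l ** \<phi>)"
   unfolding GComp(2)[OF em(1)[OF AsO lAs \<phi>'] v01] em(2-4)[OF AsO lAs \<phi>'] ..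
  also have "\<dots> = \<iota> A p ** (path_arr s ?l ** \<phi>)" unfolding \<G>m_point[OF sH lp(1)[OF lAs] \<phi>l] sl ..
  also have "path_arr s ?l ** \<phi> = \<phi>" unfolding path_arr_def sa E_Ide[OF AsO] by (rule V.id_l[OF \<phi>'])
  finally show "EMap (\<G>m s \<star>GV em As \<phi>) e01 = EMap e e01" using ep by simp
 qed
 \<comment> \<open>Both sides are endomorphisms of the generic factorization, hence equal by its
   uniqueness part.\<close>
 have sr: "s \<star>GV r = Ide GV A"
 proof (rule genericD(5)[OF G g])
  show "e : Hom GV (seq_graph [B]) (OMap (Gamma V E) A)" "AMap (Gamma V E) g \<star>GV e = em Xs f" using e ge by (simp_all add: Gamma_def)
  show "s \<star>GV r : Hom GV A A" by (rule GV.comp_Hom[OF r(1) sH])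
  show "g \<star>GV (s \<star>GV r) = g" using GV.assoc[OF r(1) sH g] gs' r(2) by simp
  show "AMap (Gamma V E) (s \<star>GV r) \<star>GV e = e"
   using \<G>m_comp[OF r(1) sH] GV.assoc[OF e \<G>m_props(1)[OF r(1)] \<G>m_props(1)[OF sH]] r(3) sem by (simp add: Gamma_def)
  show "Ide GV A : Hom GV A A" by (rule GIde_Hom[OF A])
  show "g \<star>GV Ide GV A = g" by (rule GV.id_r[OF g])
  show "AMap (Gamma V E) (Ide GV A) \<star>GV e = e" using \<G>m_Ide[OF A] GV.id_l[OF e] by (simp add: Gamma_def)
 qed
 \<comment> \<open>The labels of \<open>s\<close> along the straight path are identities, so
   \<open>sr\<close> forces the labels of \<open>r\<close> along \<open>p\<close> to be identities
   too.\<close>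
 have re: "EMap r (p ! i, p ! Suc i) = Ide V (As ! i)" if i: "i < n" for i
 proof -
  have "EMap (s \<star>GV r) (p ! i, p ! Suc i) = Ide V (As ! i) ** EMap r (p ! i, p ! Suc i)"
   unfolding GComp(2)[OF r(1) pst(2,3)[OF i]] using rv i se[OF i] by simp
  moreover have "EMap r (p ! i, p ! Suc i) : Hom V (As ! i) (As ! i)"
   using GHomD(6)[OF r(1) pst(2,3)[OF i]] rv i AsE[OF i] lAs by (simp add: Edge_seq_graph)
  ultimately show ?thesis using V.id_l GIde(2)[OF pst(2,3)[OF i]] AsE[OF i] sr by simp
 qed
 have "generic SV V E Xs B f As gs \<phi>"
 proof (rule genericI[OF gsH \<phi>' gf])
  fix Ys ks m assume ks: "ks : Hom SV Ys Xs" and m: "m : Hom V B (OMap E Ys)" and km: "AMap E ks ** m = f"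
  have O: "Ys : Seqs" "length Ys = n" using seq_Obj[OF ks] by (auto simp: n_def)
  obtain h where h: "h : Hom GV A (seq_graph Ys)" "seq_graph_map Ys Xs ks \<star>GV h = g" "\<G>m h \<star>GV e = em Ys m"
   using lift[OF ks m km] by blast
  have hk: "map (VMap h) p = ?l" "AMap E (map (EMap h) (steps p)) ** \<phi> = m"
   using key[OF h(1) O m h(3)] by (auto simp: path_arr_def)
  have "map (EMap h) (steps p) : Hom SV As Ys" using EMap_steps[OF h(1) p] hk(1) le[OF O(2)] by (simp add: As_def)
  moreover have "ks \<star>SV map (EMap h) (steps p) = gs"
  proof -
   have "map (EMap (seq_graph_map Ys Xs ks)) (steps ?l) = ks"
    using seq_graph_map(5)[OF ks, of 0 n] O(2) ks by (simp add: seq_Hom_iff)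
   then show ?thesis using EMap_steps_comp[OF h(1) p, of "seq_graph_map Ys Xs ks"] h(2) hk(1) by (simp add: gs_def)
  qed
  ultimately show "EX hs. hs : Hom SV As Ys & ks \<star>SV hs = gs & AMap E hs ** \<phi> = m" using hk(2) by blast
 next
  fix Ys ks m hs hs' assume ks: "ks : Hom SV Ys Xs" and m: "m : Hom V B (OMap E Ys)" and km: "AMap E ks ** m = f"
   and hs: "hs : Hom SV As Ys" "ks \<star>SV hs = gs" "AMap E hs ** \<phi> = m"
   and hs': "hs' : Hom SV As Ys" "ks \<star>SV hs' = gs" "AMap E hs' ** \<phi> = m"
  have O: "Ys : Seqs" "length Ys = n" using seq_Obj[OF ks] by (auto simp: n_def)
  \<comment> \<open>Composing with \<open>r\<close> extends a map of sequences to a morphism out of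
    \<open>A\<close>, so that uniqueness for \<open>A\<close> gives uniqueness for
    sequences.\<close>
  have ext: "seq_graph_map As Ys w \<star>GV r : Hom GV A (seq_graph Ys)"
   "seq_graph_map Ys Xs ks \<star>GV (seq_graph_map As Ys w \<star>GV r) = g"
   "AMap (Gamma V E) (seq_graph_map As Ys w \<star>GV r) \<star>GV e = em Ys m"
   if w: "w : Hom SV As Ys" "ks \<star>SV w = gs" "AMap E w ** \<phi> = m" for w
  proof -
   note W = seq_graph_map(1)[OF w(1)]
   show "seq_graph_map As Ys w \<star>GV r : Hom GV A (seq_graph Ys)" by (rule GV.comp_Hom[OF r(1) W])
   show "seq_graph_map Ys Xs ks \<star>GV (seq_graph_map As Ys w \<star>GV r) = g"
    unfolding GV.assoc[OF r(1) W seq_graph_map(1)[OF ks], symmetric] seq_graph_map_comp[OF w(1) ks] w(2) by (rule r(2))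
   show "AMap (Gamma V E) (seq_graph_map As Ys w \<star>GV r) \<star>GV e = em Ys m"
    using \<G>m_comp[OF r(1) W] GV.assoc[OF e \<G>m_props(1)[OF r(1)] \<G>m_props(1)[OF W]] r(3) emc[OF w(1) lAs \<phi>'] w(3)
    by (simp add: Gamma_def)
  qed
  have "em Ys m : Hom GV (seq_graph [B]) (OMap (Gamma V E) (seq_graph Ys))"
   "AMap (Gamma V E) (seq_graph_map Ys Xs ks) \<star>GV em Ys m = em Xs f"
   using em(1)[OF O m] emc[OF ks O(2) m] km by (simp_all add: Gamma_def)
  from genericD(5)[OF G seq_graph_map(1)[OF ks] this ext[OF hs] ext[OF hs']]
  have eq: "seq_graph_map As Ys hs \<star>GV r = seq_graph_map As Ys hs' \<star>GV r" .
  have val: "EMap (seq_graph_map As Ys w \<star>GV r) (p ! i, p ! Suc i) = w ! i" if w: "w : Hom SV As Ys" and i: "i < n" for w i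
  proof -
   have "w ! i : Hom V (As ! i) (Ys ! i)" using w i lAs by (simp add: seq_Hom_iff)
   then show ?thesis unfolding GComp(2)[OF r(1) pst(2,3)[OF i]] using rv i re[OF i] seq_graph_map(3)[OF w, of i] lAs V.id_r by simp
  qed
  show "hs = hs'" by (rule nth_equalityI) (use hs(1) hs'(1) lAs val[OF hs(1)] val[OF hs'(1)] eq in "auto simp: seq_Hom_iff")
 qed
 then show ?thesis by blast
qed

lemma local_right_adjoint_E:
 assumes cc: "coproducts_of_connected U V" and lra: "local_right_adjoint GV GV (Gamma V E)"
 shows "local_right_adjoint SV V E" unfolding local_right_adjoint_iff_generic
proof (intro conjI functor_E ballI allI)
 fix Xs B f assume "Xs : Obj SV" and f: "f : Hom V B (OMap E Xs)"
 then have Xs: "Xs : Seqs" by simp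
 have B: "B : Obj V" using V.Hom_Obj[OF f] by simp
 obtain I :: "'u set" and C j where I: "small U I" "!!i. i : I ==> conn (C i)" and Q: "is_coproduct V I C B j"
  using cc B unfolding coproducts_of_connected_def by metis
 have "EX As gs e. generic SV V E Xs (C i) (f ** j i) As gs e" if "i : I" for i
  by (rule generic_connected[OF lra I(2)[OF that] Xs V.comp_Hom[OF V.coproductD(3)[OF Q that] f]])
 then obtain As gs e where "!!i. i : I ==> generic SV V E Xs (C i) (f ** j i) (As i) (gs i) (e i)" by metis
 then show "EX A g e. generic SV V E Xs B f A g e" by (rule generic_coproduct[OF I(1) Q Xs f])
qed

theorem lra_iff:
 assumes cc: "coproducts_of_connected U V"
 shows "lra_multitensor V E u sig \<longleftrightarrow> lra_monad GV (Gamma V E) \<eta> \<mu>"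
 unfolding lra_multitensor_def lra_monad_def
 using multitensor monad_\<G> local_right_adjoint_\<G>[OF cc] local_right_adjoint_E[OF cc]
  cartesian_\<eta>[OF cc] cartesian_u[OF cc] cartesian_\<mu>[OF cc] cartesian_sig[OF cc] by blast

end



theorem theorem3p3p1:
  fixes V :: "('o, 'a) cat"
    and E :: "('o list, 'a list, 'o, 'a) ftor"
    and u :: "'o \<Rightarrow> 'a"
    and sig :: "'o list list \<Rightarrow> 'a"
    and lam :: "'l rel"
  assumes "universe TYPE('u)"
    and "category V"
    and "has_coproducts TYPE('u) V"
    and "distributive_multitensor TYPE('u) V E u sig"
    and "small_regular_cardinal TYPE('u) lam"
  shows "preserves_coproducts TYPE('u) (vgraph_cat TYPE('u) V) (vgraph_cat TYPE('u) V) (Gamma V E) \<and>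
    (has_filtered_colimits TYPE('u) lam V \<longrightarrow>
       (accessible TYPE('u) lam (seq_cat V) V E \<longleftrightarrow>
        accessible TYPE('u) lam (vgraph_cat TYPE('u) V) (vgraph_cat TYPE('u) V) (Gamma V E))) \<and>
    (has_pullbacks V \<longrightarrow> coproducts_of_connected TYPE('u) V \<longrightarrow>
       (cartesian_multitensor V E u sig \<longleftrightarrow>
        cartesian_monad (vgraph_cat TYPE('u) V) (Gamma V E) (Gamma_unit V E u) (Gamma_mult V E sig))) \<and>
    (locally_c_presentable TYPE('u) lam V \<longrightarrow>
       (lra_multitensor V E u sig \<longleftrightarrow>
        lra_monad (vgraph_cat TYPE('u) V) (Gamma V E) (Gamma_unit V E u) (Gamma_mult V E sig)))"
proof -
  interpret Multitensor V "TYPE('u)" E u sig by unfold_locales (use assms in auto)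
  have lam: "Cinfinite lam" using assms(5) by (simp add: small_regular_cardinal_def)
  show ?thesis
    using preserves_coproducts_\<G> accessible_\<G>[OF _ lam] accessible_E[OF _ lam] cartesian_iff
      lra_iff[OF V.lcp_coproducts_of_connected] by blast
qed

end
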